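(* Let $\beta\ge 4$, $\lambda>0$, $\alpha>0$, $\tilde y\in L^2(\Omega_T)$ and let $y_0\in H^2(\Omega)$ with $y_0\ge C_0>0$. There is a constant $\widetilde C_0=\widetilde C_0(E[y_0],H[y_0],\Omega,\beta)>0$ such that, whenever $0<C_0\le\widetilde C_0$, the following minimization problem has at least one solution: minimize $$J(y,u)=\frac12\int_0^T\!\!\int_\Omega |y-\tilde y|^2\,dx\,dt+\frac{\alpha}{2}\int_0^T\!\!\int_\Omega |u_x|^2\,dx\,dt$$ over all $(y,u)\in \big(L^2(H^4)\cap H^1(L^2)\big)\times L^2(H^1_0)$ subject to $$y_t=-(\lambda|y|^\beta y_{xxx})_x+u_x\quad\text{in }\Omega_T,\qquad y(0,\cdot)=y_0,\qquad y_x=y_{xxx}=0\ \text{ at } x=a,b,\ 0<t<T,$$ and $y\ge C_0$ in $\Omega_T$.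
   Context: $\Omega=(a,b)\subset\mathbb R$ is a bounded interval, $0<T<\infty$, $\Omega_T=(0,T)\times\Omega$. For Sobolev spaces on $\Omega$, $W^{k,p}(W^{m,q})$ denotes the Bochner space $W^{k,p}(0,T;W^{m,q}(\Omega))$; in particular $L^2(H^4)=L^2(0,T;H^4(\Omega))$, $H^1(L^2)=H^1(0,T;L^2(\Omega))$, $L^2(H^1_0)=L^2(0,T;H^1_0(\Omega))$. The energy is $E[y]=\frac12\int_\Omega|y_x|^2\,dx$ and the entropy is $H[y]=\frac{1}{(\beta-1)(\beta-2)}\int_\Omega y^{2-\beta}\,dx$.
   Formalization: Added hypothesis: (y_0)_x = 0 at x = a, b. It is necessary: y in L^2(H^4)∩H^1(L^2) lies in C([0,T];H^2), so y_x = 0 at a, b forces it at t = 0; e.g. for y_0 = x − a + 1 no admissible pair exists. *)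

theory Defs
  imports "HOL-Analysis.Analysis"
begin

section \<open>Lebesgue and Sobolev spaces\<close>

text \<open>
  Elements of the function spaces below are representatives: functions on the whole type, of which
  only the values almost everywhere in the domain matter.  Everything built on top of these
  spaces is insensitive to changes on null sets.
\<close>

definition L2_space :: "'a::euclidean_space set \<Rightarrow> ('a \<Rightarrow> real) set" where
  "L2_space S = {f. f \<in> borel_measurable (lebesgue_on S) \<and> integrable (lebesgue_on S) (\<lambda>x. (f x)\<^sup>2)}"

definition L2_norm :: "'a::euclidean_space set \<Rightarrow> ('a \<Rightarrow> real) \<Rightarrow> real" where
  "L2_norm S f = sqrt (\<integral>x. (f x)\<^sup>2 \<partial>lebesgue_on S)"

definition locally_integrable :: "real set \<Rightarrow> (real \<Rightarrow> real) \<Rightarrow> bool" where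
  "locally_integrable S f \<longleftrightarrow> (\<forall>K. compact K \<and> K \<subseteq> S \<longrightarrow> integrable (lebesgue_on K) f)"

definition test_function :: "real set \<Rightarrow> (real \<Rightarrow> real) \<Rightarrow> bool" where
  "test_function S \<phi> \<longleftrightarrow>
     (\<forall>k x. (deriv ^^ k) \<phi> field_differentiable at x) \<and>
     (\<exists>K. compact K \<and> K \<subseteq> S \<and> (\<forall>x. x \<notin> K \<longrightarrow> \<phi> x = 0))"

definition has_weak_deriv ::
    "real set \<Rightarrow> nat \<Rightarrow> (real \<Rightarrow> real) \<Rightarrow> (real \<Rightarrow> real) \<Rightarrow> bool" where
  "has_weak_deriv S k f g \<longleftrightarrow>
     locally_integrable S f \<and> locally_integrable S g \<and>
     (\<forall>\<phi>. test_function S \<phi> \<longrightarrow>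
        (\<integral>x. f x * (deriv ^^ k) \<phi> x \<partial>lebesgue_on S) =
        (-1) ^ k * (\<integral>x. g x * \<phi> x \<partial>lebesgue_on S))"

text \<open>
  A representative of the \<open>k\<close>-th weak derivative; on an open set it is unique up to null sets
  whenever it exists.
\<close>

definition weak_deriv :: "real set \<Rightarrow> nat \<Rightarrow> (real \<Rightarrow> real) \<Rightarrow> real \<Rightarrow> real" where
  "weak_deriv S k f = (SOME g. has_weak_deriv S k f g)"

definition H_space :: "nat \<Rightarrow> real set \<Rightarrow> (real \<Rightarrow> real) set" where
  "H_space m S = {f \<in> L2_space S. \<forall>k\<le>m. \<exists>g\<in>L2_space S. has_weak_deriv S k f g}"

definition H_norm :: "nat \<Rightarrow> real set \<Rightarrow> (real \<Rightarrow> real) \<Rightarrow> real" where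
  "H_norm m S f = sqrt (\<Sum>k\<le>m. (L2_norm S (weak_deriv S k f))\<^sup>2)"

definition H10_space :: "real set \<Rightarrow> (real \<Rightarrow> real) set" where
  "H10_space S = {f \<in> H_space 1 S.
     \<exists>\<phi>. (\<forall>n. test_function S (\<phi> n)) \<and> (\<lambda>n. H_norm 1 S (\<lambda>x. f x - \<phi> n x)) \<longlonglongrightarrow> 0}"

text \<open>
  Boundary values of an \<open>H\<^sup>1\<close> function on the interval \<open>(a, b)\<close> are those of its
  continuous representative on \<open>[a, b]\<close>.
\<close>

definition has_trace :: "real \<Rightarrow> real \<Rightarrow> (real \<Rightarrow> real) \<Rightarrow> real \<Rightarrow> real \<Rightarrow> bool" where
  "has_trace a b f x v \<longleftrightarrow>
     (\<exists>h. continuous_on {a..b} h \<and> (AE \<xi> in lebesgue_on {a<..<b}. f \<xi> = h \<xi>) \<and> h x = v)"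


section \<open>Bochner spaces\<close>

text \<open>
  Functions of time with values in a space \<open>X\<close> of functions of the space variable, seminormed
  by \<open>N\<close>.  The library's Bochner integral needs the target to be a type; as \<open>X\<close> depends on
  the interval, its construction by simple functions is repeated here for a carrier set.
\<close>

definition X_simple ::
    "real measure \<Rightarrow> (real \<Rightarrow> real) set \<Rightarrow> (real \<Rightarrow> real \<Rightarrow> real) \<Rightarrow> bool" where
  "X_simple M X s \<longleftrightarrow> simple_function M s \<and> s ` space M \<subseteq> X"

definition X_simple_integral ::
    "real measure \<Rightarrow> (real \<Rightarrow> real \<Rightarrow> real) \<Rightarrow> real \<Rightarrow> real" where
  "X_simple_integral M s =
     (\<lambda>x. \<Sum>v\<in>s ` space M. measure M {t \<in> space M. s t = v} * v x)"

definition strongly_measurable ::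
    "real measure \<Rightarrow> (real \<Rightarrow> real) set \<Rightarrow> ((real \<Rightarrow> real) \<Rightarrow> real) \<Rightarrow>
     (real \<Rightarrow> real \<Rightarrow> real) \<Rightarrow> bool" where
  "strongly_measurable M X N f \<longleftrightarrow>
     (AE t in M. f t \<in> X) \<and>
     (\<exists>s. (\<forall>n. X_simple M X (s n)) \<and>
          (AE t in M. (\<lambda>n. N (\<lambda>x. s n t x - f t x)) \<longlonglongrightarrow> 0))"

definition has_X_integral ::
    "real measure \<Rightarrow> (real \<Rightarrow> real) set \<Rightarrow> ((real \<Rightarrow> real) \<Rightarrow> real) \<Rightarrow>
     (real \<Rightarrow> real \<Rightarrow> real) \<Rightarrow> (real \<Rightarrow> real) \<Rightarrow> bool" where
  "has_X_integral M X N f v \<longleftrightarrow>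
     strongly_measurable M X N f \<and> v \<in> X \<and>
     (\<exists>s. (\<forall>n. X_simple M X (s n)) \<and>
          (\<lambda>n. \<integral>\<^sup>+t. ennreal (N (\<lambda>x. s n t x - f t x)) \<partial>M) \<longlonglongrightarrow> 0 \<and>
          (\<lambda>n. N (\<lambda>x. X_simple_integral M (s n) x - v x)) \<longlonglongrightarrow> 0)"

definition bochner_L2 ::
    "real \<Rightarrow> (real \<Rightarrow> real) set \<Rightarrow> ((real \<Rightarrow> real) \<Rightarrow> real) \<Rightarrow> (real \<Rightarrow> real \<Rightarrow> real) set" where
  "bochner_L2 T X N =
     {f. strongly_measurable (lebesgue_on {0<..<T}) X N f \<and>
         integrable (lebesgue_on {0<..<T}) (\<lambda>t. (N (f t))\<^sup>2)}"

text \<open>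
  \<open>g\<close> is the weak time derivative of \<open>f\<close>:
  \<open>\<integral> \<phi>' f dt = - \<integral> \<phi> g dt\<close> in \<open>X\<close> for all test functions \<open>\<phi>\<close> on \<open>(0, T)\<close>.
\<close>

definition has_time_deriv ::
    "real \<Rightarrow> (real \<Rightarrow> real) set \<Rightarrow> ((real \<Rightarrow> real) \<Rightarrow> real) \<Rightarrow>
     (real \<Rightarrow> real \<Rightarrow> real) \<Rightarrow> (real \<Rightarrow> real \<Rightarrow> real) \<Rightarrow> bool" where
  "has_time_deriv T X N f g \<longleftrightarrow>
     (\<forall>\<phi>. test_function {0<..<T} \<phi> \<longrightarrow>
        has_X_integral (lebesgue_on {0<..<T}) X N
          (\<lambda>t x. deriv \<phi> t * f t x + \<phi> t * g t x) (\<lambda>_. 0))"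

definition bochner_H1 ::
    "real \<Rightarrow> (real \<Rightarrow> real) set \<Rightarrow> ((real \<Rightarrow> real) \<Rightarrow> real) \<Rightarrow> (real \<Rightarrow> real \<Rightarrow> real) set" where
  "bochner_H1 T X N =
     {f \<in> bochner_L2 T X N. \<exists>g\<in>bochner_L2 T X N. has_time_deriv T X N f g}"

text \<open>
  The value at time \<open>0\<close> of \<open>f \<in> H\<^sup>1(0, T; L\<^sup>2(S))\<close> is that of its representative in
  \<open>C([0, T]; L\<^sup>2(S))\<close>.
\<close>

definition has_initial_value ::
    "real \<Rightarrow> real set \<Rightarrow> (real \<Rightarrow> real \<Rightarrow> real) \<Rightarrow> (real \<Rightarrow> real) \<Rightarrow> bool" where
  "has_initial_value T S f f0 \<longleftrightarrow>
     (\<exists>z. (\<forall>t\<in>{0..T}. z t \<in> L2_space S) \<and>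
          (\<forall>t\<in>{0..T}. ((\<lambda>s. L2_norm S (\<lambda>x. z s x - z t x)) \<longlongrightarrow> 0) (at t within {0..T})) \<and>
          (AE t in lebesgue_on {0<..<T}. AE x in lebesgue_on S. z t x = f t x) \<and>
          (AE x in lebesgue_on S. z 0 x = f0 x))"


section \<open>The control problem\<close>

text \<open>States and controls are curried: \<open>y t x\<close>, \<open>u t x\<close>.\<close>

definition energy :: "real set \<Rightarrow> (real \<Rightarrow> real) \<Rightarrow> real" where
  "energy S f = 1 / 2 * (\<integral>x. \<bar>weak_deriv S 1 f x\<bar>\<^sup>2 \<partial>lebesgue_on S)"

definition entropy :: "real \<Rightarrow> real set \<Rightarrow> (real \<Rightarrow> real) \<Rightarrow> real" where
  "entropy \<beta> S f = 1 / ((\<beta> - 1) * (\<beta> - 2)) * (\<integral>x. f x powr (2 - \<beta>) \<partial>lebesgue_on S)"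

definition state_space :: "real \<Rightarrow> real set \<Rightarrow> (real \<Rightarrow> real \<Rightarrow> real) set" where
  "state_space T S =
     bochner_L2 T (H_space 4 S) (H_norm 4 S) \<inter> bochner_H1 T (L2_space S) (L2_norm S)"

definition control_space :: "real \<Rightarrow> real set \<Rightarrow> (real \<Rightarrow> real \<Rightarrow> real) set" where
  "control_space T S = bochner_L2 T (H10_space S) (H_norm 1 S)"

text \<open>\<open>y\<^sub>t = - (\<lambda> |y|\<^sup>\<beta> y\<^sub>x\<^sub>x\<^sub>x)\<^sub>x + u\<^sub>x\<close> almost everywhere in \<open>(0, T) \<times> S\<close>.\<close>

definition thin_film_equation ::
    "real \<Rightarrow> real set \<Rightarrow> real \<Rightarrow> real \<Rightarrow>
     (real \<Rightarrow> real \<Rightarrow> real) \<Rightarrow> (real \<Rightarrow> real \<Rightarrow> real) \<Rightarrow> bool" where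
  "thin_film_equation T S lam \<beta> y u \<longleftrightarrow>
     (\<exists>y\<^sub>t\<in>bochner_L2 T (L2_space S) (L2_norm S).
        has_time_deriv T (L2_space S) (L2_norm S) y y\<^sub>t \<and>
        (AE t in lebesgue_on {0<..<T}.
           \<exists>q. has_weak_deriv S 1 (\<lambda>x. lam * \<bar>y t x\<bar> powr \<beta> * weak_deriv S 3 (y t) x) q \<and>
               (AE x in lebesgue_on S. y\<^sub>t t x = - q x + weak_deriv S 1 (u t) x)))"

definition boundary_conditions :: "real \<Rightarrow> real \<Rightarrow> real \<Rightarrow> (real \<Rightarrow> real \<Rightarrow> real) \<Rightarrow> bool" where
  "boundary_conditions T a b y \<longleftrightarrow>
     (AE t in lebesgue_on {0<..<T}. \<forall>x\<in>{a, b}.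
        has_trace a b (weak_deriv {a<..<b} 1 (y t)) x 0 \<and>
        has_trace a b (weak_deriv {a<..<b} 3 (y t)) x 0)"

definition cost ::
    "real \<Rightarrow> real set \<Rightarrow> real \<Rightarrow> (real \<times> real \<Rightarrow> real) \<Rightarrow>
     (real \<Rightarrow> real \<Rightarrow> real) \<Rightarrow> (real \<Rightarrow> real \<Rightarrow> real) \<Rightarrow> real" where
  "cost T S \<alpha> yd y u =
     1 / 2 * (\<integral>t. (\<integral>x. \<bar>y t x - yd (t, x)\<bar>\<^sup>2 \<partial>lebesgue_on S) \<partial>lebesgue_on {0<..<T}) +
     \<alpha> / 2 * (\<integral>t. (\<integral>x. \<bar>weak_deriv S 1 (u t) x\<bar>\<^sup>2 \<partial>lebesgue_on S) \<partial>lebesgue_on {0<..<T})"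

definition admissible ::
    "real \<Rightarrow> real \<Rightarrow> real \<Rightarrow> real \<Rightarrow> real \<Rightarrow> (real \<Rightarrow> real) \<Rightarrow> real \<Rightarrow>
     ((real \<Rightarrow> real \<Rightarrow> real) \<times> (real \<Rightarrow> real \<Rightarrow> real)) set" where
  "admissible T a b lam \<beta> y0 C0 =
     {(y, u). y \<in> state_space T {a<..<b} \<and> u \<in> control_space T {a<..<b} \<and>
        thin_film_equation T {a<..<b} lam \<beta> y u \<and>
        has_initial_value T {a<..<b} y y0 \<and>
        boundary_conditions T a b y \<and>
        (AE t in lebesgue_on {0<..<T}. AE x in lebesgue_on {a<..<b}. y t x \<ge> C0)}"

end

theory Submission
 imports Defs "HOL-Library.Diagonal_Subsequence"
begin

text \<open>Why a minimizer exists.  With Neumann conditions the state is a cosine series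
\<open>y(t, x) = \<Sum>\<^sub>k c\<^sub>k(t) e\<^sub>k(x)\<close> and the control a sine series, so that \<open>u\<^sub>x\<close> is a cosine series with
coefficients \<open>v\<^sub>k\<close> and \<open>v\<^sub>0 = 0\<close>.  The boundary conditions are then built into the basis, the Sobolev
norms become weighted sums of squares, and the equation becomes the system
\<open>c\<^sub>k' = v\<^sub>k - \<lambda> w\<^sub>k F\<^sub>k(c)\<close>, where \<open>F\<^sub>k(c)\<close> is the \<open>k\<close>-th sine coefficient of the flux
\<open>|y|\<^sup>\<beta> y\<^sub>x\<^sub>x\<^sub>x\<close> and \<open>w\<^sub>k = k \<pi> / (b - a)\<close>.  The locale predicate \<open>adm\<close> is this coefficient problem; the
lemmas \<open>admissible_imp_adm\<close>, \<open>adm_imp_admissible\<close> and \<open>cost_eq_cost_coef\<close> translate the constraint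
set and the cost in both directions.

The minimization itself is the direct method.

The constraint set is not empty (\<open>exists_admissible\<close>).  No evolution equation has to be solved for
this, because the control may be anything of finite cost: a biharmonic heat flow that is slow enough
to stay above \<open>C\<^sub>0\<close> during \<open>[0, T]\<close> is prescribed as the state, and \<open>u\<^sub>x\<close> is read off the equation.
This needs \<open>y\<^sub>0 \<ge> C\<^sub>1\<close> with some \<open>C\<^sub>1 > C\<^sub>0\<close>, and here the smallness of \<open>C\<^sub>0\<close> enters: energy and
entropy alone bound \<open>y\<^sub>0\<close> from below (\<open>initial_lower_bound\<close>).  Finite energy makes \<open>y\<^sub>0\<close> Hoelder
continuous with exponent \<open>1/2\<close>; near a point where \<open>y\<^sub>0\<close> is almost zero, \<open>y\<^sub>0\<^sup>2\<^sup>-\<^sup>\<beta>\<close> with \<open>\<beta> \<ge> 4\<close> is at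
least a multiple of \<open>1 / (\<mu>\<^sup>2 + |x - x\<^sub>0|)\<close>, whose integral diverges logarithmically as \<open>\<mu> \<rightarrow> 0\<close>.

A bound on the cost bounds the states (\<open>a_priori\<close>).  Below, \<open>|y|\<^sup>\<beta> \<ge> C\<^sub>0\<^sup>\<beta>\<close> is the given state
constraint, which makes the equation uniformly parabolic.  Testing with \<open>y\<^sub>x\<^sub>x\<close> gives the energy
estimate and with it an upper bound on \<open>y\<close>; testing with \<open>y\<^sub>x\<^sub>x\<^sub>x\<^sub>x\<close> gives \<open>y \<in> L\<^sup>2(H\<^sup>4)\<close>, the lower
order term \<open>\<beta> y\<^sup>\<beta>\<^sup>-\<^sup>1 y\<^sub>x y\<^sub>x\<^sub>x\<^sub>x\<close> being absorbed by interpolation (\<open>flux_x_coercive\<close>); the equation then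
bounds \<open>y\<^sub>t\<close>.

The constraint set is closed under weak limits (\<open>limit_admissible\<close>).  Along a subsequence \<open>d\<^sub>k = c\<^sub>k'\<close>
and \<open>v\<^sub>k\<close> converge weakly for all \<open>k\<close> at once, hence each \<open>c\<^sub>k\<close> converges pointwise, and the \<open>H\<^sup>4\<close> bound
upgrades this to convergence of \<open>y\<^sub>x\<^sub>x\<^sub>x\<close> in \<open>L\<^sup>2\<close> (\<open>tight_series_tendsto\<close>, which replaces a compactness
theorem of Aubin-Lions type).  The flux coefficients are Lipschitz in that norm, so the nonlinear
equation passes to the limit.  Finally the cost is weakly lower semicontinuous (\<open>coef_minimizer\<close>).\<close>

section \<open>Square-integrable functions on an interval\<close>

locale interval =
 fixes a b :: real
 assumes a_less_b: "a < b"
begin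

abbreviation I :: "real set" where "I \<equiv> {a<..<b}"
abbreviation L2 :: "(real \<Rightarrow> real) set" where "L2 \<equiv> L2_space I"
abbreviation M :: "real measure" where "M \<equiv> lebesgue_on {a<..<b}"

definition ip :: "(real => real) => (real => real) => real" where
 "ip f g = (\<integral>x. f x * g x \<partial>M)"

lemma I_sets [simp]: "I \<in> sets lebesgue" by simp

lemma finite_M: "finite_measure M"
 by (rule finite_measure_lebesgue_on) simp

sublocale finite_measure M by (rule finite_M)

lemma measure_M: "measure M (space M) = b - a"
 using a_less_b by (simp add: measure_restrict_space)

lemma const_integrable [simp]: "integrable M (%x. c::real)"
 by simp

lemma L2_iff: "f \<in> L2 \<longleftrightarrow> f \<in> borel_measurable M \<and> integrable M (%x. (f x)^2)"
 by (simp add: L2_space_def)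

lemma L2_meas: "f \<in> L2 ==> f \<in> borel_measurable M"
 by (simp add: L2_iff)

lemma L2_sq: "f \<in> L2 ==> integrable M (%x. (f x)^2)"
 by (simp add: L2_iff)

lemma L2_mult_integrable:
 assumes "f \<in> L2" "g \<in> L2"
 shows "integrable M (%x. f x * g x)"
proof (rule Bochner_Integration.integrable_bound[where M=M and f="%x. (f x)^2 + (g x)^2"])
 show "integrable M (%x. (f x)^2 + (g x)^2)"
  using assms by (intro Bochner_Integration.integrable_add L2_sq)
 show "(%x. f x * g x) \<in> borel_measurable M"
  using assms by (intro borel_measurable_times L2_meas)
 have "\<bar>u * v\<bar> <= u^2 + v^2" for u v :: real
 proof -
  have "0 <= (\<bar>u\<bar> - \<bar>v\<bar>)^2" by simp
  then have "2 * (\<bar>u\<bar> * \<bar>v\<bar>) <= u^2 + v^2" by (simp add: power2_diff)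
  moreover have "0 <= \<bar>u\<bar> * \<bar>v\<bar>" by simp
  ultimately show ?thesis unfolding abs_mult by linarith
 qed
 then show "AE x in M. norm (f x * g x) <= norm ((f x)^2 + (g x)^2)"
  by (auto intro!: AE_I2 order_trans[OF _ abs_ge_self])
qed

lemma L2_add: "f \<in> L2 ==> g \<in> L2 ==> (%x. f x + g x) \<in> L2"
 using L2_mult_integrable[of f g]
 by (auto simp: L2_iff power2_sum mult.assoc
    intro!: borel_measurable_add Bochner_Integration.integrable_add integrable_mult_right)

lemma L2_scale: "f \<in> L2 ==> (%x. c * f x) \<in> L2"
 by (auto simp: L2_iff power_mult_distrib intro!: borel_measurable_times)

lemma L2_minus: "f \<in> L2 ==> (%x. - f x) \<in> L2"
 using L2_scale[of f "-1"] by simp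

lemma L2_diff: "f \<in> L2 ==> g \<in> L2 ==> (%x. f x - g x) \<in> L2"
 using L2_add[of f "%x. - g x"] L2_minus[of g] by simp

lemma L2_const [simp]: "(%x. c) \<in> L2"
 by (simp add: L2_iff)

lemma L2_sum: "(\<And>i. i \<in> A ==> f i \<in> L2) ==> (%x. \<Sum>i\<in>A. f i x) \<in> L2"
 by (induction A rule: infinite_finite_induct) (auto intro: L2_add)

lemma L2_integrable: "f \<in> L2 ==> integrable M f"
 using L2_mult_integrable[of f "%_. 1"] by simp

lemma measurable_cong_AE:
 fixes f g :: "real => real"
 assumes "f \<in> borel_measurable M" "AE x in M. f x = g x"
 shows "g \<in> borel_measurable M"
proof -
 have 1: "(%x. if x \<in> I then f x else 0) \<in> borel_measurable lebesgue"
  using assms(1) by (subst borel_measurable_if) auto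
 have "AE x in lebesgue. (if x \<in> I then f x else 0) = (if x \<in> I then g x else 0)"
  using assms(2) by (subst (asm) AE_restrict_space_iff) (auto elim: AE_mp)
 from borel_measurable_AE[OF 1 this] show ?thesis
  by (subst (asm) borel_measurable_if) auto
qed

lemma L2_cong_AE:
 assumes "f \<in> L2" "AE x in M. f x = g x"
 shows "g \<in> L2"
proof -
 have m: "g \<in> borel_measurable M"
  using measurable_cong_AE[OF L2_meas[OF assms(1)] assms(2)] .
 have "integrable M (%x. (g x)^2)"
  by (rule integrable_cong_AE_imp[OF L2_sq[OF assms(1)]])
    (use m assms(2) in \<open>auto elim!: AE_mp\<close>)
 with m show ?thesis by (simp add: L2_iff)
qed

lemma L2_bounded_mult:
 assumes "f \<in> L2" "h \<in> borel_measurable M" "AE x in M. \<bar>h x\<bar> <= B"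
 shows "(%x. h x * f x) \<in> L2"
 unfolding L2_iff
proof (intro conjI)
 show m: "(%x. h x * f x) \<in> borel_measurable M"
  using assms L2_meas by (intro borel_measurable_times) auto
 show "integrable M (%x. (h x * f x)^2)"
 proof (rule Bochner_Integration.integrable_bound[where M=M and f="%x. B^2 * (f x)^2"])
  show "integrable M (%x. B^2 * (f x)^2)" using L2_sq[OF assms(1)] by simp
  show "(%x. (h x * f x)^2) \<in> borel_measurable M" using m by simp
  show "AE x in M. norm ((h x * f x)^2) <= norm (B^2 * (f x)^2)"
   using assms(3)
   by eventually_elim
     (auto simp: power_mult_distrib abs_mult abs_le_square_iff[symmetric] intro!: mult_right_mono)
 qed
qed

lemma continuous_meas:
 fixes f :: "real => real"
 shows "continuous_on I f ==> f \<in> borel_measurable M"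
 by (intro continuous_imp_measurable_on_sets_lebesgue) auto

lemma continuous_bounded:
 assumes "continuous_on {a..b} f"
 obtains B where "0 <= B" "\<And>x. x \<in> {a..b} ==> \<bar>f x :: real\<bar> <= B"
proof -
 have "bounded (f ` {a..b})"
  using assms compact_continuous_image compact_imp_bounded by blast
 then obtain B where B: "\<forall>y\<in>f ` {a..b}. norm y <= B"
  unfolding bounded_iff by blast
 show thesis
  using B by (intro that[of "max 0 B"]) (force simp: le_max_iff_disj)+
qed

lemma continuous_L2_mult:
 assumes "continuous_on {a..b} h" "f \<in> L2"
 shows "(%x. h x * f x) \<in> L2"
proof -
 obtain B where "\<And>x. x \<in> {a..b} ==> \<bar>h x\<bar> <= B"
  using continuous_bounded[OF assms(1)] by metis
 then show ?thesis
  by (intro L2_bounded_mult[OF assms(2), of _ B] continuous_meas AE_I2)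
    (auto intro: continuous_on_subset[OF assms(1)])
qed

lemma continuous_L2: "continuous_on {a..b} h ==> h \<in> L2"
 using continuous_L2_mult[of h "%_. 1"] by simp

abbreviation nrm :: "(real => real) => real" where "nrm f \<equiv> L2_norm I f"

lemma nrm_nonneg [simp]: "0 <= nrm f"
 by (simp add: L2_norm_def)

lemma nrm_sq: "(nrm f)^2 = ip f f"
 unfolding L2_norm_def ip_def power2_eq_square[symmetric] by (rule real_sqrt_pow2) simp

lemma nrm_sq': "(nrm f)^2 = (\<integral>x. (f x)^2 \<partial>M)"
 using nrm_sq[of f] by (simp only: ip_def power2_eq_square)

lemma nrm_cong_AE: "AE x in M. f x = g x ==> f \<in> L2 ==> nrm f = nrm g"
 unfolding L2_norm_def using L2_cong_AE[of f g]
 by (auto simp: L2_iff intro!: arg_cong[where f = sqrt] integral_cong_AE elim!: AE_mp)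

lemma ip_cong_AE:
 assumes "AE x in M. f x = f' x" "f \<in> L2" "AE x in M. g x = g' x" "g \<in> L2"
 shows "ip f g = ip f' g'"
 unfolding ip_def using L2_cong_AE[of f f'] L2_cong_AE[of g g'] assms
 by (intro integral_cong_AE) (auto simp: L2_iff)

lemma ip_commute: "ip f g = ip g f"
 by (simp add: ip_def mult.commute)

lemma ip_add_left: "f \<in> L2 ==> g \<in> L2 ==> h \<in> L2 ==>
  ip (%x. f x + g x) h = ip f h + ip g h"
 unfolding ip_def distrib_right by (intro Bochner_Integration.integral_add L2_mult_integrable)

lemma ip_diff_left: "f \<in> L2 ==> g \<in> L2 ==> h \<in> L2 ==>
  ip (%x. f x - g x) h = ip f h - ip g h"
 unfolding ip_def left_diff_distrib by (intro Bochner_Integration.integral_diff L2_mult_integrable)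

lemma ip_scale_left: "ip (%x. c * f x) h = c * ip f h"
 unfolding ip_def mult.assoc by simp

lemma ip_sum_left:
 assumes "\<And>i. i \<in> A ==> f i \<in> L2" "h \<in> L2"
 shows "ip (%x. \<Sum>i\<in>A. f i x) h = (\<Sum>i\<in>A. ip (f i) h)"
 using assms
proof (induction A rule: infinite_finite_induct)
 case (insert i A)
 then show ?case using ip_add_left[of "f i" "%x. \<Sum>i\<in>A. f i x" h] L2_sum[of A f] by simp
qed (auto simp: ip_def)

lemma ip_nonneg: "0 <= ip f f"
 unfolding ip_def by simp

lemma Cauchy_Schwarz_ip:
 assumes f: "f \<in> L2" and g: "g \<in> L2"
 shows "\<bar>ip f g\<bar> <= nrm f * nrm g"
proof -
 have q: "0 <= ip f f + 2 * t * ip f g + t^2 * ip g g" for t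
 proof -
  have tg: "(%x. t * g x) \<in> L2" and s: "(%x. f x + t * g x) \<in> L2"
   using f g by (auto intro: L2_add L2_scale)
  have "ip (%x. f x + t * g x) (%x. f x + t * g x)
    = ip f (%x. f x + t * g x) + t * ip g (%x. f x + t * g x)"
   using ip_add_left[OF f tg s] by (simp add: ip_scale_left)
  also have "ip f (%x. f x + t * g x) = ip f f + t * ip f g"
   using ip_add_left[OF f tg f]
   by (simp add: ip_scale_left ip_commute[of f "%x. f x + t * g x"] ip_commute[of g f])
  also have "ip g (%x. f x + t * g x) = ip f g + t * ip g g"
   using ip_add_left[OF f tg g]
   by (simp add: ip_scale_left ip_commute[of g "%x. f x + t * g x"])
  finally show ?thesis
   using ip_nonneg[of "%x. f x + t * g x"] by (simp add: algebra_simps power2_eq_square)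
 qed
 have "(ip f g)^2 <= ip f f * ip g g"
 proof (cases "ip g g = 0")
  case True
  have "ip f g = 0"
  proof (rule ccontr)
   assume "ip f g \<noteq> 0"
   with q[of "- (ip f f + 1) / (2 * ip f g)"] True show False
    by (simp add: field_simps)
  qed
  then show ?thesis by (simp add: ip_nonneg)
 next
  case False
  then have "0 < ip g g" using ip_nonneg[of g] by linarith
  with q[of "- ip f g / ip g g"] show ?thesis
   by (simp add: field_simps power2_eq_square)
 qed
 then have "(ip f g)^2 <= (nrm f * nrm g)^2"
  by (simp add: power_mult_distrib nrm_sq)
 then have "\<bar>ip f g\<bar> <= \<bar>nrm f * nrm g\<bar>"
  unfolding abs_le_square_iff .
 then show ?thesis by (simp only: abs_mult abs_of_nonneg nrm_nonneg)
qed

lemma nrm_triangle: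
 assumes f: "f \<in> L2" and g: "g \<in> L2"
 shows "nrm (%x. f x + g x) <= nrm f + nrm g"
proof -
 have s: "(%x. f x + g x) \<in> L2" using f g by (rule L2_add)
 have "(nrm (%x. f x + g x))^2 = ip f (%x. f x + g x) + ip g (%x. f x + g x)"
  unfolding nrm_sq by (rule ip_add_left[OF f g s])
 also have "\<dots> <= nrm f * nrm (%x. f x + g x) + nrm g * nrm (%x. f x + g x)"
  using Cauchy_Schwarz_ip[OF f s] Cauchy_Schwarz_ip[OF g s] by linarith
 finally have "nrm (%x. f x + g x) * nrm (%x. f x + g x)
   <= (nrm f + nrm g) * nrm (%x. f x + g x)"
  by (simp add: power2_eq_square algebra_simps)
 then show ?thesis
  using nrm_nonneg[of f] nrm_nonneg[of g] nrm_nonneg[of "%x. f x + g x"]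
  unfolding mult_le_cancel_right by linarith
qed

lemma nrm_scale: "nrm (%x. c * f x) = \<bar>c\<bar> * nrm f"
 by (simp add: L2_norm_def power_mult_distrib real_sqrt_mult)

lemma nrm_diff_commute: "nrm (%x. f x - g x) = nrm (%x. g x - f x)"
 by (simp add: L2_norm_def power2_commute)

lemma nrm_triangle_diff:
 assumes "f \<in> L2" "g \<in> L2" "h \<in> L2"
 shows "nrm (%x. f x - h x) <= nrm (%x. f x - g x) + nrm (%x. g x - h x)"
 using nrm_triangle[OF L2_diff[OF assms(1,2)] L2_diff[OF assms(2,3)]] by simp

lemma nrm_rev_triangle:
 assumes "f \<in> L2" "g \<in> L2"
 shows "\<bar>nrm f - nrm g\<bar> <= nrm (%x. f x - g x)"
 using nrm_triangle[OF assms(1) L2_diff[OF assms(2,1)]]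
  nrm_triangle[OF assms(2) L2_diff[OF assms]] nrm_diff_commute[of f g] by simp

lemma nrm_zero_imp_AE:
 assumes "f \<in> L2" "nrm f = 0"
 shows "AE x in M. f x = 0"
proof -
 have "(\<integral>x. (f x)^2 \<partial>M) = 0" using assms(2) nrm_sq'[of f] by simp
 then have "AE x in M. (f x)^2 = 0"
  using integral_nonneg_eq_0_iff_AE[OF L2_sq[OF assms(1)]] by simp
 then show ?thesis by simp
qed

lemma nrm_const: "nrm (%x. c) = \<bar>c\<bar> * sqrt (b - a)"
 using measure_M by (simp add: L2_norm_def real_sqrt_mult)

lemma abs_L2: "f \<in> L2 ==> (%x. \<bar>f x\<bar>) \<in> L2"
 by (auto simp: L2_iff)

lemma integral_abs_le_nrm:
 assumes "f \<in> L2"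
 shows "(\<integral>x. \<bar>f x\<bar> \<partial>M) <= sqrt (b - a) * nrm f"
proof -
 have "(\<integral>x. \<bar>f x\<bar> \<partial>M) <= \<bar>ip (%x. \<bar>f x\<bar>) (%x. 1)\<bar>" by (simp add: ip_def)
 also have "\<dots> <= nrm (%x. \<bar>f x\<bar>) * nrm (%x. 1)"
  by (intro Cauchy_Schwarz_ip abs_L2 assms) simp
 also have "nrm (%x. \<bar>f x\<bar>) = nrm f" by (simp add: L2_norm_def)
 finally show ?thesis by (simp add: nrm_const mult.commute)
qed

lemma nrm_mono:
 assumes "f \<in> L2" "g \<in> L2" "AE x in M. \<bar>f x\<bar> <= \<bar>g x\<bar>"
 shows "nrm f <= nrm g"
 unfolding L2_norm_def using assms
 by (intro real_sqrt_le_mono integral_mono_AE L2_sq) (auto simp: abs_le_square_iff)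

lemma nrm_bounded_mult:
 assumes "f \<in> L2" "h \<in> borel_measurable M" "AE x in M. \<bar>h x\<bar> <= B" "0 <= B"
 shows "nrm (%x. h x * f x) <= B * nrm f"
proof -
 have "nrm (%x. h x * f x) <= nrm (%x. B * f x)"
  using assms(3) \<open>0 <= B\<close>
  by (intro nrm_mono L2_bounded_mult[OF assms(1-3)] L2_scale[OF assms(1)])
    (auto simp: abs_mult intro!: mult_right_mono elim!: AE_mp)
 with \<open>0 <= B\<close> show ?thesis by (simp add: nrm_scale)
qed

lemma ip_tendsto:
 assumes "\<And>n. f n \<in> L2" "g \<in> L2" "h \<in> L2"
  and "(%n. nrm (%x. f n x - g x)) \<longlonglongrightarrow> 0"
 shows "(%n. ip (f n) h) \<longlonglongrightarrow> ip g h"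
proof (rule LIM_zero_cancel, rule Lim_null_comparison)
 show "(%n. nrm (%x. f n x - g x) * nrm h) \<longlonglongrightarrow> 0"
  using tendsto_mult_left_zero[OF assms(4)] .
 show "\<forall>\<^sub>F n in sequentially. norm (ip (f n) h - ip g h) <= nrm (%x. f n x - g x) * nrm h"
  using Cauchy_Schwarz_ip[OF L2_diff[OF assms(1,2)] assms(3)]
  by (simp add: ip_diff_left assms)
qed

lemma nrm_tendsto:
 assumes "\<And>n. f n \<in> L2" "g \<in> L2"
  and "(%n. nrm (%x. f n x - g x)) \<longlonglongrightarrow> 0"
 shows "(%n. nrm (f n)) \<longlonglongrightarrow> nrm g"
 by (rule LIM_zero_cancel, rule Lim_null_comparison[OF _ assms(3)])
   (use nrm_rev_triangle[OF assms(1,2)] in auto)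

end

text \<open>Fatou's lemma in the form used throughout: a bound on integrals survives pointwise limits.\<close>

lemma integral_le_of_AE_tendsto:
 fixes u :: "nat => 'a => real"
 assumes u: "\<And>i. integrable N (u i)" "\<And>i. AE x in N. 0 <= u i x"
  and B: "\<And>i. integral\<^sup>L N (u i) <= B"
  and lim: "AE x in N. (%i. u i x) \<longlonglongrightarrow> v x" and v: "v \<in> borel_measurable N"
 shows "integrable N v" "integral\<^sup>L N v <= B" "AE x in N. 0 <= v x"
proof -
 have all0: "AE x in N. \<forall>i. 0 <= u i x" using u(2) by (simp add: AE_all_countable)
 show v0: "AE x in N. 0 <= v x"
  using all0 lim by eventually_elim (rule LIMSEQ_le_const, auto)
 have B0: "0 <= B" using B[of 0] integral_nonneg_AE[OF u(2), of 0] by linarith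
 have "(\<integral>\<^sup>+x. ennreal (v x) \<partial>N) = (\<integral>\<^sup>+x. liminf (%i. ennreal (u i x)) \<partial>N)"
 proof (intro nn_integral_cong_AE, use lim in eventually_elim)
  fix x assume "(%i. u i x) \<longlonglongrightarrow> v x"
  from lim_imp_Liminf[OF sequentially_bot tendsto_ennrealI[OF this]]
  show "ennreal (v x) = liminf (%i. ennreal (u i x))" by simp
 qed
 also have "\<dots> <= liminf (%i. \<integral>\<^sup>+x. ennreal (u i x) \<partial>N)"
  using u(1) by (intro nn_integral_liminf) auto
 also have "\<dots> <= ennreal B"
 proof -
  have "(\<integral>\<^sup>+x. ennreal (u i x) \<partial>N) <= ennreal B" for i
   unfolding nn_integral_eq_integral[OF u] using B by (rule ennreal_leI)
  then have "liminf (%i. \<integral>\<^sup>+x. ennreal (u i x) \<partial>N) <= liminf (%i. ennreal B)"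
   by (intro Liminf_mono) simp
  then show ?thesis by (simp add: Liminf_const)
 qed
 finally have le: "(\<integral>\<^sup>+x. ennreal (v x) \<partial>N) <= ennreal B" .
 show i: "integrable N v"
  using le v v0 by (intro integrableI_nonneg) (auto intro: le_less_trans)
 show "integral\<^sup>L N v <= B"
  using le B0 by (simp add: nn_integral_eq_integral[OF i v0])
qed

context interval
begin

text \<open>The sequence is Cauchy in \<open>L\<^sup>1\<close> as well, so a subsequence converges almost everywhere; by Fatou's lemma its
 pointwise limit is the limit in norm.\<close>

lemma L2_complete:
 assumes f: "\<And>n. f n \<in> L2"
  and cau: "\<And>e. e > 0 ==> \<exists>N. \<forall>m\<ge>N. \<forall>n\<ge>N. nrm (%x. f m x - f n x) < e"
 obtains g where "g \<in> L2" "(%n. nrm (%x. f n x - g x)) \<longlonglongrightarrow> 0"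
proof -
 have ba: "0 < sqrt (b - a)" using a_less_b by simp
 obtain r where r: "strict_mono r" "AE x in M. Cauchy (%i. f (r i) x)"
 proof (rule cauchy_L1_AE_cauchy_subseq[of M f])
  show "integrable M (f n)" for n using f by (rule L2_integrable)
  show "\<exists>N. \<forall>i\<ge>N. \<forall>j\<ge>N. (\<integral>x. norm (f i x - f j x) \<partial>M) < e" if "e > 0" for e
  proof -
   have "0 < e / sqrt (b - a)" using that ba by simp
   from cau[OF this] obtain N
    where N: "\<And>m n. m \<ge> N ==> n \<ge> N ==> nrm (%x. f m x - f n x) < e / sqrt (b - a)"
    by blast
   have "(\<integral>x. norm (f i x - f j x) \<partial>M) < e" if "i \<ge> N" "j \<ge> N" for i j
    using integral_abs_le_nrm[OF L2_diff[OF f f], of i j] N[OF that] ba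
    by (auto simp: field_simps)
   then show ?thesis by blast
  qed
 qed
 define g where "g x = lim (%i. f (r i) x)" for x
 have gm: "g \<in> borel_measurable M"
  unfolding g_def using L2_meas[OF f] by (intro borel_measurable_lim_metric) auto
 have glim: "AE x in M. (%i. f (r i) x) \<longlonglongrightarrow> g x"
  using r(2) unfolding g_def
  by eventually_elim (simp add: Cauchy_convergent_iff convergent_LIMSEQ_iff)
 have key: "(%x. f n x - g x) \<in> L2 \<and> nrm (%x. f n x - g x) <= e"
  if N: "\<forall>m\<ge>N. \<forall>n\<ge>N. nrm (%x. f m x - f n x) < e" and n: "n \<ge> N" for N n e
 proof -
  have e0: "0 <= e"
   using N[rule_format, OF n n] nrm_nonneg[of "%x. f n x - f n x"] by linarith
  have "integrable M (%x. (f n x - g x)^2)" "(\<integral>x. (f n x - g x)^2 \<partial>M) <= e^2"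
  proof -
   have a1: "integrable M (%x. (f n x - f (r (i + N)) x)^2)" for i
    by (intro L2_sq L2_diff f)
   have a2: "(\<integral>x. (f n x - f (r (i + N)) x)^2 \<partial>M) <= e^2" for i
   proof -
    have "r (i + N) \<ge> N" using seq_suble[OF r(1), of "i + N"] by linarith
    then have "nrm (%x. f n x - f (r (i + N)) x) <= e" using N n by (simp add: less_imp_le)
    from power_mono[OF this, of 2] show ?thesis by (simp add: nrm_sq')
   qed
   have a3: "AE x in M. (%i. (f n x - f (r (i + N)) x)^2) \<longlonglongrightarrow> (f n x - g x)^2"
    using glim by eventually_elim
     (intro tendsto_intros, erule LIMSEQ_ignore_initial_segment)
   have a4: "(%x. (f n x - g x)^2) \<in> borel_measurable M"
    using gm L2_meas[OF f] by simp
   show "integrable M (%x. (f n x - g x)^2)" "(\<integral>x. (f n x - g x)^2 \<partial>M) <= e^2"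
    using integral_le_of_AE_tendsto(1,2)[OF a1 _ a2 a3 a4] by auto
  qed
  moreover from this have "nrm (%x. f n x - g x) <= e"
   using e0 by (simp add: L2_norm_def real_le_lsqrt)
  ultimately show ?thesis using gm L2_meas[OF f] by (simp add: L2_iff)
 qed
 obtain N0 where "\<forall>m\<ge>N0. \<forall>n\<ge>N0. nrm (%x. f m x - f n x) < 1" using cau[of 1] by auto
 from key[OF this order_refl] have "(%x. f N0 x - g x) \<in> L2" ..
 from L2_diff[OF f this, of N0] have g: "g \<in> L2" by simp
 show thesis
 proof (rule that[OF g], rule LIMSEQ_I)
  fix e :: real assume "0 < e"
  then obtain N where N: "\<forall>m\<ge>N. \<forall>n\<ge>N. nrm (%x. f m x - f n x) < e / 2"
   using cau[of "e/2"] by auto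
  show "\<exists>N. \<forall>n\<ge>N. norm (nrm (%x. f n x - g x) - 0) < e"
  proof (intro exI[of _ N] allI impI)
   fix n assume "N <= n"
   with key[OF N] have "nrm (%x. f n x - g x) <= e / 2" by blast
   with \<open>0 < e\<close> show "norm (nrm (%x. f n x - g x) - 0) < e" by simp
  qed
 qed
qed

end

section \<open>Test functions and weak derivatives\<close>

definition smooth :: "(real => real) => bool" where
 "smooth f \<longleftrightarrow> (\<forall>k x. (deriv ^^ k) f field_differentiable at x)"

lemma smooth_coinduct:
 assumes "f \<in> A" "\<And>g x. g \<in> A ==> g field_differentiable at x" "\<And>g. g \<in> A ==> deriv g \<in> A"
 shows "smooth f"
proof -
 have "(deriv ^^ k) f \<in> A" for k
  by (induction k) (auto simp: assms)
 then show ?thesis using assms(2) by (auto simp: smooth_def)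
qed

lemma smooth_deriv: "smooth f ==> smooth (deriv f)"
 unfolding smooth_def by (metis comp_apply funpow_Suc_right)

lemma smooth_differentiable: "smooth f ==> f field_differentiable at x"
 unfolding smooth_def by (metis funpow_0)

lemma smooth_DERIV: "smooth f ==> (f has_real_derivative deriv f x) (at x)"
 by (simp add: DERIV_deriv_iff_field_differentiable smooth_differentiable)

lemma smooth_DERIV_within: "smooth f ==> (f has_real_derivative deriv f x) (at x within A)"
 using smooth_DERIV has_field_derivative_at_within by blast

lemma smooth_continuous: "smooth f ==> continuous_on A f"
 by (meson continuous_at_imp_continuous_on DERIV_isCont smooth_DERIV)

lemma smooth_of_DERIV:
 assumes "\<And>x. (f has_real_derivative g x) (at x)" "smooth g"
 shows "smooth f"
proof -
 have "deriv f = g" using assms(1) DERIV_imp_deriv by blast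
 then have "(deriv ^^ k) f = (if k = 0 then f else (deriv ^^ (k - 1)) g)" for k
  by (cases k) (simp_all add: funpow_Suc_right del: funpow.simps(2))
 then show ?thesis
  using assms by (auto simp: smooth_def field_differentiable_def)
qed

lemma smooth_add:
 assumes "smooth f" "smooth g"
 shows "smooth (%x. f x + g x)"
proof (rule smooth_coinduct[where A = "{%x. f x + g x |f g. smooth f \<and> smooth g}"])
 fix h x assume "h \<in> {%x. f x + g x |f g. smooth f \<and> smooth g}"
 then obtain f g where h: "h = (%x. f x + g x)" "smooth f" "smooth g" by auto
 have D: "(h has_real_derivative deriv f x + deriv g x) (at x)" for x
  unfolding h(1) by (intro DERIV_add smooth_DERIV h)
 then show "h field_differentiable at x" by (auto simp: field_differentiable_def)
 show "deriv h \<in> {%x. f x + g x |f g. smooth f \<and> smooth g}"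
  using DERIV_imp_deriv[OF D] smooth_deriv h(2,3) by blast
qed (use assms in auto)

lemma smooth_const: "smooth (%x. c)"
 by (rule smooth_coinduct[where A = "range (%c x. c)"])
   (auto intro!: ext DERIV_imp_deriv derivative_eq_intros)

inductive_set product_sums :: "(real => real) set" where
 mult: "smooth f ==> smooth g ==> (%x. f x * g x) \<in> product_sums"
| add: "f \<in> product_sums ==> g \<in> product_sums ==> (%x. f x + g x) \<in> product_sums"

lemma smooth_mult:
 assumes "smooth f" "smooth g"
 shows "smooth (%x. f x * g x)"
proof (rule smooth_coinduct[where A = product_sums])
 have "(\<forall>x. h field_differentiable at x) \<and> deriv h \<in> product_sums" if "h \<in> product_sums" for h
  using that
 proof induction
  case (mult f g)
  have D: "((%x. f x * g x) has_real_derivative f x * deriv g x + deriv f x * g x) (at x)" for x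
   using DERIV_mult'[OF smooth_DERIV[OF mult(1)] smooth_DERIV[OF mult(2)]] .
  have "(%x. f x * deriv g x + deriv f x * g x) \<in> product_sums"
   by (intro product_sums.intros smooth_deriv mult)
  then show ?case
   using DERIV_imp_deriv[OF D] D by (auto simp: field_differentiable_def)
 next
  case (add f g)
  have D: "((%x. f x + g x) has_real_derivative deriv f x + deriv g x) (at x)" for x
   using add by (intro DERIV_add) (auto simp: DERIV_deriv_iff_field_differentiable)
  have "(%x. deriv f x + deriv g x) \<in> product_sums"
   using add by (intro product_sums.intros) auto
  then show ?case
   using DERIV_imp_deriv[OF D] D by (auto simp: field_differentiable_def)
 qed
 then show "h field_differentiable at x" "deriv h \<in> product_sums" if "h \<in> product_sums" for h x
  using that by auto
qed (use assms in \<open>rule product_sums.mult\<close>)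

lemma smooth_cmult: "smooth f ==> smooth (%x. c * f x)"
 by (intro smooth_mult smooth_const)

lemma smooth_affine:
 assumes "smooth f"
 shows "smooth (%x. f (m * x + q))"
proof (rule smooth_coinduct[where A = "{%x. r * f (m * x + q) |f r. smooth f}"])
 fix h x assume "h \<in> {%x. r * f (m * x + q) |f r. smooth f}"
 then obtain f r where h: "h = (%x. r * f (m * x + q))" "smooth f" by auto
 have D: "(h has_real_derivative (r * m) * deriv f (m * x + q)) (at x)" for x
  unfolding h(1)
  by (rule derivative_eq_intros DERIV_chain2[OF smooth_DERIV[OF h(2)]] refl | simp)+
 then show "h field_differentiable at x" by (auto simp: field_differentiable_def)
 show "deriv h \<in> {%x. r * f (m * x + q) |f r. smooth f}"
  using DERIV_imp_deriv[OF D] smooth_deriv[OF h(2)] by blast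
next
 have "(%x. f (m * x + q)) = (%x. 1 * f (m * x + q))" by simp
 with assms show "(%x. f (m * x + q)) \<in> {%x. r * f (m * x + q) |f r. smooth f}" by blast
qed

lemma smooth_cos: "smooth (%x. r * cos (m * x + q))"
proof (rule smooth_coinduct[where A = "{%x. r * cos (m * x + q) |r q. True}"])
 fix h x assume "h \<in> {%x. r * cos (m * x + q) |r q. True}"
 then obtain r q where h: "h = (%x. r * cos (m * x + q))" by auto
 have D: "(h has_real_derivative (r * m) * cos (m * x + (q + pi / 2))) (at x)" for x
 proof -
  have "(h has_real_derivative r * (- sin (m * x + q) * m)) (at x)"
   unfolding h by (auto intro!: derivative_eq_intros)
  moreover have "cos (m * x + (q + pi / 2)) = - sin (m * x + q)"
   using cos_add[of "m * x + q" "pi / 2"] by (simp add: add.assoc)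
  ultimately show ?thesis by (simp add: mult.commute mult.left_commute mult.assoc)
 qed
 then show "h field_differentiable at x" by (auto simp: field_differentiable_def)
 show "deriv h \<in> {%x. r * cos (m * x + q) |r q. True}"
  using DERIV_imp_deriv[OF D] by blast
qed auto

text \<open>The standard flat function; all its derivatives have the form \<open>p(1/x) e\<^sup>-\<^sup>1\<^sup>/\<^sup>x\<close> on \<open>x > 0\<close>.\<close>

definition flat :: "real poly => real => real" where
 "flat p x = (if x > 0 then poly p (1 / x) * exp (- 1 / x) else 0)"

lemma poly_exp_tendsto_0: "((%u. poly p u * exp (- u)) \<longlongrightarrow> (0::real)) at_top"
proof -
 have "((%u. coeff p i * (u ^ i / exp u)) \<longlongrightarrow> coeff p i * 0) at_top" for i
  by (intro tendsto_intros tendsto_power_div_exp_0)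
 then have "((%u. \<Sum>i\<le>degree p. coeff p i * (u ^ i / exp u)) \<longlongrightarrow> 0) at_top"
  by (intro tendsto_null_sum) simp
 moreover have "poly p u * exp (- u) = (\<Sum>i\<le>degree p. coeff p i * (u ^ i / exp u))" for u
  unfolding poly_altdef sum_distrib_right by (simp add: exp_minus divide_inverse mult.assoc)
 ultimately show ?thesis by simp
qed

lemma flat_DERIV: "(flat p has_real_derivative flat ([:0, 0, 1:] * (p - pderiv p)) x) (at x)"
proof -
 consider "x > 0" | "x < 0" | "x = 0" by linarith
 then show ?thesis
 proof cases
  case 1
  have "((%x. poly p (1 / x) * exp (- 1 / x)) has_real_derivative
    flat ([:0, 0, 1:] * (p - pderiv p)) x) (at x)"
   using 1 by (auto intro!: derivative_eq_intros poly_DERIV[THEN DERIV_chain2]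
     simp: flat_def power2_eq_square field_simps)
  then show ?thesis
   by (rule has_field_derivative_transform_within_open[where S = "{0<..}"])
     (use 1 in \<open>auto simp: flat_def\<close>)
 next
  case 2
  have "((%x. 0) has_real_derivative 0) (at x)" by simp
  then have "(flat p has_real_derivative 0) (at x)"
   by (rule has_field_derivative_transform_within_open[where S = "{..<0}"])
     (use 2 in \<open>auto simp: flat_def\<close>)
  then show ?thesis using 2 by (simp add: flat_def)
 next
  case 3
  have "((%h. flat p h / h) \<longlongrightarrow> 0) (at_left 0)"
   by (rule tendsto_eventually) (auto simp: flat_def eventually_at_filter)
  moreover have "((%h. flat p h / h) \<longlongrightarrow> 0) (at_right 0)"
  proof -
   have "((%h::real. poly (pCons 0 p) (inverse h) * exp (- inverse h)) \<longlongrightarrow> 0) (at_right 0)"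
    by (rule filterlim_compose[OF poly_exp_tendsto_0 filterlim_inverse_at_top_right])
   then show ?thesis
    by (rule Lim_transform_eventually)
      (auto simp: eventually_at_filter flat_def field_simps)
  qed
  ultimately have "((%h. flat p h / h) \<longlongrightarrow> 0) (at 0)"
   by (rule filterlim_split_at)
  then show ?thesis using 3 by (simp add: has_field_derivative_iff flat_def)
 qed
qed

lemma smooth_flat: "smooth (flat p)"
proof (rule smooth_coinduct[where A = "range flat"])
 show "g field_differentiable at x" if "g \<in> range flat" for g x
  using that flat_DERIV by (auto simp: field_differentiable_def)
 show "deriv g \<in> range flat" if "g \<in> range flat" for g
  using that DERIV_imp_deriv[OF flat_DERIV] by (auto intro!: image_eqI ext)
qed simp

text \<open>Smooth approximations of the indicator function of \<open>(c, d)\<close>.\<close>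

definition bump :: "real => real => nat => real => real" where
 "bump c d n x = flat 1 (real (Suc n) * (x - c)) * flat 1 (real (Suc n) * (d - x))"

lemma flat_1: "flat 1 x = (if x > 0 then exp (- 1 / x) else 0)"
 by (simp add: flat_def)

lemma flat_1_bounds: "0 <= flat 1 x" "flat 1 x <= 1"
 by (auto simp: flat_1)

lemma smooth_bump: "smooth (bump c d n)"
proof -
 have "smooth (%x. flat 1 (real (Suc n) * x + (- real (Suc n) * c)) *
   flat 1 ((- real (Suc n)) * x + real (Suc n) * d))"
  by (intro smooth_mult smooth_affine smooth_flat)
 moreover have "bump c d n = (%x. flat 1 (real (Suc n) * x + (- real (Suc n) * c)) *
   flat 1 ((- real (Suc n)) * x + real (Suc n) * d))"
  by (rule ext) (simp add: bump_def algebra_simps)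
 ultimately show ?thesis by simp
qed

lemma bump_bounds: "0 <= bump c d n x" "bump c d n x <= 1"
 using flat_1_bounds by (auto simp: bump_def intro!: mult_le_one)

lemma bump_outside: "x \<notin> {c<..<d} ==> bump c d n x = 0"
 by (auto simp: bump_def flat_1 zero_less_mult_iff)

lemma flat_1_tendsto: "0 < y ==> (%n. flat 1 (real (Suc n) * y)) \<longlonglongrightarrow> 1"
proof -
 assume y: "0 < y"
 have "(%n. - 1 / y * inverse (real (Suc n))) \<longlonglongrightarrow> - 1 / y * 0"
  by (intro tendsto_intros LIMSEQ_inverse_real_of_nat)
 then have "(%n. exp (- 1 / y * inverse (real (Suc n)))) \<longlonglongrightarrow> exp 0"
  by (intro tendsto_exp) simp
 moreover have "flat 1 (real (Suc n) * y) = exp (- 1 / y * inverse (real (Suc n)))" for n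
  using y by (simp add: flat_1 inverse_eq_divide mult.commute)
 ultimately show ?thesis by simp
qed

lemma bump_tendsto: "(%n. bump c d n x) \<longlonglongrightarrow> indicator {c<..<d} x"
proof (cases "x \<in> {c<..<d}")
 case True
 then have "(%n. bump c d n x) \<longlonglongrightarrow> 1 * 1"
  unfolding bump_def by (intro tendsto_mult flat_1_tendsto) auto
 then show ?thesis using True by simp
qed (simp add: bump_outside)

lemma test_functionI: "smooth \<phi> ==> compact K ==> K \<subseteq> S ==> (\<And>x. x \<notin> K ==> \<phi> x = 0) ==> test_function S \<phi>"
 unfolding test_function_def smooth_def by blast

lemma test_function_support:
 "test_function S \<phi> ==> smooth \<phi> \<and> (\<exists>K. compact K \<and> K \<subseteq> S \<and> (\<forall>x. x \<notin> K --> \<phi> x = 0))"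
 unfolding test_function_def smooth_def by blast

lemma test_smooth: "test_function S \<phi> ==> smooth \<phi>"
 unfolding test_function_def smooth_def by blast

lemma test_bump: "{c..d} \<subseteq> S ==> test_function S (bump c d n)"
 by (rule test_functionI[of _ "{c..d}"]) (auto simp: smooth_bump intro!: bump_outside)

lemma test_deriv:
 assumes "test_function S \<phi>"
 shows "test_function S (deriv \<phi>)"
proof -
 obtain K where K: "smooth \<phi>" "compact K" "K \<subseteq> S" "\<And>x. x \<notin> K ==> \<phi> x = 0"
  using test_function_support[OF assms] by auto
 show ?thesis
 proof (rule test_functionI[OF smooth_deriv[OF K(1)] K(2,3)])
  fix x assume "x \<notin> K"
  have "((%x. 0) has_real_derivative 0) (at x)" by simp
  then have "(\<phi> has_real_derivative 0) (at x)"
   by (rule has_field_derivative_transform_within_open[where S = "- K"])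
     (use K \<open>x \<notin> K\<close> compact_imp_closed in \<open>auto simp: open_Compl\<close>)
  then show "deriv \<phi> x = 0" by (rule DERIV_imp_deriv)
 qed
qed

lemma test_deriv_funpow: "test_function S \<phi> ==> test_function S ((deriv ^^ k) \<phi>)"
 by (induction k) (auto intro: test_deriv)

lemma test_mult: "smooth f ==> test_function S \<phi> ==> test_function S (%x. f x * \<phi> x)"
 by (drule test_function_support) (auto intro!: test_functionI smooth_mult)

lemma test_add:
 assumes "test_function S \<phi>" "test_function S \<psi>"
 shows "test_function S (%x. \<phi> x + \<psi> x)"
proof -
 obtain K where K: "smooth \<phi>" "compact K" "K \<subseteq> S" "\<And>x. x \<notin> K ==> \<phi> x = 0"
  using test_function_support[OF assms(1)] by auto
 obtain L where L: "smooth \<psi>" "compact L" "L \<subseteq> S" "\<And>x. x \<notin> L ==> \<psi> x = 0"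
  using test_function_support[OF assms(2)] by auto
 show ?thesis
  by (rule test_functionI[of _ "K \<union> L"]) (use K L in \<open>auto intro: smooth_add\<close>)
qed

lemma test_cmult: "test_function S \<phi> ==> test_function S (%x. c * \<phi> x)"
 by (rule test_mult[OF smooth_const])

text \<open>A function whose integral over every half-line vanishes is null, because half-lines
 generate the Borel sets.\<close>

lemma AE_zero_of_halfline_integrals:
 fixes g :: "real => real"
 assumes g: "integrable lebesgue g"
  and z: "\<And>u. (\<integral>x. indicator {u<..} x * g x \<partial>lebesgue) = 0"
 shows "AE x in lebesgue. g x = 0"
proof -
 obtain h where h: "h \<in> borel_measurable lborel" "AE x in lborel. g x = h x"
  using completion_ex_borel_measurable_real[OF borel_measurable_integrable[OF g]] by auto
 have gh: "AE x in lebesgue. g x = h x" using h(2) by (rule AE_completion)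
 have "integrable lebesgue h"
  using h gh by (intro integrable_cong_AE_imp[OF g]) (auto elim!: AE_mp intro: measurable_completion)
 then have hi: "integrable lborel h" using h(1) integrable_completion[of h lborel] by simp
 have zh: "(\<integral>x. indicator {u<..} x * h x \<partial>lborel) = 0" for u
 proof -
  have "(\<integral>x. indicator {u<..} x * h x \<partial>lborel) = (\<integral>x. indicator {u<..} x * h x \<partial>lebesgue)"
   using h(1) by (intro integral_completion[symmetric]) auto
  also have "\<dots> = (\<integral>x. indicator {u<..} x * g x \<partial>lebesgue)"
   using h(1) gh borel_measurable_integrable[OF g]
   by (intro integral_cong_AE borel_measurable_times) 
     (auto elim!: AE_mp intro: measurable_completion)
  finally show ?thesis using z by simp
 qed
 let ?p = "%x. ennreal (h x)" and ?n = "%x. ennreal (- h x)"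
 have em: "emeasure (density lborel (%x. ennreal (s * h x))) {u<..}
   = ennreal (\<integral>x. indicator {u<..} x * max 0 (s * h x) \<partial>lborel)" for s u
 proof -
  have i: "integrable lborel (%x. indicator {u<..} x * max 0 (s * h x))"
   using hi by (subst mult.commute, intro integrable_real_mult_indicator Bochner_Integration.integrable_max) auto
  have "emeasure (density lborel (%x. ennreal (s * h x))) {u<..}
    = (\<integral>\<^sup>+x. ennreal (s * h x) * indicator {u<..} x \<partial>lborel)"
   using h(1) by (intro emeasure_density) auto
  also have "\<dots> = (\<integral>\<^sup>+x. ennreal (indicator {u<..} x * max 0 (s * h x)) \<partial>lborel)"
   by (intro nn_integral_cong) (auto simp: indicator_def max_def ennreal_neg)
  also have "\<dots> = ennreal (\<integral>x. indicator {u<..} x * max 0 (s * h x) \<partial>lborel)"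
   by (intro nn_integral_eq_integral i) auto
  finally show ?thesis .
 qed
 have "density lborel (%x. ennreal (1 * h x)) = density lborel (%x. ennreal ((-1) * h x))"
 proof (rule measure_eqI_lessThan)
  fix u
  show "emeasure (density lborel (%x. ennreal (1 * h x))) {u<..} < \<infinity>"
   unfolding em by simp
  have i: "integrable lborel (%x. indicator {u<..} x * max 0 (s * h x))" for s
   using hi by (subst mult.commute, intro integrable_real_mult_indicator Bochner_Integration.integrable_max) auto
  have "(\<integral>x. indicator {u<..} x * max 0 (1 * h x) \<partial>lborel) - (\<integral>x. indicator {u<..} x * max 0 ((-1) * h x) \<partial>lborel)
   = (\<integral>x. indicator {u<..} x * max 0 (1 * h x) - indicator {u<..} x * max 0 ((-1) * h x) \<partial>lborel)"
   by (rule Bochner_Integration.integral_diff[symmetric]) (rule i)+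
  also have "\<dots> = (\<integral>x. indicator {u<..} x * h x \<partial>lborel)"
   by (intro Bochner_Integration.integral_cong) (auto simp: max_def indicator_def)
  finally show "emeasure (density lborel (%x. ennreal (1 * h x))) {u<..}
    = emeasure (density lborel (%x. ennreal ((-1) * h x))) {u<..}"
   unfolding em zh by simp
 qed auto
 then have "AE x in lborel. ennreal (1 * h x) = ennreal ((-1) * h x)"
 proof (subst (asm) finite_density_unique)
  have "(\<integral>\<^sup>+x. ennreal (1 * h x) \<partial>lborel) <= (\<integral>\<^sup>+x. ennreal (norm (h x)) \<partial>lborel)"
   by (intro nn_integral_mono ennreal_leI) auto
  also have "\<dots> < \<infinity>" using hi by (simp add: integrable_iff_bounded)
  finally show "(\<integral>\<^sup>+x. ennreal (1 * h x) \<partial>lborel) \<noteq> \<infinity>" by simp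
 qed (use h(1) in auto)
 then have "AE x in lborel. h x = 0"
 proof eventually_elim
  case (elim x)
  then show ?case by (cases "h x \<ge> 0") (auto simp: ennreal_neg)
 qed
 then have "AE x in lebesgue. h x = 0" by (rule AE_completion)
 with gh show ?thesis by eventually_elim simp
qed

context interval
begin

lemma compact_in_I:
 assumes "compact K" "K \<subseteq> I"
 obtains c d where "a < c" "c <= d" "d < b" "K \<subseteq> {c..d}"
proof (cases "K = {}")
 case True
 with that[of "(a+b)/2" "(a+b)/2"] a_less_b show thesis by auto
next
 case False
 obtain c where c: "c \<in> K" "\<And>t. t \<in> K ==> c <= t"
  using compact_attains_inf[OF assms(1) False] by auto
 obtain d where d: "d \<in> K" "\<And>t. t \<in> K ==> t <= d"
  using compact_attains_sup[OF assms(1) False] by auto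
 show thesis
  by (rule that[of c d]) (use c d assms(2) in auto)
qed

lemma test_boundary: "test_function I \<phi> ==> \<phi> a = 0 \<and> \<phi> b = 0"
 by (drule test_function_support) (auto simp: subset_eq)

lemma test_bounded:
 assumes "test_function I \<phi>"
 obtains B where "0 <= B" "\<And>x. \<bar>\<phi> x\<bar> <= B"
proof -
 obtain B where B: "0 <= B" "\<And>x. x \<in> {a..b} ==> \<bar>\<phi> x\<bar> <= B"
  using continuous_bounded[OF smooth_continuous[OF test_smooth[OF assms]]] by blast
 obtain K where K: "smooth \<phi>" "compact K" "K \<subseteq> I" "\<And>x. x \<notin> K ==> \<phi> x = 0"
  using test_function_support[OF assms] by auto
 have "\<bar>\<phi> x\<bar> <= B" for x
 proof (cases "x \<in> {a..b}")
  case False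
  then have "x \<notin> K" using K(3) by auto
  then show ?thesis using K(4) B(1) by simp
 qed (rule B(2))
 with B(1) show thesis by (rule that)
qed

lemma test_L2: "test_function I \<phi> ==> \<phi> \<in> L2"
 by (intro continuous_L2 smooth_continuous test_smooth)

lemma locally_integrable_mult_test:
 assumes f: "locally_integrable I f" and \<phi>: "test_function I \<phi>"
 shows "integrable M (%x. f x * \<phi> x)"
proof -
 obtain K where K: "smooth \<phi>" "compact K" "K \<subseteq> I" "\<And>x. x \<notin> K ==> \<phi> x = 0"
  using test_function_support[OF \<phi>] by auto
 obtain B where B: "\<And>x. \<bar>\<phi> x\<bar> <= B" using test_bounded[OF \<phi>] by metis
 have KL: "K \<in> sets lebesgue" using K(2) by (simp add: lmeasurable_compact fmeasurableD)
 have fK: "integrable (lebesgue_on K) f" using f K by (simp add: locally_integrable_def)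
 have m: "\<phi> \<in> borel_measurable (lebesgue_on K)"
  by (intro continuous_imp_measurable_on_sets_lebesgue smooth_continuous test_smooth[OF \<phi>] KL)
 have "integrable (lebesgue_on K) (%x. f x * \<phi> x)"
 proof (rule Bochner_Integration.integrable_bound[where f = "%x. B * f x"])
  show "integrable (lebesgue_on K) (%x. B * f x)" using fK by simp
  show "(%x. f x * \<phi> x) \<in> borel_measurable (lebesgue_on K)"
   by (rule borel_measurable_times[OF borel_measurable_integrable[OF fK] m])
  have "\<bar>f x * \<phi> x\<bar> <= \<bar>B * f x\<bar>" for x
   using B[of x] by (simp add: abs_mult mult.commute[of B] mult_left_mono)
  then show "AE x in lebesgue_on K. norm (f x * \<phi> x) <= norm (B * f x)" by simp
 qed
 then have "integrable lebesgue (%x. if x \<in> K then f x * \<phi> x else 0)"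
  by (simp add: Lebesgue_Measure.integrable_restrict_UNIV[OF KL])
 also have "(%x. if x \<in> K then f x * \<phi> x else 0) = (%x. if x \<in> I then f x * \<phi> x else 0)"
  using K by fastforce
 finally show ?thesis by (subst (asm) Lebesgue_Measure.integrable_restrict_UNIV) auto
qed

lemma integrable_locally_integrable:
 assumes "integrable M f"
 shows "locally_integrable I f"
 unfolding locally_integrable_def
proof (intro allI impI)
 fix K assume K: "compact K \<and> K \<subseteq> I"
 then have KL: "K \<in> sets lebesgue" by (simp add: lmeasurable_compact fmeasurableD)
 have "integrable lebesgue (%x. if x \<in> I then f x else 0)"
  using assms by (subst Lebesgue_Measure.integrable_restrict_UNIV) auto
 then have "integrable lebesgue (%x. (if x \<in> I then f x else 0) * indicator K x)"
  using KL by (intro integrable_real_mult_indicator) auto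
 also have "(%x. (if x \<in> I then f x else 0) * indicator K x) = (%x. if x \<in> K then f x else 0)"
  using K by (force simp: indicator_def)
 finally show "integrable (lebesgue_on K) f" by (simp add: Lebesgue_Measure.integrable_restrict_UNIV[OF KL])
qed

lemma L2_locally_integrable: "f \<in> L2 ==> locally_integrable I f"
 by (rule integrable_locally_integrable[OF L2_integrable])

text \<open>Fundamental lemma of the calculus of variations: bumps converge boundedly to indicators.\<close>

lemma fundamental_lemma:
 assumes f: "locally_integrable I f"
  and z: "\<And>\<phi>. test_function I \<phi> ==> (\<integral>x. f x * \<phi> x \<partial>M) = 0"
 shows "AE x in M. f x = 0"
proof -
 have loc: "AE x in lebesgue. x \<in> {c..d} --> f x = 0" if cd: "a < c" "d < b" for c d
 proof -
  define g where "g x = (if x \<in> {c..d} then f x else 0)" for x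
  have sub: "{c..d} \<subseteq> I" using cd by auto
  have g: "integrable lebesgue g"
  proof -
   have "integrable (lebesgue_on {c..d}) f"
    using f sub by (simp add: locally_integrable_def)
   then show ?thesis unfolding g_def by (subst Lebesgue_Measure.integrable_restrict_UNIV) auto
  qed
  have "(\<integral>x. indicator {u<..} x * g x \<partial>lebesgue) = 0" for u
  proof -
   define c' where "c' = max u c"
   have sub': "{c'..d} \<subseteq> I" using sub by (auto simp: c'_def)
   have "(%n. \<integral>x. g x * bump c' d n x \<partial>lebesgue) \<longlonglongrightarrow> (\<integral>x. g x * indicator {c'<..<d} x \<partial>lebesgue)"
   proof (rule integral_dominated_convergence[where w = "%x. norm (g x)"])
    show "(%x. g x * bump c' d n x) \<in> borel_measurable lebesgue" for n
     by (intro borel_measurable_times borel_measurable_integrable[OF g] measurable_completion)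
      (auto intro!: borel_measurable_continuous_onI smooth_continuous smooth_bump)
    show "AE x in lebesgue. (%n. g x * bump c' d n x) \<longlonglongrightarrow> g x * indicator {c'<..<d} x"
     by (intro AE_I2 tendsto_intros bump_tendsto)
    show "AE x in lebesgue. norm (g x * bump c' d n x) <= norm (g x)" for n
     using bump_bounds by (auto simp: abs_mult intro!: mult_left_le)
    show "(%x. g x * indicator {c'<..<d} x) \<in> borel_measurable lebesgue"
     by (rule borel_measurable_times[OF borel_measurable_integrable[OF g] borel_measurable_indicator]) simp
   qed (use g in auto)
   moreover have "(\<integral>x. g x * bump c' d n x \<partial>lebesgue) = 0" for n
   proof -
    have "(\<integral>x. g x * bump c' d n x \<partial>lebesgue) = (\<integral>x. (if x \<in> I then f x * bump c' d n x else 0) \<partial>lebesgue)"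
    proof (intro Bochner_Integration.integral_cong refl)
     fix x show "g x * bump c' d n x = (if x \<in> I then f x * bump c' d n x else 0)"
     proof (cases "x \<in> {c'<..<d}")
      case True
      then have "x \<in> {c..d}" by (auto simp: c'_def)
      with sub show ?thesis by (auto simp: g_def)
     next
      case False
      then have "bump c' d n x = 0" by (rule bump_outside)
      then show ?thesis by simp
     qed
    qed
    also have "\<dots> = (\<integral>x. f x * bump c' d n x \<partial>M)"
     by (intro Lebesgue_Measure.integral_restrict_UNIV) simp
    finally show ?thesis using z[OF test_bump[OF sub']] by simp
   qed
   ultimately have "(\<integral>x. g x * indicator {c'<..<d} x \<partial>lebesgue) = 0"
    by (simp add: LIMSEQ_const_iff)
   moreover have "AE x in lebesgue. indicator {u<..} x * g x = g x * indicator {c'<..<d} x"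
   proof -
    have "AE x in lebesgue. x \<noteq> c" "AE x in lebesgue. x \<noteq> d"
     by (intro AE_completion AE_lborel_singleton)+
    then show ?thesis
     by eventually_elim (auto simp: indicator_def g_def c'_def)
   qed
   moreover have "(%x. indicator {u<..} x * g x) \<in> borel_measurable lebesgue"
    by (rule borel_measurable_times[OF borel_measurable_indicator borel_measurable_integrable[OF g]]) simp
   moreover have "(%x. g x * indicator {c'<..<d} x) \<in> borel_measurable lebesgue"
    by (rule borel_measurable_times[OF borel_measurable_integrable[OF g] borel_measurable_indicator]) simp
   ultimately show ?thesis
    using integral_cong_AE[of "%x. indicator {u<..} x * g x" lebesgue "%x. g x * indicator {c'<..<d} x"]
    by simp
  qed
  from AE_zero_of_halfline_integrals[OF g this] show ?thesis
   unfolding g_def by (auto elim!: AE_mp)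
 qed
 have "AE x in lebesgue. \<forall>n::nat. x \<in> {a + 1 / real (Suc n)..b - 1 / real (Suc n)} --> f x = 0"
  unfolding AE_all_countable by (intro allI loc) auto
 then have "AE x in lebesgue. x \<in> I --> f x = 0"
 proof eventually_elim
  fix x assume *: "\<forall>n::nat. x \<in> {a + 1 / real (Suc n)..b - 1 / real (Suc n)} --> f x = 0"
  show "x \<in> I --> f x = 0"
  proof
   assume "x \<in> I"
   then have "0 < min (x - a) (b - x)" by auto
   then obtain n where "inverse (real (Suc n)) < min (x - a) (b - x)"
    using reals_Archimedean by blast
   then have "x \<in> {a + 1 / real (Suc n)..b - 1 / real (Suc n)}" by (auto simp: inverse_eq_divide)
   with * show "f x = 0" by blast
  qed
 qed
 then show ?thesis by (simp add: AE_restrict_space_iff)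
qed

lemma locally_integrable_diff:
 "locally_integrable I f ==> locally_integrable I g ==> locally_integrable I (%x. f x - g x)"
 by (auto simp: locally_integrable_def)

lemma has_weak_deriv_unique:
 assumes g: "has_weak_deriv I k f g" and h: "has_weak_deriv I k f h"
 shows "AE x in M. g x = h x"
proof -
 have "AE x in M. g x - h x = 0"
 proof (rule fundamental_lemma)
  show "locally_integrable I (%x. g x - h x)"
   using g h by (intro locally_integrable_diff) (auto simp: has_weak_deriv_def)
  fix \<phi> assume \<phi>: "test_function I \<phi>"
  have "(-1) ^ k * (\<integral>x. g x * \<phi> x \<partial>M) = (-1) ^ k * (\<integral>x. h x * \<phi> x \<partial>M)"
   using g h \<phi> by (simp add: has_weak_deriv_def)
  then have "(\<integral>x. g x * \<phi> x \<partial>M) = (\<integral>x. h x * \<phi> x \<partial>M)" by simp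
  moreover have "(\<integral>x. (g x - h x) * \<phi> x \<partial>M) = (\<integral>x. g x * \<phi> x \<partial>M) - (\<integral>x. h x * \<phi> x \<partial>M)"
   unfolding left_diff_distrib
   using g h by (intro Bochner_Integration.integral_diff locally_integrable_mult_test[OF _ \<phi>])
    (auto simp: has_weak_deriv_def)
  ultimately show "(\<integral>x. (g x - h x) * \<phi> x \<partial>M) = 0" by simp
 qed
 then show ?thesis by simp
qed

lemma weak_deriv_spec: "has_weak_deriv I k f g ==> has_weak_deriv I k f (weak_deriv I k f)"
 unfolding weak_deriv_def by (rule someI[of "has_weak_deriv I k f"])

lemma weak_deriv_eq_AE: "has_weak_deriv I k f g ==> AE x in M. weak_deriv I k f x = g x"
 by (rule has_weak_deriv_unique[OF weak_deriv_spec])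

lemma has_weak_deriv_L2_iff:
 assumes "f \<in> L2" "g \<in> L2"
 shows "has_weak_deriv I k f g \<longleftrightarrow>
  (\<forall>\<phi>. test_function I \<phi> --> ip f ((deriv ^^ k) \<phi>) = (-1) ^ k * ip g \<phi>)"
 using assms by (simp add: has_weak_deriv_def L2_locally_integrable ip_def)

lemma has_weak_deriv_cong_AE:
 assumes "has_weak_deriv I k f g" "f \<in> L2" "g \<in> L2"
  and "AE x in M. f x = f' x" "AE x in M. g x = g' x"
 shows "has_weak_deriv I k f' g'"
proof -
 have "f' \<in> L2" "g' \<in> L2" using assms L2_cong_AE by blast+
 moreover have "ip f' ((deriv ^^ k) \<phi>) = (-1) ^ k * ip g' \<phi>" if "test_function I \<phi>" for \<phi>
 proof -
  have "ip f' ((deriv ^^ k) \<phi>) = ip f ((deriv ^^ k) \<phi>)"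
   using that assms by (intro ip_cong_AE[symmetric]) (auto intro: test_L2 test_deriv_funpow)
  also have "\<dots> = (-1) ^ k * ip g \<phi>"
   using assms(1) that by (simp add: has_weak_deriv_L2_iff[OF assms(2,3)])
  also have "ip g \<phi> = ip g' \<phi>"
   using that assms by (intro ip_cong_AE) (auto intro: test_L2)
  finally show ?thesis .
 qed
 ultimately show ?thesis by (simp add: has_weak_deriv_L2_iff)
qed

lemma weak_deriv_L2:
 assumes "has_weak_deriv I k f g" "g \<in> L2"
 shows "weak_deriv I k f \<in> L2"
 by (rule L2_cong_AE[OF assms(2)]) (use weak_deriv_eq_AE[OF assms(1)] in eventually_elim, simp)

text \<open>Derivatives of test functions are test functions, so weak derivatives may be taken one order at a time.\<close>

lemma has_weak_deriv_Suc:
 assumes "has_weak_deriv I k f g" "has_weak_deriv I 1 g h"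
 shows "has_weak_deriv I (Suc k) f h"
 unfolding has_weak_deriv_def
proof (intro conjI allI impI)
 fix \<phi> assume \<phi>: "test_function I \<phi>"
 have "(\<integral>x. f x * (deriv ^^ Suc k) \<phi> x \<partial>M) = (\<integral>x. f x * (deriv ^^ k) (deriv \<phi>) x \<partial>M)"
  by (simp only: funpow_Suc_right comp_apply)
 also have "\<dots> = (-1) ^ k * (\<integral>x. g x * deriv \<phi> x \<partial>M)"
  using assms(1) test_deriv[OF \<phi>] unfolding has_weak_deriv_def by blast
 also have "(\<integral>x. g x * deriv \<phi> x \<partial>M) = - (\<integral>x. h x * \<phi> x \<partial>M)"
  using assms(2) \<phi> unfolding has_weak_deriv_def by auto
 finally show "(\<integral>x. f x * (deriv ^^ Suc k) \<phi> x \<partial>M) = (-1) ^ Suc k * (\<integral>x. h x * \<phi> x \<partial>M)"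
  by simp
qed (use assms in \<open>auto simp: has_weak_deriv_def\<close>)

lemma has_weak_deriv_step:
 assumes "has_weak_deriv I k f g" "has_weak_deriv I (Suc k) f h"
 shows "has_weak_deriv I 1 g h"
 unfolding has_weak_deriv_def
proof (intro conjI allI impI)
 fix \<phi> assume \<phi>: "test_function I \<phi>"
 have "(-1) ^ k * (\<integral>x. g x * deriv \<phi> x \<partial>M) = (\<integral>x. f x * (deriv ^^ k) (deriv \<phi>) x \<partial>M)"
  using assms(1) test_deriv[OF \<phi>] unfolding has_weak_deriv_def by auto
 also have "\<dots> = (-1) ^ Suc k * (\<integral>x. h x * \<phi> x \<partial>M)"
 proof -
  have "(\<integral>x. f x * (deriv ^^ Suc k) \<phi> x \<partial>M) = (-1) ^ Suc k * (\<integral>x. h x * \<phi> x \<partial>M)"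
   using assms(2) \<phi> unfolding has_weak_deriv_def by blast
  then show ?thesis by (simp only: funpow_Suc_right comp_apply)
 qed
 finally have "(-1) ^ k * (\<integral>x. g x * deriv \<phi> x \<partial>M) = (-1) ^ k * (- (\<integral>x. h x * \<phi> x \<partial>M))"
  by simp
 then have "(\<integral>x. g x * deriv \<phi> x \<partial>M) = - (\<integral>x. h x * \<phi> x \<partial>M)"
  by (subst (asm) mult_cancel_left) auto
 then show "(\<integral>x. g x * (deriv ^^ 1) \<phi> x \<partial>M) = (-1) ^ 1 * (\<integral>x. h x * \<phi> x \<partial>M)" by simp
qed (use assms in \<open>auto simp: has_weak_deriv_def\<close>)

lemma has_weak_deriv_0: "f \<in> L2 ==> has_weak_deriv I 0 f f"
 by (simp add: has_weak_deriv_L2_iff)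

lemma FTC_M:
 assumes "\<And>x. x \<in> {a..b} ==> (F has_real_derivative f x) (at x within {a..b})"
  and "continuous_on {a..b} f"
 shows "(\<integral>x. f x \<partial>M) = F b - F a"
proof -
 have "(\<integral>x. f x \<partial>M) = integral I f"
  by (intro lebesgue_integral_eq_integral L2_integrable continuous_L2 assms(2)) simp
 also have "\<dots> = integral {a..b} f" by (rule integral_open_interval_real[symmetric])
 also have "\<dots> = F b - F a"
  using fundamental_theorem_of_calculus[of a b F f] assms(1) a_less_b
  by (intro integral_unique) (auto simp: has_real_derivative_iff_has_vector_derivative)
 finally show ?thesis .
qed

lemma integration_by_parts_C1:
 assumes F: "\<And>x. x \<in> {a..b} ==> (F has_real_derivative f x) (at x within {a..b})"
  and G: "\<And>x. x \<in> {a..b} ==> (G has_real_derivative g x) (at x within {a..b})"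
  and c: "continuous_on {a..b} f" "continuous_on {a..b} g"
 shows "ip F g = F b * G b - F a * G a - ip f G"
proof -
 have cF: "continuous_on {a..b} F" "continuous_on {a..b} G"
  by (rule DERIV_continuous_on[OF F], simp) (rule DERIV_continuous_on[OF G], simp)
 have "(\<integral>x. f x * G x + F x * g x \<partial>M) = F b * G b - F a * G a"
  using F G c cF by (intro FTC_M) (auto intro!: derivative_eq_intros continuous_intros)
 also have "(\<integral>x. f x * G x + F x * g x \<partial>M) = ip f G + ip F g"
  unfolding ip_def using c cF
  by (intro Bochner_Integration.integral_add L2_mult_integrable continuous_L2)
 finally show ?thesis by simp
qed

lemma weak_deriv_classical:
 assumes F: "\<And>x. x \<in> {a..b} ==> (F has_real_derivative f x) (at x within {a..b})"
  and c: "continuous_on {a..b} f"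
 shows "has_weak_deriv I 1 F f"
proof -
 have "continuous_on {a..b} F" by (rule DERIV_continuous_on[OF F], simp)
 then have L: "F \<in> L2" "f \<in> L2" using c by (auto intro: continuous_L2)
 have "ip F (deriv \<phi>) = - ip f \<phi>" if \<phi>: "test_function I \<phi>" for \<phi>
  using integration_by_parts_C1[OF F smooth_DERIV_within[OF test_smooth[OF \<phi>]] c
    smooth_continuous[OF smooth_deriv[OF test_smooth[OF \<phi>]]]] test_boundary[OF \<phi>] by simp
 then show ?thesis by (simp add: has_weak_deriv_L2_iff[OF L])
qed

text \<open>The primitive of a test function of zero mean vanishes near both end points, so it is a test function
 again.  This reduces the statement that weakly constant functions are constant to the
 fundamental lemma.\<close>

lemma test_antiderivative:
 assumes \<eta>: "test_function I \<eta>" and z: "(\<integral>x. \<eta> x \<partial>M) = 0"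
 obtains \<phi> where "test_function I \<phi>" "deriv \<phi> = \<eta>"
proof -
 obtain K where K: "smooth \<eta>" "compact K" "K \<subseteq> I" "\<And>x. x \<notin> K ==> \<eta> x = 0"
  using test_function_support[OF \<eta>] by auto
 obtain c d where cd: "a < c" "c <= d" "d < b" "K \<subseteq> {c..d}"
  using compact_in_I[OF K(2,3)] .
 have \<eta>0: "\<eta> x = 0" if "x < c \<or> d < x" for x using that cd K(4) by force
 have int: "\<eta> integrable_on {u..v}" for u v
  by (intro integrable_continuous_real smooth_continuous K)
 define \<phi> where "\<phi> x = integral {a - 1..x} \<eta>" for x
 have left: "\<phi> x = 0" if "x < c" for x
 proof -
  have "integral {a-1..x} \<eta> = integral {a-1..x} (%_. 0)"
   by (rule Henstock_Kurzweil_Integration.integral_cong) (use that in \<open>auto intro!: \<eta>0\<close>)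
  then show ?thesis by (simp add: \<phi>_def)
 qed
 have right: "\<phi> x = 0" if "d < x" for x
 proof -
  have "integral {u..v} \<eta> = 0" if "d < u" for u v
  proof -
   have "integral {u..v} \<eta> = integral {u..v} (%_. 0)"
    by (rule Henstock_Kurzweil_Integration.integral_cong) (use that in \<open>auto intro!: \<eta>0\<close>)
   then show ?thesis by simp
  qed note zr = this
  have "(\<integral>x. \<eta> x \<partial>M) = integral {a..b} \<eta>"
   using lebesgue_integral_eq_integral[OF L2_integrable[OF test_L2[OF \<eta>]]]
   by (simp add: integral_open_interval_real)
  then have ab0: "integral {a..b} \<eta> = 0" using z by simp
  have A: "\<phi> y = integral {a-1..a} \<eta> + integral {a..y} \<eta>" if "a <= y" for y
   unfolding \<phi>_def using that
   by (intro Henstock_Kurzweil_Integration.integral_combine[symmetric] int) auto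
  have "integral {a-1..a} \<eta> = 0" using left[of a] cd by (simp add: \<phi>_def)
  moreover have "integral {a..x} \<eta> = integral {a..b} \<eta>"
  proof (cases "x <= b")
   case True
   have "integral {a..x} \<eta> + integral {x..b} \<eta> = integral {a..b} \<eta>"
    using True that cd
    by (intro Henstock_Kurzweil_Integration.integral_combine int) auto
   then show ?thesis using zr[OF that] by simp
  next
   case False
   have "integral {a..b} \<eta> + integral {b..x} \<eta> = integral {a..x} \<eta>"
    using False a_less_b
    by (intro Henstock_Kurzweil_Integration.integral_combine int) auto
   then show ?thesis using zr[of b x] cd by simp
  qed
  ultimately show ?thesis using A[of x] ab0 that cd by simp
 qed
 have D: "(\<phi> has_real_derivative \<eta> x) (at x)" for x
 proof -
  consider "x < c" | "d < x" | "c <= x" "x <= d" by linarith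
  then show ?thesis
  proof cases
   case 1
   have "((%x. 0) has_real_derivative 0) (at x)" by simp
   then have "(\<phi> has_real_derivative 0) (at x)"
    by (rule has_field_derivative_transform_within_open[where S = "{..<c}"])
      (use 1 left in auto)
   then show ?thesis using \<eta>0 1 by simp
  next
   case 2
   have "((%x. 0) has_real_derivative 0) (at x)" by simp
   then have "(\<phi> has_real_derivative 0) (at x)"
    by (rule has_field_derivative_transform_within_open[where S = "{d<..}"])
      (use 2 right in auto)
   then show ?thesis using \<eta>0 2 by simp
  next
   case 3
   have "(\<phi> has_real_derivative \<eta> x) (at x within {a-1..b})"
    unfolding \<phi>_def using 3 cd by (intro integral_has_real_derivative smooth_continuous K) auto
   moreover have "at x within {a-1..b} = at x"
    using 3 cd by (intro at_within_interior) auto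
   ultimately show ?thesis by simp
  qed
 qed
 show thesis
 proof (rule that)
  show "test_function I \<phi>"
   by (rule test_functionI[OF smooth_of_DERIV[OF D K(1)], of "{c..d}"])
     (use cd left right in \<open>auto simp: not_le\<close>)
  show "deriv \<phi> = \<eta>" using D DERIV_imp_deriv by blast
 qed
qed

lemma unit_test_function:
 obtains \<rho> where "test_function I \<rho>" "(\<integral>x. \<rho> x \<partial>M) = 1"
proof -
 have "\<exists>\<phi>. test_function I \<phi> \<and> (\<integral>x. 1 * \<phi> x \<partial>M) \<noteq> 0"
 proof (rule ccontr)
  assume "\<not> ?thesis"
  then have "AE x in M. (1::real) = 0"
   by (intro fundamental_lemma[of "%_. 1"] L2_locally_integrable) auto
  then have "(\<integral>x. (1::real) \<partial>M) = (\<integral>x. 0 \<partial>M)" by (intro integral_cong_AE) auto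
  then show False using measure_M a_less_b by simp
 qed
 then obtain \<phi> where \<phi>: "test_function I \<phi>" "(\<integral>x. \<phi> x \<partial>M) \<noteq> 0" by auto
 show thesis
  by (rule that[of "%x. 1 / (\<integral>x. \<phi> x \<partial>M) * \<phi> x"])
    (use \<phi> in \<open>simp_all add: test_cmult del: times_divide_eq_left\<close>, simp)
qed

lemma weak_deriv_zero_const:
 assumes h: "h \<in> L2" and z: "\<And>\<phi>. test_function I \<phi> ==> ip h (deriv \<phi>) = 0"
 obtains C where "AE x in M. h x = C"
proof -
 obtain \<rho> where \<rho>: "test_function I \<rho>" "(\<integral>x. \<rho> x \<partial>M) = 1" by (rule unit_test_function)
 have "AE x in M. h x - ip h \<rho> = 0"
 proof (rule fundamental_lemma)
  show "locally_integrable I (%x. h x - ip h \<rho>)"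
   by (intro L2_locally_integrable L2_diff h L2_const)
  fix \<psi> assume \<psi>: "test_function I \<psi>"
  define m where "m = (\<integral>x. \<psi> x \<partial>M)"
  have t: "test_function I (%x. \<psi> x + (- m) * \<rho> x)"
   by (intro test_add test_cmult \<psi> \<rho>)
  have "(\<integral>x. \<psi> x + (- m) * \<rho> x \<partial>M) = 0"
   using L2_integrable[OF test_L2[OF \<psi>]] L2_integrable[OF test_L2[OF \<rho>(1)]] \<rho>(2)
   by (simp add: m_def)
  then obtain \<phi> where \<phi>: "test_function I \<phi>" "deriv \<phi> = (%x. \<psi> x + (- m) * \<rho> x)"
   by (rule test_antiderivative[OF t])
  have 0: "ip (%x. \<psi> x + (- m) * \<rho> x) h = 0"
   using z[OF \<phi>(1)] unfolding \<phi>(2) by (subst ip_commute)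
  have "ip \<psi> h - m * ip \<rho> h = 0"
   using 0 ip_add_left[OF test_L2[OF \<psi>] test_L2[OF test_cmult[OF \<rho>(1), of "- m"]] h]
    ip_scale_left[of "-m" \<rho> h] by simp
  moreover have "ip (%x. h x - ip h \<rho>) \<psi> = ip h \<psi> - ip h \<rho> * m"
   unfolding ip_diff_left[OF h L2_const test_L2[OF \<psi>]] by (simp add: ip_def m_def)
  ultimately have "ip (%x. h x - ip h \<rho>) \<psi> = 0"
   unfolding ip_commute[of \<psi> h] ip_commute[of \<rho> h] by (simp only: mult.commute[of m])
  then show "(\<integral>x. (h x - ip h \<rho>) * \<psi> x \<partial>M) = 0" unfolding ip_def .
 qed
 then show thesis by (intro that[of "ip h \<rho>"]) simp
qed

end

section \<open>Cosine and sine series\<close>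

text \<open>Bolzano-Weierstrass for countably many bounded sequences simultaneously.\<close>

lemma diagonal_subsequence:
 fixes x :: "nat => nat => real"
 assumes "\<And>i. \<exists>B. \<forall>n. \<bar>x n i\<bar> <= B"
 obtains r l where "strict_mono (r :: nat => nat)" "\<forall>i. (%n. x (r n) i) \<longlonglongrightarrow> l i"
proof -
 define P where "P i s \<longleftrightarrow> (\<exists>l. (%n. x (s n) i) \<longlonglongrightarrow> l)" for i and s :: "nat => nat"
 interpret subseqs P
 proof
  fix i and s :: "nat => nat"
  obtain B where "\<forall>n. \<bar>x n i\<bar> <= B" using assms by blast
  then have "bounded (range (%n. x (s n) i))" by (auto simp: bounded_iff)
  then obtain l r' where "strict_mono r'" "((%n. x (s n) i) \<circ> r') \<longlonglongrightarrow> l"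
   using bounded_imp_convergent_subsequence by blast
  then show "\<exists>r'. strict_mono r' \<and> P i (s \<circ> r')"
   by (auto simp: P_def comp_def)
 qed
 have "P i diagseq" for i
 proof -
  have "P i (diagseq \<circ> (+) (Suc i))"
  proof (rule diagseq_holds)
   fix r s :: "nat => nat" and n assume "strict_mono r" "P n s"
   then show "P n (s \<circ> r)"
    using LIMSEQ_subseq_LIMSEQ[of "%m. x (s m) n" _ r] by (auto simp: P_def comp_def)
  qed
  then obtain l where "(%n. x (diagseq (Suc i + n)) i) \<longlonglongrightarrow> l" by (auto simp: P_def)
  then have "(%n. x (diagseq (n + Suc i)) i) \<longlonglongrightarrow> l" by (simp only: add.commute)
  from LIMSEQ_offset[OF this] show ?thesis unfolding P_def by blast
 qed
 then have "(%n. x (diagseq n) i) \<longlonglongrightarrow> lim (%n. x (diagseq n) i)" for i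
  unfolding P_def convergent_def[symmetric] convergent_LIMSEQ_iff .
 then show thesis
  by (intro that[OF subseq_diagseq, of "%i. lim (%n. x (diagseq n) i)"] allI)
qed

context interval
begin

definition w :: "nat => real" where "w k = real k * pi / (b - a)"

definition e :: "nat => real => real" where
 "e k x = (if k = 0 then 1 / sqrt (b - a) else sqrt (2 / (b - a)) * cos (w k * (x - a)))"

definition s :: "nat => real => real" where
 "s k x = sqrt (2 / (b - a)) * sin (w k * (x - a))"

definition eb :: real where "eb = sqrt (2 / (b - a))"

lemma eb_pos: "0 < eb" using a_less_b by (simp add: eb_def)

lemma w_0 [simp]: "w 0 = 0" by (simp add: w_def)

lemma w_pos: "0 < k ==> 0 < w k" using a_less_b by (simp add: w_def)

lemma w_nonneg [simp]: "0 <= w k" using a_less_b by (simp add: w_def)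

lemma w_eq: "w k = real k * w 1" by (simp add: w_def)

lemma e_0: "e 0 x = 1 / sqrt (b - a)" by (simp add: e_def)

lemma s_0 [simp]: "s 0 x = 0" by (simp add: s_def)

lemma e_DERIV: "(e k has_real_derivative - w k * s k x) (at x within A)"
proof (cases "k = 0")
 case True
 then have "e k = (%x. 1 / sqrt (b - a))" by (auto simp: e_def)
 then show ?thesis using True by simp
next
 case False
 then have "e k = (%x. sqrt (2 / (b - a)) * cos (w k * (x - a)))" by (auto simp: e_def)
 then show ?thesis
  by (auto intro!: derivative_eq_intros simp: s_def)
qed

lemma s_DERIV: "(s k has_real_derivative w k * e k x) (at x within A)"
proof -
 have "s k = (%x. sqrt (2 / (b - a)) * sin (w k * (x - a)))" by (auto simp: s_def)
 then show ?thesis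
  by (cases "k = 0") (auto intro!: derivative_eq_intros simp: e_def)
qed

lemma e_cont: "continuous_on A (e k)" by (rule DERIV_continuous_on[OF e_DERIV])
lemma s_cont: "continuous_on A (s k)" by (rule DERIV_continuous_on[OF s_DERIV])

lemma e_L2 [simp]: "e k \<in> L2" by (intro continuous_L2 e_cont)
lemma s_L2 [simp]: "s k \<in> L2" by (intro continuous_L2 s_cont)

lemma e_bound: "\<bar>e k x\<bar> <= eb"
proof -
 have "1 / sqrt (b - a) <= eb"
  using a_less_b by (auto simp: eb_def real_sqrt_divide intro!: divide_right_mono)
 moreover have "eb * \<bar>cos y\<bar> <= eb * 1" for y
  using eb_pos by (intro mult_left_mono) auto
 ultimately show ?thesis
  using a_less_b eb_pos by (auto simp: e_def abs_mult eb_def[symmetric] simp del: mult_1_right)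
qed

lemma s_bound: "\<bar>s k x\<bar> <= eb"
proof -
 have "eb * \<bar>sin y\<bar> <= eb * 1" for y
  using eb_pos by (intro mult_left_mono) auto
 then show ?thesis using eb_pos by (simp add: s_def abs_mult eb_def[symmetric])
qed

lemma s_a [simp]: "s k a = 0" by (simp add: s_def)
lemma s_b [simp]: "s k b = 0" using a_less_b by (simp add: s_def w_def)

lemma smooth_e: "smooth (e k)"
proof (cases "k = 0")
 case True
 then have "e k = (%x. 1 / sqrt (b - a))" by (auto simp: e_def)
 then show ?thesis by (simp add: smooth_const)
next
 case False
 then have "e k = (%x. eb * cos (w k * x + (- w k * a)))"
  by (auto simp: e_def eb_def right_diff_distrib)
 then show ?thesis by (simp only: smooth_cos)
qed

lemma ip_e_e_s_s:
 "w k * ip (e j) (e k) = w j * ip (s j) (s k)"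
proof -
 have "ip (e j) (%x. w k * e k x) = e j b * s k b - e j a * s k a - ip (%x. - w j * s j x) (s k)"
  by (intro integration_by_parts_C1 e_DERIV s_DERIV continuous_intros e_cont s_cont)
 then show ?thesis
  unfolding ip_commute[of "e j" "%x. w k * e k x"] ip_scale_left ip_commute[of "e k"] by simp
qed

text \<open>Integration by parts moves a derivative from one factor to the other in two ways; the two
 identities, added and subtracted, are contradictory for \<open>w\<^sub>j \<noteq> w\<^sub>k\<close> unless both inner products vanish.\<close>

lemma ip_ee_ss_neq:
 assumes "j \<noteq> k"
 shows "ip (e j) (e k) = 0" "ip (s j) (s k) = 0"
proof -
 have ne: "w j \<noteq> w k" using assms a_less_b by (simp add: w_def)
 have 1: "w k * ip (e j) (e k) = w j * ip (s j) (s k)" by (rule ip_e_e_s_s)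
 have 2: "w j * ip (e j) (e k) = w k * ip (s j) (s k)"
  using ip_e_e_s_s[of j k] by (simp add: ip_commute)
 have "(w k - w j) * (ip (e j) (e k) + ip (s j) (s k)) = 0"
  using 1 2 by (simp add: algebra_simps)
 moreover have "(w k + w j) * (ip (e j) (e k) - ip (s j) (s k)) = 0"
  using 1 2 by (simp add: algebra_simps)
 moreover have "w k + w j \<noteq> 0"
  using ne w_nonneg[of k] w_nonneg[of j] by linarith
 ultimately have "ip (e j) (e k) + ip (s j) (s k) = 0" "ip (e j) (e k) - ip (s j) (s k) = 0"
  using ne by auto
 then show "ip (e j) (e k) = 0" "ip (s j) (s k) = 0" by auto
qed

lemma ip_ee_ss_eq:
 "ip (e k) (e k) = 1" "0 < k ==> ip (s k) (s k) = 1"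
proof -
 have "ip (e k) (e k) = 1 \<and> (0 < k --> ip (s k) (s k) = 1)"
 proof (cases "k = 0")
  case True
  then have "e k = (%x. 1 / sqrt (b - a))" by (auto simp: e_def)
  then show ?thesis using True measure_M a_less_b by (simp add: ip_def)
 next
  case False
  have lin: "u * c * (u * c) + u * d * (u * d) = u * u * (c * c + d * d)" for u c d :: real
   by (simp add: algebra_simps)
  have "ip (e k) (e k) + ip (s k) (s k) = (\<integral>x. e k x * e k x + s k x * s k x \<partial>M)"
   unfolding ip_def by (intro Bochner_Integration.integral_add[symmetric] L2_mult_integrable) auto
  also have "\<dots> = (\<integral>x. 2 / (b - a) \<partial>M)"
  proof (intro Bochner_Integration.integral_cong refl)
   fix x
   have "e k x * e k x + s k x * s k x
     = (sqrt (2 / (b - a)))^2 * ((cos (w k * (x - a)))^2 + (sin (w k * (x - a)))^2)"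
    using False unfolding e_def s_def power2_eq_square by (simp only: if_False) (rule lin)
   then show "e k x * e k x + s k x * s k x = 2 / (b - a)"
    using a_less_b by simp
  qed
  also have "\<dots> = 2" using a_less_b measure_M by (simp add: field_simps)
  finally have "ip (e k) (e k) + ip (s k) (s k) = 2" .
  moreover have "ip (e k) (e k) = ip (s k) (s k)"
   using ip_e_e_s_s[of k k] w_pos[of k] False by simp
  ultimately show ?thesis by simp
 qed
 then show "ip (e k) (e k) = 1" "0 < k ==> ip (s k) (s k) = 1" by auto
qed

text \<open>The two systems are treated together: \<open>\<nu> k\<close> is the squared norm of the \<open>k\<close>-th function,
 which is \<open>0\<close> for the zeroth sine.\<close>

definition ons :: "(nat => real => real) => (nat => real) => bool" where
 "ons p \<nu> \<longleftrightarrow> (\<forall>k. continuous_on UNIV (p k)) \<and> (\<forall>k x. \<bar>p k x\<bar> <= eb) \<and>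
   (\<forall>k. 0 <= \<nu> k \<and> \<nu> k <= 1) \<and> (\<forall>j k. ip (p j) (p k) = (if j = k then \<nu> k else 0))"

definition nu_s :: "nat => real" where "nu_s k = (if k = 0 then 0 else 1)"

lemma ons_e: "ons e (%_. 1)"
 using ip_ee_ss_neq ip_ee_ss_eq by (auto simp: ons_def e_cont e_bound)

lemma ons_s: "ons s nu_s"
proof -
 have "ip (s 0) (s 0) = 0" by (simp add: ip_def)
 then show ?thesis
  using ip_ee_ss_neq ip_ee_ss_eq by (auto simp: ons_def s_cont s_bound nu_s_def)
qed

definition psum :: "(nat => real => real) => (nat => real) => nat => real => real" where
 "psum p c n x = (\<Sum>k<n. c k * p k x)"

text \<open>The sum of a series; the pointwise sum is preferred so that absolutely convergent series
 are continuous everywhere and not only up to a null set.\<close>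

definition ser :: "(nat => real => real) => (nat => real) => real => real" where
 "ser p c = (if summable (%k. \<bar>c k\<bar>) then (%x. \<Sum>k. c k * p k x)
   else (SOME f. f \<in> L2 \<and> (%n. nrm (%x. psum p c n x - f x)) \<longlonglongrightarrow> 0))"

lemma ons_L2: "ons p \<nu> ==> p k \<in> L2"
 by (intro continuous_L2) (auto simp: ons_def intro: continuous_on_subset)

lemma psum_L2: "ons p \<nu> ==> psum p c n \<in> L2"
 unfolding psum_def[abs_def] by (intro L2_sum L2_scale ons_L2)

lemma psum_cont: "ons p \<nu> ==> continuous_on A (psum p c n)"
 unfolding psum_def[abs_def]
 by (intro continuous_intros) (auto simp: ons_def intro: continuous_on_subset)

lemma ip_psum_left:
 assumes "ons p \<nu>" "h \<in> L2"
 shows "ip (psum p c n) h = (\<Sum>k<n. c k * ip (p k) h)"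
 unfolding psum_def[abs_def]
 by (subst ip_sum_left) (auto simp: ip_scale_left intro: L2_scale ons_L2[OF assms(1)] assms(2))

lemma ip_psum_basis:
 assumes "ons p \<nu>"
 shows "ip (psum p c n) (p j) = (if j < n then c j * \<nu> j else 0)"
proof -
 have "ip (psum p c n) (p j) = (\<Sum>k<n. c k * ip (p k) (p j))"
  using assms by (intro ip_psum_left ons_L2)
 also have "\<dots> = (\<Sum>k<n. if k = j then c j * \<nu> j else 0)"
  using assms by (intro sum.cong) (auto simp: ons_def)
 finally show ?thesis by (simp add: sum.delta)
qed

lemma nrm_psum_sq:
 assumes "ons p \<nu>"
 shows "(nrm (psum p c n))^2 = (\<Sum>k<n. (c k)^2 * \<nu> k)"
proof -
 have "(nrm (psum p c n))^2 = (\<Sum>k<n. c k * ip (p k) (psum p c n))"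
  unfolding nrm_sq by (rule ip_psum_left[OF assms psum_L2[OF assms]])
 also have "\<dots> = (\<Sum>k<n. (c k)^2 * \<nu> k)"
  by (intro sum.cong refl, subst ip_commute)
    (simp add: ip_psum_basis[OF assms] power2_eq_square)
 finally show ?thesis .
qed

lemma Bessel:
 assumes f: "f \<in> L2"
 shows "(\<Sum>k<n. (ip f (e k))^2) <= (nrm f)^2"
proof -
 let ?c = "%k. ip f (e k)"
 let ?p = "psum e ?c n"
 have p: "?p \<in> L2" by (rule psum_L2[OF ons_e])
 have 1: "ip ?p f = (\<Sum>k<n. (?c k)^2)"
  unfolding ip_psum_left[OF ons_e f]
  by (intro sum.cong refl) (simp add: power2_eq_square ip_commute[of _ f])
 have 2: "ip ?p ?p = (\<Sum>k<n. (?c k)^2)"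
  using nrm_psum_sq[OF ons_e, of ?c n] by (simp add: nrm_sq)
 have "0 <= ip (%x. f x - ?p x) (%x. f x - ?p x)" by (rule ip_nonneg)
 also have "\<dots> = ip f (%x. f x - ?p x) - ip ?p (%x. f x - ?p x)"
  by (rule ip_diff_left[OF f p L2_diff[OF f p]])
 also have "ip f (%x. f x - ?p x) = ip f f - ip ?p f"
  by (subst ip_commute) (rule ip_diff_left[OF f p f])
 also have "ip ?p (%x. f x - ?p x) = ip f ?p - ip ?p ?p"
  by (subst ip_commute) (rule ip_diff_left[OF f p p])
 finally show ?thesis using 1 2 by (simp add: nrm_sq ip_commute[of f ?p])
qed

lemma psum_diff_zero_pad:
 assumes "m <= n"
 shows "psum p c n x - psum p c m x = psum p (%k. if k < m then 0 else c k) n x"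
proof -
 have "psum p c m x = (\<Sum>k<n. if k < m then c k * p k x else 0)"
  unfolding psum_def using assms
  by (intro sum.mono_neutral_cong_left) auto
 then show ?thesis
  unfolding psum_def by (simp add: sum_subtractf[symmetric]) (rule sum.cong, auto)
qed

text \<open>Partial sums are Cauchy because squared distances are tails of \<open>\<Sum> c\<^sub>k\<^sup>2\<close>.\<close>

lemma Riesz_Fischer:
 assumes p: "ons p \<nu>" and c: "summable (%k. (c k)^2)"
 shows "\<exists>f. f \<in> L2 \<and> (%n. nrm (%x. psum p c n x - f x)) \<longlonglongrightarrow> 0"
proof -
 have half: "nrm (%x. psum p c n x - psum p c m x) <= sqrt (\<Sum>k=m..<n. (c k)^2)" if "m <= n" for m n
 proof -
  have "(nrm (%x. psum p c n x - psum p c m x))^2 = (\<Sum>k<n. (if k < m then 0 else c k)^2 * \<nu> k)"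
   unfolding psum_diff_zero_pad[OF that] by (rule nrm_psum_sq[OF p])
  also have "\<dots> <= (\<Sum>k<n. if k < m then 0 else (c k)^2)"
   using p by (intro sum_mono) (auto simp: ons_def intro!: mult_left_le)
  also have "\<dots> = (\<Sum>k=m..<n. (c k)^2)"
   by (intro sum.mono_neutral_cong_right) auto
  finally show ?thesis by (simp add: real_le_rsqrt)
 qed
 have cau: "\<exists>N. \<forall>m\<ge>N. \<forall>n\<ge>N. nrm (%x. psum p c m x - psum p c n x) < d" if "0 < d" for d
 proof -
  have "0 < d^2" using that by simp
  then obtain N where N: "\<And>m n. m \<ge> N ==> norm (\<Sum>k=m..<n. (c k)^2) < d^2"
   using c unfolding summable_Cauchy by blast
  have lt: "sqrt (\<Sum>k=m..<n. (c k)^2) < d" if "m \<ge> N" for m n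
   using N[OF that, of n] \<open>0 < d\<close> by (intro real_less_lsqrt) (auto intro: sum_nonneg)
  have "nrm (%x. psum p c m x - psum p c n x) < d" if "m \<ge> N" "n \<ge> N" for m n
  proof (cases "m <= n")
   case True
   then show ?thesis using half[OF True] lt[OF that(1), of n]
    by (subst nrm_diff_commute) linarith
  next
   case False
   then show ?thesis using half[of n m] lt[OF that(2), of m] by simp
  qed
  then show ?thesis by blast
 qed
 obtain g where "g \<in> L2" "(%n. nrm (%x. psum p c n x - g x)) \<longlonglongrightarrow> 0"
  by (rule L2_complete[OF psum_L2[OF p] cau])
 then show ?thesis by blast
qed

lemma ons_summable:
 assumes p: "ons p \<nu>" and c: "summable (%k. \<bar>c k\<bar>)"
 shows "summable (%k. c k * p k x)"
proof (rule summable_comparison_test'[where g = "%k. \<bar>c k\<bar> * eb" and N = 0])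
 show "norm (c k * p k x) <= \<bar>c k\<bar> * eb" for k
  using p by (auto simp: ons_def abs_mult intro!: mult_left_mono)
qed (use c in \<open>rule summable_mult2\<close>)

lemma ser_uniform:
 assumes p: "ons p \<nu>" and c: "summable (%k. \<bar>c k\<bar>)"
 shows "\<bar>psum p c n x - ser p c x\<bar> <= eb * (\<Sum>k. \<bar>c (k + n)\<bar>)"
proof -
 have s: "summable (%k. \<bar>c (k + n)\<bar>)" using c by (subst summable_iff_shift)
 have "ser p c x = psum p c n x + (\<Sum>k. c (k + n) * p (k + n) x)"
  using suminf_split_initial_segment[OF ons_summable[OF p c], of x n] c
  by (simp add: ser_def psum_def)
 then have "\<bar>psum p c n x - ser p c x\<bar> = \<bar>\<Sum>k. c (k + n) * p (k + n) x\<bar>" by simp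
 also have "\<dots> <= (\<Sum>k. eb * \<bar>c (k + n)\<bar>)"
 proof -
  have le: "\<bar>c (k + n) * p (k + n) x\<bar> <= eb * \<bar>c (k + n)\<bar>" for k
   using p by (auto simp: ons_def abs_mult mult.commute[of eb] intro!: mult_left_mono)
  have s': "summable (%k. eb * \<bar>c (k + n)\<bar>)" by (rule summable_mult[OF s])
  have "summable (%k. \<bar>c (k + n) * p (k + n) x\<bar>)"
   by (rule summable_comparison_test'[OF s', of 0]) (use le in auto)
  then show ?thesis
   by (intro order_trans[OF summable_rabs suminf_le[OF le _ s']])
 qed
 also have "\<dots> = eb * (\<Sum>k. \<bar>c (k + n)\<bar>)" by (rule suminf_mult[OF s])
 finally show ?thesis .
qed

lemma ser_abs_bound:
 assumes p: "ons p \<nu>" and c: "summable (%k. \<bar>c k\<bar>)"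
 shows "\<bar>ser p c x\<bar> <= eb * (\<Sum>k. \<bar>c k\<bar>)"
 using ser_uniform[OF assms, of 0 x] by (simp add: psum_def)

lemma tail_tendsto_0: "summable (f :: nat => real) ==> (%n. \<Sum>k. f (k + n)) \<longlonglongrightarrow> 0"
 using suminf_exist_split2 by blast

lemma ser_uniform_limit:
 assumes p: "ons p \<nu>" and c: "summable (%k. \<bar>c k\<bar>)"
 shows "uniform_limit A (psum p c) (ser p c) sequentially"
proof (rule uniform_limitI)
 fix d :: real assume "0 < d"
 have "(%n. eb * (\<Sum>k. \<bar>c (k + n)\<bar>)) \<longlonglongrightarrow> eb * 0"
  by (intro tendsto_intros tail_tendsto_0 c)
 then have "\<forall>\<^sub>F n in sequentially. eb * (\<Sum>k. \<bar>c (k + n)\<bar>) < d"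
  using \<open>0 < d\<close> by (intro order_tendstoD(2)) auto
 then show "\<forall>\<^sub>F n in sequentially. \<forall>x\<in>A. dist (psum p c n x) (ser p c x) < d"
  by eventually_elim (use ser_uniform[OF p c] in \<open>auto simp: dist_real_def intro: le_less_trans\<close>)
qed

lemma ser_cont:
 assumes p: "ons p \<nu>" and c: "summable (%k. \<bar>c k\<bar>)"
 shows "continuous_on A (ser p c)"
 by (rule uniform_limit_theorem[OF _ ser_uniform_limit[OF p c]])
   (auto intro!: always_eventually psum_cont[OF p])

lemma ser_L2_limit:
 assumes p: "ons p \<nu>" and c: "summable (%k. (c k)^2)"
 shows "ser p c \<in> L2" "(%n. nrm (%x. psum p c n x - ser p c x)) \<longlonglongrightarrow> 0"
proof -
 have "ser p c \<in> L2 \<and> (%n. nrm (%x. psum p c n x - ser p c x)) \<longlonglongrightarrow> 0"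
 proof (cases "summable (%k. \<bar>c k\<bar>)")
  case True
  have L: "ser p c \<in> L2" by (intro continuous_L2 ser_cont[OF p True])
  have le: "nrm (%x. psum p c n x - ser p c x) <= (eb * (\<Sum>k. \<bar>c (k + n)\<bar>)) * sqrt (b - a)" for n
  proof -
   have "0 <= (\<Sum>k. \<bar>c (k + n)\<bar>)" using True summable_iff_shift[of "%k. \<bar>c k\<bar>" n] by (intro suminf_nonneg) auto
   then have n0: "0 <= eb * (\<Sum>k. \<bar>c (k + n)\<bar>)" using eb_pos by simp
   have "nrm (%x. psum p c n x - ser p c x) <= nrm (%x. eb * (\<Sum>k. \<bar>c (k + n)\<bar>))"
    using ser_uniform[OF p True, of n] n0
    by (intro nrm_mono L2_diff psum_L2[OF p] L L2_const AE_I2) auto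
   then show ?thesis using n0 by (simp add: nrm_const)
  qed
  have "(%n. (eb * (\<Sum>k. \<bar>c (k + n)\<bar>)) * sqrt (b - a)) \<longlonglongrightarrow> (eb * 0) * sqrt (b - a)"
   by (intro tendsto_intros tail_tendsto_0 True)
  then have lim0: "(%n. (eb * (\<Sum>k. \<bar>c (k + n)\<bar>)) * sqrt (b - a)) \<longlonglongrightarrow> 0" by simp
  have "(%n. nrm (%x. psum p c n x - ser p c x)) \<longlonglongrightarrow> 0"
   by (rule Lim_null_comparison[OF _ lim0]) (simp add: le)
  with L show ?thesis by simp
 next
  case False
  then show ?thesis
   using someI_ex[OF Riesz_Fischer[OF p c]] by (simp add: ser_def)
 qed
 then show "ser p c \<in> L2" "(%n. nrm (%x. psum p c n x - ser p c x)) \<longlonglongrightarrow> 0" by auto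
qed

lemma ip_ser_sums:
 assumes p: "ons p \<nu>" and c: "summable (%k. (c k)^2)" and h: "h \<in> L2"
 shows "(%k. c k * ip (p k) h) sums ip (ser p c) h"
 using ip_tendsto[OF psum_L2[OF p] ser_L2_limit(1)[OF p c] h ser_L2_limit(2)[OF p c]]
 unfolding sums_def ip_psum_left[OF p h] .

lemma ip_ser_basis:
 assumes p: "ons p \<nu>" and c: "summable (%k. (c k)^2)"
 shows "ip (ser p c) (p j) = c j * \<nu> j"
proof -
 have "(%k. if k = j then c k * \<nu> k else 0) sums ip (ser p c) (p j)"
 proof -
  have "(%k. c k * ip (p k) (p j)) = (%k. if k = j then c k * \<nu> k else 0)"
   using p by (auto simp: ons_def)
  then show ?thesis using ip_ser_sums[OF p c ons_L2[OF p, of j]] by simp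
 qed
 from sums_unique2[OF this sums_single[of j "%k. c k * \<nu> k"]] show ?thesis .
qed

lemma nrm_ser_sums:
 assumes p: "ons p \<nu>" and c: "summable (%k. (c k)^2)"
 shows "(%k. (c k)^2 * \<nu> k) sums (nrm (ser p c))^2"
proof -
 have "ip (p k) (ser p c) = c k * \<nu> k" for k
  by (subst ip_commute) (rule ip_ser_basis[OF p c])
 with ip_ser_sums[OF p c ser_L2_limit(1)[OF p c]] show ?thesis
  unfolding nrm_sq by (simp add: power2_eq_square mult.assoc)
qed

text \<open>Completeness of the cosines.  A function orthogonal to all of them is orthogonal to all
 polynomials in \<open>cos \<theta>\<close>, \<open>\<theta> = \<pi> (x - a) / (b - a)\<close>, hence by the Weierstrass theorem to all
 continuous functions.\<close>

lemma cosine_completeness: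
 assumes f: "f \<in> L2" and z: "\<And>k. ip f (e k) = 0"
 shows "AE x in M. f x = 0"
proof -
 define \<theta> where "\<theta> x = w 1 * (x - a)" for x
 have contcos: "continuous_on A (%x. (cos (\<theta> x)) ^ n * cos (real k * \<theta> x))" for A n k
  unfolding \<theta>_def by (intro continuous_intros)
 have L: "(%x. (cos (\<theta> x)) ^ n * cos (real k * \<theta> x)) \<in> L2" for n k
  by (intro continuous_L2 contcos)
 have pw: "ip (%x. (cos (\<theta> x)) ^ n * cos (real k * \<theta> x)) f = 0" for n k
 proof (induction n arbitrary: k)
  case 0
  have "(%x. cos (real k * \<theta> x)) = (%x. (if k = 0 then sqrt (b - a) else 1 / sqrt (2 / (b - a))) * e k x)"
  proof
   fix x
   have "w k * (x - a) = real k * \<theta> x" unfolding \<theta>_def by (subst w_eq) simp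
   then show "cos (real k * \<theta> x) = (if k = 0 then sqrt (b - a) else 1 / sqrt (2 / (b - a))) * e k x"
    using a_less_b by (simp add: e_def)
  qed
  then show ?case using z[of k] ip_commute[of f "e k"] by (simp add: ip_scale_left)
 next
  case (Suc n)
  show ?case
  proof (cases "k = 0")
   case True
   then have "(%x. (cos (\<theta> x)) ^ Suc n * cos (real k * \<theta> x)) = (%x. (cos (\<theta> x)) ^ n * cos (real 1 * \<theta> x))"
    by (auto simp: mult.commute)
   then show ?thesis using Suc[of 1] by (simp only:)
  next
   case False
   have "(%x. (cos (\<theta> x)) ^ Suc n * cos (real k * \<theta> x))
     = (%x. 1/2 * ((cos (\<theta> x)) ^ n * cos (real (k - 1) * \<theta> x)
       + (cos (\<theta> x)) ^ n * cos (real (Suc k) * \<theta> x)))"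
   proof
    fix x
    have "real (k - 1) * \<theta> x = real k * \<theta> x - \<theta> x" "real (Suc k) * \<theta> x = real k * \<theta> x + \<theta> x"
     using False by (auto simp: of_nat_diff algebra_simps)
    then have "cos (real (k - 1) * \<theta> x) + cos (real (Suc k) * \<theta> x) = 2 * cos (\<theta> x) * cos (real k * \<theta> x)"
     by (simp add: cos_add cos_diff)
    then have "1/2 * (cos (\<theta> x) ^ n * (cos (real (k - 1) * \<theta> x) + cos (real (Suc k) * \<theta> x)))
      = cos (\<theta> x) ^ n * (cos (\<theta> x) * cos (real k * \<theta> x))" by simp
    then show "(cos (\<theta> x)) ^ Suc n * cos (real k * \<theta> x) = 1/2 * ((cos (\<theta> x)) ^ n * cos (real (k - 1) * \<theta> x)
       + (cos (\<theta> x)) ^ n * cos (real (Suc k) * \<theta> x))"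
     by (simp only: distrib_left power_Suc mult.assoc mult.left_commute[of "cos (\<theta> x)" "cos (\<theta> x) ^ n"])
   qed
   then show ?thesis
    using Suc[of "k - 1"] Suc[of "Suc k"] ip_add_left[OF L L f]
    by (simp only: ip_scale_left) simp
  qed
 qed
 have poly: "ip (%x. P (cos (\<theta> x))) f = 0" if P: "real_polynomial_function P" for P
 proof -
  obtain c n where "P = (%x. \<Sum>i\<le>n. c i * x ^ i)"
   using P by (auto simp: real_polynomial_function_iff_sum)
  then have "ip (%x. P (cos (\<theta> x))) f = (\<Sum>i\<le>n. c i * ip (%x. (cos (\<theta> x)) ^ i) f)"
   using L[of _ 0] by (simp add: ip_sum_left[OF L2_scale f] ip_scale_left)
  then show ?thesis using pw[of _ 0] by simp
 qed
 have \<theta>: "\<theta> x \<in> {0..pi}" if "x \<in> {a..b}" for x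
 proof -
  have t: "\<theta> x = pi * ((x - a) / (b - a))" by (simp add: \<theta>_def w_def)
  have "0 <= (x - a) / (b - a)" "(x - a) / (b - a) <= 1" using that a_less_b by (auto simp: divide_simps)
  then have "0 <= pi * ((x - a) / (b - a))" "pi * ((x - a) / (b - a)) <= pi"
   by (auto intro!: mult_nonneg_nonneg mult_left_le simp del: times_divide_eq_right)
  then show ?thesis unfolding t by simp
 qed
 have cont0: "ip g f = 0" if g: "continuous_on {a..b} g" for g
 proof -
  define G where "G u = g (a + arccos u / w 1)" for u
  have Gc: "continuous_on {-1..1} G"
   unfolding G_def
  proof (rule continuous_on_compose2[OF g])
   show "continuous_on {-1..1} (%u. a + arccos u / w 1)"
    by (intro continuous_intros) (use w_pos[of 1] in auto)
   show "(%u. a + arccos u / w 1) ` {-1..1} \<subseteq> {a..b}"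
   proof clarsimp
    fix u :: real assume u: "- 1 <= u" "u <= 1"
    have "0 <= arccos u" "arccos u <= pi" using u arccos_bounded by auto
    moreover have "pi / w 1 = b - a" using a_less_b by (simp add: w_def)
    ultimately show "0 <= arccos u / w (Suc 0) \<and> a + arccos u / w (Suc 0) <= b"
     using w_pos[of 1] divide_right_mono[of "arccos u" pi "w 1"] by auto
   qed
  qed
  have Gg: "G (cos (\<theta> x)) = g x" if "x \<in> {a..b}" for x
   using \<theta>[OF that] w_pos[of 1] by (simp add: G_def arccos_cos \<theta>_def)
  have gL: "g \<in> L2" by (rule continuous_L2[OF g])
  define K where "K = (\<integral>x. \<bar>f x\<bar> \<partial>M)"
  have bd: "\<bar>ip g f\<bar> <= d * K" if d: "0 < d" for d
  proof -
   obtain P where P: "real_polynomial_function P" "\<And>u. u \<in> {-1..1} ==> \<bar>G u - P u\<bar> < d"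
    using Stone_Weierstrass_real_polynomial_function[OF compact_Icc Gc d] by blast
   have cP: "continuous_on A (%x. P (cos (\<theta> x)))" for A
   proof -
    have "continuous_on UNIV P" using P(1) real_polynomial_function_eq continuous_on_polymonial_function by blast
    then show ?thesis unfolding \<theta>_def
     by (rule continuous_on_compose2) (auto intro!: continuous_intros)
   qed
   have PL: "(%x. P (cos (\<theta> x))) \<in> L2" by (intro continuous_L2 cP)
   have "ip g f = ip (%x. g x - P (cos (\<theta> x))) f"
    using ip_diff_left[OF gL PL f] poly[OF P(1)] by simp
   also have "\<bar>\<dots>\<bar> <= (\<integral>x. \<bar>(g x - P (cos (\<theta> x))) * f x\<bar> \<partial>M)"
    unfolding ip_def by (rule integral_abs_bound)
   also have "\<dots> <= (\<integral>x. d * \<bar>f x\<bar> \<partial>M)"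
   proof (rule integral_mono)
    show "integrable M (%x. \<bar>(g x - P (cos (\<theta> x))) * f x\<bar>)"
     by (intro integrable_abs L2_mult_integrable L2_diff gL PL f)
    show "integrable M (%x. d * \<bar>f x\<bar>)" using L2_integrable[OF f] by simp
    show "\<bar>(g x - P (cos (\<theta> x))) * f x\<bar> <= d * \<bar>f x\<bar>" if "x \<in> space M" for x
    proof -
     have "\<bar>g x - P (cos (\<theta> x))\<bar> <= d"
      using P(2)[of "cos (\<theta> x)"] Gg[of x] that by force
     then show ?thesis unfolding abs_mult by (rule mult_right_mono) simp
    qed
   qed
   finally show ?thesis by (simp add: K_def)
  qed
  have K0: "0 <= K" unfolding K_def by (rule Bochner_Integration.integral_nonneg) simp
  show "ip g f = 0"
  proof (rule ccontr)
   assume "ip g f \<noteq> 0"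
   then have p: "0 < \<bar>ip g f\<bar> / (2 * (K + 1))" using K0 by simp
   have "\<bar>ip g f\<bar> * (2 * (K + 1)) <= \<bar>ip g f\<bar> * K"
    using bd[OF p] K0 by (simp add: field_simps)
   then show False using K0 \<open>ip g f \<noteq> 0\<close> by (simp add: mult_le_cancel_left)
  qed
 qed
 show ?thesis
 proof (rule fundamental_lemma[OF L2_locally_integrable[OF f]])
  fix \<phi> assume "test_function I \<phi>"
  then have "ip \<phi> f = 0" by (intro cont0 smooth_continuous test_smooth)
  then show "(\<integral>x. f x * \<phi> x \<partial>M) = 0" unfolding ip_def by (simp add: mult.commute)
 qed
qed

lemma coef_summable: "f \<in> L2 ==> summable (%k. (ip f (e k))^2)"
 by (rule summableI_nonneg_bounded[OF _ Bessel]) auto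

lemma ser_coef_AE:
 assumes f: "f \<in> L2"
 shows "AE x in M. f x = ser e (%k. ip f (e k)) x"
proof -
 let ?g = "ser e (%k. ip f (e k))"
 have g: "?g \<in> L2" by (rule ser_L2_limit(1)[OF ons_e coef_summable[OF f]])
 have "AE x in M. f x - ?g x = 0"
  by (rule cosine_completeness[OF L2_diff[OF f g]])
    (simp add: ip_diff_left[OF f g] ip_ser_basis[OF ons_e coef_summable[OF f]])
 then show ?thesis by eventually_elim simp
qed

lemma AE_eq_of_coef_eq:
 assumes "f \<in> L2" "g \<in> L2" "\<And>k. ip f (e k) = ip g (e k)"
 shows "AE x in M. f x = g x"
proof -
 have "AE x in M. f x - g x = 0"
  by (rule cosine_completeness[OF L2_diff[OF assms(1,2)]]) (simp add: ip_diff_left assms)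
 then show ?thesis by eventually_elim simp
qed

lemma psum_coef_tendsto:
 assumes f: "f \<in> L2"
 shows "(%n. nrm (%x. psum e (%k. ip f (e k)) n x - f x)) \<longlonglongrightarrow> 0"
proof -
 have g: "ser e (%k. ip f (e k)) \<in> L2"
  by (rule ser_L2_limit(1)[OF ons_e coef_summable[OF f]])
 have "nrm (%x. psum e (%k. ip f (e k)) n x - ser e (%k. ip f (e k)) x)
   = nrm (%x. psum e (%k. ip f (e k)) n x - f x)" for n
  by (rule nrm_cong_AE[OF _ L2_diff[OF psum_L2[OF ons_e] g]])
    (use ser_coef_AE[OF f] in \<open>eventually_elim, simp\<close>)
 then show ?thesis using ser_L2_limit(2)[OF ons_e coef_summable[OF f]] by simp
qed

lemma Parseval_ip:
 assumes f: "f \<in> L2" and g: "g \<in> L2"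
 shows "(%k. ip f (e k) * ip g (e k)) sums ip f g"
 using ip_tendsto[OF psum_L2[OF ons_e] f g psum_coef_tendsto[OF f]]
 unfolding sums_def ip_psum_left[OF ons_e g] by (simp add: ip_commute[of _ g])

lemma Parseval: "f \<in> L2 ==> (%k. (ip f (e k))^2) sums (nrm f)^2"
 using Parseval_ip[of f f] nrm_sq[of f] by (simp add: power2_eq_square)

text \<open>There are only countably many inner products with cosines, so a diagonal sequence makes all of them
 converge, for all \<open>k\<close> at once.  By Bessel's inequality the limits are square summable; the series that
 has them as coefficients is the weak limit.\<close>

lemma weak_compactness:
 fixes f :: "nat => nat => real => real"
 assumes f: "\<And>n k. f n k \<in> L2" and B: "\<And>n k. nrm (f n k) <= B k"
 obtains r g where "strict_mono (r :: nat => nat)" "\<forall>k. g k \<in> L2"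
  "\<forall>k. \<forall>h\<in>L2. (%n. ip (f (r n) k) h) \<longlonglongrightarrow> ip (g k) h"
proof -
 have B0: "0 <= B k" for k using B[of 0 k] nrm_nonneg[of "f 0 k"] by linarith
 define x where "x n i = ip (f n (fst (prod_decode i))) (e (snd (prod_decode i)))" for n i
 have "\<exists>C. \<forall>n. \<bar>x n i\<bar> <= C" for i
 proof -
  have "(nrm (e j))^2 = 1" for j by (simp only: nrm_sq ip_ee_ss_eq)
  then have ne: "nrm (e j) = 1" for j
  proof -
   have "nrm (e j) = 1 \<or> nrm (e j) = - 1"
    unfolding power2_eq_1_iff[symmetric] by fact
   then show ?thesis using nrm_nonneg[of "e j"] by linarith
  qed
  have "\<bar>x n i\<bar> <= B (fst (prod_decode i))" for n
   using Cauchy_Schwarz_ip[OF f e_L2, of n "fst (prod_decode i)" "snd (prod_decode i)"]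
    B[of n "fst (prod_decode i)"] unfolding x_def ne by simp
  then show ?thesis by blast
 qed
 then obtain r l where r: "strict_mono (r :: nat => nat)" and l: "\<forall>i. (%n. x (r n) i) \<longlonglongrightarrow> l i"
  by (rule diagonal_subsequence)
 define \<gamma> where "\<gamma> k j = l (prod_encode (k, j))" for k j
 have \<gamma>: "(%n. ip (f (r n) k) (e j)) \<longlonglongrightarrow> \<gamma> k j" for k j
  using l[rule_format, of "prod_encode (k, j)"] by (simp add: \<gamma>_def x_def)
 have sm: "summable (%j. (\<gamma> k j)^2)" for k
 proof (rule summableI_nonneg_bounded)
  fix J
  have "(%n. \<Sum>j<J. (ip (f (r n) k) (e j))^2) \<longlonglongrightarrow> (\<Sum>j<J. (\<gamma> k j)^2)"
   by (intro tendsto_sum tendsto_power \<gamma>)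
  moreover have "(\<Sum>j<J. (ip (f (r n) k) (e j))^2) <= (B k)^2" for n
   using Bessel[OF f, of "r n" k J] power_mono[OF B nrm_nonneg, of "r n" k 2] by (rule order_trans)
  ultimately show "(\<Sum>j<J. (\<gamma> k j)^2) <= (B k)^2" by (intro LIMSEQ_le_const2) auto
 qed simp
 define g where "g k = ser e (\<gamma> k)" for k
 have g: "g k \<in> L2" for k unfolding g_def by (rule ser_L2_limit(1)[OF ons_e sm])
 have "(%n. ip (f (r n) k) h) \<longlonglongrightarrow> ip (g k) h" if h: "h \<in> L2" for k h
 proof (rule LIMSEQ_I)
  fix d :: real assume d: "0 < d"
  define D where "D = B k + nrm (g k) + 1"
  have D: "0 < D" using B0[of k] by (simp add: D_def add_nonneg_pos)
  let ?h = "psum e (%k. ip h (e k))"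
  have "\<forall>\<^sub>F N in sequentially. nrm (%x. ?h N x - h x) < d / (2 * D)"
   using psum_coef_tendsto[OF h] d D by (intro order_tendstoD(2)) auto
  then obtain N where N: "nrm (%x. ?h N x - h x) < d / (2 * D)"
   unfolding eventually_sequentially by blast
  have hN: "?h N \<in> L2" by (rule psum_L2[OF ons_e])
  have "(%n. ip (?h N) (f (r n) k)) \<longlonglongrightarrow> ip (?h N) (g k)"
  proof -
   have "ip (e j) (g k) = \<gamma> k j" for j
    unfolding ip_commute[of "e j"] g_def ip_ser_basis[OF ons_e sm] by simp
   then have "(%n. ip (e j) (f (r n) k)) \<longlonglongrightarrow> ip (e j) (g k)" for j
    using \<gamma>[of k j] by (simp add: ip_commute[of "e j"])
   then show ?thesis
    unfolding ip_psum_left[OF ons_e f] ip_psum_left[OF ons_e g] by (intro tendsto_sum tendsto_mult_left)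
  qed
  from tendstoD[OF this, of "d / 2"] d
  have "\<forall>\<^sub>F n in sequentially. \<bar>ip (?h N) (f (r n) k) - ip (?h N) (g k)\<bar> < d / 2"
   by (simp add: dist_real_def)
  then obtain n0 where n0: "\<And>n. n \<ge> n0 ==> \<bar>ip (?h N) (f (r n) k) - ip (?h N) (g k)\<bar> < d / 2"
   by (auto simp: eventually_sequentially)
  show "\<exists>n0. \<forall>n\<ge>n0. norm (ip (f (r n) k) h - ip (g k) h) < d"
  proof (intro exI[of _ n0] allI impI)
   fix n assume n: "n0 <= n"
   have 1: "\<bar>ip (%x. ?h N x - h x) (f (r n) k)\<bar> <= nrm (%x. ?h N x - h x) * B k"
    using Cauchy_Schwarz_ip[OF L2_diff[OF hN h] f, of "r n" k] B[of "r n" k]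
     mult_left_mono[OF B[of "r n" k] nrm_nonneg[of "%x. ?h N x - h x"]] by linarith
   have 2: "\<bar>ip (%x. ?h N x - h x) (g k)\<bar> <= nrm (%x. ?h N x - h x) * nrm (g k)"
    by (rule Cauchy_Schwarz_ip[OF L2_diff[OF hN h] g])
   have "nrm (%x. ?h N x - h x) * D <= d / (2 * D) * D"
    using N D by (intro mult_right_mono) auto
   then have 3: "nrm (%x. ?h N x - h x) * B k + nrm (%x. ?h N x - h x) * nrm (g k) <= d / 2"
   proof -
    assume le: "nrm (%x. ?h N x - h x) * D <= d / (2 * D) * D"
    have "nrm (%x. ?h N x - h x) * B k + nrm (%x. ?h N x - h x) * nrm (g k)
      <= nrm (%x. ?h N x - h x) * D"
     using nrm_nonneg[of "%x. ?h N x - h x"] by (simp add: D_def distrib_left)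
    also note le
    also have "d / (2 * D) * D = d / 2" using D by simp
    finally show ?thesis .
   qed
   have "ip h (f (r n) k) - ip h (g k) = (ip (?h N) (f (r n) k) - ip (?h N) (g k))
     - ip (%x. ?h N x - h x) (f (r n) k) + ip (%x. ?h N x - h x) (g k)"
    unfolding ip_diff_left[OF hN h f] ip_diff_left[OF hN h g] by simp
   then show "norm (ip (f (r n) k) h - ip (g k) h) < d"
    using 1 2 3 n0[OF n] unfolding ip_commute[of _ h] real_norm_def by linarith
  qed
 qed
 with g show thesis by (intro that[OF r]) auto
qed

end

section \<open>Sobolev functions and their cosine coefficients\<close>

context interval
begin

lemma nrm_e: "nrm (e k) = 1"
proof -
 have "(nrm (e k))^2 = 1" by (simp only: nrm_sq ip_ee_ss_eq)
 then have "nrm (e k) = 1 \<or> nrm (e k) = - 1" unfolding power2_eq_1_iff .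
 then show ?thesis using nrm_nonneg[of "e k"] by linarith
qed

lemma has_weak_derivD:
 "has_weak_deriv I k f g ==> test_function I \<phi> ==> ip f ((deriv ^^ k) \<phi>) = (-1) ^ k * ip g \<phi>"
 by (simp add: has_weak_deriv_def ip_def)

lemma has_weak_derivI_L2:
 assumes "f \<in> L2" "g \<in> L2"
  and "\<And>\<phi>. test_function I \<phi> ==> ip f ((deriv ^^ k) \<phi>) = (-1) ^ k * ip g \<phi>"
 shows "has_weak_deriv I k f g"
 using assms by (simp add: has_weak_deriv_L2_iff)

lemma has_weak_deriv_limit:
 assumes L: "\<And>n. F n \<in> L2" "\<And>n. f n \<in> L2" "F' \<in> L2" "f' \<in> L2"
  and lim: "(%n. nrm (%x. F n x - F' x)) \<longlonglongrightarrow> 0" "(%n. nrm (%x. f n x - f' x)) \<longlonglongrightarrow> 0"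
  and d: "\<And>n. has_weak_deriv I k (F n) (f n)"
 shows "has_weak_deriv I k F' f'"
proof -
 have *: "ip F' ((deriv ^^ k) \<phi>) = (-1) ^ k * ip f' \<phi>" if \<phi>: "test_function I \<phi>" for \<phi>
 proof (rule LIMSEQ_unique)
  show "(%n. ip (F n) ((deriv ^^ k) \<phi>)) \<longlonglongrightarrow> ip F' ((deriv ^^ k) \<phi>)"
   by (rule ip_tendsto[OF L(1,3) test_L2[OF test_deriv_funpow[OF \<phi>]] lim(1)])
  have "(%n. (-1) ^ k * ip (f n) \<phi>) \<longlonglongrightarrow> (-1) ^ k * ip f' \<phi>"
   by (rule tendsto_mult_left[OF ip_tendsto[OF L(2,4) test_L2[OF \<phi>] lim(2)]])
  moreover have "ip (F n) ((deriv ^^ k) \<phi>) = (-1) ^ k * ip (f n) \<phi>" for n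
   by (rule has_weak_derivD[OF d \<phi>])
  ultimately show "(%n. ip (F n) ((deriv ^^ k) \<phi>)) \<longlonglongrightarrow> (-1) ^ k * ip f' \<phi>" by simp
 qed
 show ?thesis by (rule has_weak_derivI_L2[OF L(3,4) *])
qed

lemma has_weak_deriv_diff:
 assumes "has_weak_deriv I 1 f f'" "has_weak_deriv I 1 g g'"
  and "f \<in> L2" "f' \<in> L2" "g \<in> L2" "g' \<in> L2"
 shows "has_weak_deriv I 1 (%x. f x - g x) (%x. f' x - g' x)"
proof (rule has_weak_derivI_L2)
 fix \<phi> assume \<phi>: "test_function I \<phi>"
 show "ip (%x. f x - g x) ((deriv ^^ 1) \<phi>) = (-1) ^ 1 * ip (%x. f' x - g' x) \<phi>"
  using has_weak_derivD[OF assms(1) \<phi>] has_weak_derivD[OF assms(2) \<phi>]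
  unfolding ip_diff_left[OF assms(3,5) test_L2[OF test_deriv_funpow[OF \<phi>]]]
   ip_diff_left[OF assms(4,6) test_L2[OF \<phi>]] by simp
qed (intro L2_diff assms)+

lemma test_weak_deriv:
 assumes "test_function I \<phi>"
 shows "has_weak_deriv I 1 \<phi> (deriv \<phi>)"
 by (rule weak_deriv_classical[OF smooth_DERIV_within[OF test_smooth[OF assms]]
   smooth_continuous[OF smooth_deriv[OF test_smooth[OF assms]]]])

lemma psum_e_DERIV: "(psum e c n has_real_derivative psum s (%k. - w k * c k) n x) (at x within A)"
proof -
 have "((%x. \<Sum>k<n. c k * e k x) has_real_derivative (\<Sum>k<n. c k * (- w k * s k x))) (at x within A)"
  by (intro DERIV_sum DERIV_cmult e_DERIV)
 then show ?thesis by (simp add: psum_def[abs_def] mult.assoc mult.left_commute)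
qed

lemma psum_s_DERIV: "(psum s c n has_real_derivative psum e (%k. w k * c k) n x) (at x within A)"
proof -
 have "((%x. \<Sum>k<n. c k * s k x) has_real_derivative (\<Sum>k<n. c k * (w k * e k x))) (at x within A)"
  by (intro DERIV_sum DERIV_cmult s_DERIV)
 then show ?thesis by (simp add: psum_def[abs_def] mult.assoc mult.left_commute)
qed

lemma ser_e_weak_deriv:
 assumes "summable (%k. (c k)^2)" "summable (%k. (w k * c k)^2)"
 shows "has_weak_deriv I 1 (ser e c) (ser s (%k. - w k * c k))"
proof -
 have c2: "summable (%k. (- w k * c k)^2)" using assms(2) by simp
 show ?thesis
  by (rule has_weak_deriv_limit[OF psum_L2[OF ons_e] psum_L2[OF ons_s]
     ser_L2_limit(1)[OF ons_e assms(1)] ser_L2_limit(1)[OF ons_s c2]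
     ser_L2_limit(2)[OF ons_e assms(1)] ser_L2_limit(2)[OF ons_s c2]])
    (rule weak_deriv_classical[OF psum_e_DERIV psum_cont[OF ons_s]])
qed

lemma ser_s_weak_deriv:
 assumes "summable (%k. (c k)^2)" "summable (%k. (w k * c k)^2)"
 shows "has_weak_deriv I 1 (ser s c) (ser e (%k. w k * c k))"
 by (rule has_weak_deriv_limit[OF psum_L2[OF ons_s] psum_L2[OF ons_e]
    ser_L2_limit(1)[OF ons_s assms(1)] ser_L2_limit(1)[OF ons_e assms(2)]
    ser_L2_limit(2)[OF ons_s assms(1)] ser_L2_limit(2)[OF ons_e assms(2)]])
   (rule weak_deriv_classical[OF psum_s_DERIV psum_cont[OF ons_e]])

lemma ser_e_DERIV:
 assumes "summable (%k. \<bar>c k\<bar>)" "summable (%k. \<bar>w k * c k\<bar>)"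
 shows "(ser e c has_real_derivative ser s (%k. - w k * c k) x) (at x)"
proof -
 have c2: "summable (%k. \<bar>- w k * c k\<bar>)" using assms(2) by simp
 have "((%x. \<Sum>k. c k * e k x) has_real_derivative (\<Sum>k. c k * (- w k * s k x))) (at x)"
 proof (rule has_field_derivative_series'(2)[where S = UNIV and x0 = x])
  show "uniformly_convergent_on UNIV (%n x. \<Sum>k<n. c k * (- w k * s k x))"
   using ser_uniform_limit[OF ons_s c2, of UNIV]
   by (auto simp: uniformly_convergent_on_def psum_def[abs_def] mult.assoc mult.left_commute)
  show "summable (%k. c k * e k x)" by (rule ons_summable[OF ons_e assms(1)])
  show "((%x. c n * e n x) has_real_derivative c n * (- w n * s n x)) (at x within UNIV)" for n x
   by (rule DERIV_cmult[OF e_DERIV])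
 qed auto
 then show ?thesis using assms(1) c2 by (simp add: ser_def mult.assoc mult.left_commute)
qed

lemma ser_s_DERIV:
 assumes "summable (%k. \<bar>c k\<bar>)" "summable (%k. \<bar>w k * c k\<bar>)"
 shows "(ser s c has_real_derivative ser e (%k. w k * c k) x) (at x)"
proof -
 have "((%x. \<Sum>k. c k * s k x) has_real_derivative (\<Sum>k. c k * (w k * e k x))) (at x)"
 proof (rule has_field_derivative_series'(2)[where S = UNIV and x0 = x])
  show "uniformly_convergent_on UNIV (%n x. \<Sum>k<n. c k * (w k * e k x))"
   using ser_uniform_limit[OF ons_e assms(2), of UNIV]
   by (auto simp: uniformly_convergent_on_def psum_def[abs_def] mult.assoc mult.left_commute)
  show "summable (%k. c k * s k x)" by (rule ons_summable[OF ons_s assms(1)])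
  show "((%x. c n * s n x) has_real_derivative c n * (w n * e n x)) (at x within UNIV)" for n x
   by (rule DERIV_cmult[OF s_DERIV])
 qed auto
 then show ?thesis using assms by (simp add: ser_def mult.assoc mult.left_commute)
qed

text \<open>The cosine series with coefficients \<open>c\<close> lies in \<open>H\<^sup>m\<close> and its odd derivatives of order below \<open>m\<close>
 vanish at the end points.\<close>

definition hs :: "nat => (nat => real) => bool" where
 "hs m c \<longleftrightarrow> summable (%k. (w k ^ m * c k)^2)"

lemma w_ge_w1: "1 <= k ==> w 1 <= w k"
 using a_less_b by (auto simp: w_def divide_right_mono)

lemma hs_mono:
 assumes "hs m c" "j <= m"
 shows "hs j c"
 unfolding hs_def
proof (rule summable_comparison_test'[where N = 1])
 let ?C = "1 / (w 1 ^ (m - j))^2"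
 show "summable (%k. ?C * (w k ^ m * c k)^2)" using assms(1) by (intro summable_mult) (simp add: hs_def)
 show "norm ((w k ^ j * c k)^2) <= ?C * (w k ^ m * c k)^2" if "1 <= k" for k
 proof -
  have w1: "0 < w 1" by (rule w_pos) simp
  have "(w k ^ j * c k)^2 * (w 1 ^ (m - j))^2 <= (w k ^ j * c k)^2 * (w k ^ (m - j))^2"
   using w_ge_w1[OF that] w1 by (intro mult_left_mono power_mono) auto
  also have "\<dots> = (w k ^ m * c k)^2"
  proof -
   have "w k ^ m = w k ^ j * w k ^ (m - j)" using assms(2) by (simp flip: power_add)
   then show ?thesis by (simp add: power_mult_distrib)
  qed
  finally show ?thesis using w1 by (simp add: field_simps)
 qed
qed

lemma hs_0: "hs m c ==> summable (%k. (c k)^2)"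
 using hs_mono[of m c 0] by (simp add: hs_def)

lemma hs_weight: "hs m c ==> j <= m ==> summable (%k. (w k ^ j * c k)^2)"
 using hs_mono[of m c j] by (simp add: hs_def)

lemma summable_inverse_w_sq: "summable (%k. 1 / (w k)^2)"
proof -
 have "summable (%k. (1 / (w 1)^2) * (1 / real k ^ 2))"
  by (intro summable_mult inverse_power_summable[of 2, where 'a=real, unfolded inverse_eq_divide]) simp
 moreover have "(%k. (1 / (w 1)^2) * (1 / real k ^ 2)) = (%k. 1 / (w k)^2)"
 proof
  fix k
  have "(w k)^2 = (w 1)^2 * real k ^ 2"
   unfolding w_eq[of k] power_mult_distrib by (rule mult.commute)
  then show "(1 / (w 1)^2) * (1 / real k ^ 2) = 1 / (w k)^2" by simp
 qed
 ultimately show ?thesis by (simp only:)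
qed

lemma hs_abs_summable:
 assumes "hs (Suc m) c"
 shows "summable (%k. \<bar>w k ^ m * c k\<bar>)"
proof (rule summable_comparison_test'[where N = 1])
 show "summable (%k. 1 / (w k)^2 + (w k ^ Suc m * c k)^2)"
  using assms by (intro summable_add summable_inverse_w_sq) (simp add: hs_def)
 show "norm \<bar>w k ^ m * c k\<bar> <= 1 / (w k)^2 + (w k ^ Suc m * c k)^2" if "1 <= k" for k
 proof -
  have wk: "0 < w k" using that by (intro w_pos) simp
  define p where "p = 1 / w k"
  define q where "q = \<bar>w k ^ Suc m * c k\<bar>"
  have "0 <= (p - q)^2" by simp
  then have "2 * (p * q) <= p^2 + q^2" by (simp add: power2_diff)
  moreover have "p * q = \<bar>w k ^ m * c k\<bar>" using wk by (simp add: p_def q_def abs_mult)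
  moreover have "0 <= p * q" using wk by (simp add: p_def q_def)
  ultimately have "\<bar>w k ^ m * c k\<bar> <= p^2 + q^2" by linarith
  then show ?thesis by (simp add: p_def q_def power_divide)
 qed
qed

lemma hs_abs: "hs m c ==> j < m ==> summable (%k. \<bar>w k ^ j * c k\<bar>)"
 by (rule hs_abs_summable) (rule hs_mono, auto)

lemma hs_diff: "hs m c ==> hs m d ==> hs m (%k. c k - d k)"
 unfolding hs_def
proof (rule summable_comparison_test'[where N = 0])
 assume "summable (%k. (w k ^ m * c k)^2)" "summable (%k. (w k ^ m * d k)^2)"
 then show "summable (%k. 2 * ((w k ^ m * c k)^2 + (w k ^ m * d k)^2))"
  by (intro summable_mult summable_add)
 have "(x - y)^2 <= 2 * (x^2 + y^2)" for x y :: real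
  using zero_le_power2[of "x + y"] by (simp add: power2_sum power2_diff)
 then show "norm ((w k ^ m * (c k - d k))^2) <= 2 * ((w k ^ m * c k)^2 + (w k ^ m * d k)^2)" for k
  by (simp add: right_diff_distrib)
qed

lemma hs_finite: "(\<And>k. n <= k ==> c k = 0) ==> hs m c"
 unfolding hs_def by (rule summable_comparison_test'[OF summable_zero, of n]) auto

text \<open>The \<open>j\<close>-th derivative of the cosine series, a cosine series for even and a sine series for odd \<open>j\<close>;
 the signs are those of repeated differentiation of the cosine.\<close>

definition sder :: "nat => (nat => real) => real => real" where
 "sder j c = (if even j then ser e (%k. (-1) ^ (j div 2) * w k ^ j * c k)
   else ser s (%k. (-1) ^ (Suc j div 2) * w k ^ j * c k))"

lemma sder_0: "sder 0 c = ser e c"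
 by (simp add: sder_def)

lemma sq_sign: "((-1) ^ i * x)^2 = (x :: real)^2"
 by (simp add: power_mult_distrib flip: power_mult)

lemma summable_sder: "hs m c ==> j <= m ==> summable (%k. ((-1) ^ i * w k ^ j * c k)^2)"
 using hs_weight[of m c j] by (simp add: mult.assoc sq_sign)

lemma sder_L2: "hs m c ==> j <= m ==> sder j c \<in> L2"
 unfolding sder_def by (auto intro!: ser_L2_limit(1)[OF ons_e] ser_L2_limit(1)[OF ons_s] summable_sder)

lemma sder_weak_deriv:
 assumes "hs m c" "j < m"
 shows "has_weak_deriv I 1 (sder j c) (sder (Suc j) c)"
proof (cases "even j")
 case True
 have 1: "summable (%k. ((-1) ^ (j div 2) * w k ^ j * c k)^2)"
  using assms by (intro summable_sder) auto
 have eq: "w k * ((-1) ^ (j div 2) * w k ^ j * c k) = (-1) ^ (j div 2) * w k ^ Suc j * c k" for k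
  by simp
 have 2: "summable (%k. (w k * ((-1) ^ (j div 2) * w k ^ j * c k))^2)"
  unfolding eq using assms by (intro summable_sder) auto
 have "(%k. - w k * ((-1) ^ (j div 2) * w k ^ j * c k)) = (%k. (-1) ^ (Suc (Suc j) div 2) * w k ^ Suc j * c k)"
  using True by (auto simp: fun_eq_iff)
 then show ?thesis using ser_e_weak_deriv[OF 1 2] True by (simp add: sder_def)
next
 case False
 have 1: "summable (%k. ((-1) ^ (Suc j div 2) * w k ^ j * c k)^2)"
  using assms by (intro summable_sder) auto
 have eq: "w k * ((-1) ^ (Suc j div 2) * w k ^ j * c k) = (-1) ^ (Suc j div 2) * w k ^ Suc j * c k" for k
  by simp
 have 2: "summable (%k. (w k * ((-1) ^ (Suc j div 2) * w k ^ j * c k))^2)"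
  unfolding eq using assms by (intro summable_sder) auto
 show ?thesis using ser_s_weak_deriv[OF 1 2] False unfolding eq by (simp add: sder_def)
qed

lemma sder_DERIV:
 assumes "hs m c" "Suc j < m"
 shows "(sder j c has_real_derivative sder (Suc j) c x) (at x)"
proof (cases "even j")
 case True
 have 1: "summable (%k. \<bar>(-1) ^ (j div 2) * w k ^ j * c k\<bar>)"
  using hs_abs[of m c j] assms by (simp add: abs_mult power_abs)
 have eq: "w k * ((-1) ^ (j div 2) * w k ^ j * c k) = (-1) ^ (j div 2) * w k ^ Suc j * c k" for k
  by simp
 have 2: "summable (%k. \<bar>w k * ((-1) ^ (j div 2) * w k ^ j * c k)\<bar>)"
  unfolding eq using hs_abs[of m c "Suc j"] assms by (simp add: abs_mult power_abs)
 have "(%k. - w k * ((-1) ^ (j div 2) * w k ^ j * c k)) = (%k. (-1) ^ (Suc (Suc j) div 2) * w k ^ Suc j * c k)"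
  using True by (auto simp: fun_eq_iff)
 then show ?thesis using ser_e_DERIV[OF 1 2] True by (simp add: sder_def)
next
 case False
 have 1: "summable (%k. \<bar>(-1) ^ (Suc j div 2) * w k ^ j * c k\<bar>)"
  using hs_abs[of m c j] assms by (simp add: abs_mult power_abs)
 have eq: "w k * ((-1) ^ (Suc j div 2) * w k ^ j * c k) = (-1) ^ (Suc j div 2) * w k ^ Suc j * c k" for k
  by simp
 have 2: "summable (%k. \<bar>w k * ((-1) ^ (Suc j div 2) * w k ^ j * c k)\<bar>)"
  unfolding eq using hs_abs[of m c "Suc j"] assms by (simp add: abs_mult power_abs)
 show ?thesis using ser_s_DERIV[OF 1 2] False unfolding eq by (simp add: sder_def)
qed

lemma sder_cont: "hs m c ==> j < m ==> continuous_on A (sder j c)"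
 using hs_abs[of m c j] unfolding sder_def
 by (auto intro!: ser_cont[OF ons_e] ser_cont[OF ons_s] simp: abs_mult power_abs)

text \<open>Odd derivatives are sine series, and these vanish at both ends; this is why the Neumann
 conditions on \<open>y\<^sub>x\<close> and \<open>y\<^sub>x\<^sub>x\<^sub>x\<close> need no separate treatment.\<close>

lemma sder_boundary:
 assumes "hs m c" "j < m" "odd j" "x \<in> {a, b}"
 shows "sder j c x = 0"
proof -
 have "summable (%k. \<bar>(-1) ^ (Suc j div 2) * w k ^ j * c k\<bar>)"
  using hs_abs[of m c j] assms by (simp add: abs_mult power_abs)
 then show ?thesis using assms(3,4) by (auto simp: sder_def ser_def)
qed

lemma sder_sup_bound:
 assumes "hs m c" "j < m"
 shows "\<bar>sder j c x\<bar> <= eb * (\<Sum>k. \<bar>w k ^ j * c k\<bar>)"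
proof -
 have 1: "summable (%k. \<bar>(-1) ^ i * w k ^ j * c k\<bar>)" for i
  using hs_abs[of m c j] assms by (simp add: abs_mult power_abs)
 have 2: "\<bar>(-1) ^ i * w k ^ j * c k\<bar> = \<bar>w k ^ j * c k\<bar>" for i k
  by (simp add: abs_mult power_abs)
 show ?thesis
  using ser_abs_bound[OF ons_e 1, of "j div 2" x] ser_abs_bound[OF ons_s 1, of "Suc j div 2" x]
  unfolding 2 by (auto simp: sder_def)
qed

lemma nrm_sder_sums:
 assumes "hs m c" "j <= m"
 shows "(%k. (w k ^ j * c k)^2) sums (nrm (sder j c))^2"
proof (cases "even j")
 case True
 then show ?thesis
  using nrm_ser_sums[OF ons_e summable_sder[OF assms, of "j div 2"]]
  by (simp add: sder_def mult.assoc sq_sign)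
next
 case False
 have "(%k. ((-1) ^ (Suc j div 2) * w k ^ j * c k)^2 * nu_s k) sums (nrm (sder j c))^2"
  using nrm_ser_sums[OF ons_s summable_sder[OF assms, of "Suc j div 2"]] False
  by (simp only: sder_def if_False)
 moreover have "((-1) ^ (Suc j div 2) * w k ^ j * c k)^2 * nu_s k = (w k ^ j * c k)^2" for k
  unfolding mult.assoc sq_sign using odd_pos[OF False] by (cases "k = 0") (auto simp: nu_s_def)
 ultimately show ?thesis by simp
qed

lemma sder_weak_deriv_order:
 assumes "hs m c" "j <= m"
 shows "has_weak_deriv I j (ser e c) (sder j c)"
 using assms(2)
proof (induction j)
 case 0
 then show ?case using has_weak_deriv_0[OF sder_L2[OF assms(1), of 0]] by (simp add: sder_0)
next
 case (Suc j)
 then show ?case by (intro has_weak_deriv_Suc[OF _ sder_weak_deriv[OF assms(1)]]) auto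
qed

lemma series_in_H:
 assumes "hs m c" "f \<in> L2" "AE x in M. f x = ser e c x"
 shows "f \<in> H_space m I" "H_norm m I f = sqrt (\<Sum>j\<le>m. \<Sum>k. (w k ^ j * c k)^2)"
  "\<And>j. j <= m ==> AE x in M. weak_deriv I j f x = sder j c x"
proof -
 have sym: "AE x in M. ser e c x = f x" using assms(3) by eventually_elim simp
 have wd: "has_weak_deriv I j f (sder j c)" if "j <= m" for j
  by (rule has_weak_deriv_cong_AE[OF sder_weak_deriv_order[OF assms(1) that]
    _ sder_L2[OF assms(1) that] sym])
    (use sder_L2[OF assms(1), of 0] in \<open>auto simp: sder_0\<close>)
 then show ae: "AE x in M. weak_deriv I j f x = sder j c x" if "j <= m" for j
  using weak_deriv_eq_AE that by blast
 show "f \<in> H_space m I"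
  using assms(2) wd sder_L2[OF assms(1)] by (auto simp: H_space_def)
 have "(nrm (weak_deriv I j f))^2 = (\<Sum>k. (w k ^ j * c k)^2)" if "j <= m" for j
 proof -
  have "nrm (weak_deriv I j f) = nrm (sder j c)"
   by (rule nrm_cong_AE[OF ae[OF that] weak_deriv_L2[OF wd[OF that] sder_L2[OF assms(1) that]]])
  then show ?thesis using sums_unique[OF nrm_sder_sums[OF assms(1) that]] by simp
 qed
 then show "H_norm m I f = sqrt (\<Sum>j\<le>m. \<Sum>k. (w k ^ j * c k)^2)"
  by (simp add: H_norm_def)
qed

text \<open>Primitives of square-integrable functions.  Identities known for continuous integrands extend
 to square-integrable ones by approximation with partial sums of the cosine series.\<close>

lemma indicator_L2: "indicator {x..y} \<in> L2"
proof -
 have "(indicator {x..y} :: real => real) \<in> borel_measurable lebesgue"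
  by (rule borel_measurable_indicator) simp
 then have "(indicator {x..y} :: real => real) \<in> borel_measurable M" by (rule measurable_restrict_space1)
 then have "(%t. indicator {x..y} t * (1::real)) \<in> L2"
  by (rule L2_bounded_mult[OF L2_const, of _ 1]) (simp add: indicator_def)
 then show ?thesis by simp
qed

lemma nrm_indicator_le: "x <= y ==> nrm (indicator {x..y}) <= sqrt (y - x)"
proof -
 assume xy: "x <= y"
 have "(\<integral>t. (indicator {x..y} t :: real)^2 \<partial>M) = (\<integral>t. indicator {x..y} t \<partial>M)"
  by (intro Bochner_Integration.integral_cong) (auto simp: indicator_def)
 also have "\<dots> = measure M ({x..y} \<inter> I)" by simp
 also have "\<dots> = measure lebesgue ({x..y} \<inter> I)"
  by (intro measure_restrict_space) auto
 also have "\<dots> <= measure lebesgue {x..y}"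
  by (intro measure_mono_fmeasurable) auto
 also have "\<dots> = y - x" using xy by simp
 finally show ?thesis by (simp add: L2_norm_def)
qed

definition prim :: "(real => real) => real => real" where
 "prim g x = integral {a..x} g"

lemma L2_integrable_on:
 assumes "g \<in> L2" "a <= x" "y <= b"
 shows "g integrable_on {x..y}"
proof -
 have "g integrable_on I" by (intro integrable_on_lebesgue_on L2_integrable assms) simp
 then have "g integrable_on {a..b}" by (simp add: integrable_on_Icc_iff_Ioo)
 then show ?thesis by (rule integrable_on_subinterval) (use assms in auto)
qed

lemma integral_eq_ip:
 assumes g: "g \<in> L2" and xy: "a <= x" "y <= b"
 shows "integral {x..y} g = ip g (indicator {x..y})"
proof -
 have "ip g (indicator {x..y}) = integral I (%t. g t * indicator {x..y} t)"
  unfolding ip_def by (intro lebesgue_integral_eq_integral L2_mult_integrable g indicator_L2) simp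
 also have "\<dots> = integral {a..b} (%t. g t * indicator {x..y} t)"
  by (rule integral_open_interval_real[symmetric])
 also have "\<dots> = integral {a..b} (%t. if t \<in> {x..y} then g t else 0)"
  by (intro Henstock_Kurzweil_Integration.integral_cong) (auto simp: indicator_def)
 also have "\<dots> = integral {x..y} g"
  using xy by (subst Henstock_Kurzweil_Integration.integral_restrict_Int) (simp add: Int_absorb1)
 finally show ?thesis by simp
qed

lemma integral_CS:
 assumes g: "g \<in> L2" and xy: "a <= x" "x <= y" "y <= b"
 shows "\<bar>integral {x..y} g\<bar> <= sqrt (y - x) * nrm g"
proof -
 have "\<bar>integral {x..y} g\<bar> <= nrm g * nrm (indicator {x..y})"
  unfolding integral_eq_ip[OF g xy(1,3)] by (rule Cauchy_Schwarz_ip[OF g indicator_L2])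
 also have "\<dots> <= nrm g * sqrt (y - x)" by (intro mult_left_mono nrm_indicator_le xy) simp
 finally show ?thesis by (simp add: mult.commute)
qed

lemma prim_a [simp]: "prim g a = 0" by (simp add: prim_def)

lemma prim_diff:
 assumes "g \<in> L2" "a <= x" "x <= y" "y <= b"
 shows "prim g y - prim g x = integral {x..y} g"
proof -
 have "integral {a..x} g + integral {x..y} g = integral {a..y} g"
  using assms by (intro Henstock_Kurzweil_Integration.integral_combine L2_integrable_on) auto
 then show ?thesis by (simp add: prim_def)
qed

lemma prim_cont:
 assumes "g \<in> L2"
 shows "continuous_on {a..b} (prim g)"
proof -
 have "g integrable_on {a..b}" by (rule L2_integrable_on[OF assms]) auto
 from indefinite_integral_continuous_1[OF this] show ?thesis
  by (simp add: prim_def[abs_def])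
qed

lemma prim_L2: "g \<in> L2 ==> prim g \<in> L2"
 by (rule continuous_L2[OF prim_cont])

lemma prim_near:
 assumes "f \<in> L2" "g \<in> L2" "x \<in> {a..b}"
 shows "\<bar>prim f x - prim g x\<bar> <= sqrt (b - a) * nrm (%x. f x - g x)"
proof -
 have "prim f x - prim g x = integral {a..x} (%t. f t - g t)"
  unfolding prim_def using assms
  by (intro Henstock_Kurzweil_Integration.integral_diff[symmetric] L2_integrable_on) auto
 also have "\<bar>\<dots>\<bar> <= sqrt (x - a) * nrm (%x. f x - g x)"
  using assms by (intro integral_CS L2_diff) auto
 also have "\<dots> <= sqrt (b - a) * nrm (%x. f x - g x)"
  using assms by (intro mult_right_mono) auto
 finally show ?thesis .
qed

lemma prim_DERIV:
 assumes "continuous_on {a..b} g" "x \<in> {a..b}"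
 shows "(prim g has_real_derivative g x) (at x within {a..b})"
 unfolding prim_def[abs_def] by (rule integral_has_real_derivative[OF assms])

lemma prim_nrm_tendsto:
 assumes "\<And>n. f n \<in> L2" "g \<in> L2" "(%n. nrm (%x. f n x - g x)) \<longlonglongrightarrow> 0"
 shows "(%n. nrm (%x. prim (f n) x - prim g x)) \<longlonglongrightarrow> 0"
proof (rule Lim_null_comparison)
 have le: "nrm (%x. prim (f n) x - prim g x) <= (sqrt (b - a) * nrm (%x. f n x - g x)) * sqrt (b - a)" for n
 proof -
  have "nrm (%x. prim (f n) x - prim g x) <= nrm (%x. sqrt (b - a) * nrm (%x. f n x - g x))"
   using prim_near[OF assms(1,2)] a_less_b
   by (intro nrm_mono L2_diff prim_L2 assms L2_const AE_I2) auto
  then show ?thesis using a_less_b by (simp add: nrm_const)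
 qed
 then show "\<forall>\<^sub>F n in sequentially. norm (nrm (%x. prim (f n) x - prim g x))
   <= (sqrt (b - a) * nrm (%x. f n x - g x)) * sqrt (b - a)" by simp
 have "(%n. (sqrt (b - a) * nrm (%x. f n x - g x)) * sqrt (b - a)) \<longlonglongrightarrow> (sqrt (b - a) * 0) * sqrt (b - a)"
  by (intro tendsto_intros assms(3))
 then show "(%n. (sqrt (b - a) * nrm (%x. f n x - g x)) * sqrt (b - a)) \<longlonglongrightarrow> 0" by simp
qed

lemma prim_tendsto:
 assumes "\<And>n. f n \<in> L2" "g \<in> L2" "(%n. nrm (%x. f n x - g x)) \<longlonglongrightarrow> 0" "x \<in> {a..b}"
 shows "(%n. prim (f n) x) \<longlonglongrightarrow> prim g x"
proof (rule LIM_zero_cancel, rule Lim_null_comparison)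
 show "\<forall>\<^sub>F n in sequentially. norm (prim (f n) x - prim g x) <= sqrt (b - a) * nrm (%x. f n x - g x)"
  using prim_near[OF assms(1,2,4)] by simp
 show "(%n. sqrt (b - a) * nrm (%x. f n x - g x)) \<longlonglongrightarrow> 0"
  using tendsto_mult_left[OF assms(3), of "sqrt (b - a)"] by simp
qed

abbreviation (input) trig :: "(real => real) => nat => real => real" where
 "trig g \<equiv> psum e (%k. ip g (e k))"

lemma trig_L2: "trig g n \<in> L2" by (rule psum_L2[OF ons_e])

lemma prim_weak_deriv:
 assumes g: "g \<in> L2"
 shows "has_weak_deriv I 1 (prim g) g"
 by (rule has_weak_deriv_limit[OF prim_L2[OF trig_L2] trig_L2 prim_L2[OF g] g
    prim_nrm_tendsto[OF trig_L2 g psum_coef_tendsto[OF g]] psum_coef_tendsto[OF g]])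
   (rule weak_deriv_classical[OF prim_DERIV[OF psum_cont[OF ons_e]] psum_cont[OF ons_e]])

text \<open>The lemma of du Bois-Reymond.\<close>

lemma weak_deriv_imp_primitive:
 assumes "has_weak_deriv I 1 f g" and f: "f \<in> L2" and g: "g \<in> L2"
 obtains C where "AE x in M. f x = C + prim g x"
proof -
 have "ip (%x. f x - prim g x) (deriv \<phi>) = 0" if \<phi>: "test_function I \<phi>" for \<phi>
 proof -
  have "ip f (deriv \<phi>) = - ip g \<phi>" "ip (prim g) (deriv \<phi>) = - ip g \<phi>"
   using has_weak_derivD[OF assms(1) \<phi>] has_weak_derivD[OF prim_weak_deriv[OF g] \<phi>] by auto
  then show ?thesis
   using ip_diff_left[OF f prim_L2[OF g] test_L2[OF test_deriv[OF \<phi>]]] by simp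
 qed
 then obtain C where C: "AE x in M. f x - prim g x = C"
  by (rule weak_deriv_zero_const[OF L2_diff[OF f prim_L2[OF g]]])
 show thesis by (rule that[of C]) (use C in \<open>eventually_elim, simp\<close>)
qed

lemma integration_by_parts_prim:
 assumes g: "g \<in> L2"
  and \<psi>: "\<And>x. x \<in> {a..b} ==> (\<psi> has_real_derivative \<psi>' x) (at x within {a..b})" "continuous_on {a..b} \<psi>'"
 shows "ip g \<psi> = (C + prim g b) * \<psi> b - C * \<psi> a - ip (%x. C + prim g x) \<psi>'"
proof (rule LIMSEQ_unique)
 have c\<psi>: "continuous_on {a..b} \<psi>" by (rule DERIV_continuous_on[OF \<psi>(1)], simp)
 have L: "\<psi> \<in> L2" "\<psi>' \<in> L2" using c\<psi> \<psi>(2) by (auto intro: continuous_L2)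
 show "(%n. ip (trig g n) \<psi>) \<longlonglongrightarrow> ip g \<psi>"
  by (rule ip_tendsto[OF trig_L2 g L(1) psum_coef_tendsto[OF g]])
 have ab: "b \<in> {a..b}" using a_less_b by simp
 have LC: "(%x. C + prim h x) \<in> L2" if "h \<in> L2" for h
  by (intro L2_add prim_L2 that L2_const)
 have "(%n. ip (%x. C + prim (trig g n) x) \<psi>') \<longlonglongrightarrow> ip (%x. C + prim g x) \<psi>'"
  by (rule ip_tendsto[OF LC[OF trig_L2] LC[OF g] L(2)])
    (use prim_nrm_tendsto[OF trig_L2 g psum_coef_tendsto[OF g]] in simp)
 then have "(%n. (C + prim (trig g n) b) * \<psi> b - C * \<psi> a - ip (%x. C + prim (trig g n) x) \<psi>')
   \<longlonglongrightarrow> (C + prim g b) * \<psi> b - C * \<psi> a - ip (%x. C + prim g x) \<psi>'"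
  by (intro tendsto_intros prim_tendsto[OF trig_L2 g psum_coef_tendsto[OF g] ab])
 moreover have "ip (trig g n) \<psi> = (C + prim (trig g n) b) * \<psi> b - C * \<psi> a - ip (%x. C + prim (trig g n) x) \<psi>'" for n
 proof -
  have "((%x. C + prim (trig g n) x) has_real_derivative trig g n x) (at x within {a..b})" if "x \<in> {a..b}" for x
   using prim_DERIV[OF psum_cont[OF ons_e] that] by (auto intro!: derivative_eq_intros)
  from integration_by_parts_C1[OF this \<psi>(1) psum_cont[OF ons_e] \<psi>(2)]
  have "ip (%x. C + prim (trig g n) x) \<psi>' = (C + prim (trig g n) b) * \<psi> b - (C + prim (trig g n) a) * \<psi> a - ip (trig g n) \<psi>" .
  then show ?thesis by simp
 qed
 ultimately show "(%n. ip (trig g n) \<psi>)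
   \<longlonglongrightarrow> (C + prim g b) * \<psi> b - C * \<psi> a - ip (%x. C + prim g x) \<psi>'" by simp
qed

text \<open>The chain rule \<open>(g\<^sup>2)' = 2 g g'\<close> for functions that are only absolutely continuous.\<close>

lemma prim_square:
 assumes g: "g \<in> L2" and t: "t \<in> {a..b}"
 shows "(C + prim g t)^2 = C^2 + 2 * ip (%x. (C + prim g x) * indicator {a..t} x) g"
proof (rule LIMSEQ_unique)
 let ?H = "%n x. C + prim (trig g n) x" and ?i = "indicator {a..t} :: real => real"
 note lim = psum_coef_tendsto[OF g]
 show "(%n. (?H n t)^2) \<longlonglongrightarrow> (C + prim g t)^2"
  by (intro tendsto_intros prim_tendsto[OF trig_L2 g lim t])
 have LC: "(%x. (C + prim h x) * ?i x) \<in> L2" if "h \<in> L2" for h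
 proof -
  have "(%x. (C + prim h x) * ?i x) \<in> L2"
   by (intro continuous_L2_mult continuous_intros prim_cont that indicator_L2)
  then show ?thesis .
 qed
 have lim1: "(%n. nrm (%x. ?H n x * ?i x - (C + prim g x) * ?i x)) \<longlonglongrightarrow> 0"
 proof (rule Lim_null_comparison[OF _ prim_nrm_tendsto[OF trig_L2 g lim]])
  have "nrm (%x. ?H n x * ?i x - (C + prim g x) * ?i x) <= nrm (%x. prim (trig g n) x - prim g x)" for n
   by (intro nrm_mono L2_diff LC prim_L2 trig_L2 g AE_I2) (auto simp: indicator_def)
  then show "\<forall>\<^sub>F n in sequentially. norm (nrm (%x. ?H n x * ?i x - (C + prim g x) * ?i x))
    <= nrm (%x. prim (trig g n) x - prim g x)" by simp
 qed
 have "(%n. ip (%x. ?H n x * ?i x) (trig g n)) \<longlonglongrightarrow> ip (%x. (C + prim g x) * ?i x) g"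
 proof -
  have 1: "(%n. ip (%x. ?H n x * ?i x) g) \<longlonglongrightarrow> ip (%x. (C + prim g x) * ?i x) g"
   by (rule ip_tendsto[OF LC[OF trig_L2] LC[OF g] g lim1])
  have 2: "(%n. ip (%x. ?H n x * ?i x) (trig g n) - ip (%x. ?H n x * ?i x) g) \<longlonglongrightarrow> 0"
  proof (rule Lim_null_comparison)
   have "\<bar>ip (%x. ?H n x * ?i x) (trig g n) - ip (%x. ?H n x * ?i x) g\<bar>
     <= nrm (%x. trig g n x - g x) * nrm (%x. ?H n x * ?i x)" for n
    using Cauchy_Schwarz_ip[OF L2_diff[OF trig_L2 g, of g n] LC[OF trig_L2, of g n]]
     ip_diff_left[OF trig_L2 g LC[OF trig_L2], of g n g n]
    by (simp add: ip_commute[of "%x. ?H n x * ?i x"])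
   then show "\<forall>\<^sub>F n in sequentially. norm (ip (%x. ?H n x * ?i x) (trig g n) - ip (%x. ?H n x * ?i x) g)
     <= nrm (%x. trig g n x - g x) * nrm (%x. ?H n x * ?i x)" by simp
   show "(%n. nrm (%x. trig g n x - g x) * nrm (%x. ?H n x * ?i x)) \<longlonglongrightarrow> 0"
    using tendsto_mult[OF lim nrm_tendsto[OF LC[OF trig_L2] LC[OF g] lim1]] by simp
  qed
  from tendsto_add[OF 1 2] show ?thesis by simp
 qed
 then have "(%n. C^2 + 2 * ip (%x. ?H n x * ?i x) (trig g n))
   \<longlonglongrightarrow> C^2 + 2 * ip (%x. (C + prim g x) * ?i x) g"
  by (intro tendsto_intros)
 moreover have "(?H n t)^2 = C^2 + 2 * ip (%x. ?H n x * ?i x) (trig g n)" for n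
 proof -
  have c: "continuous_on {a..b} (trig g n)" by (rule psum_cont[OF ons_e])
  have D: "((%x. (?H n x)^2) has_real_derivative 2 * (?H n x * trig g n x)) (at x within {a..b})"
   if "x \<in> {a..b}" for x
   using prim_DERIV[OF c that] by (auto intro!: derivative_eq_intros)
  have cH: "continuous_on {a..b} (%x. ?H n x * trig g n x)"
   by (intro continuous_intros prim_cont trig_L2 c)
  have "((%x. 2 * (?H n x * trig g n x)) has_integral (?H n t)\<^sup>2 - (?H n a)^2) {a..t}"
  proof (rule fundamental_theorem_of_calculus)
   show "((%x. (?H n x)^2) has_vector_derivative 2 * (?H n x * trig g n x)) (at x within {a..t})"
    if "x \<in> {a..t}" for x
    unfolding has_real_derivative_iff_has_vector_derivative[symmetric]
    by (rule has_field_derivative_subset[OF D]) (use that t in auto)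
  qed (use t in auto)
  then have "integral {a..t} (%x. 2 * (?H n x * trig g n x)) = (?H n t)^2 - (?H n a)^2"
   by (rule integral_unique)
  then have "2 * integral {a..t} (%x. ?H n x * trig g n x) = (?H n t)^2 - C^2"
   by simp
  moreover have "integral {a..t} (%x. ?H n x * trig g n x) = ip (%x. ?H n x * trig g n x) ?i"
   using t by (intro integral_eq_ip continuous_L2 cH) auto
  moreover have "ip (%x. ?H n x * trig g n x) ?i = ip (%x. ?H n x * ?i x) (trig g n)"
   unfolding ip_def by (intro Bochner_Integration.integral_cong) auto
  ultimately show ?thesis by simp
 qed
 ultimately show "(%n. (?H n t)^2) \<longlonglongrightarrow> C^2 + 2 * ip (%x. (C + prim g x) * ?i x) g" by simp
qed

lemma continuous_AE_eq:
 assumes f: "continuous_on {a..b} f" and g: "continuous_on {a..b} g"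
  and eq: "AE x in M. f x = (g x :: real)" and x: "x \<in> {a..b}"
 shows "f x = g x"
proof -
 have op: "f y = g y" if y: "y \<in> I" for y
 proof (rule ccontr)
  assume ne: "f y \<noteq> g y"
  have "continuous_on I (%x. f x - g x)"
   by (intro continuous_intros continuous_on_subset[OF f] continuous_on_subset[OF g]) auto
  then have "open (I \<inter> (%x. f x - g x) -` (- {0}))"
   by (intro continuous_open_preimage) auto
  moreover have "y \<in> I \<inter> (%x. f x - g x) -` (- {0})" using ne y by simp
  ultimately obtain d where d: "0 < d" "ball y d \<subseteq> I \<inter> (%x. f x - g x) -` (- {0})"
   unfolding open_contains_ball by blast
  have "AE x in lebesgue. x \<notin> ball y d"
  proof -
   have "AE x in lebesgue. x \<in> I --> f x = g x" using eq by (simp add: AE_restrict_space_iff)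
   then show ?thesis by eventually_elim (use d in auto)
  qed
  then have "ball y d \<in> null_sets lebesgue" by (subst AE_iff_null_sets) auto
  then have "emeasure lebesgue (ball y d) = 0" by (rule null_setsD1)
  moreover have "ball y d = {y - d<..<y + d}" by (auto simp: dist_real_def)
  ultimately show False using d(1) by simp
 qed
 have "{a..b} = closure I" using a_less_b by simp
 moreover have "closed {z \<in> {a..b}. f z - g z = 0}"
  by (intro continuous_closed_preimage_constant continuous_intros f g)
 ultimately have "closure I \<subseteq> {z \<in> {a..b}. f z - g z = 0}"
  using op by (intro closure_minimal) auto
 then show ?thesis using x \<open>{a..b} = closure I\<close> by auto
qed

text \<open>Integration by parts against the two systems: sines vanish at the end points, so no boundary
 condition is needed in the first case.\<close>

lemma weak_deriv_sine_coef:
 assumes "has_weak_deriv I 1 f g" and f: "f \<in> L2" and g: "g \<in> L2"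
 shows "ip g (s k) = - w k * ip f (e k)"
proof -
 obtain C where C: "AE x in M. f x = C + prim g x"
  by (rule weak_deriv_imp_primitive[OF assms])
 have "ip g (s k) = - ip (%x. C + prim g x) (%x. w k * e k x)"
  using integration_by_parts_prim[OF g s_DERIV, of "k" C] by (simp add: continuous_intros e_cont)
 also have "ip (%x. C + prim g x) (%x. w k * e k x) = ip f (%x. w k * e k x)"
  by (rule ip_cong_AE[symmetric, OF C f]) (auto intro: L2_scale)
 also have "\<dots> = w k * ip f (e k)"
  by (subst (1 2) ip_commute) (rule ip_scale_left)
 finally show ?thesis by simp
qed

lemma weak_deriv_cosine_coef:
 assumes "has_weak_deriv I 1 f g" and f: "f \<in> L2" and g: "g \<in> L2"
  and tr: "has_trace a b f a 0" "has_trace a b f b 0"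
 shows "ip g (e k) = w k * ip f (s k)"
proof -
 obtain C where C: "AE x in M. f x = C + prim g x"
  by (rule weak_deriv_imp_primitive[OF assms(1-3)])
 have c: "continuous_on {a..b} (%x. C + prim g x)"
  by (intro continuous_intros prim_cont g)
 have zero: "C + prim g x = 0" if "has_trace a b f x 0" "x \<in> {a..b}" for x
 proof -
  obtain h where h: "continuous_on {a..b} h" "AE t in M. f t = h t" "h x = 0"
   using \<open>has_trace a b f x 0\<close> by (auto simp: has_trace_def)
  have "AE t in M. C + prim g t = h t" using C h(2) by eventually_elim simp
  from continuous_AE_eq[OF c h(1) this that(2)] h(3) show ?thesis by simp
 qed
 have Ca: "C = 0" using zero[OF tr(1)] a_less_b by simp
 have Cb: "C + prim g b = 0" using zero[OF tr(2)] a_less_b by simp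
 have "ip g (e k) = - ip (%x. C + prim g x) (%x. - w k * s k x)"
  using integration_by_parts_prim[OF g e_DERIV, of "k" C] Ca Cb by (simp add: continuous_intros s_cont)
 also have "ip (%x. C + prim g x) (%x. - w k * s k x) = ip f (%x. - w k * s k x)"
  by (rule ip_cong_AE[symmetric, OF C f]) (simp, rule L2_scale, simp)
 also have "\<dots> = - w k * ip f (s k)"
  by (subst (1 2) ip_commute) (rule ip_scale_left)
 finally show ?thesis by simp
qed

lemma H_spaceD:
 assumes "f \<in> H_space m I" "j <= m"
 shows "has_weak_deriv I j f (weak_deriv I j f)" "weak_deriv I j f \<in> L2"
 using assms weak_deriv_spec weak_deriv_L2 by (auto simp: H_space_def)

lemma H_space_L2: "f \<in> H_space m I ==> f \<in> L2"
 by (simp add: H_space_def)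

lemma H_space_step:
 assumes "f \<in> H_space m I" "Suc j <= m"
 shows "has_weak_deriv I 1 (weak_deriv I j f) (weak_deriv I (Suc j) f)"
 by (rule has_weak_deriv_step[OF H_spaceD(1)[OF assms(1)] H_spaceD(1)[OF assms]])
   (use assms(2) in simp)

lemma weak_deriv_0_AE: "f \<in> L2 ==> AE x in M. weak_deriv I 0 f x = f x"
 by (rule weak_deriv_eq_AE[OF has_weak_deriv_0])

text \<open>Integrating by parts twice, against a cosine and then against a sine: the boundary term of the first
 step vanishes because \<open>f\<^sub>x\<close> has trace zero, that of the second because the sine does.\<close>

lemma Neumann_coef_2:
 assumes f: "f \<in> H_space m I" "2 <= m" and tr: "\<forall>x\<in>{a, b}. has_trace a b (weak_deriv I 1 f) x 0"
 shows "ip (weak_deriv I 2 f) (e k) = - (w k)\<^sup>2 * ip f (e k)"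
proof -
 have fL: "f \<in> L2" by (rule H_space_L2[OF f(1)])
 have L: "weak_deriv I j f \<in> L2" if "j <= 2" for j using that f by (auto intro: H_spaceD)
 have "ip (weak_deriv I 2 f) (e k) = w k * ip (weak_deriv I 1 f) (s k)"
  using H_space_step[OF f(1), of 1] f(2) tr L
  by (intro weak_deriv_cosine_coef) (auto simp: numeral_2_eq_2)
 also have "ip (weak_deriv I 1 f) (s k) = - w k * ip f (e k)"
  using H_spaceD[OF f(1), of 1] f(2) by (intro weak_deriv_sine_coef fL) auto
 finally show ?thesis by (simp add: power2_eq_square)
qed

text \<open>The same computation applied to the second derivative, whose own derivative has trace zero.\<close>

lemma Neumann_coef_4:
 assumes f: "f \<in> H_space 4 I"
  and tr: "\<forall>x\<in>{a, b}. has_trace a b (weak_deriv I 1 f) x 0 \<and> has_trace a b (weak_deriv I 3 f) x 0"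
 shows "ip (weak_deriv I 4 f) (e k) = w k ^ 4 * ip f (e k)"
proof -
 have L: "weak_deriv I j f \<in> L2" if "j <= 4" for j using that f by (auto intro: H_spaceD)
 have "ip (weak_deriv I 4 f) (e k) = w k * ip (weak_deriv I 3 f) (s k)"
  using H_space_step[OF f, of 3] tr L
  by (intro weak_deriv_cosine_coef) (auto simp: eval_nat_numeral)
 also have "ip (weak_deriv I 3 f) (s k) = - w k * ip (weak_deriv I 2 f) (e k)"
  using H_space_step[OF f, of 2] L
  by (intro weak_deriv_sine_coef) (auto simp: eval_nat_numeral)
 also have "ip (weak_deriv I 2 f) (e k) = - (w k)\<^sup>2 * ip f (e k)"
  using tr by (intro Neumann_coef_2[OF f]) auto
 finally show ?thesis by (simp add: power2_eq_square power4_eq_xxxx)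
qed

lemma L2_norm_le_H_norm:
 assumes "j <= m"
 shows "nrm (weak_deriv I j f) <= H_norm m I f"
 unfolding H_norm_def using assms
 by (intro real_le_rsqrt member_le_sum) auto

text \<open>A test function vanishes at the ends, so its derivative has mean zero, and the mean is continuous in
 the norm of \<open>H\<^sup>1\<close>.\<close>

lemma H10_mean_zero:
 assumes "u \<in> H10_space I"
 shows "ip (weak_deriv I 1 u) (e 0) = 0"
proof -
 obtain \<phi> where u: "u \<in> H_space 1 I" and \<phi>: "\<And>n. test_function I (\<phi> n)"
  and lim: "(%n. H_norm 1 I (%x. u x - \<phi> n x)) \<longlonglongrightarrow> 0"
  using assms by (auto simp: H10_space_def)
 let ?u = "weak_deriv I 1 u"
 have uL: "?u \<in> L2" and wu: "has_weak_deriv I 1 u ?u" and u0: "u \<in> L2"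
  using H_spaceD[OF u, of 1] H_space_L2[OF u] by auto
 have dL: "deriv (\<phi> n) \<in> L2" for n by (intro test_L2 test_deriv \<phi>)
 have wd: "has_weak_deriv I 1 (%x. u x - \<phi> n x) (%x. ?u x - deriv (\<phi> n) x)" for n
  by (rule has_weak_deriv_diff[OF wu test_weak_deriv[OF \<phi>] u0 uL test_L2[OF \<phi>] dL])
 have "\<bar>ip ?u (e 0)\<bar> <= H_norm 1 I (%x. u x - \<phi> n x)" for n
 proof -
  have "ip (deriv (\<phi> n)) (e 0) = 0"
  proof -
   have "ip (deriv (\<phi> n)) (e 0) = 1 / sqrt (b - a) * (\<integral>x. deriv (\<phi> n) x \<partial>M)"
    by (simp add: ip_def e_0 mult.commute)
   also have "(\<integral>x. deriv (\<phi> n) x \<partial>M) = \<phi> n b - \<phi> n a"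
    by (rule FTC_M[OF smooth_DERIV_within[OF test_smooth[OF \<phi>]]
      smooth_continuous[OF smooth_deriv[OF test_smooth[OF \<phi>]]]])
   finally show ?thesis using test_boundary[OF \<phi>, of n] by simp
  qed
  then have eq: "ip ?u (e 0) = ip (%x. ?u x - deriv (\<phi> n) x) (e 0)"
   using ip_diff_left[OF uL dL e_L2, of n 0] by simp
  have "\<bar>ip ?u (e 0)\<bar> <= nrm (%x. ?u x - deriv (\<phi> n) x) * nrm (e 0)"
   unfolding eq by (rule Cauchy_Schwarz_ip[OF L2_diff[OF uL dL] e_L2])
  moreover have "nrm (%x. ?u x - deriv (\<phi> n) x) = nrm (weak_deriv I 1 (%x. u x - \<phi> n x))"
   by (rule nrm_cong_AE[symmetric, OF weak_deriv_eq_AE[OF wd] weak_deriv_L2[OF wd L2_diff[OF uL dL]]])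
  ultimately have "\<bar>ip ?u (e 0)\<bar> <= nrm (weak_deriv I 1 (%x. u x - \<phi> n x))"
   by (simp only: nrm_e mult_1_right)
  then show ?thesis using L2_norm_le_H_norm[of 1 1 "%x. u x - \<phi> n x"] by simp
 qed
 then have "\<bar>ip ?u (e 0)\<bar> <= 0" by (intro LIMSEQ_le_const[OF lim]) auto
 then show ?thesis by simp
qed

text \<open>Test functions are dense in \<open>L\<^sup>2\<close>: cosine sums are multiplied with bumps that tend to \<open>1\<close>.\<close>

lemma test_dense:
 assumes v: "v \<in> L2" and d: "0 < d"
 obtains \<psi> where "test_function I \<psi>" "nrm (%x. \<psi> x - v x) < d"
proof -
 have "\<forall>\<^sub>F n in sequentially. nrm (%x. trig v n x - v x) < d / 2"
  using psum_coef_tendsto[OF v] d by (intro order_tendstoD(2)) auto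
 then obtain N where N: "nrm (%x. trig v N x - v x) < d / 2"
  unfolding eventually_sequentially by blast
 define P where "P = trig v N"
 have P: "P \<in> L2" unfolding P_def by (rule trig_L2)
 have sP: "smooth P"
 proof -
  have "smooth (%x. \<Sum>k<n. c k * e k x)" for n c
   by (induction n) (simp_all add: smooth_const smooth_add smooth_cmult smooth_e)
  then show ?thesis by (simp add: P_def psum_def[abs_def])
 qed
 define \<delta> where "\<delta> n = (b - a) / (2 * real (Suc n))" for n
 define \<eta> where "\<eta> n = bump (a + \<delta> n) (b - \<delta> n) n" for n
 have \<delta>: "0 < \<delta> n" for n using a_less_b by (simp add: \<delta>_def)
 have t: "test_function I (%x. P x * \<eta> n x)" for n
  unfolding \<eta>_def by (intro test_mult[OF sP] test_bump) (use \<delta>[of n] in auto)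
 have flat_lim: "(%n. flat 1 (real (Suc n) * (y - \<delta> n))) \<longlonglongrightarrow> 1" if y: "0 < y" for y
 proof -
  have eq: "real (Suc n) * (y - \<delta> n) = real (Suc n) * y - (b - a) / 2" for n
  proof -
   have "real (Suc n) * \<delta> n = (b - a) / 2" by (simp add: \<delta>_def del: of_nat_Suc)
   then show ?thesis by (simp add: right_diff_distrib)
  qed
  have "filterlim (%n. - ((b - a) / 2) + real (Suc n) * y) at_top sequentially"
   using y by (intro filterlim_tendsto_add_at_top[OF tendsto_const] filterlim_at_top_mult_tendsto_pos[OF tendsto_const]
     filterlim_compose[OF filterlim_real_sequentially filterlim_Suc])
  then have top: "filterlim (%n. real (Suc n) * (y - \<delta> n)) at_top sequentially"
   unfolding eq by (simp add: algebra_simps)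
  have "((%z::real. exp (- (1 / z))) \<longlongrightarrow> exp (- 0)) at_top"
   by (intro tendsto_intros tendsto_divide_0[OF tendsto_const] filterlim_at_top_imp_at_infinity filterlim_ident)
  from filterlim_compose[OF this top]
  have "(%n. exp (- (1 / (real (Suc n) * (y - \<delta> n))))) \<longlonglongrightarrow> 1" by simp
  moreover have "\<forall>\<^sub>F n in sequentially. exp (- (1 / (real (Suc n) * (y - \<delta> n)))) = flat 1 (real (Suc n) * (y - \<delta> n))"
   using filterlim_at_top_dense[THEN iffD1, OF top, rule_format, of 0]
   by eventually_elim (simp add: flat_1)
  ultimately show ?thesis by (rule Lim_transform_eventually)
 qed
 have \<eta>lim: "(%n. \<eta> n x) \<longlonglongrightarrow> 1" if "x \<in> I" for x
 proof -
  have "(%n. flat 1 (real (Suc n) * ((x - a) - \<delta> n)) * flat 1 (real (Suc n) * ((b - x) - \<delta> n))) \<longlonglongrightarrow> 1 * 1"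
   using that by (intro tendsto_mult flat_lim) auto
  moreover have "\<eta> n x = flat 1 (real (Suc n) * ((x - a) - \<delta> n)) * flat 1 (real (Suc n) * ((b - x) - \<delta> n))" for n
  proof -
   have "x - (a + \<delta> n) = (x - a) - \<delta> n" "b - \<delta> n - x = (b - x) - \<delta> n" by auto
   then show ?thesis unfolding \<eta>_def bump_def by (simp only:)
  qed
  ultimately show ?thesis by simp
 qed
 have "(%n. \<integral>x. (P x * \<eta> n x - P x)^2 \<partial>M) \<longlonglongrightarrow> (\<integral>x. 0 \<partial>M)"
 proof (rule integral_dominated_convergence[where w = "%x. (P x)^2"])
  show "integrable M (%x. (P x)^2)" by (rule L2_sq[OF P])
  show "(%x. (P x * \<eta> n x - P x)^2) \<in> borel_measurable M" for n
   using L2_sq[OF L2_diff[OF test_L2[OF t] P]] by (rule borel_measurable_integrable)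
  have "(%n. (P x * \<eta> n x - P x)^2) \<longlonglongrightarrow> 0" if "x \<in> I" for x
  proof -
   have "(%n. (P x * \<eta> n x - P x)^2) \<longlonglongrightarrow> (P x * 1 - P x)^2"
    by (intro tendsto_intros \<eta>lim that)
   then show ?thesis by simp
  qed
  then show "AE x in M. (%n. (P x * \<eta> n x - P x)^2) \<longlonglongrightarrow> 0" by (intro AE_I2) simp
  have "\<bar>P x * \<eta> n x - P x\<bar> <= \<bar>P x\<bar>" for n x
  proof -
   have "P x * \<eta> n x - P x = P x * (\<eta> n x - 1)" by (simp add: right_diff_distrib)
   moreover have "\<bar>\<eta> n x - 1\<bar> <= 1" using bump_bounds[of "a + \<delta> n" "b - \<delta> n" n x] by (auto simp: \<eta>_def)
   ultimately show ?thesis by (simp add: abs_mult mult_left_le)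
  qed
  then show "AE x in M. norm ((P x * \<eta> n x - P x)^2) <= (P x)^2" for n
   by (intro AE_I2) (simp add: abs_le_square_iff)
 qed simp
 then have "(%n. nrm (%x. P x * \<eta> n x - P x)) \<longlonglongrightarrow> 0"
  unfolding L2_norm_def using tendsto_real_sqrt by fastforce
 from order_tendstoD(2)[OF this, of "d / 2"] d
 obtain n where n: "nrm (%x. P x * \<eta> n x - P x) < d / 2"
  unfolding eventually_sequentially by auto
 show thesis
 proof (rule that[OF t[of n]])
  show "nrm (%x. P x * \<eta> n x - v x) < d"
   using nrm_triangle_diff[OF test_L2[OF t] P v, of n] n N by (simp add: P_def)
 qed
qed

lemma sine_series_H1:
 assumes c1: "hs 1 c" and u: "u \<in> L2" "AE x in M. u x = ser s c x"
 shows "u \<in> H_space 1 I" "AE x in M. weak_deriv I 1 u x = ser e (%k. w k * c k) x"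
  "(H_norm 1 I u)^2 = (\<Sum>k. (c k)^2 * nu_s k + (w k * c k)^2)"
proof -
 have c0: "summable (%k. (c k)^2)" and c1': "summable (%k. (w k * c k)^2)"
  using hs_0[OF c1] c1 by (auto simp: hs_def)
 have L: "ser s c \<in> L2" "ser e (%k. w k * c k) \<in> L2"
  by (auto intro: ser_L2_limit(1)[OF ons_s c0] ser_L2_limit(1)[OF ons_e c1'])
 have sym: "AE x in M. ser s c x = u x" using u(2) by eventually_elim simp
 have wd: "has_weak_deriv I 1 u (ser e (%k. w k * c k))"
  by (rule has_weak_deriv_cong_AE[OF ser_s_weak_deriv[OF c0 c1'] L sym]) simp
 show ae: "AE x in M. weak_deriv I 1 u x = ser e (%k. w k * c k) x" by (rule weak_deriv_eq_AE[OF wd])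
 have 0: "has_weak_deriv I 0 u u" by (rule has_weak_deriv_0[OF u(1)])
 show "u \<in> H_space 1 I"
  using u(1) wd 0 L(2) by (auto simp: H_space_def le_Suc_eq)
 have "nrm (weak_deriv I 0 u) = nrm (ser s c)"
  using nrm_cong_AE[OF weak_deriv_0_AE[OF u(1)] weak_deriv_L2[OF 0 u(1)]] nrm_cong_AE[OF u(2,1)] by simp
 then have n0: "(nrm (weak_deriv I 0 u))^2 = (\<Sum>k. (c k)^2 * nu_s k)"
  using nrm_ser_sums[OF ons_s c0] by (simp add: sums_iff)
 have n1: "(nrm (weak_deriv I 1 u))^2 = (\<Sum>k. (w k * c k)^2)"
  using nrm_cong_AE[OF ae weak_deriv_L2[OF wd L(2)]] nrm_ser_sums[OF ons_e c1'] by (simp add: sums_iff)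
 have "(H_norm 1 I u)^2 = (nrm (weak_deriv I 0 u))^2 + (nrm (weak_deriv I 1 u))^2"
  by (simp add: H_norm_def atMost_Suc)
 also have "\<dots> = (\<Sum>k. (c k)^2 * nu_s k + (w k * c k)^2)"
  unfolding n0 n1 by (rule suminf_add[OF sums_summable[OF nrm_ser_sums[OF ons_s c0]] c1'])
 finally show "(H_norm 1 I u)^2 = (\<Sum>k. (c k)^2 * nu_s k + (w k * c k)^2)" .
qed

lemma sine_series_prim:
 assumes c1: "hs 1 c" and x: "x \<in> {a..b}"
 shows "ser s c x = prim (ser e (%k. w k * c k)) x"
proof -
 have c0: "summable (%k. (c k)^2)" and c1': "summable (%k. (w k * c k)^2)"
  using hs_0[OF c1] c1 by (auto simp: hs_def)
 have ab: "summable (%k. \<bar>c k\<bar>)" using hs_abs[OF c1, of 0] by simp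
 let ?v = "ser e (%k. w k * c k)"
 have v: "?v \<in> L2" by (rule ser_L2_limit(1)[OF ons_e c1'])
 obtain C where C: "AE t in M. ser s c t = C + prim ?v t"
  by (rule weak_deriv_imp_primitive[OF ser_s_weak_deriv[OF c0 c1'] ser_L2_limit(1)[OF ons_s c0] v])
 have eq: "ser s c t = C + prim ?v t" if "t \<in> {a..b}" for t
  by (rule continuous_AE_eq[OF ser_cont[OF ons_s ab] _ C that]) (intro continuous_intros prim_cont v)
 have "ser s c a = 0" using ab by (simp add: ser_def)
 then have "C = 0" using eq[of a] a_less_b by simp
 then show ?thesis using eq[OF x] by simp
qed

text \<open>The derivative \<open>v\<close> has mean zero.  A test function close to \<open>v\<close>, corrected by a multiple of a unit test
 function to have mean zero as well, is the derivative of a test function that is close to the series in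
 \<open>H\<^sup>1\<close>.\<close>

lemma sine_series_H10:
 assumes c1: "hs 1 c" and u: "u \<in> L2" "AE x in M. u x = ser s c x"
 shows "u \<in> H10_space I"
proof -
 have c0: "summable (%k. (c k)^2)" and c1': "summable (%k. (w k * c k)^2)"
  using hs_0[OF c1] c1 by (auto simp: hs_def)
 let ?v = "ser e (%k. w k * c k)"
 have v: "?v \<in> L2" by (rule ser_L2_limit(1)[OF ons_e c1'])
 have mv: "(\<integral>x. ?v x \<partial>M) = 0"
 proof -
  have "ip ?v (e 0) = 0" unfolding ip_ser_basis[OF ons_e c1'] by simp
  then show ?thesis using a_less_b by (simp add: ip_def e_0)
 qed
 obtain \<rho> where \<rho>: "test_function I \<rho>" "(\<integral>x. \<rho> x \<partial>M) = 1" by (rule unit_test_function)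
 have "\<exists>\<phi>. test_function I \<phi> \<and> H_norm 1 I (%x. u x - \<phi> x) <= d" if d: "0 < d" for d
 proof -
  define K where "K = (1 + sqrt (b - a) * nrm \<rho>) * (1 + (b - a))"
  have K: "0 < K" unfolding K_def using a_less_b
   by (intro mult_pos_pos add_pos_nonneg mult_nonneg_nonneg) auto
  have "0 < d / K" using d K by simp
  then obtain \<psi> where \<psi>: "test_function I \<psi>" "nrm (%x. \<psi> x - ?v x) < d / K"
   by (rule test_dense[OF v])
  define m where "m = (\<integral>x. \<psi> x \<partial>M)"
  have m: "\<bar>m\<bar> <= sqrt (b - a) * nrm (%x. \<psi> x - ?v x)"
  proof -
   have eq: "m = (\<integral>x. \<psi> x - ?v x \<partial>M)"
    using L2_integrable[OF test_L2[OF \<psi>(1)]] L2_integrable[OF v] mv by (simp add: m_def)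
   have "\<bar>m\<bar> <= (\<integral>x. \<bar>\<psi> x - ?v x\<bar> \<partial>M)" unfolding eq by (rule integral_abs_bound)
   also have "\<dots> <= sqrt (b - a) * nrm (%x. \<psi> x - ?v x)"
    by (rule integral_abs_le_nrm[OF L2_diff[OF test_L2[OF \<psi>(1)] v]])
   finally show ?thesis .
  qed
  have t: "test_function I (%x. \<psi> x + (- m) * \<rho> x)"
   by (intro test_add test_cmult \<psi> \<rho>)
  have "(\<integral>x. \<psi> x + (- m) * \<rho> x \<partial>M) = 0"
   using L2_integrable[OF test_L2[OF \<psi>(1)]] L2_integrable[OF test_L2[OF \<rho>(1)]] \<rho>(2)
   by (simp add: m_def)
  then obtain \<phi> where \<phi>: "test_function I \<phi>" "deriv \<phi> = (%x. \<psi> x + (- m) * \<rho> x)"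
   by (rule test_antiderivative[OF t])
  have dL: "deriv \<phi> \<in> L2" unfolding \<phi>(2) by (rule test_L2[OF t])
  define N where "N = nrm (%x. deriv \<phi> x - ?v x)"
  have N: "N <= (1 + sqrt (b - a) * nrm \<rho>) * nrm (%x. \<psi> x - ?v x)"
  proof -
   have "N = nrm (%x. (\<psi> x - ?v x) + (- m) * \<rho> x)"
    unfolding N_def \<phi>(2) by (simp add: algebra_simps)
   also have "\<dots> <= nrm (%x. \<psi> x - ?v x) + nrm (%x. (- m) * \<rho> x)"
    by (rule nrm_triangle[OF L2_diff[OF test_L2[OF \<psi>(1)] v] test_L2[OF test_cmult[OF \<rho>(1)]]])
   also have "nrm (%x. (- m) * \<rho> x) = \<bar>m\<bar> * nrm \<rho>" unfolding nrm_scale by simp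
   also have "\<bar>m\<bar> * nrm \<rho> <= (sqrt (b - a) * nrm (%x. \<psi> x - ?v x)) * nrm \<rho>"
    by (intro mult_right_mono m) simp
   finally show ?thesis by (simp add: algebra_simps)
  qed
  have \<phi>p: "\<phi> x = prim (deriv \<phi>) x" if x: "x \<in> {a..b}" for x
  proof -
   have "(deriv \<phi> has_integral \<phi> x - \<phi> a) {a..x}"
    using x by (intro fundamental_theorem_of_calculus)
     (auto simp: has_real_derivative_iff_has_vector_derivative[symmetric]
      intro: smooth_DERIV_within test_smooth \<phi>(1))
   then show ?thesis using test_boundary[OF \<phi>(1)] by (simp add: prim_def integral_unique)
  qed
  have near: "\<bar>ser s c x - \<phi> x\<bar> <= sqrt (b - a) * N" if "x \<in> {a..b}" for x
   using prim_near[OF v dL that] sine_series_prim[OF c1 that] \<phi>p[OF that]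
   by (simp add: N_def nrm_diff_commute[of ?v])
  have wd: "has_weak_deriv I 1 (%x. u x - \<phi> x) (%x. ?v x - deriv \<phi> x)"
  proof -
   have "has_weak_deriv I 1 u ?v"
    by (rule has_weak_deriv_cong_AE[OF ser_s_weak_deriv[OF c0 c1'] ser_L2_limit(1)[OF ons_s c0] v])
      (use u(2) in \<open>eventually_elim, simp\<close>, simp)
   from has_weak_deriv_diff[OF this test_weak_deriv[OF \<phi>(1)] u(1) v test_L2[OF \<phi>(1)] dL]
   show ?thesis .
  qed
  have uL: "(%x. u x - \<phi> x) \<in> L2" by (intro L2_diff u(1) test_L2 \<phi>(1))
  have N0: "0 <= N" by (simp add: N_def)
  have "nrm (weak_deriv I 0 (%x. u x - \<phi> x)) = nrm (%x. u x - \<phi> x)"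
   by (rule nrm_cong_AE[OF weak_deriv_0_AE[OF uL] weak_deriv_L2[OF has_weak_deriv_0[OF uL] uL]])
  also have "\<dots> <= nrm (%x. sqrt (b - a) * N)"
  proof (rule nrm_mono[OF uL L2_const])
   have "AE x in M. x \<in> I" by (intro AE_I2) simp
   then show "AE x in M. \<bar>u x - \<phi> x\<bar> <= \<bar>sqrt (b - a) * N\<bar>"
    using u(2)
   proof eventually_elim
    case (elim x)
    then show ?case using near[of x] by simp
   qed
  qed
  also have "\<dots> = (b - a) * N" unfolding nrm_const using N0 a_less_b by simp
  finally have 0: "nrm (weak_deriv I 0 (%x. u x - \<phi> x)) <= (b - a) * N" .
  have 1: "nrm (weak_deriv I 1 (%x. u x - \<phi> x)) = N"
   using nrm_cong_AE[OF weak_deriv_eq_AE[OF wd] weak_deriv_L2[OF wd L2_diff[OF v dL]]]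
   by (simp add: N_def nrm_diff_commute[of ?v])
  have "H_norm 1 I (%x. u x - \<phi> x) = sqrt ((nrm (weak_deriv I 0 (%x. u x - \<phi> x)))^2 + N^2)"
   using 1 by (simp add: H_norm_def atMost_Suc)
  also have "\<dots> <= nrm (weak_deriv I 0 (%x. u x - \<phi> x)) + N"
   using N0 by (intro sqrt_sum_squares_le_sum) auto
  also have "\<dots> <= N * (1 + (b - a))" using 0 by (simp add: algebra_simps)
  also have "\<dots> <= ((1 + sqrt (b - a) * nrm \<rho>) * nrm (%x. \<psi> x - ?v x)) * (1 + (b - a))"
   using a_less_b by (intro mult_right_mono N) auto
  also have "\<dots> = K * nrm (%x. \<psi> x - ?v x)" by (simp add: K_def)
  also have "\<dots> <= K * (d / K)" using K \<psi>(2) by (intro mult_left_mono) auto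
  also have "\<dots> = d" using K by simp
  finally show ?thesis using \<phi>(1) by blast
 qed
 then have "\<forall>n. \<exists>\<phi>. test_function I \<phi> \<and> H_norm 1 I (%x. u x - \<phi> x) <= inverse (real (Suc n))" by simp
 from choice[OF this] obtain \<phi>
  where \<phi>: "\<forall>n. test_function I (\<phi> n) \<and> H_norm 1 I (%x. u x - \<phi> n x) <= inverse (real (Suc n))" ..
 have "(%n. H_norm 1 I (%x. u x - \<phi> n x)) \<longlonglongrightarrow> 0"
 proof (rule Lim_null_comparison[OF _ LIMSEQ_inverse_real_of_nat])
  have "0 <= H_norm 1 I f" for f unfolding H_norm_def by (intro real_sqrt_ge_zero sum_nonneg) simp
  then show "\<forall>\<^sub>F n in sequentially. norm (H_norm 1 I (%x. u x - \<phi> n x)) <= inverse (real (Suc n))"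
   using \<phi> by simp
 qed
 then show ?thesis using \<phi> sine_series_H1(1)[OF assms] by (auto simp: H10_space_def)
qed

end

section \<open>Bochner spaces in terms of coefficient functions\<close>

lemma integral_of_simple_function:
 fixes g :: "'b => real"
 assumes "finite_measure Q" and s: "simple_function Q s"
 shows "integrable Q (%t. g (s t))"
  "(\<integral>t. g (s t) \<partial>Q) = (\<Sum>v\<in>s ` space Q. measure Q {t \<in> space Q. s t = v} * g v)"
proof -
 interpret finite_measure Q by fact
 have fin: "finite (s ` space Q)" by (rule simple_functionD(1)[OF s])
 have sets: "{t \<in> space Q. s t = v} \<in> sets Q" for v
 proof -
  have "s -` {v} \<inter> space Q \<in> sets Q" by (rule simple_functionD(2)[OF s])
  also have "s -` {v} \<inter> space Q = {t \<in> space Q. s t = v}" by auto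
  finally show ?thesis .
 qed
 have eq: "g (s t) = (\<Sum>v\<in>s ` space Q. g v * indicator {t \<in> space Q. s t = v} t)" if "t \<in> space Q" for t
 proof -
  have "(\<Sum>v\<in>s ` space Q. g v * indicator {t \<in> space Q. s t = v} t) = (\<Sum>v\<in>s ` space Q. if v = s t then g v else 0)"
   using that by (intro sum.cong) (auto simp: indicator_def)
  then show ?thesis using that fin by simp
 qed
 have ii: "integrable Q (%t. g v * indicator {t \<in> space Q. s t = v} t)" for v
  using sets[of v] by (intro integrable_mult_right) (simp add: less_top[symmetric])
 have "integrable Q (%t. \<Sum>v\<in>s ` space Q. g v * indicator {t \<in> space Q. s t = v} t)"
  by (intro Bochner_Integration.integrable_sum ii)
 then show "integrable Q (%t. g (s t))"
  by (subst Bochner_Integration.integrable_cong[OF refl eq])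
 have "(\<integral>t. g (s t) \<partial>Q) = (\<integral>t. (\<Sum>v\<in>s ` space Q. g v * indicator {t \<in> space Q. s t = v} t) \<partial>Q)"
  by (intro Bochner_Integration.integral_cong refl eq)
 also have "\<dots> = (\<Sum>v\<in>s ` space Q. \<integral>t. g v * indicator {t \<in> space Q. s t = v} t \<partial>Q)"
  by (rule Bochner_Integration.integral_sum[OF ii])
 also have "\<dots> = (\<Sum>v\<in>s ` space Q. measure Q {t \<in> space Q. s t = v} * g v)"
  using sets by (intro sum.cong refl) (simp add: mult.commute)
 finally show "(\<integral>t. g (s t) \<partial>Q) = (\<Sum>v\<in>s ` space Q. measure Q {t \<in> space Q. s t = v} * g v)" .
qed

text \<open>Rounding to a finite grid turns coefficient functions into simple functions.\<close>

definition rnd :: "real => real => real => real" where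
 "rnd n m z = (if \<bar>z\<bar> <= n then real_of_int \<lfloor>z * m\<rfloor> / m else 0)"

lemma rnd_close: "0 < m ==> \<bar>z\<bar> <= n ==> \<bar>rnd n m z - z\<bar> <= 1 / m"
proof -
 assume m: "0 < m" and z: "\<bar>z\<bar> <= n"
 have "rnd n m z - z = (real_of_int \<lfloor>z * m\<rfloor> - z * m) / m"
  using m z by (simp add: rnd_def diff_divide_distrib)
 moreover have "\<bar>real_of_int \<lfloor>z * m\<rfloor> - z * m\<bar> <= 1" by linarith
 ultimately show ?thesis using m by (simp add: divide_right_mono)
qed

lemma rnd_near: "0 < m ==> \<bar>rnd n m z - z\<bar> <= 1 / m + \<bar>z\<bar>"
proof (cases "\<bar>z\<bar> <= n")
 case True
 assume "0 < m"
 from rnd_close[OF this True] show ?thesis by simp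
qed (simp add: rnd_def)

lemma rnd_finite: "0 < m ==> finite (range (rnd n m))"
proof (rule finite_subset)
 assume m: "0 < m"
 let ?J = "{\<lfloor>- n * m\<rfloor>..\<lfloor>n * m\<rfloor>}"
 show "range (rnd n m) \<subseteq> insert 0 ((%i. real_of_int i / m) ` ?J)"
 proof
  fix y assume "y \<in> range (rnd n m)"
  then obtain z where y: "y = rnd n m z" by auto
  show "y \<in> insert 0 ((%i. real_of_int i / m) ` ?J)"
  proof (cases "\<bar>z\<bar> <= n")
   case True
   have "- n <= z" "z <= n" using True by linarith+
   then have "z * m <= n * m" "- n * m <= z * m" 
    using m mult_right_mono[of z n m] mult_right_mono[of "- n" z m] by simp_all
   then have "\<lfloor>z * m\<rfloor> \<in> ?J" by (auto intro: floor_mono)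
   then show ?thesis using True y by (auto simp: rnd_def)
  qed (simp add: y rnd_def)
 qed
qed simp

lemma rnd_measurable:
 assumes f: "f \<in> borel_measurable Q"
 shows "(%t. rnd n m (f t)) \<in> borel_measurable Q"
proof -
 have [measurable]: "f \<in> borel_measurable Q" by fact
 show ?thesis unfolding rnd_def by measurable
qed

text \<open>Rounding step for the coefficient functions.  The mesh \<open>1 / ((n + 1) (1 + \<Sum>\<^sub>k\<^sub><\<^sub>n W\<^sub>k))\<close> is so fine that
 the squared rounding errors of the first \<open>n\<close> coefficients, weighted with \<open>W\<close>, sum up to at most \<open>1 / (n + 1)\<close>.\<close>

definition grid :: "(nat => real) => nat => real => real" where
 "grid W n z = rnd (real n) (real (Suc n) * (1 + (\<Sum>k<n. W k))) z"

definition trunc_grid :: "(nat => real) => nat => (nat => real) => nat => real" where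
 "trunc_grid W n c k = (if k < n then grid W n (c k) else 0)"

definition grid_error :: "(nat => real) => nat => (nat => real) => real" where
 "grid_error W n c = (\<Sum>k. W k * (trunc_grid W n c k - c k)^2)"

context
 fixes W :: "nat => real"
 assumes W: "\<And>k. 1 <= W k"
begin

lemma W_sum_nonneg: "0 <= (\<Sum>k<n. W k)"
 by (intro sum_nonneg) (use W in \<open>auto intro: order_trans[of 0 1]\<close>)

lemma grid_scale_pos: "0 < real (Suc n) * (1 + (\<Sum>k<n. W k))"
 using W_sum_nonneg[of n] by (intro mult_pos_pos) auto

lemma W_pos: "0 <= W k" using W[of k] by linarith

lemma grid_weight: "(\<Sum>k<n. W k * (1 / (real (Suc n) * (1 + (\<Sum>k<n. W k))))^2) <= 1 / real (Suc n)"
proof -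
 let ?S = "1 + (\<Sum>k<n. W k)" and ?m = "real (Suc n)"
 have S: "1 <= ?S" using W_sum_nonneg[of n] by simp
 have "(\<Sum>k<n. W k * (1 / (?m * ?S))^2) = (\<Sum>k<n. W k) * (1 / (?m * ?S))^2"
  by (simp add: sum_distrib_right)
 also have "\<dots> <= ?S * (1 / (?m * ?S))^2" by (intro mult_right_mono) auto
 also have "\<dots> = (1 / ?m) * (1 / (?m * ?S))" using S by (simp add: power2_eq_square del: of_nat_Suc)
 also have "\<dots> <= (1 / ?m) * 1"
 proof (rule mult_left_mono)
  have "1 * 1 <= ?m * ?S" using S by (intro mult_mono) auto
  then show "1 / (?m * ?S) <= 1" by (simp add: divide_le_eq_1)
 qed simp
 finally show ?thesis by simp
qed

lemma grid_growth: "\<bar>grid W n z\<bar> <= 2 * \<bar>z\<bar> + 1"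
proof -
 let ?m = "real (Suc n) * (1 + (\<Sum>k<n. W k))"
 have 1: "\<bar>grid W n z - z\<bar> <= 1 / ?m + \<bar>z\<bar>"
  unfolding grid_def by (rule rnd_near[OF grid_scale_pos])
 have "1 * 1 <= ?m"
  using W_sum_nonneg[of n] by (intro mult_mono) auto
 then have "1 / ?m <= 1" by (simp add: divide_le_eq_1)
 with 1 show ?thesis by linarith
qed

lemma grid_error_split:
 assumes c: "summable (%k. W k * (c k)^2)"
 shows "summable (%k. W k * (trunc_grid W n c k - c k)^2)"
  "grid_error W n c = (\<Sum>k<n. W k * (grid W n (c k) - c k)^2) + (\<Sum>k. W (k + n) * (c (k + n))^2)"
proof -
 show s: "summable (%k. W k * (trunc_grid W n c k - c k)^2)"
  by (rule summable_comparison_test'[OF c, of n]) (use W_pos in \<open>simp add: trunc_grid_def\<close>)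
 show "grid_error W n c = (\<Sum>k<n. W k * (grid W n (c k) - c k)^2) + (\<Sum>k. W (k + n) * (c (k + n))^2)"
  unfolding grid_error_def suminf_split_initial_segment[OF s, of n]
  by (simp add: trunc_grid_def)
qed

lemma grid_error_nonneg: "summable (%k. W k * (c k)^2) ==> 0 <= grid_error W n c"
 unfolding grid_error_def by (intro suminf_nonneg grid_error_split(1)) (simp_all add: W_pos)

lemma grid_error_bound:
 assumes c: "summable (%k. W k * (c k)^2)"
 shows "grid_error W n c <= 2 + 2 * (\<Sum>k. W k * (c k)^2)"
proof -
 let ?m = "real (Suc n) * (1 + (\<Sum>k<n. W k))"
 have t: "W k * (grid W n (c k) - c k)^2 <= 2 * (W k * (1 / ?m)^2) + 2 * (W k * (c k)^2)" for k
 proof -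
  have "\<bar>grid W n (c k) - c k\<bar> <= 1 / ?m + \<bar>c k\<bar>"
   unfolding grid_def by (rule rnd_near[OF grid_scale_pos])
  then have "(grid W n (c k) - c k)^2 <= (1 / ?m + \<bar>c k\<bar>)^2"
   by (metis abs_ge_zero power2_abs power_mono)
  also have "\<dots> <= 2 * (1 / ?m)^2 + 2 * (c k)^2"
   using zero_le_power2[of "1 / ?m - \<bar>c k\<bar>"] unfolding power2_sum power2_diff power2_abs by linarith
  finally have "W k * (grid W n (c k) - c k)^2 <= W k * (2 * (1 / ?m)^2 + 2 * (c k)^2)"
   by (rule mult_left_mono[OF _ W_pos])
  then show ?thesis by (simp only: distrib_left mult.left_commute)
 qed
 have "(\<Sum>k<n. W k * (grid W n (c k) - c k)^2) <= (\<Sum>k<n. 2 * (W k * (1 / ?m)^2) + 2 * (W k * (c k)^2))"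
  by (rule sum_mono[OF t])
 also have "\<dots> = 2 * (\<Sum>k<n. W k * (1 / ?m)^2) + 2 * (\<Sum>k<n. W k * (c k)^2)"
  by (simp only: sum.distrib sum_distrib_left)
 also have "\<dots> <= 2 * 1 + 2 * (\<Sum>k<n. W k * (c k)^2)"
 proof -
  have "1 / real (Suc n) <= 1" by simp
  then show ?thesis using grid_weight[of n] by linarith
 qed
 finally have 1: "(\<Sum>k<n. W k * (grid W n (c k) - c k)^2) <= 2 + 2 * (\<Sum>k<n. W k * (c k)^2)" by simp
 have 2: "0 <= (\<Sum>k. W (k + n) * (c (k + n))^2)"
 proof (rule suminf_nonneg)
  show "summable (%k. W (k + n) * (c (k + n))^2)"
   using c summable_iff_shift[of "%k. W k * (c k)^2" n] by blast
  show "0 <= W (k + n) * (c (k + n))^2" for k using W_pos by simp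
 qed
 show ?thesis
  using 1 2 suminf_split_initial_segment[OF c, of n] grid_error_split(2)[OF c, of n] by linarith
qed

text \<open>Eventually a given coefficient is neither truncated nor cut off; what remains is the rounding error and the
 tail of a convergent series.\<close>

lemma grid_error_tendsto:
 assumes c: "summable (%k. W k * (c k)^2)"
 shows "(%n. grid_error W n c) \<longlonglongrightarrow> 0"
proof -
 define S where "S = (\<Sum>k. W k * (c k)^2)"
 have bd: "\<bar>c k\<bar> <= 1 + S" for k
 proof -
  have "(c k)^2 <= W k * (c k)^2" using W[of k] mult_right_mono[of 1 "W k" "(c k)^2"] by simp
  also have "\<dots> = (\<Sum>i\<in>{k}. W i * (c i)^2)" by simp
  also have "\<dots> <= S" unfolding S_def by (intro sum_le_suminf c) (simp_all add: W_pos)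
  finally have "\<bar>c k\<bar>\<^sup>2 <= S" by simp
  moreover have "2 * \<bar>c k\<bar> <= 1 + \<bar>c k\<bar>\<^sup>2"
   using zero_le_power2[of "\<bar>c k\<bar> - 1"] by (simp add: power2_diff)
  ultimately show ?thesis by linarith
 qed
 obtain n0 :: nat where n0: "1 + S <= real n0" using real_arch_simple by blast
 show ?thesis
 proof (rule tendsto_sandwich[of "%_. 0"])
  show "\<forall>\<^sub>F n in sequentially. grid_error W n c <= inverse (real (Suc n)) + (\<Sum>k. W (k + n) * (c (k + n))^2)"
   unfolding eventually_sequentially
  proof (intro exI[of _ n0] allI impI)
   fix n assume n: "n0 <= n"
   let ?m = "real (Suc n) * (1 + (\<Sum>k<n. W k))"
   have "W k * (grid W n (c k) - c k)^2 <= W k * (1 / ?m)^2" for k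
   proof (rule mult_left_mono[OF _ W_pos])
    have "\<bar>c k\<bar> <= real n" using bd[of k] n0 n by linarith
    then have "\<bar>grid W n (c k) - c k\<bar> <= 1 / ?m"
     unfolding grid_def by (rule rnd_close[OF grid_scale_pos])
    then show "(grid W n (c k) - c k)^2 <= (1 / ?m)^2"
     by (metis abs_ge_zero power2_abs power_mono)
   qed
   then have "(\<Sum>k<n. W k * (grid W n (c k) - c k)^2) <= 1 / real (Suc n)"
    by (intro order_trans[OF sum_mono grid_weight])
   then show "grid_error W n c <= inverse (real (Suc n)) + (\<Sum>k. W (k + n) * (c (k + n))^2)"
    unfolding grid_error_split(2)[OF c] by (simp add: inverse_eq_divide)
  qed
  have "(%n. inverse (real (Suc n)) + (\<Sum>k. W (k + n) * (c (k + n))^2)) \<longlonglongrightarrow> 0 + 0"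
  proof (rule tendsto_add[OF LIMSEQ_inverse_real_of_nat])
   show "(%n. \<Sum>k. W (k + n) * (c (k + n))^2) \<longlonglongrightarrow> 0"
    using suminf_exist_split2[OF c] .
  qed
  then show "(%n. inverse (real (Suc n)) + (\<Sum>k. W (k + n) * (c (k + n))^2)) \<longlonglongrightarrow> 0" by simp
 qed (use grid_error_nonneg[OF c] in auto)
qed

lemma simple_grid_sum:
 fixes c :: "nat => 'a => real" and p :: "nat => 'b => real"
 assumes c: "\<And>k. c k \<in> borel_measurable Q"
 shows "simple_function Q (%t x. \<Sum>k<n. grid W N (c k t) * p k x)"
proof (induction n)
 case 0
 then show ?case by (simp add: simple_function_const)
next
 case (Suc n)
 have g: "simple_function Q (%t. grid W N (c n t))"
 proof (rule simple_function_borel_measurable)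
  show "(%t. grid W N (c n t)) \<in> borel_measurable Q"
   unfolding grid_def by (rule rnd_measurable[OF c])
  show "finite ((%t. grid W N (c n t)) ` space Q)"
   by (rule finite_subset[OF _ rnd_finite[OF grid_scale_pos[of N], of "real N"]]) (auto simp: grid_def)
 qed
 have "simple_function Q (%t. (%F z x. F x + z * p n x) (%x. \<Sum>k<n. grid W N (c k t) * p k x) (grid W N (c n t)))"
  by (rule simple_function_compose2[OF Suc g, where h = "%F z x. F x + z * p n x"])
 then show ?case by simp
qed

end

context interval
begin

text \<open>Membership in \<open>L\<^sup>2(0, T; l\<^sup>2)\<close>, written coefficient by coefficient.\<close>

definition L2_family :: "(nat => real => real) => bool" where
 "L2_family g \<longleftrightarrow> (\<forall>k. g k \<in> L2) \<and> summable (%k. \<integral>t. (g k t)^2 \<partial>M)"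

lemma L2_family_AE:
 assumes "L2_family g"
 shows "AE t in M. summable (%k. (g k t)^2)" "integrable M (%t. \<Sum>k. (g k t)^2)"
  "(\<integral>t. (\<Sum>k. (g k t)^2) \<partial>M) = (\<Sum>k. \<integral>t. (g k t)^2 \<partial>M)"
proof -
 have i: "integrable M (%t. (g k t)^2)" for k using assms by (intro L2_sq) (simp add: L2_family_def)
 have s: "summable (%k. \<integral>t. (g k t)^2 \<partial>M)" using assms by (simp add: L2_family_def)
 have "(\<integral>\<^sup>+t. (\<Sum>k. ennreal ((g k t)^2)) \<partial>M) = (\<Sum>k. \<integral>\<^sup>+t. ennreal ((g k t)^2) \<partial>M)"
  using i by (intro nn_integral_suminf) auto
 also have "\<dots> = (\<Sum>k. ennreal (\<integral>t. (g k t)^2 \<partial>M))"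
  by (intro suminf_cong nn_integral_eq_integral i) simp
 finally have eq: "(\<integral>\<^sup>+t. (\<Sum>k. ennreal ((g k t)^2)) \<partial>M) = (\<Sum>k. ennreal (\<integral>t. (g k t)^2 \<partial>M))" .
 have nn: "0 <= (\<integral>t. (g k t)^2 \<partial>M)" for k by (rule Bochner_Integration.integral_nonneg) simp
 have fin: "(\<integral>\<^sup>+t. (\<Sum>k. ennreal ((g k t)^2)) \<partial>M) \<noteq> \<infinity>"
  unfolding eq suminf_ennreal2[OF nn s] by (rule ennreal_neq_top[unfolded infinity_ennreal_def[symmetric]])
 have "(%t. \<Sum>k. ennreal ((g k t)^2)) \<in> borel_measurable M"
  by (intro borel_measurable_suminf_order measurable_compose[OF borel_measurable_integrable[OF i] measurable_ennreal])
 from nn_integral_PInf_AE[OF this fin]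
 show ae: "AE t in M. summable (%k. (g k t)^2)"
 proof eventually_elim
  case (elim t)
  then show ?case by (intro summable_suminf_not_top) auto
 qed
 have ae': "AE t in M. summable (%k. norm ((g k t)^2))" using ae by simp
 have s': "summable (%k. \<integral>t. norm ((g k t)^2) \<partial>M)" using s by simp
 show "integrable M (%t. \<Sum>k. (g k t)^2)" by (rule integrable_suminf[OF i ae' s'])
 show "(\<integral>t. (\<Sum>k. (g k t)^2) \<partial>M) = (\<Sum>k. \<integral>t. (g k t)^2 \<partial>M)" by (rule integral_suminf[OF i ae' s'])
qed

text \<open>Integrating a pointwise bound on the partial sums bounds the sum of the integrals.\<close>

lemma L2_family_of_bound:
 assumes g: "\<And>k. g k \<in> borel_measurable M" and F: "integrable M F"
  and le: "AE t in M. \<forall>n. (\<Sum>k<n. (g k t)^2) <= F t"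
 shows "L2_family g" "(\<Sum>k. \<integral>t. (g k t)^2 \<partial>M) <= integral\<^sup>L M F"
proof -
 have i: "integrable M (%t. (g k t)^2)" for k
 proof (rule Bochner_Integration.integrable_bound[OF F])
  show "(%t. (g k t)^2) \<in> borel_measurable M" using g by simp
  show "AE t in M. norm ((g k t)^2) <= norm (F t)"
   using le
  proof eventually_elim
   case (elim t)
   then have "(\<Sum>k<Suc k. (g k t)^2) <= F t" by blast
   moreover have "0 <= (\<Sum>k<k. (g k t)^2)" by (intro sum_nonneg) simp
   ultimately show ?case by simp
  qed
 qed
 have b: "(\<Sum>k<n. \<integral>t. (g k t)^2 \<partial>M) <= integral\<^sup>L M F" for n
 proof -
  have "(\<Sum>k<n. \<integral>t. (g k t)^2 \<partial>M) = (\<integral>t. (\<Sum>k<n. (g k t)^2) \<partial>M)"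
   using i by (simp add: Bochner_Integration.integral_sum)
  also have "\<dots> <= integral\<^sup>L M F"
  proof (intro integral_mono_AE Bochner_Integration.integrable_sum i F)
   show "AE t in M. (\<Sum>k<n. (g k t)^2) <= F t" using le by eventually_elim blast
  qed
  finally show ?thesis .
 qed
 have s: "summable (%k. \<integral>t. (g k t)^2 \<partial>M)"
  by (rule summableI_nonneg_bounded[OF _ b]) simp
 then show "L2_family g" using i g by (simp add: L2_family_def L2_iff)
 show "(\<Sum>k. \<integral>t. (g k t)^2 \<partial>M) <= integral\<^sup>L M F" by (rule suminf_le_const[OF s b])
qed

lemma L2_family_dominated:
 assumes g: "\<And>k. g k \<in> borel_measurable M" and f: "L2_family f" and h: "L2_family h"
  and le: "AE t in M. \<forall>k. (g k t)^2 <= A * (f k t)^2 + B * (h k t)^2"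
 shows "L2_family g"
proof -
 have iF: "integrable M (%t. (f k t)^2)" and iH: "integrable M (%t. (h k t)^2)" for k
  using f h by (auto simp: L2_family_def intro: L2_sq)
 have i: "integrable M (%t. (g k t)^2)" for k
 proof (rule Bochner_Integration.integrable_bound)
  show "integrable M (%t. A * (f k t)^2 + B * (h k t)^2)" using iF iH by simp
  show "(%t. (g k t)^2) \<in> borel_measurable M" using g by simp
  show "AE t in M. norm ((g k t)^2) <= norm (A * (f k t)^2 + B * (h k t)^2)"
   using le
  proof eventually_elim
   case (elim t)
   then have "(g k t)^2 <= A * (f k t)^2 + B * (h k t)^2" ..
   then show ?case by simp
  qed
 qed
 have "summable (%k. \<integral>t. (g k t)^2 \<partial>M)"
 proof (rule summable_comparison_test'[where N = 0])
  show "summable (%k. A * (\<integral>t. (f k t)^2 \<partial>M) + B * (\<integral>t. (h k t)^2 \<partial>M))"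
   using f h by (intro summable_add summable_mult) (auto simp: L2_family_def)
  fix k
  have "(\<integral>t. (g k t)^2 \<partial>M) <= (\<integral>t. A * (f k t)^2 + B * (h k t)^2 \<partial>M)"
  proof (intro integral_mono_AE i Bochner_Integration.integrable_add integrable_mult_right iF iH)
   show "AE t in M. (g k t)^2 <= A * (f k t)^2 + B * (h k t)^2" using le by eventually_elim blast
  qed
  also have "\<dots> = A * (\<integral>t. (f k t)^2 \<partial>M) + B * (\<integral>t. (h k t)^2 \<partial>M)"
   using iF iH by simp
  finally show "norm (\<integral>t. (g k t)^2 \<partial>M) <= A * (\<integral>t. (f k t)^2 \<partial>M) + B * (\<integral>t. (h k t)^2 \<partial>M)" by simp
 qed
 then show ?thesis using i g by (simp add: L2_family_def L2_iff)
qed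

text \<open>Continuous functionals of simple functions are simple, and almost everywhere limits of measurable
 functions are measurable.  The functional has to be Lipschitz only, which covers the coefficients of
 functions and of their weak derivatives alike.\<close>

lemma strongly_measurable_functional:
 assumes "strongly_measurable M X Nm f"
  and Lf: "\<And>g h. g \<in> X ==> h \<in> X ==> \<bar>Lf g - Lf h\<bar> <= Nm (%x. g x - h x)"
 shows "(%t. Lf (f t)) \<in> borel_measurable M"
proof -
 obtain s where s: "\<And>n. X_simple M X (s n)" and fX: "AE t in M. f t \<in> X"
  and lim: "AE t in M. (%n. Nm (%x. s n t x - f t x)) \<longlonglongrightarrow> 0"
  using assms(1) by (auto simp: strongly_measurable_def)
 have m: "(%t. Lf (s n t)) \<in> borel_measurable M" for n
  using integral_of_simple_function(1)[OF finite_M, of "s n" Lf] s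
  by (auto simp: X_simple_def)
 have sX: "s n t \<in> X" if "t \<in> I" for n t using s[of n] that by (auto simp: X_simple_def)
 have ae: "AE t in M. lim (%n. Lf (s n t)) = Lf (f t)"
 proof -
  have "AE t in M. t \<in> I" by (intro AE_I2) simp
  with fX lim show ?thesis
  proof eventually_elim
   case (elim t)
   note t = elim(1,2,3)
   have "(%n. Lf (s n t)) \<longlonglongrightarrow> Lf (f t)"
    by (rule LIM_zero_cancel, rule Lim_null_comparison[OF _ t(2)])
      (use Lf[OF sX[OF t(3)] t(1)] in simp)
   then show ?case by (rule limI)
  qed
 qed
 show ?thesis
  by (rule measurable_cong_AE[OF _ ae]) (intro borel_measurable_lim_metric m)
qed

end

locale space_time = interval a b for a b :: real +
 fixes T :: real
 assumes T_pos: "0 < T"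
begin

sublocale time: interval 0 T by unfold_locales (rule T_pos)

abbreviation Tm :: "real measure" where "Tm \<equiv> lebesgue_on {0<..<T}"

text \<open>The converse direction, for any seminorm controlled by a weighted sum of squares: truncating the series and
 rounding its coefficients to a finite grid gives approximating simple functions.\<close>

lemma series_strongly_measurable:
 assumes c: "\<And>k. c k \<in> borel_measurable Tm" and W: "\<And>k. 1 <= W k"
  and sm: "AE t in Tm. summable (%k. W k * (c k t)^2)"
  and X: "\<And>q n. (%x. \<Sum>k<n. q k * p k x) \<in> X" "AE t in Tm. f t \<in> X"
  and nm: "\<And>g. 0 <= Nm g"
   "AE t in Tm. \<forall>q n. (Nm (%x. (\<Sum>k<n. q k * p k x) - f t x))^2
     <= (\<Sum>k. W k * ((if k < n then q k else 0) - c k t)^2)"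
 shows "strongly_measurable Tm X Nm f"
 unfolding strongly_measurable_def
proof (intro conjI exI[of _ "%n t x. \<Sum>k<n. grid W n (c k t) * p k x"] allI)
 show "AE t in Tm. f t \<in> X" by (rule X(2))
 show "X_simple Tm X (%t x. \<Sum>k<n. grid W n (c k t) * p k x)" for n
  using simple_grid_sum[OF W c, where ?N = n] X(1) by (auto simp: X_simple_def)
 show "AE t in Tm. (%n. Nm (%x. (\<Sum>k<n. grid W n (c k t) * p k x) - f t x)) \<longlonglongrightarrow> 0"
  using sm nm(2)
 proof eventually_elim
  case (elim t)
  note s = elim(1) and le = elim(2)
  have le: "Nm (%x. (\<Sum>k<n. grid W n (c k t) * p k x) - f t x) <= sqrt (grid_error W n (%k. c k t))" for n
   using le[rule_format, of "%k. grid W n (c k t)" n]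
   unfolding grid_error_def trunc_grid_def by (rule real_le_rsqrt)
  have lim: "(%n. sqrt (grid_error W n (%k. c k t))) \<longlonglongrightarrow> 0"
   using tendsto_real_sqrt[OF grid_error_tendsto[OF W s]] by simp
  show ?case
   by (rule Lim_null_comparison[OF _ lim]) (simp add: le nm(1))
 qed
qed

lemma nrm_psum_diff:
 assumes f: "f \<in> L2"
 shows "(nrm (%x. (\<Sum>k<n. q k * e k x) - f x))^2
   = (\<Sum>k. 1 * ((if k < n then q k else 0) - ip f (e k))^2)"
proof -
 have P: "(%x. \<Sum>k<n. q k * e k x) \<in> L2"
  using psum_L2[OF ons_e, of q n] by (simp add: psum_def[abs_def])
 have co: "ip (%x. (\<Sum>k<n. q k * e k x) - f x) (e k) = (if k < n then q k else 0) - ip f (e k)" for k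
  using ip_psum_basis[OF ons_e, of q n k] by (simp add: ip_diff_left[OF P f] psum_def[abs_def])
 show ?thesis using Parseval[OF L2_diff[OF P f]] unfolding co by (simp add: sums_iff)
qed

lemma L2_series_strongly_measurable:
 assumes c: "\<And>k. c k \<in> borel_measurable Tm"
  and f: "AE t in Tm. f t \<in> L2 \<and> (\<forall>k. ip (f t) (e k) = c k t)"
 shows "strongly_measurable Tm (L2) nrm f"
proof (rule series_strongly_measurable[OF c, where W = "%_. 1" and p = e])
 show "AE t in Tm. summable (%k. 1 * (c k t)^2)"
  using f
 proof eventually_elim
  case (elim t)
  then show ?case using coef_summable[of "f t"] by simp
 qed
 show "(%x. \<Sum>k<n. q k * e k x) \<in> L2" for q n
  using psum_L2[OF ons_e, of q n] by (simp add: psum_def[abs_def])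
 show "AE t in Tm. f t \<in> L2" using f by eventually_elim simp
 show "AE t in Tm. \<forall>q n. (nrm (%x. (\<Sum>k<n. q k * e k x) - f t x))^2
     <= (\<Sum>k. 1 * ((if k < n then q k else 0) - c k t)^2)"
  using f
 proof eventually_elim
  case (elim t)
  then show ?case
   using nrm_psum_diff[of "f t"] by simp
 qed
qed auto

lemma bochner_L2_coef:
 assumes "f \<in> bochner_L2 T (L2) nrm"
 shows "time.L2_family (%k t. ip (f t) (e k))" "AE t in Tm. f t \<in> L2"
proof -
 have sm: "strongly_measurable Tm (L2) nrm f" and i: "integrable Tm (%t. (nrm (f t))^2)"
  using assms by (auto simp: bochner_L2_def)
 show L: "AE t in Tm. f t \<in> L2" using sm by (simp add: strongly_measurable_def)
 have m: "(%t. ip (f t) (e k)) \<in> borel_measurable Tm" for k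
 proof (rule time.strongly_measurable_functional[OF sm])
  fix g h assume gh: "g \<in> L2" "h \<in> L2"
  show "\<bar>ip g (e k) - ip h (e k)\<bar> <= nrm (%x. g x - h x)"
   using Cauchy_Schwarz_ip[OF L2_diff[OF gh] e_L2, of k] unfolding nrm_e ip_diff_left[OF gh e_L2] by simp
 qed
 show "time.L2_family (%k t. ip (f t) (e k))"
  by (rule time.L2_family_of_bound(1)[OF m i]) (use L in \<open>eventually_elim, simp add: Bessel\<close>)
qed

lemma bochner_L2_of_coef:
 assumes c: "time.L2_family c"
  and f: "AE t in Tm. f t \<in> L2 \<and> (\<forall>k. ip (f t) (e k) = c k t)"
 shows "f \<in> bochner_L2 T (L2) nrm"
proof -
 have m: "c k \<in> borel_measurable Tm" for k
  using c time.L2_meas by (auto simp: time.L2_family_def)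
 have sm: "strongly_measurable Tm (L2) nrm f"
  by (rule L2_series_strongly_measurable[OF m f])
 have "AE t in Tm. (\<Sum>k. (c k t)^2) = (nrm (f t))^2"
  using f
 proof eventually_elim
  case (elim t)
  then show ?case using Parseval[of "f t"] by (simp add: sums_iff)
 qed
 then have ae: "AE t in Tm. (nrm (f t))^2 = (\<Sum>k. (c k t)^2)" by eventually_elim simp
 have "(%t. (nrm (f t))^2) \<in> borel_measurable Tm"
  by (rule time.measurable_cong_AE[OF borel_measurable_integrable[OF time.L2_family_AE(2)[OF c]]])
    (use ae in \<open>eventually_elim, simp\<close>)
 then have "integrable Tm (%t. (nrm (f t))^2)"
  by (rule integrable_cong_AE_imp[OF time.L2_family_AE(2)[OF c]])
    (use ae in \<open>eventually_elim, simp\<close>)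
 with sm show ?thesis by (simp add: bochner_L2_def)
qed

lemma has_X_integral_coef:
 assumes "has_X_integral Tm (L2) nrm f v" and i: "integrable Tm (%t. ip (f t) (e k))"
 shows "(\<integral>t. ip (f t) (e k) \<partial>Tm) = ip v (e k)"
proof -
 obtain s where s: "\<And>n. X_simple Tm (L2) (s n)" and v: "v \<in> L2"
  and fL: "AE t in Tm. f t \<in> L2"
  and l1: "(%n. \<integral>\<^sup>+t. ennreal (nrm (%x. s n t x - f t x)) \<partial>Tm) \<longlonglongrightarrow> 0"
  and l2: "(%n. nrm (%x. X_simple_integral Tm (s n) x - v x)) \<longlonglongrightarrow> 0"
  using assms(1) by (auto simp: has_X_integral_def strongly_measurable_def)
 have ss: "simple_function Tm (s n)" and sX: "\<And>t. t \<in> {0<..<T} ==> s n t \<in> L2" for n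
  using s[of n] by (auto simp: X_simple_def)
 have vL: "u \<in> L2" if "u \<in> s n ` space Tm" for u n using that sX by auto
 have XL: "X_simple_integral Tm (s n) \<in> L2" for n
  unfolding X_simple_integral_def by (intro L2_sum L2_scale vL)
 have Xi: "ip (X_simple_integral Tm (s n)) (e k) = (\<integral>t. ip (s n t) (e k) \<partial>Tm)" for n
 proof -
  have "ip (X_simple_integral Tm (s n)) (e k)
    = (\<Sum>u\<in>s n ` space Tm. measure Tm {t \<in> space Tm. s n t = u} * ip u (e k))"
   unfolding X_simple_integral_def
   by (subst ip_sum_left[OF L2_scale[OF vL] e_L2]) (simp_all add: ip_scale_left)
  then show ?thesis
   using integral_of_simple_function(2)[OF time.finite_M ss, where g = "%u. ip u (e k)"] by simp
 qed
 have lim1: "(%n. \<integral>t. ip (s n t) (e k) \<partial>Tm) \<longlonglongrightarrow> ip v (e k)"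
  using ip_tendsto[OF XL v e_L2[of k] l2] unfolding Xi .
 have si: "integrable Tm (%t. ip (s n t) (e k))" for n
  by (rule integral_of_simple_function(1)[OF time.finite_M ss])
 have le: "ennreal \<bar>(\<integral>t. ip (s n t) (e k) \<partial>Tm) - (\<integral>t. ip (f t) (e k) \<partial>Tm)\<bar>
   <= (\<integral>\<^sup>+t. ennreal (nrm (%x. s n t x - f t x)) \<partial>Tm)" for n
 proof -
  have d: "integrable Tm (%t. ip (s n t) (e k) - ip (f t) (e k))"
   by (intro Bochner_Integration.integrable_diff si i)
  have "\<bar>(\<integral>t. ip (s n t) (e k) \<partial>Tm) - (\<integral>t. ip (f t) (e k) \<partial>Tm)\<bar>
    = \<bar>\<integral>t. ip (s n t) (e k) - ip (f t) (e k) \<partial>Tm\<bar>"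
   using si i by simp
  also have "\<dots> <= (\<integral>t. \<bar>ip (s n t) (e k) - ip (f t) (e k)\<bar> \<partial>Tm)" by (rule integral_abs_bound)
  finally have "ennreal \<bar>(\<integral>t. ip (s n t) (e k) \<partial>Tm) - (\<integral>t. ip (f t) (e k) \<partial>Tm)\<bar>
    <= ennreal (\<integral>t. \<bar>ip (s n t) (e k) - ip (f t) (e k)\<bar> \<partial>Tm)" by (rule ennreal_leI)
  also have "\<dots> = (\<integral>\<^sup>+t. ennreal \<bar>ip (s n t) (e k) - ip (f t) (e k)\<bar> \<partial>Tm)"
   by (intro nn_integral_eq_integral[symmetric] integrable_abs d) simp
  also have "\<dots> <= (\<integral>\<^sup>+t. ennreal (nrm (%x. s n t x - f t x)) \<partial>Tm)"
  proof (rule nn_integral_mono_AE)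
   have "AE t in Tm. t \<in> {0<..<T}" by (intro AE_I2) simp
   with fL show "AE t in Tm. ennreal \<bar>ip (s n t) (e k) - ip (f t) (e k)\<bar> <= ennreal (nrm (%x. s n t x - f t x))"
   proof eventually_elim
    case (elim t)
    note t = elim(1,2)
    show ?case
     using Cauchy_Schwarz_ip[OF L2_diff[OF sX[OF t(2)] t(1)] e_L2, of n k]
     unfolding nrm_e ip_diff_left[OF sX[OF t(2)] t(1) e_L2] by (intro ennreal_leI) simp
   qed
  qed
  finally show ?thesis .
 qed
 have "(%n. ennreal \<bar>(\<integral>t. ip (s n t) (e k) \<partial>Tm) - (\<integral>t. ip (f t) (e k) \<partial>Tm)\<bar>) \<longlonglongrightarrow> 0"
  by (rule tendsto_sandwich[of "%_. 0", OF _ _ _ l1]) (auto simp: le)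
 then have "(%n. \<bar>(\<integral>t. ip (s n t) (e k) \<partial>Tm) - (\<integral>t. ip (f t) (e k) \<partial>Tm)\<bar>) \<longlonglongrightarrow> 0"
  by (subst (asm) ennreal_0[symmetric], subst (asm) tendsto_ennreal_iff) auto
 then have "(%n. \<integral>t. ip (s n t) (e k) \<partial>Tm) \<longlonglongrightarrow> (\<integral>t. ip (f t) (e k) \<partial>Tm)"
  by (rule LIM_zero_cancel[OF tendsto_rabs_zero_cancel])
 from LIMSEQ_unique[OF this lim1] show ?thesis .
qed

text \<open>The simple functions obtained by rounding have integrals that need not vanish, but by the
 Cauchy-Schwarz inequality in time their coefficients are controlled by the rounding error, since those of
 the function itself integrate to zero.\<close>

lemma has_X_integral_zero_of_coef:
 assumes g: "time.L2_family g"
  and f: "AE t in Tm. f t \<in> L2 \<and> (\<forall>k. ip (f t) (e k) = g k t)"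
  and z: "\<And>k. (\<integral>t. g k t \<partial>Tm) = 0"
 shows "has_X_integral Tm (L2) nrm f (%_. 0)"
proof -
 define W :: "nat => real" where "W k = 1" for k
 have W: "1 <= W k" for k by (simp add: W_def)
 have gL: "g k \<in> time.L2" for k using g by (simp add: time.L2_family_def)
 have m: "g k \<in> borel_measurable Tm" for k using gL by (rule time.L2_meas)
 define s where "s n t x = (\<Sum>k<n. grid W n (g k t) * e k x)" for n t x
 define D where "D n t = grid_error W n (%k. g k t)" for n t
 have sm: "AE t in Tm. summable (%k. W k * (g k t)^2)"
  using time.L2_family_AE(1)[OF g] by (simp add: W_def)
 have xs: "X_simple Tm (L2) (s n)" for n
  using simple_grid_sum[OF W m, where ?N = n and n = n] psum_L2[OF ons_e]
  by (auto simp: X_simple_def s_def[abs_def] psum_def[abs_def])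
 have gm: "(%t. grid W n (g k t)) \<in> borel_measurable Tm" for n k
  unfolding grid_def by (rule rnd_measurable[OF m])
 have Dm: "D n \<in> borel_measurable Tm" for n
  unfolding D_def[abs_def] grid_error_def trunc_grid_def
 proof (intro borel_measurable_suminf borel_measurable_times borel_measurable_power borel_measurable_diff m)
  show "(%t. if k < n then grid W n (g k t) else 0) \<in> borel_measurable Tm" for k
   by (cases "k < n") (simp_all add: gm)
 qed simp
 have Dn: "AE t in Tm. \<forall>n. nrm (%x. s n t x - f t x) = sqrt (D n t)"
  using f
 proof eventually_elim
  case (elim t)
  note t = elim
  have sq: "(nrm (%x. s n t x - f t x))^2 = D n t" for n
   using nrm_psum_diff[of "f t" "%k. grid W n (g k t)" n] t
   by (simp add: s_def D_def grid_error_def trunc_grid_def W_def)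
  then show ?case
   using real_sqrt_unique[OF sq nrm_nonneg] by simp
 qed
 have D0: "AE t in Tm. \<forall>n. 0 <= D n t"
  using sm by eventually_elim (simp add: D_def grid_error_nonneg[OF W])
 define w where "w t = 3 + 2 * (\<Sum>k. (g k t)^2)" for t
 have wi: "integrable Tm w" unfolding w_def
  using time.L2_family_AE(2)[OF g] by simp
 have Db: "AE t in Tm. \<forall>n. D n t <= w t"
  using sm
 proof eventually_elim
  case (elim t)
  note t = elim
  have eq: "(\<Sum>k. W k * (g k t)^2) = (\<Sum>k. (g k t)^2)" by (simp add: W_def)
  have le: "D n t <= 2 + 2 * (\<Sum>k. (g k t)^2)" for n
   using grid_error_bound[where W = W and n = n, OF W t] unfolding D_def eq .
  show ?case
  proof
   fix n show "D n t <= w t" using le[of n] unfolding w_def by linarith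
  qed
 qed
 have Dlim: "AE t in Tm. (%n. D n t) \<longlonglongrightarrow> 0"
  using sm by eventually_elim (simp add: D_def grid_error_tendsto[OF W])
 have intD: "(%n. \<integral>t. D n t \<partial>Tm) \<longlonglongrightarrow> (\<integral>t. 0 \<partial>Tm)"
 proof (rule integral_dominated_convergence[OF _ Dm wi Dlim])
  show "AE t in Tm. norm (D n t) <= w t" for n using D0 Db by eventually_elim simp
 qed simp
 have Di: "integrable Tm (D n)" for n
 proof (rule Bochner_Integration.integrable_bound[OF wi Dm])
  show "AE t in Tm. norm (D n t) <= norm (w t)"
   using D0 Db
  proof eventually_elim
   case (elim t)
   then have "0 <= D n t" "D n t <= w t" by blast+
   then show ?case by simp
  qed
 qed
 have "AE t in Tm. (%n. sqrt (D n t)) \<longlonglongrightarrow> 0"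
  using Dlim
 proof eventually_elim
  case (elim t)
  from tendsto_real_sqrt[OF this] show ?case by simp
 qed
 moreover have sqb: "AE t in Tm. norm (sqrt (D n t)) <= w t" for n
  using D0 sm
 proof eventually_elim
  case (elim t)
  note t = elim(1,2)
  have eq: "(\<Sum>k. W k * (g k t)^2) = (\<Sum>k. (g k t)^2)" by (simp add: W_def)
  have "D n t <= 2 + 2 * (\<Sum>k. (g k t)^2)"
   using grid_error_bound[where W = W and n = n, OF W t(2)] unfolding D_def eq .
  moreover have "sqrt (D n t) <= 1 + D n t"
  proof (rule real_le_lsqrt)
   show "D n t <= (1 + D n t)^2" using t(1) by (simp add: power2_sum)
  qed (use t(1) in \<open>auto intro: add_nonneg_nonneg\<close>)
  ultimately show ?case using t(1) by (simp add: w_def)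
 qed
 ultimately have "(%n. \<integral>t. sqrt (D n t) \<partial>Tm) \<longlonglongrightarrow> (\<integral>t. 0 \<partial>Tm)"
  using Dm by (intro integral_dominated_convergence[OF _ _ wi]) auto
 from tendsto_ennrealI[OF this]
 have "(%n. ennreal (\<integral>t. sqrt (D n t) \<partial>Tm)) \<longlonglongrightarrow> 0" by simp
 moreover have "(\<integral>\<^sup>+t. ennreal (nrm (%x. s n t x - f t x)) \<partial>Tm) = ennreal (\<integral>t. sqrt (D n t) \<partial>Tm)" for n
 proof -
  have "(\<integral>\<^sup>+t. ennreal (nrm (%x. s n t x - f t x)) \<partial>Tm) = (\<integral>\<^sup>+t. ennreal (sqrt (D n t)) \<partial>Tm)"
   using Dn by (intro nn_integral_cong_AE, eventually_elim) simp
  also have "\<dots> = ennreal (\<integral>t. sqrt (D n t) \<partial>Tm)"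
  proof (rule nn_integral_eq_integral)
   show "integrable Tm (%t. sqrt (D n t))"
    by (rule Bochner_Integration.integrable_bound[OF wi])
      (use Dm sqb[of n] in \<open>auto elim!: AE_mp\<close>)
   show "AE t in Tm. 0 <= sqrt (D n t)" using D0 by eventually_elim simp
  qed
  finally show ?thesis .
 qed
 ultimately have L1: "(%n. \<integral>\<^sup>+t. ennreal (nrm (%x. s n t x - f t x)) \<partial>Tm) \<longlonglongrightarrow> 0" by simp
 have gi: "integrable Tm (%t. grid W n (g k t))" for n k
 proof -
  have "simple_function Tm (%t. grid W n (g k t))"
  proof (rule simple_function_borel_measurable[OF gm])
   show "finite ((%t. grid W n (g k t)) ` space Tm)"
    by (rule finite_subset[OF _ rnd_finite[OF grid_scale_pos[OF W, of n], of "real n"]]) (auto simp: grid_def)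
  qed
  from integral_of_simple_function(1)[OF time.finite_M this, where g = "%z. z"] show ?thesis .
 qed
 have XI: "X_simple_integral Tm (s n) = psum e (%k. \<integral>t. grid W n (g k t) \<partial>Tm) n" for n
 proof
  fix x
  have "X_simple_integral Tm (s n) x = (\<integral>t. s n t x \<partial>Tm)"
   unfolding X_simple_integral_def
   using integral_of_simple_function(2)[OF time.finite_M, of "s n" "%v. v x"] xs[of n]
   by (simp add: X_simple_def)
  also have "\<dots> = (\<Sum>k<n. \<integral>t. grid W n (g k t) * e k x \<partial>Tm)"
   unfolding s_def by (rule Bochner_Integration.integral_sum) (intro integrable_mult_left gi)
  finally show "X_simple_integral Tm (s n) x = psum e (%k. \<integral>t. grid W n (g k t) \<partial>Tm) n x"
   by (simp add: psum_def)
 qed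
 have "(nrm (X_simple_integral Tm (s n)))^2 <= T * (\<integral>t. D n t \<partial>Tm)" for n
 proof -
  have one: "(\<integral>t. grid W n (g k t) \<partial>Tm)^2 <= T * (\<integral>t. (grid W n (g k t) - g k t)^2 \<partial>Tm)"
   and dL: "(%t. grid W n (g k t) - g k t) \<in> time.L2" for k
  proof -
   have "(%t. grid W n (g k t)) \<in> time.L2"
   proof -
    have le: "\<bar>grid W n (g k t)\<bar> <= \<bar>2 * \<bar>g k t\<bar> + 1\<bar>" for t
     using grid_growth[where W = W and n = n and z = "g k t", OF W] by simp
    have L: "(%t. 2 * \<bar>g k t\<bar> + 1) \<in> time.L2"
     by (intro time.L2_add time.L2_scale time.abs_L2 gL time.L2_const)
    have "integrable Tm (%t. (grid W n (g k t))^2)"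
    proof (rule Bochner_Integration.integrable_bound[OF time.L2_sq[OF L]])
     show "(%t. (grid W n (g k t))^2) \<in> borel_measurable Tm" using gm[of n k] by simp
     show "AE t in Tm. norm ((grid W n (g k t))^2) <= norm ((2 * \<bar>g k t\<bar> + 1)^2)"
      using le unfolding abs_le_square_iff by simp
    qed
    then show ?thesis using gm by (simp add: time.L2_iff)
   qed
   then show dL: "(%t. grid W n (g k t) - g k t) \<in> time.L2"
    by (intro time.L2_diff gL)
   have "(\<integral>t. grid W n (g k t) \<partial>Tm) = (\<integral>t. grid W n (g k t) - g k t \<partial>Tm)"
    using gi time.L2_integrable[OF gL] z by simp
   then have "\<bar>\<integral>t. grid W n (g k t) \<partial>Tm\<bar> <= (\<integral>t. \<bar>grid W n (g k t) - g k t\<bar> \<partial>Tm)"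
    using integral_abs_bound[of Tm "%t. grid W n (g k t) - g k t"] by simp
   also have "\<dots> <= sqrt T * time.nrm (%t. grid W n (g k t) - g k t)"
    using time.integral_abs_le_nrm[OF dL] by simp
   finally have "\<bar>\<integral>t. grid W n (g k t) \<partial>Tm\<bar>\<^sup>2 <= (sqrt T * time.nrm (%t. grid W n (g k t) - g k t))^2"
    by (rule power_mono) simp
   then show "(\<integral>t. grid W n (g k t) \<partial>Tm)^2 <= T * (\<integral>t. (grid W n (g k t) - g k t)^2 \<partial>Tm)"
    using T_pos by (simp add: power_mult_distrib time.nrm_sq')
  qed
  have "(nrm (X_simple_integral Tm (s n)))^2 = (\<Sum>k<n. (\<integral>t. grid W n (g k t) \<partial>Tm)^2)"
   unfolding XI nrm_psum_sq[OF ons_e] by simp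
  also have "\<dots> <= (\<Sum>k<n. T * (\<integral>t. (grid W n (g k t) - g k t)^2 \<partial>Tm))"
   by (intro sum_mono one)
  also have "\<dots> = T * (\<integral>t. (\<Sum>k<n. (grid W n (g k t) - g k t)^2) \<partial>Tm)"
   using time.L2_sq[OF dL] by (simp add: sum_distrib_left[symmetric] Bochner_Integration.integral_sum)
  also have "\<dots> <= T * (\<integral>t. D n t \<partial>Tm)"
  proof (intro mult_left_mono integral_mono_AE Di Bochner_Integration.integrable_sum time.L2_sq[OF dL])
   show "AE t in Tm. (\<Sum>k<n. (grid W n (g k t) - g k t)^2) <= D n t"
    using sm
   proof eventually_elim
    case (elim t)
    note t = elim
    have "0 <= (\<Sum>k. W (k + n) * (g (k + n) t)^2)"
     using t summable_iff_shift[of "%k. W k * (g k t)^2" n] by (intro suminf_nonneg) (auto simp: W_def)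
    moreover have "D n t = (\<Sum>k<n. W k * (grid W n (g k t) - g k t)^2) + (\<Sum>k. W (k + n) * (g (k + n) t)^2)"
     unfolding D_def by (rule grid_error_split(2)[where W = W and n = n, OF W t])
    moreover have "(\<Sum>k<n. W k * (grid W n (g k t) - g k t)^2) = (\<Sum>k<n. (grid W n (g k t) - g k t)^2)"
     by (intro sum.cong refl) (simp only: W_def mult_1)
    ultimately show ?case by linarith
   qed
  qed (use T_pos in simp)
  finally show ?thesis .
 qed
 then have le2: "nrm (X_simple_integral Tm (s n)) <= sqrt (T * (\<integral>t. D n t \<partial>Tm))" for n
  by (rule real_le_rsqrt)
 have "(%n. sqrt (T * (\<integral>t. D n t \<partial>Tm))) \<longlonglongrightarrow> sqrt (T * 0)"
  using intD by (intro tendsto_intros) simp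
 then have "(%n. sqrt (T * (\<integral>t. D n t \<partial>Tm))) \<longlonglongrightarrow> 0" by simp
 note lim = this
 have L2: "(%n. nrm (X_simple_integral Tm (s n))) \<longlonglongrightarrow> 0"
  by (rule Lim_null_comparison[OF _ lim]) (simp add: le2)
 show ?thesis
  unfolding has_X_integral_def
 proof (intro conjI exI[of _ s] allI)
  show "strongly_measurable Tm (L2) nrm f" by (rule L2_series_strongly_measurable[OF m f])
  show "(%n. nrm (%x. X_simple_integral Tm (s n) x - 0)) \<longlonglongrightarrow> 0" using L2 by simp
 qed (rule L2_const xs L1)+
qed

text \<open>Weak time derivatives are taken coefficient by coefficient.\<close>

lemma has_time_deriv_coef:
 assumes td: "has_time_deriv T (L2) nrm f g"
  and f: "f \<in> bochner_L2 T (L2) nrm" and g: "g \<in> bochner_L2 T (L2) nrm"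
 shows "has_weak_deriv {0<..<T} 1 (%t. ip (f t) (e k)) (%t. ip (g t) (e k))"
proof -
 let ?c = "%t. ip (f t) (e k)" and ?d = "%t. ip (g t) (e k)"
 have cL: "?c \<in> time.L2" and dL: "?d \<in> time.L2"
  using bochner_L2_coef(1)[OF f] bochner_L2_coef(1)[OF g] by (auto simp: time.L2_family_def)
 show ?thesis
 proof (rule time.has_weak_derivI_L2[OF cL dL])
  fix \<phi> assume \<phi>: "test_function {0<..<T} \<phi>"
  note pL = time.test_L2[OF \<phi>] time.test_L2[OF test_deriv[OF \<phi>]]
  have ae: "AE t in Tm. ip (%x. deriv \<phi> t * f t x + \<phi> t * g t x) (e k) = deriv \<phi> t * ?c t + \<phi> t * ?d t"
   using bochner_L2_coef(2)[OF f] bochner_L2_coef(2)[OF g]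
   by eventually_elim (simp add: ip_add_left L2_scale ip_scale_left)
  have ii: "integrable Tm (%t. deriv \<phi> t * ?c t + \<phi> t * ?d t)"
   by (intro Bochner_Integration.integrable_add time.L2_mult_integrable pL cL dL)
  have m: "(%t. ip (%x. deriv \<phi> t * f t x + \<phi> t * g t x) (e k)) \<in> borel_measurable Tm"
   by (rule time.measurable_cong_AE[OF borel_measurable_integrable[OF ii]])
     (use ae in \<open>eventually_elim, simp\<close>)
  have "integrable Tm (%t. ip (%x. deriv \<phi> t * f t x + \<phi> t * g t x) (e k))"
   by (rule integrable_cong_AE_imp[OF ii m]) (use ae in \<open>eventually_elim, simp\<close>)
  then have "(\<integral>t. ip (%x. deriv \<phi> t * f t x + \<phi> t * g t x) (e k) \<partial>Tm) = ip (%_. 0) (e k)"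
   using td \<phi> by (intro has_X_integral_coef) (auto simp: has_time_deriv_def)
  then have "(\<integral>t. deriv \<phi> t * ?c t + \<phi> t * ?d t \<partial>Tm) = 0"
   using integral_cong_AE[OF m borel_measurable_integrable[OF ii] ae] by (simp add: ip_def)
  then have "(\<integral>t. deriv \<phi> t * ?c t \<partial>Tm) + (\<integral>t. \<phi> t * ?d t \<partial>Tm) = 0"
   using time.L2_mult_integrable[OF pL(2) cL] time.L2_mult_integrable[OF pL(1) dL] by simp
  then show "time.ip ?c ((deriv ^^ 1) \<phi>) = (-1) ^ 1 * time.ip ?d \<phi>"
   by (simp add: time.ip_def mult.commute)
 qed
qed

lemma has_time_deriv_of_coef:
 assumes c: "time.L2_family c" and d: "time.L2_family d"
  and cd: "\<And>k. \<exists>C. \<forall>t\<in>{0..T}. c k t = C + time.prim (d k) t"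
  and f: "AE t in Tm. f t \<in> L2 \<and> (\<forall>k. ip (f t) (e k) = c k t)"
  and g: "AE t in Tm. g t \<in> L2 \<and> (\<forall>k. ip (g t) (e k) = d k t)"
 shows "has_time_deriv T (L2) nrm f g"
 unfolding has_time_deriv_def
proof (intro allI impI)
 fix \<phi> assume \<phi>: "test_function {0<..<T} \<phi>"
 note pL = time.test_L2[OF \<phi>] time.test_L2[OF test_deriv[OF \<phi>]]
 have cL: "c k \<in> time.L2" and dL: "d k \<in> time.L2" for k
  using c d by (auto simp: time.L2_family_def)
 obtain B1 where B1: "\<And>t. \<bar>deriv \<phi> t\<bar> <= B1" using time.test_bounded[OF test_deriv[OF \<phi>]] by blast
 obtain B2 where B2: "\<And>t. \<bar>\<phi> t\<bar> <= B2" using time.test_bounded[OF \<phi>] by blast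
 let ?h = "%k t. deriv \<phi> t * c k t + \<phi> t * d k t"
 have hi: "integrable Tm (%t. deriv \<phi> t * c k t)" "integrable Tm (%t. \<phi> t * d k t)" for k
  by (intro time.L2_mult_integrable pL cL dL)+
 show "has_X_integral Tm (L2) nrm (%t x. deriv \<phi> t * f t x + \<phi> t * g t x) (%_. 0)"
 proof (rule has_X_integral_zero_of_coef[where g = ?h])
  show "time.L2_family ?h"
  proof (rule time.L2_family_dominated[OF _ c d])
   show "?h k \<in> borel_measurable Tm" for k
    using hi by (intro borel_measurable_integrable Bochner_Integration.integrable_add)
   show "AE t in Tm. \<forall>k. (?h k t)^2 <= (2 * B1^2) * (c k t)^2 + (2 * B2^2) * (d k t)^2"
   proof (intro AE_I2 allI)
    fix t k
    have "(?h k t)^2 <= 2 * (deriv \<phi> t * c k t)^2 + 2 * (\<phi> t * d k t)^2"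
     using zero_le_power2[of "deriv \<phi> t * c k t - \<phi> t * d k t"] unfolding power2_sum power2_diff by linarith
    moreover have "(deriv \<phi> t * c k t)^2 <= B1^2 * (c k t)^2" "(\<phi> t * d k t)^2 <= B2^2 * (d k t)^2"
     unfolding power_mult_distrib using power_mono[OF B1 abs_ge_zero, of t 2] power_mono[OF B2 abs_ge_zero, of t 2]
     by (auto intro!: mult_right_mono)
    ultimately show "(?h k t)^2 <= (2 * B1^2) * (c k t)^2 + (2 * B2^2) * (d k t)^2" by linarith
   qed
  qed
  show "AE t in Tm. (%x. deriv \<phi> t * f t x + \<phi> t * g t x) \<in> L2 \<and>
    (\<forall>k. ip (%x. deriv \<phi> t * f t x + \<phi> t * g t x) (e k) = ?h k t)"
   using f g
   by eventually_elim (simp add: ip_add_left L2_scale L2_add ip_scale_left)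
  fix k
  obtain C where C: "\<forall>t\<in>{0..T}. c k t = C + time.prim (d k) t" using cd by blast
  have "time.ip (c k) (deriv \<phi>) = time.ip (%t. C + time.prim (d k) t) (deriv \<phi>)"
   by (rule time.ip_cong_AE[OF _ cL _ pL(2)]) (use C in \<open>auto intro!: AE_I2\<close>)
  also have "\<dots> = time.ip (%t. C) (deriv \<phi>) + time.ip (time.prim (d k)) (deriv \<phi>)"
   by (rule time.ip_add_left[OF time.L2_const time.prim_L2[OF dL] pL(2)])
  also have "time.ip (%t. C) (deriv \<phi>) = 0"
  proof -
   have "(\<integral>t. deriv \<phi> t \<partial>Tm) = \<phi> T - \<phi> 0"
    by (rule time.FTC_M[OF smooth_DERIV_within[OF test_smooth[OF \<phi>]]
      smooth_continuous[OF smooth_deriv[OF test_smooth[OF \<phi>]]]])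
   then show ?thesis using time.test_boundary[OF \<phi>] by (simp add: time.ip_def)
  qed
  also have "time.ip (time.prim (d k)) (deriv \<phi>) = - time.ip (d k) \<phi>"
   using time.has_weak_derivD[OF time.prim_weak_deriv[OF dL] \<phi>, of k] by simp
  finally have "time.ip (c k) (deriv \<phi>) + time.ip (d k) \<phi> = 0" by simp
  then show "(\<integral>t. ?h k t \<partial>Tm) = 0"
   using hi[of k] by (simp add: time.ip_def mult.commute)
 qed
qed

text \<open>The initial value fixes the constant of integration of each coefficient.\<close>

lemma initial_value_coef:
 assumes iv: "has_initial_value T I f f0" and f0: "f0 \<in> L2"
  and wd: "has_weak_deriv {0<..<T} 1 (%t. ip (f t) (e k)) d" and d: "d \<in> time.L2"
  and cL: "(%t. ip (f t) (e k)) \<in> time.L2"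
 shows "AE t in Tm. ip (f t) (e k) = ip f0 (e k) + time.prim d t"
proof -
 obtain z where z: "\<forall>t\<in>{0..T}. z t \<in> L2"
   "\<forall>t\<in>{0..T}. ((%s. nrm (%x. z s x - z t x)) \<longlongrightarrow> 0) (at t within {0..T})"
  and zf: "AE t in Tm. AE x in M. z t x = f t x" and z0: "AE x in M. z 0 x = f0 x"
  using iv unfolding has_initial_value_def by blast
 note zL = bspec[OF z(1)] and zc = bspec[OF z(2)]
 obtain C where C: "AE t in Tm. ip (f t) (e k) = C + time.prim d t"
  by (rule time.weak_deriv_imp_primitive[OF wd cL d])
 have cz: "continuous_on {0..T} (%t. ip (z t) (e k))"
  unfolding continuous_on_def
 proof
  fix t assume t: "t \<in> {0..T}"
  show "((%s. ip (z s) (e k)) \<longlongrightarrow> ip (z t) (e k)) (at t within {0..T})"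
  proof (rule LIM_zero_cancel, rule Lim_null_comparison[OF _ zc[OF t]])
   have "\<bar>ip (z s) (e k) - ip (z t) (e k)\<bar> <= nrm (%x. z s x - z t x)" if "s \<in> {0..T}" for s
    using Cauchy_Schwarz_ip[OF L2_diff[OF zL[OF that] zL[OF t]] e_L2, of k]
    unfolding nrm_e ip_diff_left[OF zL[OF that] zL[OF t] e_L2] by simp
   then show "\<forall>\<^sub>F s in at t within {0..T}. norm (ip (z s) (e k) - ip (z t) (e k)) <= nrm (%x. z s x - z t x)"
    unfolding eventually_at_filter by (intro always_eventually) auto
  qed
 qed
 have "AE t in Tm. t \<in> {0<..<T}" by (intro AE_I2) simp
 then have "AE t in Tm. ip (z t) (e k) = C + time.prim d t"
  using zf C
 proof eventually_elim
  case (elim t)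
  note t = elim(1,2,3)
  have "z t \<in> L2" using t(1) zL by auto
  then have "ip (z t) (e k) = ip (f t) (e k)" by (intro ip_cong_AE[OF t(2)]) auto
  with t(3) show ?case by simp
 qed
 moreover have "continuous_on {0..T} (%t. C + time.prim d t)"
  by (intro continuous_on_add continuous_on_const time.prim_cont d)
 moreover have "0 \<in> {0..T}" using T_pos by simp
 ultimately have "ip (z 0) (e k) = C + time.prim d 0"
  using time.continuous_AE_eq[OF cz] by blast
 moreover have "ip (z 0) (e k) = ip f0 (e k)"
  by (rule ip_cong_AE[OF z0 _ _ e_L2]) (use zL T_pos in auto)
 ultimately have "C = ip f0 (e k)" by simp
 with C show ?thesis by simp
qed

lemma nrm_sq_series:
 assumes f: "f \<in> L2" and g: "g \<in> L2"
 shows "(nrm (%x. f x - g x))^2 = (\<Sum>k. (ip f (e k) - ip g (e k))^2)"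
 using Parseval[OF L2_diff[OF f g]] by (simp add: ip_diff_left[OF f g] sums_iff)

text \<open>The continuous representative is the series with coefficients \<open>\<gamma>\<^sub>k + \<integral>\<^sub>0\<^sup>t d\<^sub>k\<close>.  By Cauchy-Schwarz each
 coefficient moves by at most \<open>|t - s|\<^sup>1\<^sup>/\<^sup>2 \<parallel>d\<^sub>k\<parallel>\<close>, and these bounds are square summable.\<close>

lemma has_initial_value_of_coef:
 assumes d: "time.L2_family d" and \<gamma>: "summable (%k. (\<gamma> k)^2)"
  and f: "AE t in Tm. f t \<in> L2 \<and> (\<forall>k. ip (f t) (e k) = \<gamma> k + time.prim (d k) t)"
  and f0: "f0 \<in> L2" "\<And>k. ip f0 (e k) = \<gamma> k"
 shows "has_initial_value T I f f0"
proof -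
 have dL: "d k \<in> time.L2" and ds: "summable (%k. \<integral>t. (d k t)^2 \<partial>Tm)" for k
  using d by (auto simp: time.L2_family_def)
 define S where "S = (\<Sum>k. \<integral>t. (d k t)^2 \<partial>Tm)"
 define c where "c t k = \<gamma> k + time.prim (d k) t" for t k
 have step: "(c t k - c r k)^2 <= \<bar>t - r\<bar> * (\<integral>t. (d k t)^2 \<partial>Tm)" if "t \<in> {0..T}" "r \<in> {0..T}" for t r k
 proof -
  have *: "(time.prim (d k) y - time.prim (d k) x)^2 <= (y - x) * (\<integral>t. (d k t)^2 \<partial>Tm)"
   if xy: "0 <= x" "x <= y" "y <= T" for x y
  proof -
   have "\<bar>time.prim (d k) y - time.prim (d k) x\<bar> <= sqrt (y - x) * time.nrm (d k)"
    using time.prim_diff[OF dL xy, of k] time.integral_CS[OF dL xy, of k] by simp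
   from power_mono[OF this abs_ge_zero, of 2] show ?thesis
    using xy by (simp add: power_mult_distrib time.nrm_sq')
  qed
  show ?thesis
  proof (cases "r <= t")
   case True
   then show ?thesis using *[of r t] that by (simp add: c_def)
  next
   case False
   then show ?thesis using *[of t r] that by (simp add: c_def power2_commute)
  qed
 qed
 have sm0: "summable (%k. (c t k - c r k)^2)" if "t \<in> {0..T}" "r \<in> {0..T}" for t r
  by (rule summable_comparison_test'[OF summable_mult[OF ds, of "\<bar>t - r\<bar>"], of 0]) (use step[OF that] in simp)
 have c0: "c 0 k = \<gamma> k" for k by (simp add: c_def)
 have sm: "summable (%k. (c t k)^2)" if "t \<in> {0..T}" for t
 proof (rule summable_comparison_test'[where N = 0])
  show "summable (%k. 2 * (c t k - c 0 k)^2 + 2 * (\<gamma> k)^2)"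
   using sm0[OF that, of 0] \<gamma> T_pos by (intro summable_add summable_mult) auto
  have "x^2 <= 2 * (x - y)^2 + 2 * y^2" for x y :: real
   using zero_le_power2[of "x - 2 * y"] by (simp add: power2_diff power_mult_distrib)
  then show "norm ((c t k)^2) <= 2 * (c t k - c 0 k)^2 + 2 * (\<gamma> k)^2" for k by (simp add: c0)
 qed
 define z where "z t = ser e (c t)" for t
 have zL: "z t \<in> L2" if "t \<in> {0..T}" for t
  unfolding z_def by (rule ser_L2_limit(1)[OF ons_e sm[OF that]])
 have zk: "ip (z t) (e k) = c t k" if "t \<in> {0..T}" for t k
  unfolding z_def ip_ser_basis[OF ons_e sm[OF that]] by simp
 show ?thesis
  unfolding has_initial_value_def
 proof (intro exI[of _ z] conjI ballI)
  show "z t \<in> L2" if "t \<in> {0..T}" for t by (rule zL[OF that])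
  show "((%s. nrm (%x. z s x - z t x)) \<longlongrightarrow> 0) (at t within {0..T})" if t: "t \<in> {0..T}" for t
  proof (rule Lim_null_comparison)
   have "nrm (%x. z r x - z t x) <= sqrt (\<bar>r - t\<bar> * S)" if r: "r \<in> {0..T}" for r
   proof (rule real_le_rsqrt)
    have "(nrm (%x. z r x - z t x))^2 = (\<Sum>k. (c r k - c t k)^2)"
     unfolding nrm_sq_series[OF zL[OF r] zL[OF t]] zk[OF r] zk[OF t] ..
    also have "\<dots> <= (\<Sum>k. \<bar>r - t\<bar> * (\<integral>t. (d k t)^2 \<partial>Tm))"
     by (rule suminf_le[OF step[OF r t] sm0[OF r t] summable_mult[OF ds]])
    also have "\<dots> = \<bar>r - t\<bar> * S" unfolding S_def by (rule suminf_mult[OF ds])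
    finally show "(nrm (%x. z r x - z t x))^2 <= \<bar>r - t\<bar> * S" .
   qed
   then show "\<forall>\<^sub>F r in at t within {0..T}. norm (nrm (%x. z r x - z t x)) <= sqrt (\<bar>r - t\<bar> * S)"
    unfolding eventually_at_filter by (intro always_eventually) auto
   have "((%r. sqrt (\<bar>r - t\<bar> * S)) \<longlongrightarrow> sqrt (\<bar>t - t\<bar> * S)) (at t within {0..T})"
    by (intro tendsto_intros)
   then show "((%r. sqrt (\<bar>r - t\<bar> * S)) \<longlongrightarrow> 0) (at t within {0..T})" by simp
  qed
  have "AE t in Tm. t \<in> {0<..<T}" by (intro AE_I2) simp
  then show "AE t in Tm. AE x in M. z t x = f t x"
   using f
  proof eventually_elim
   case (elim t)
   note t = elim(1) and ft = elim(2)
   have t': "t \<in> {0..T}" using t by auto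
   show ?case
    by (rule AE_eq_of_coef_eq[OF zL[OF t']]) (use ft zk[OF t'] in \<open>auto simp: c_def\<close>)
  qed
  show "AE x in M. z 0 x = f0 x"
   by (rule AE_eq_of_coef_eq[OF zL f0(1)]) (use zk[of 0] T_pos f0(2) c0 in auto)
 qed
qed

end

section \<open>The nonlinear flux\<close>

lemma Cauchy_Schwarz_suminf:
 fixes f g :: "nat => real"
 assumes f: "summable (%k. (f k)^2)" and g: "summable (%k. (g k)^2)"
 shows "summable (%k. \<bar>f k * g k\<bar>)"
  "(\<Sum>k. \<bar>f k * g k\<bar>) <= sqrt (\<Sum>k. (f k)^2) * sqrt (\<Sum>k. (g k)^2)"
proof -
 have part: "(\<Sum>k<n. \<bar>f k * g k\<bar>) <= sqrt (\<Sum>k. (f k)^2) * sqrt (\<Sum>k. (g k)^2)" for n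
 proof -
  have "(\<Sum>k<n. \<bar>f k\<bar> * \<bar>g k\<bar>)^2 <= (\<Sum>k<n. \<bar>f k\<bar>\<^sup>2) * (\<Sum>k<n. \<bar>g k\<bar>\<^sup>2)"
   by (rule Cauchy_Schwarz_ineq_sum)
  also have "\<dots> <= (\<Sum>k. (f k)^2) * (\<Sum>k. (g k)^2)"
   using sum_le_suminf[OF f, of "{..<n}"] sum_le_suminf[OF g, of "{..<n}"]
   by (intro mult_mono) (auto intro: suminf_nonneg f g sum_nonneg)
  finally have "(\<Sum>k<n. \<bar>f k\<bar> * \<bar>g k\<bar>) <= sqrt ((\<Sum>k. (f k)^2) * (\<Sum>k. (g k)^2))"
   by (rule real_le_rsqrt)
  then show ?thesis by (simp add: abs_mult real_sqrt_mult)
 qed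
 show s: "summable (%k. \<bar>f k * g k\<bar>)"
  by (rule summableI_nonneg_bounded[OF _ part]) simp
 show "(\<Sum>k. \<bar>f k * g k\<bar>) <= sqrt (\<Sum>k. (f k)^2) * sqrt (\<Sum>k. (g k)^2)"
  by (rule suminf_le_const[OF s part])
qed

context interval
begin

lemma nrm_tendsto_mult:
 assumes h: "continuous_on {a..b} h" and L: "\<And>n. f n \<in> L2" "g \<in> L2"
  and lim: "(%n. nrm (%x. f n x - g x)) \<longlonglongrightarrow> 0"
 shows "(%n. nrm (%x. h x * f n x - h x * g x)) \<longlonglongrightarrow> 0"
proof -
 obtain B where B: "0 <= B" "\<And>x. x \<in> {a..b} ==> \<bar>h x\<bar> <= B"
  using continuous_bounded[OF h] by blast
 have m: "h \<in> borel_measurable M" by (rule L2_meas[OF continuous_L2[OF h]])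
 have le: "nrm (%x. h x * f n x - h x * g x) <= B * nrm (%x. f n x - g x)" for n
  unfolding right_diff_distrib[symmetric]
  by (rule nrm_bounded_mult[OF L2_diff[OF L] m _ B(1)]) (rule AE_I2, rule B(2), simp)
 have lim': "(%n. B * nrm (%x. f n x - g x)) \<longlonglongrightarrow> 0"
  using tendsto_mult_left[OF lim, of B] by simp
 show ?thesis by (rule Lim_null_comparison[OF _ lim']) (simp add: le)
qed

lemma nrm_tendsto_add:
 assumes L: "\<And>n. f n \<in> L2" "g \<in> L2" "\<And>n. f' n \<in> L2" "g' \<in> L2"
  and lim: "(%n. nrm (%x. f n x - g x)) \<longlonglongrightarrow> 0" "(%n. nrm (%x. f' n x - g' x)) \<longlonglongrightarrow> 0"
 shows "(%n. nrm (%x. (f n x + f' n x) - (g x + g' x))) \<longlonglongrightarrow> 0"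
proof -
 have le: "nrm (%x. (f n x + f' n x) - (g x + g' x)) <= nrm (%x. f n x - g x) + nrm (%x. f' n x - g' x)" for n
  using nrm_triangle[OF L2_diff[OF L(1,2)] L2_diff[OF L(3,4)], of n n] by (simp add: add_diff_add)
 have lim': "(%n. nrm (%x. f n x - g x) + nrm (%x. f' n x - g' x)) \<longlonglongrightarrow> 0"
  using tendsto_add[OF lim] by simp
 show ?thesis by (rule Lim_null_comparison[OF _ lim']) (simp add: le)
qed

text \<open>The product rule for a \<open>C\<^sup>1\<close> function and a limit of \<open>C\<^sup>1\<close> functions vanishing at the end
 points.\<close>

lemma product_rule_limit:
 assumes G: "\<And>x. x \<in> {a..b} ==> (G has_real_derivative G' x) (at x within {a..b})" "continuous_on {a..b} G'"
  and P: "\<And>n x. (P n has_real_derivative P' n x) (at x within {a..b})" "\<And>n. continuous_on {a..b} (P' n)"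
  and P0: "\<And>n. P n a = 0" "\<And>n. P n b = 0"
  and L: "f \<in> L2" "g \<in> L2"
  and lim: "(%n. nrm (%x. P n x - f x)) \<longlonglongrightarrow> 0" "(%n. nrm (%x. P' n x - g x)) \<longlonglongrightarrow> 0"
 shows "(%x. G' x * f x + G x * g x) \<in> L2"
  "has_weak_deriv I 1 (%x. G x * f x) (%x. G' x * f x + G x * g x)"
  "ip (%x. G' x * f x + G x * g x) (e k) = w k * ip (%x. G x * f x) (s k)"
proof -
 have cG: "continuous_on {a..b} G" by (rule DERIV_continuous_on[OF G(1)], simp)
 have cP: "continuous_on {a..b} (P n)" for n by (rule DERIV_continuous_on[OF P(1)])
 have PL: "P n \<in> L2" "P' n \<in> L2" for n
  by (rule continuous_L2[OF cP]) (rule continuous_L2[OF P(2)])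
 have Gf: "(%x. G x * f x) \<in> L2" "(%x. G' x * f x) \<in> L2" "(%x. G x * g x) \<in> L2"
  by (rule continuous_L2_mult[OF cG L(1)] continuous_L2_mult[OF G(2) L(1)] continuous_L2_mult[OF cG L(2)])+
 have GP: "(%x. G x * P n x) \<in> L2" "(%x. G' x * P n x) \<in> L2" "(%x. G x * P' n x) \<in> L2" for n
  by (rule continuous_L2_mult[OF cG PL(1)] continuous_L2_mult[OF G(2) PL(1)] continuous_L2_mult[OF cG PL(2)])+
 show Q: "(%x. G' x * f x + G x * g x) \<in> L2" by (rule L2_add[OF Gf(2,3)])
 have QP: "(%x. G' x * P n x + G x * P' n x) \<in> L2" for n by (rule L2_add[OF GP(2,3)])
 have l1: "(%n. nrm (%x. G x * P n x - G x * f x)) \<longlonglongrightarrow> 0"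
  by (rule nrm_tendsto_mult[OF cG PL(1) L(1) lim(1)])
 have l2: "(%n. nrm (%x. (G' x * P n x + G x * P' n x) - (G' x * f x + G x * g x))) \<longlonglongrightarrow> 0"
  by (rule nrm_tendsto_add[OF GP(2) Gf(2) GP(3) Gf(3) nrm_tendsto_mult[OF G(2) PL(1) L(1) lim(1)]
     nrm_tendsto_mult[OF cG PL(2) L(2) lim(2)]])
 have D: "((%x. G x * P n x) has_real_derivative G' x * P n x + G x * P' n x) (at x within {a..b})"
  if "x \<in> {a..b}" for n x
  using DERIV_mult[OF G(1)[OF that] P(1)] by (simp add: mult.commute add.commute)
 have cD: "continuous_on {a..b} (%x. G' x * P n x + G x * P' n x)" for n
  by (intro continuous_on_add continuous_on_mult cG G(2) cP P(2))
 show "has_weak_deriv I 1 (%x. G x * f x) (%x. G' x * f x + G x * g x)"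
  by (rule has_weak_deriv_limit[OF GP(1) QP Gf(1) Q l1 l2]) (rule weak_deriv_classical[OF D cD])
 have cs: "continuous_on {a..b} (%x. - w k * s k x)" by (intro continuous_on_mult continuous_on_const s_cont)
 have eqn: "ip (%x. G' x * P n x + G x * P' n x) (e k) = w k * ip (%x. G x * P n x) (s k)" for n
 proof -
  have "ip (%x. G x * P n x) (%x. - w k * s k x)
   = G b * P n b * e k b - G a * P n a * e k a - ip (%x. G' x * P n x + G x * P' n x) (e k)"
   by (rule integration_by_parts_C1[OF D e_DERIV cD cs])
  moreover have "ip (%x. G x * P n x) (%x. - w k * s k x) = - w k * ip (%x. G x * P n x) (s k)"
   by (simp only: ip_commute[of "%x. G x * P n x"] ip_scale_left)
  ultimately show ?thesis using P0 by simp
 qed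
 show "ip (%x. G' x * f x + G x * g x) (e k) = w k * ip (%x. G x * f x) (s k)"
 proof (rule LIMSEQ_unique)
  show "(%n. ip (%x. G' x * P n x + G x * P' n x) (e k)) \<longlonglongrightarrow> ip (%x. G' x * f x + G x * g x) (e k)"
   by (rule ip_tendsto[OF QP Q e_L2 l2])
  show "(%n. ip (%x. G' x * P n x + G x * P' n x) (e k)) \<longlonglongrightarrow> w k * ip (%x. G x * f x) (s k)"
   unfolding eqn by (rule tendsto_mult_left[OF ip_tendsto[OF GP(1) Gf(1) s_L2 l1]])
 qed
qed

text \<open>The constant \<open>\<Sum> w\<^sub>k\<^sup>-\<^sup>2\<close> in Cauchy-Schwarz estimates of \<open>\<Sum> |c\<^sub>k|\<close>; the mode \<open>k = 0\<close> contributes \<open>0\<close>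
 because division by zero yields zero.\<close>

definition Zw :: real where "Zw = (\<Sum>k. (1 / w k)^2)"

lemma summable_Zw: "summable (%k. (1 / w k)^2)"
 using summable_inverse_w_sq by (simp add: power_divide)

lemma Zw_nonneg: "0 <= Zw" unfolding Zw_def by (rule suminf_nonneg[OF summable_Zw]) simp

lemma nrm_sder_sq: "hs m c ==> j <= m ==> (nrm (sder j c))^2 = (\<Sum>k. (w k ^ j * c k)^2)"
 using nrm_sder_sums[of m c j] by (simp add: sums_iff)

lemma nrm_sder: "hs m c ==> j <= m ==> nrm (sder j c) = sqrt (\<Sum>k. (w k ^ j * c k)^2)"
 using real_sqrt_unique[OF nrm_sder_sq[of m c j] nrm_nonneg] by simp

lemma abs_sum_tail_le:
 assumes "hs (Suc m) c" "1 <= K"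
 shows "(\<Sum>k. \<bar>w (k + K) ^ m * c (k + K)\<bar>) <= sqrt (\<Sum>k. (1 / w (k + K))^2) * nrm (sder (Suc m) c)"
proof -
 let ?f = "%k. 1 / w (k + K)" and ?g = "%k. w (k + K) ^ Suc m * c (k + K)"
 have sf: "summable (%k. (?f k)^2)"
  using summable_Zw summable_iff_shift[of "%k. (1 / w k)^2" K] by blast
 have s0: "summable (%k. (w k ^ Suc m * c k)^2)" using assms(1) by (simp add: hs_def)
 have sg: "summable (%k. (?g k)^2)"
  using s0 summable_iff_shift[of "%k. (w k ^ Suc m * c k)^2" K] by blast
 have eq: "\<bar>?f k * ?g k\<bar> = \<bar>w (k + K) ^ m * c (k + K)\<bar>" for k
 proof -
  have "0 < w (k + K)" using assms(2) by (intro w_pos) simp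
  then show ?thesis by simp
 qed
 have "(\<Sum>k. \<bar>w (k + K) ^ m * c (k + K)\<bar>) <= sqrt (\<Sum>k. (?f k)^2) * sqrt (\<Sum>k. (?g k)^2)"
  using Cauchy_Schwarz_suminf(2)[OF sf sg] unfolding eq .
 also have "\<dots> <= sqrt (\<Sum>k. (?f k)^2) * nrm (sder (Suc m) c)"
 proof (rule mult_left_mono)
  have "(\<Sum>k. (?g k)^2) <= (\<Sum>k. (w k ^ Suc m * c k)^2)"
   using suminf_split_initial_segment[OF s0, of K] sum_nonneg[of "{..<K}" "%k. (w k ^ Suc m * c k)^2"] by simp
  then show "sqrt (\<Sum>k. (?g k)^2) <= nrm (sder (Suc m) c)"
   unfolding nrm_sder[OF assms(1) order_refl] by (rule real_sqrt_le_mono)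
  show "0 <= sqrt (\<Sum>k. (?f k)^2)" by (intro real_sqrt_ge_zero suminf_nonneg sf) simp
 qed
 finally show ?thesis .
qed

lemma abs_sum_le:
 assumes "hs (Suc m) c"
 shows "(\<Sum>k. \<bar>w k ^ m * c k\<bar>) <= \<bar>w 0 ^ m * c 0\<bar> + sqrt Zw * nrm (sder (Suc m) c)"
proof -
 have s: "summable (%k. \<bar>w k ^ m * c k\<bar>)" by (rule hs_abs_summable[OF assms])
 have "(\<Sum>k. \<bar>w k ^ m * c k\<bar>) = (\<Sum>k. \<bar>w (k + 1) ^ m * c (k + 1)\<bar>) + (\<Sum>k<1. \<bar>w k ^ m * c k\<bar>)"
  by (rule suminf_split_initial_segment[OF s])
 also have "\<dots> <= sqrt (\<Sum>k. (1 / w (k + 1))^2) * nrm (sder (Suc m) c) + \<bar>w 0 ^ m * c 0\<bar>"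
  using abs_sum_tail_le[OF assms, of 1] by simp
 also have "(\<Sum>k. (1 / w (k + 1))^2) = Zw"
  unfolding Zw_def using suminf_split_initial_segment[OF summable_Zw, of 1] by simp
 finally show ?thesis by simp
qed

lemma abs_coef_le_nrm:
 assumes "hs m c" "j <= m"
 shows "\<bar>w k ^ j * c k\<bar> <= nrm (sder j c)"
proof (rule power2_le_imp_le)
 have "(w k ^ j * c k)^2 = (\<Sum>k\<in>{k}. (w k ^ j * c k)^2)" by simp
 also have "\<dots> <= (\<Sum>k. (w k ^ j * c k)^2)"
  by (rule sum_le_suminf[OF hs_weight[OF assms]]) auto
 finally show "\<bar>w k ^ j * c k\<bar>\<^sup>2 <= (nrm (sder j c))^2" unfolding nrm_sder_sq[OF assms] by simp
qed simp

lemma abs_sum_interpolation: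
 assumes "hs 4 c" "1 <= K"
 shows "(\<Sum>k. \<bar>w k ^ 3 * c k\<bar>) <= real K * nrm (sder 3 c) + sqrt (\<Sum>k. (1 / w (k + K))^2) * nrm (sder 4 c)"
proof -
 have h: "hs (Suc 3) c" using assms(1) by simp
 have "(\<Sum>k. \<bar>w k ^ 3 * c k\<bar>) = (\<Sum>k. \<bar>w (k + K) ^ 3 * c (k + K)\<bar>) + (\<Sum>k<K. \<bar>w k ^ 3 * c k\<bar>)"
  by (rule suminf_split_initial_segment[OF hs_abs_summable[OF h]])
 moreover have "(\<Sum>k<K. \<bar>w k ^ 3 * c k\<bar>) <= (\<Sum>k<K. nrm (sder 3 c))"
  by (intro sum_mono abs_coef_le_nrm[OF assms(1)]) simp
 moreover have "(\<Sum>k. \<bar>w (k + K) ^ 3 * c (k + K)\<bar>) <= sqrt (\<Sum>k. (1 / w (k + K))^2) * nrm (sder 4 c)"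
  using abs_sum_tail_le[OF h assms(2)] by simp
 ultimately show ?thesis by simp
qed

lemma nrm_sder_mono:
 assumes "hs m c" "1 <= i" "i <= j" "j <= m"
 shows "w 1 ^ (j - i) * nrm (sder i c) <= nrm (sder j c)"
proof (rule power2_le_imp_le)
 have sj: "summable (%k. (w k ^ j * c k)^2)" and si: "summable (%k. (w k ^ i * c k)^2)"
  using hs_weight[OF assms(1)] assms by auto
 have "(w 1 ^ (j - i) * nrm (sder i c))^2 = (\<Sum>k. (w 1 ^ (j - i))^2 * (w k ^ i * c k)^2)"
  using nrm_sder_sq[OF assms(1), of i] assms suminf_mult[OF si] by (simp add: power_mult_distrib)
 also have "\<dots> <= (\<Sum>k. (w k ^ j * c k)^2)"
 proof (rule suminf_le[OF _ summable_mult[OF si] sj])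
  fix k
  show "(w 1 ^ (j - i))^2 * (w k ^ i * c k)^2 <= (w k ^ j * c k)^2"
  proof (cases "k = 0")
   case True
   have "i \<noteq> 0" "j \<noteq> 0" using assms by auto
   then show ?thesis using True by (simp add: power_0_left)
  next
   case False
   have "w 1 <= w k" using False by (intro w_ge_w1) simp
   then have "(w 1 ^ (j - i))^2 * (w k ^ i * c k)^2 <= (w k ^ (j - i))^2 * (w k ^ i * c k)^2"
    by (intro mult_right_mono power_mono) auto
   moreover have "w k ^ j = w k ^ (j - i) * w k ^ i" using assms(3) by (simp flip: power_add)
   ultimately show ?thesis by (simp add: power_mult_distrib mult.assoc)
  qed
 qed
 finally show "(w 1 ^ (j - i) * nrm (sder i c))^2 <= (nrm (sder j c))^2"
  unfolding nrm_sder_sq[OF assms(1) assms(4)] .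
qed simp

lemma sder_3: "sder 3 c = ser s (%k. w k ^ 3 * c k)"
 by (simp add: sder_def)

lemma sder_4: "sder 4 c = ser e (%k. w k ^ 4 * c k)"
 by (simp add: sder_def)

text \<open>Sine coefficients of the flux \<open>|y|\<^sup>\<beta> y\<^sub>x\<^sub>x\<^sub>x\<close>, and its spatial derivative.\<close>

definition flux :: "real => (nat => real) => real => real" where
 "flux \<beta> c x = \<bar>ser e c x\<bar> powr \<beta> * sder 3 c x"

definition flux_coef :: "real => (nat => real) => nat => real" where
 "flux_coef \<beta> c k = ip (flux \<beta> c) (s k)"

definition flux_x :: "real => (nat => real) => real => real" where
 "flux_x \<beta> c x = (\<beta> * ser e c x powr (\<beta> - 1) * sder 1 c x) * sder 3 c x + \<bar>ser e c x\<bar> powr \<beta> * sder 4 c x"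

context
 fixes \<beta> C0 R :: real and c :: "nat => real"
 assumes \<beta>: "1 <= \<beta>" and C0: "0 < C0" and c: "hs 4 c"
  and lower: "\<forall>x\<in>{a..b}. C0 <= ser e c x" and upper: "\<forall>x\<in>{a..b}. ser e c x <= R"
begin

lemma Y_cont: "continuous_on A (ser e c)"
 using sder_cont[OF c, of 0] by (simp add: sder_0)

lemma power_DERIV:
 assumes x: "x \<in> {a..b}"
 shows "((%x. \<bar>ser e c x\<bar> powr \<beta>) has_real_derivative \<beta> * ser e c x powr (\<beta> - 1) * sder 1 c x) (at x within {a..b})"
proof -
 have pos: "0 < ser e c y" if "y \<in> {a..b}" for y using lower that C0 by force
 have "(ser e c has_real_derivative sder 1 c x) (at x)"
  using sder_DERIV[OF c, of 0 x] by (simp add: sder_0)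
 from DERIV_fun_powr[OF this pos[OF x], of \<beta>]
 have "((%x. ser e c x powr \<beta>) has_real_derivative \<beta> * ser e c x powr (\<beta> - 1) * sder 1 c x) (at x)" by simp
 then have "((%x. ser e c x powr \<beta>) has_real_derivative \<beta> * ser e c x powr (\<beta> - 1) * sder 1 c x) (at x within {a..b})"
  by (rule has_field_derivative_at_within)
 then show ?thesis
 proof (rule has_field_derivative_transform_within[where d = 1])
  fix y assume "y \<in> {a..b}"
  from pos[OF this] show "ser e c y powr \<beta> = \<bar>ser e c y\<bar> powr \<beta>" by simp
 qed (use x in auto)
qed

lemma power_DERIV_cont: "continuous_on {a..b} (%x. \<beta> * ser e c x powr (\<beta> - 1) * sder 1 c x)"
proof -
 have "\<forall>x\<in>{a..b}. ser e c x \<noteq> 0" using lower C0 by force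
 then show ?thesis
  by (intro continuous_on_mult continuous_on_const continuous_on_powr Y_cont sder_cont[OF c]) auto
qed

lemma power_cont: "continuous_on {a..b} (%x. \<bar>ser e c x\<bar> powr \<beta>)"
 by (rule DERIV_continuous_on[OF power_DERIV])

lemma flux_x_facts:
 shows "flux_x \<beta> c \<in> L2" "has_weak_deriv I 1 (flux \<beta> c) (flux_x \<beta> c)"
  "ip (flux_x \<beta> c) (e k) = w k * flux_coef \<beta> c k"
proof -
 let ?q = "%k. w k ^ 3 * c k"
 have s3: "summable (%k. (?q k)^2)" and s4: "summable (%k. (w k * ?q k)^2)"
  using hs_weight[OF c, of 3] hs_weight[OF c, of 4] by (simp_all add: eval_nat_numeral mult.assoc)
 have e4: "sder 4 c = ser e (%k. w k * ?q k)" unfolding sder_4 by (simp add: eval_nat_numeral mult.assoc)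
 have P0: "psum s ?q n a = 0" "psum s ?q n b = 0" for n by (simp_all add: psum_def)
 have l3: "(%n. nrm (%x. psum s ?q n x - sder 3 c x)) \<longlonglongrightarrow> 0"
  unfolding sder_3 by (rule ser_L2_limit(2)[OF ons_s s3])
 have l4: "(%n. nrm (%x. psum e (%k. w k * ?q k) n x - sder 4 c x)) \<longlonglongrightarrow> 0"
  unfolding e4 by (rule ser_L2_limit(2)[OF ons_e s4])
 have L3: "sder 3 c \<in> L2" and L4: "sder 4 c \<in> L2"
  by (rule sder_L2[OF c], simp)+
 note rule = product_rule_limit[OF power_DERIV power_DERIV_cont psum_s_DERIV psum_cont[OF ons_e] P0 L3 L4 l3 l4]
 show "flux_x \<beta> c \<in> L2" unfolding flux_x_def[abs_def] by (rule rule(1))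
 show "has_weak_deriv I 1 (flux \<beta> c) (flux_x \<beta> c)"
  unfolding flux_x_def[abs_def] flux_def[abs_def] by (rule rule(2))
 show "ip (flux_x \<beta> c) (e k) = w k * flux_coef \<beta> c k"
  unfolding flux_x_def[abs_def] flux_coef_def flux_def[abs_def] by (rule rule(3))
qed

lemma flux_L2: "flux \<beta> c \<in> L2"
 unfolding flux_def[abs_def] by (rule continuous_L2_mult[OF power_cont sder_L2[OF c]]) simp

lemma flux_energy_sums: "(%k. w k ^ 3 * c k * flux_coef \<beta> c k) sums ip (sder 3 c) (flux \<beta> c)"
proof -
 have s3: "summable (%k. (w k ^ 3 * c k)^2)" by (rule hs_weight[OF c]) simp
 show ?thesis
  using ip_ser_sums[OF ons_s s3 flux_L2] unfolding sder_3 flux_coef_def ip_commute[of "flux \<beta> c"] .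
qed

lemma flux_x_energy_sums: "(%k. w k ^ 4 * c k * (w k * flux_coef \<beta> c k)) sums ip (sder 4 c) (flux_x \<beta> c)"
proof -
 have s4: "summable (%k. (w k ^ 4 * c k)^2)" by (rule hs_weight[OF c]) simp
 show ?thesis
  using ip_ser_sums[OF ons_e s4 flux_x_facts(1)]
  unfolding sder_4 flux_x_facts(3)[symmetric] ip_commute[of "flux_x \<beta> c"] .
qed

text \<open>Uniform parabolicity, from the state constraint alone.\<close>

lemma flux_energy_lower: "C0 powr \<beta> * (nrm (sder 3 c))^2 <= ip (sder 3 c) (flux \<beta> c)"
proof -
 have L3: "sder 3 c \<in> L2" by (rule sder_L2[OF c]) simp
 have "C0 powr \<beta> * (nrm (sder 3 c))^2 = (\<integral>x. C0 powr \<beta> * (sder 3 c x)^2 \<partial>M)"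
  by (simp add: nrm_sq')
 also have "\<dots> <= (\<integral>x. sder 3 c x * flux \<beta> c x \<partial>M)"
 proof (rule integral_mono)
  show "integrable M (%x. C0 powr \<beta> * (sder 3 c x)^2)" using L2_sq[OF L3] by simp
  show "integrable M (%x. sder 3 c x * flux \<beta> c x)" by (rule L2_mult_integrable[OF L3 flux_L2])
  fix x assume "x \<in> space M"
  then have "x \<in> {a..b}" by auto
  with lower have "C0 <= ser e c x" by blast
  then have "C0 powr \<beta> <= \<bar>ser e c x\<bar> powr \<beta>"
   using C0 \<beta> by (intro powr_mono2) auto
  then have "C0 powr \<beta> * (sder 3 c x)^2 <= \<bar>ser e c x\<bar> powr \<beta> * (sder 3 c x)^2"
   by (rule mult_right_mono) simp
  then show "C0 powr \<beta> * (sder 3 c x)^2 <= sder 3 c x * flux \<beta> c x"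
   by (simp add: flux_def power2_eq_square mult.left_commute)
 qed
 finally show ?thesis by (simp add: ip_def)
qed

lemma coefficient_bounds:
 assumes x: "x \<in> {a..b}"
 shows "\<bar>ser e c x\<bar> powr \<beta> <= R powr \<beta>" "C0 powr \<beta> <= \<bar>ser e c x\<bar> powr \<beta>"
  "0 <= \<beta> * ser e c x powr (\<beta> - 1)" "\<beta> * ser e c x powr (\<beta> - 1) <= \<beta> * R powr (\<beta> - 1)"
proof -
 have "C0 <= ser e c x" "ser e c x <= R" using lower upper x by auto
 then show "\<bar>ser e c x\<bar> powr \<beta> <= R powr \<beta>" "C0 powr \<beta> <= \<bar>ser e c x\<bar> powr \<beta>"
  "\<beta> * ser e c x powr (\<beta> - 1) <= \<beta> * R powr (\<beta> - 1)"
  using \<beta> C0 by (auto intro!: powr_mono2 mult_left_mono)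
 show "0 <= \<beta> * ser e c x powr (\<beta> - 1)" using \<beta> by simp
qed

definition flux_x_low :: "real => real" where
 "flux_x_low x = (\<beta> * ser e c x powr (\<beta> - 1) * sder 1 c x) * sder 3 c x"

lemma flux_x_low_L2: "flux_x_low \<in> L2"
 unfolding flux_x_low_def[abs_def] by (rule continuous_L2_mult[OF power_DERIV_cont sder_L2[OF c]]) simp

lemma flux_x_high_L2: "(%x. \<bar>ser e c x\<bar> powr \<beta> * sder 4 c x) \<in> L2"
 by (rule continuous_L2_mult[OF power_cont sder_L2[OF c]]) simp

lemma flux_x_split: "flux_x \<beta> c = (%x. flux_x_low x + \<bar>ser e c x\<bar> powr \<beta> * sder 4 c x)"
 by (simp add: fun_eq_iff flux_x_def flux_x_low_def)

lemma flux_x_low_bound: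
 "nrm flux_x_low <= (\<beta> * R powr (\<beta> - 1)) * (eb * (\<Sum>k. \<bar>w k ^ 3 * c k\<bar>)) * nrm (sder 1 c)"
proof -
 let ?\<sigma> = "eb * (\<Sum>k. \<bar>w k ^ 3 * c k\<bar>)"
 have L1: "sder 1 c \<in> L2" by (rule sder_L2[OF c]) simp
 have \<sigma>: "\<bar>sder 3 c x\<bar> <= ?\<sigma>" for x by (rule sder_sup_bound[OF c]) simp
 have \<sigma>0: "0 <= ?\<sigma>" using \<sigma>[of a] abs_ge_zero[of "sder 3 c a"] by linarith
 have B0: "0 <= \<beta> * R powr (\<beta> - 1)" using \<beta> by simp
 have "nrm flux_x_low <= nrm (%x. ((\<beta> * R powr (\<beta> - 1)) * ?\<sigma>) * sder 1 c x)"
 proof (rule nrm_mono[OF flux_x_low_L2 L2_scale[OF L1]], rule AE_I2)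
  fix x assume "x \<in> space M"
  then have x: "x \<in> {a..b}" by auto
  have "\<bar>flux_x_low x\<bar> = (\<beta> * ser e c x powr (\<beta> - 1)) * \<bar>sder 3 c x\<bar> * \<bar>sder 1 c x\<bar>"
   using coefficient_bounds(3)[OF x] \<beta> by (simp add: flux_x_low_def abs_mult)
  also have "\<dots> <= ((\<beta> * R powr (\<beta> - 1)) * ?\<sigma>) * \<bar>sder 1 c x\<bar>"
   by (intro mult_right_mono mult_mono coefficient_bounds(4)[OF x] \<sigma> B0) auto
  also have "\<dots> = \<bar>((\<beta> * R powr (\<beta> - 1)) * ?\<sigma>) * sder 1 c x\<bar>"
   using B0 \<sigma>0 unfolding abs_mult[of "(\<beta> * R powr (\<beta> - 1)) * ?\<sigma>"] by (simp only: abs_of_nonneg mult_nonneg_nonneg)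
  finally show "\<bar>flux_x_low x\<bar> <= \<bar>((\<beta> * R powr (\<beta> - 1)) * ?\<sigma>) * sder 1 c x\<bar>" .
 qed
 also have "\<dots> = ((\<beta> * R powr (\<beta> - 1)) * ?\<sigma>) * nrm (sder 1 c)"
  unfolding nrm_scale using mult_nonneg_nonneg[OF B0 \<sigma>0] by simp
 finally show ?thesis .
qed

lemma flux_x_upper:
 "nrm (flux_x \<beta> c) <= (R powr \<beta> + (\<beta> * R powr (\<beta> - 1)) * (eb * sqrt Zw) * nrm (sder 1 c)) * nrm (sder 4 c)"
proof -
 have L4: "sder 4 c \<in> L2" by (rule sder_L2[OF c]) simp
 have h: "hs (Suc 3) c" using c by simp
 have B0: "0 <= \<beta> * R powr (\<beta> - 1)" using \<beta> by simp
 have "nrm (flux_x \<beta> c) <= nrm flux_x_low + nrm (%x. \<bar>ser e c x\<bar> powr \<beta> * sder 4 c x)"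
  unfolding flux_x_split by (rule nrm_triangle[OF flux_x_low_L2 flux_x_high_L2])
 moreover have "nrm (%x. \<bar>ser e c x\<bar> powr \<beta> * sder 4 c x) <= R powr \<beta> * nrm (sder 4 c)"
  by (rule nrm_bounded_mult[OF L4 L2_meas[OF continuous_L2[OF power_cont]]])
    (use coefficient_bounds(1) in \<open>auto intro!: AE_I2\<close>)
 moreover have "nrm flux_x_low <= (\<beta> * R powr (\<beta> - 1)) * (eb * (sqrt Zw * nrm (sder 4 c))) * nrm (sder 1 c)"
 proof (rule order_trans[OF flux_x_low_bound], intro mult_right_mono mult_left_mono)
  show "(\<Sum>k. \<bar>w k ^ 3 * c k\<bar>) <= sqrt Zw * nrm (sder 4 c)"
   using abs_sum_le[OF h] by simp
 qed (use eb_pos B0 in auto)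
 ultimately show ?thesis by (simp add: algebra_simps)
qed

lemma flux_x_energy_lower:
 "C0 powr \<beta> * (nrm (sder 4 c))^2
   - (\<beta> * R powr (\<beta> - 1)) * (eb * (\<Sum>k. \<bar>w k ^ 3 * c k\<bar>)) * nrm (sder 1 c) * nrm (sder 4 c)
  <= ip (sder 4 c) (flux_x \<beta> c)"
proof -
 have L4: "sder 4 c \<in> L2" by (rule sder_L2[OF c]) simp
 have "ip (sder 4 c) (flux_x \<beta> c) = ip flux_x_low (sder 4 c) + ip (%x. \<bar>ser e c x\<bar> powr \<beta> * sder 4 c x) (sder 4 c)"
 proof -
  have "ip (sder 4 c) (flux_x \<beta> c) = ip (flux_x \<beta> c) (sder 4 c)" by (rule ip_commute)
  then show ?thesis
   unfolding flux_x_split ip_add_left[OF flux_x_low_L2 flux_x_high_L2 L4] .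
 qed
 moreover have "\<bar>ip flux_x_low (sder 4 c)\<bar>
   <= (\<beta> * R powr (\<beta> - 1)) * (eb * (\<Sum>k. \<bar>w k ^ 3 * c k\<bar>)) * nrm (sder 1 c) * nrm (sder 4 c)"
  by (rule order_trans[OF Cauchy_Schwarz_ip[OF flux_x_low_L2 L4] mult_right_mono[OF flux_x_low_bound nrm_nonneg]])
 moreover have "C0 powr \<beta> * (nrm (sder 4 c))^2 <= ip (%x. \<bar>ser e c x\<bar> powr \<beta> * sder 4 c x) (sder 4 c)"
 proof -
  have "C0 powr \<beta> * (nrm (sder 4 c))^2 = (\<integral>x. C0 powr \<beta> * (sder 4 c x)^2 \<partial>M)"
   by (simp add: nrm_sq')
  also have "\<dots> <= (\<integral>x. (\<bar>ser e c x\<bar> powr \<beta> * sder 4 c x) * sder 4 c x \<partial>M)"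
  proof (rule integral_mono)
   show "integrable M (%x. C0 powr \<beta> * (sder 4 c x)^2)" using L2_sq[OF L4] by simp
   show "integrable M (%x. (\<bar>ser e c x\<bar> powr \<beta> * sder 4 c x) * sder 4 c x)"
    by (rule L2_mult_integrable[OF flux_x_high_L2 L4])
   fix x assume "x \<in> space M"
   then have "C0 powr \<beta> <= \<bar>ser e c x\<bar> powr \<beta>" by (intro coefficient_bounds) auto
   from mult_right_mono[OF this, of "(sder 4 c x)^2"]
   show "C0 powr \<beta> * (sder 4 c x)^2 <= (\<bar>ser e c x\<bar> powr \<beta> * sder 4 c x) * sder 4 c x"
    by (simp add: power2_eq_square mult.assoc)
  qed
  finally show ?thesis by (simp add: ip_def)
 qed
 ultimately show ?thesis by linarith
qed

end

text \<open>The term with \<open>y\<^sub>x y\<^sub>x\<^sub>x\<^sub>x\<close> is of lower order: \<open>y\<^sub>x\<^sub>x\<^sub>x\<close> in the supremum norm interpolates between the \<open>L\<^sup>2\<close> norms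
 of \<open>y\<^sub>x\<^sub>x\<^sub>x\<close> and \<open>y\<^sub>x\<^sub>x\<^sub>x\<^sub>x\<close>, so half of the leading term absorbs it.  The constant \<open>A\<close> depends on the bounds
 \<open>C0\<close>, \<open>R\<close> and \<open>m\<close> but not on the state.\<close>

lemma flux_x_coercive:
 assumes \<beta>: "1 <= \<beta>" and C0: "0 < C0"
 obtains A where "0 <= A"
  "\<forall>c. hs 4 c --> (\<forall>x\<in>{a..b}. C0 <= ser e c x) --> (\<forall>x\<in>{a..b}. ser e c x <= R) --> nrm (sder 1 c) <= m -->
    C0 powr \<beta> / 2 * (nrm (sder 4 c))^2 - A * (nrm (sder 3 c))^2 <= ip (sder 4 c) (flux_x \<beta> c)"
proof -
 define \<kappa> where "\<kappa> = C0 powr \<beta>"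
 define D where "D = (\<beta> * R powr (\<beta> - 1)) * eb * \<bar>m\<bar>"
 have \<kappa>: "0 < \<kappa>" using C0 by (simp add: \<kappa>_def)
 have D: "0 <= D" using \<beta> eb_pos by (simp add: D_def)
 have lim: "(%K. sqrt (\<Sum>k. (1 / w (k + K))^2)) \<longlonglongrightarrow> 0"
  using tendsto_real_sqrt[OF tail_tendsto_0[OF summable_Zw]] by simp
 have "\<forall>\<^sub>F K in sequentially. sqrt (\<Sum>k. (1 / w (k + K))^2) < \<kappa> / (4 * (D + 1))"
  using lim \<kappa> D by (intro order_tendstoD(2)) auto
 then obtain K0 where K0: "\<And>K. K \<ge> K0 ==> sqrt (\<Sum>k. (1 / w (k + K))^2) < \<kappa> / (4 * (D + 1))"
  unfolding eventually_sequentially by blast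
 define K where "K = Suc K0"
 define \<tau> where "\<tau> = sqrt (\<Sum>k. (1 / w (k + K))^2)"
 have "\<tau> < \<kappa> / (4 * (D + 1))" unfolding \<tau>_def by (rule K0) (simp add: K_def)
 then have "(D + 1) * \<tau> <= \<kappa> / 4" using D by (simp add: field_simps)
 moreover have "0 <= \<tau>" unfolding \<tau>_def
  by (intro real_sqrt_ge_zero suminf_nonneg) (use summable_Zw summable_iff_shift[of "%k. (1 / w k)^2" K] in auto)
 ultimately have D\<tau>: "D * \<tau> <= \<kappa> / 4" by (simp add: algebra_simps)
 define A where "A = (D * real K)^2 / \<kappa>"
 show thesis
 proof (rule that[of A], simp add: A_def \<kappa> less_imp_le, intro allI impI)
  fix c assume c: "hs 4 c" and lo: "\<forall>x\<in>{a..b}. C0 <= ser e c x" and up: "\<forall>x\<in>{a..b}. ser e c x <= R"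
   and m: "nrm (sder 1 c) <= m"
  define n3 n4 where "n3 = nrm (sder 3 c)" and "n4 = nrm (sder 4 c)"
  have n: "0 <= n3" "0 <= n4" by (simp_all add: n3_def n4_def)
  have B0: "0 <= \<beta> * R powr (\<beta> - 1)" using \<beta> by simp
  have S: "(\<Sum>k. \<bar>w k ^ 3 * c k\<bar>) <= real K * n3 + \<tau> * n4"
   unfolding n3_def n4_def \<tau>_def by (rule abs_sum_interpolation[OF c]) (simp add: K_def)
  have S0: "0 <= (\<Sum>k. \<bar>w k ^ 3 * c k\<bar>)"
   by (intro suminf_nonneg hs_abs[OF c]) auto
  have "(\<beta> * R powr (\<beta> - 1)) * (eb * (\<Sum>k. \<bar>w k ^ 3 * c k\<bar>)) * nrm (sder 1 c)
    <= (\<beta> * R powr (\<beta> - 1)) * (eb * (real K * n3 + \<tau> * n4)) * \<bar>m\<bar>"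
   using S S0 B0 eb_pos m \<beta> by (intro mult_mono mult_left_mono mult_nonneg_nonneg) auto
  also have "\<dots> = D * (real K * n3 + \<tau> * n4)" by (simp add: D_def)
  finally have "(\<beta> * R powr (\<beta> - 1)) * (eb * (\<Sum>k. \<bar>w k ^ 3 * c k\<bar>)) * nrm (sder 1 c) * n4
    <= D * (real K * n3 + \<tau> * n4) * n4"
   by (rule mult_right_mono[OF _ n(2)])
  also have "\<dots> = D * real K * n3 * n4 + D * \<tau> * n4^2" by (simp add: algebra_simps power2_eq_square)
  also have "D * \<tau> * n4^2 <= \<kappa> / 4 * n4^2" by (intro mult_right_mono D\<tau>) simp
  also have "D * real K * n3 * n4 <= A * n3^2 + \<kappa> / 4 * n4^2"
  proof -
   have "0 <= (D * real K * n3 - \<kappa> / 2 * n4)^2 / \<kappa>" using \<kappa> by simp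
   also have "\<dots> = A * n3^2 + \<kappa> / 4 * n4^2 - D * real K * n3 * n4"
    using \<kappa> by (simp add: A_def power2_diff power_mult_distrib field_simps power2_eq_square)
   finally show ?thesis by simp
  qed
  finally have "(\<beta> * R powr (\<beta> - 1)) * (eb * (\<Sum>k. \<bar>w k ^ 3 * c k\<bar>)) * nrm (sder 1 c) * n4
    <= A * n3^2 + \<kappa> / 2 * n4^2" by simp
  with flux_x_energy_lower[OF \<beta> C0 c lo up]
  show "C0 powr \<beta> / 2 * (nrm (sder 4 c))^2 - A * (nrm (sder 3 c))^2 <= ip (sder 4 c) (flux_x \<beta> c)"
   unfolding n3_def n4_def \<kappa>_def by linarith
 qed
qed

lemma powr_Lipschitz:
 assumes "0 < x" "x <= R" "0 < y" "y <= R" "1 <= (\<beta>::real)"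
 shows "\<bar>x powr \<beta> - y powr \<beta>\<bar> <= \<beta> * R powr (\<beta> - 1) * \<bar>x - y\<bar>"
proof -
 have *: "\<bar>x powr \<beta> - y powr \<beta>\<bar> <= \<beta> * R powr (\<beta> - 1) * \<bar>x - y\<bar>" if "0 < x" "x < y" "y <= R" for x y
 proof -
  have "\<exists>z. x < z \<and> z < y \<and> y powr \<beta> - x powr \<beta> = (y - x) * (\<beta> * z powr (\<beta> - 1))"
  proof (rule MVT2[OF that(2)])
   fix t assume "x <= t" "t <= y"
   then show "((%t. t powr \<beta>) has_real_derivative \<beta> * t powr (\<beta> - 1)) (at t)"
    using that by (intro has_real_derivative_powr) simp
  qed
  then obtain z where z: "x < z" "z < y" "y powr \<beta> - x powr \<beta> = (y - x) * (\<beta> * z powr (\<beta> - 1))" by blast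
  have "z powr (\<beta> - 1) <= R powr (\<beta> - 1)" using z that assms(5) by (intro powr_mono2) auto
  then have "(y - x) * (\<beta> * z powr (\<beta> - 1)) <= (y - x) * (\<beta> * R powr (\<beta> - 1))"
   using that assms(5) by (intro mult_left_mono) auto
  moreover have "0 <= (y - x) * (\<beta> * z powr (\<beta> - 1))" using that assms(5) by simp
  moreover have "\<bar>x powr \<beta> - y powr \<beta>\<bar> = \<bar>y powr \<beta> - x powr \<beta>\<bar>" by (rule abs_minus_commute)
  moreover have "\<bar>x - y\<bar> = y - x" using that by simp
  ultimately show ?thesis using z(3) by (simp add: mult.commute)
 qed
 consider "x < y" | "x = y" | "y < x" by linarith
 then show ?thesis
 proof cases
  case 1
  then show ?thesis by (rule *[OF assms(1) _ assms(4)])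
 next
  case 3
  from *[OF assms(3) this assms(2)] show ?thesis by (simp only: abs_minus_commute)
 qed simp
qed

lemma ser_diff:
 assumes "ons p \<nu>" "summable (%k. \<bar>c k\<bar>)" "summable (%k. \<bar>d k\<bar>)"
 shows "ser p c x - ser p d x = ser p (%k. c k - d k) x"
proof -
 have "summable (%k. \<bar>c k - d k\<bar>)"
  by (rule summable_comparison_test'[OF summable_add[OF assms(2,3)], of 0]) auto
 then show ?thesis
  using suminf_diff[OF ons_summable[OF assms(1,2)] ons_summable[OF assms(1,3)], of x x] assms
  by (simp add: ser_def left_diff_distrib)
qed

lemma sder_diff:
 assumes "hs m c" "hs m d" "j < m"
 shows "sder j c x - sder j d x = sder j (%k. c k - d k) x"
proof -
 have 1: "summable (%k. \<bar>(-1) ^ i * w k ^ j * c k\<bar>)" "summable (%k. \<bar>(-1) ^ i * w k ^ j * d k\<bar>)" for i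
  using hs_abs[OF assms(1,3)] hs_abs[OF assms(2,3)] by (simp_all add: abs_mult power_abs)
 show ?thesis
  using ser_diff[OF ons_e 1(1)[of "j div 2"] 1(2)[of "j div 2"], of x]
   ser_diff[OF ons_s 1(1)[of "Suc j div 2"] 1(2)[of "Suc j div 2"], of x]
  unfolding sder_def right_diff_distrib by (cases "even j") (simp_all only: if_True if_False simp_thms)
qed

lemma ser_near:
 assumes c: "hs 4 c" and d: "hs 4 d" and c0: "c 0 = d 0"
 shows "\<bar>ser e c x - ser e d x\<bar> <= eb * (sqrt Zw / (w 1)^2 * nrm (sder 3 (%k. c k - d k)))"
proof -
 let ?h = "%k. c k - d k"
 have h: "hs 4 ?h" by (rule hs_diff[OF c d])
 have w1: "0 < w 1" by (rule w_pos) simp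
 have h1: "hs (Suc 0) ?h" by (rule hs_mono[OF h]) simp
 have "ser e c x - ser e d x = sder 0 ?h x" using sder_diff[OF c d, of 0 x] by (simp add: sder_0)
 then have "\<bar>ser e c x - ser e d x\<bar> <= eb * (\<Sum>k. \<bar>w k ^ 0 * ?h k\<bar>)"
  using sder_sup_bound[OF h, of 0 x] by simp
 also have "\<dots> <= eb * (sqrt Zw * nrm (sder 1 ?h))"
  using abs_sum_le[OF h1] c0 eb_pos by (intro mult_left_mono) auto
 also have "\<dots> <= eb * (sqrt Zw * (nrm (sder 3 ?h) / (w 1)^2))"
 proof -
  have "w 1 ^ (3 - 1) * nrm (sder 1 ?h) <= nrm (sder 3 ?h)" by (rule nrm_sder_mono[OF h]) auto
  then have "nrm (sder 1 ?h) <= nrm (sder 3 ?h) / (w 1)^2" using w1 by (simp add: field_simps)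
  then show ?thesis using eb_pos Zw_nonneg by (intro mult_left_mono) auto
 qed
 finally show ?thesis by simp
qed

text \<open>The difference of two fluxes splits into one part with the difference of the third derivatives and one with
 the difference of the powers; the latter is estimated in the supremum norm, which the norm of the third
 derivative controls because the zeroth modes agree.\<close>

lemma flux_coef_Lipschitz:
 assumes \<beta>: "1 <= \<beta>" and C0: "0 < C0" and c: "hs 4 c" and d: "hs 4 d" and c0: "c 0 = d 0"
  and lc: "\<forall>x\<in>{a..b}. C0 <= ser e c x" and uc: "\<forall>x\<in>{a..b}. ser e c x <= R"
  and ld: "\<forall>x\<in>{a..b}. C0 <= ser e d x" and ud: "\<forall>x\<in>{a..b}. ser e d x <= R"
 shows "\<bar>flux_coef \<beta> c k - flux_coef \<beta> d k\<bar> \<le>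
  (R powr \<beta> + \<beta> * R powr (\<beta> - 1) * (eb * (sqrt Zw / (w 1)^2)) * nrm (sder 3 d)) * nrm (sder 3 (%k. c k - d k))"
proof -
 let ?h = "%k. c k - d k"
 let ?G = "%x. \<bar>ser e c x\<bar> powr \<beta>" and ?H = "%x. \<bar>ser e d x\<bar> powr \<beta>"
 define D where "D = nrm (sder 3 ?h)"
 have h: "hs 4 ?h" by (rule hs_diff[OF c d])
 have w1: "0 < w 1" by (rule w_pos) simp
 have L: "sder 3 c \<in> L2" "sder 3 d \<in> L2" "sder 3 ?h \<in> L2"
  by (rule sder_L2[OF c], simp) (rule sder_L2[OF d], simp, rule sder_L2[OF h], simp)
 have B0: "0 <= \<beta> * R powr (\<beta> - 1)" using \<beta> by simp
 have near: "\<bar>ser e c x - ser e d x\<bar> <= eb * (sqrt Zw / (w 1)^2 * D)" for x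
  unfolding D_def by (rule ser_near[OF c d c0])
 have mG: "?G \<in> borel_measurable M" "?H \<in> borel_measurable M"
  by (rule L2_meas[OF continuous_L2[OF power_cont[OF \<beta> C0 c lc uc]]])
    (rule L2_meas[OF continuous_L2[OF power_cont[OF \<beta> C0 d ld ud]]])
 have bG: "\<bar>?G x\<bar> <= R powr \<beta>" if "x \<in> {a..b}" for x
  using coefficient_bounds(1)[OF \<beta> C0 c lc uc that] by simp
 have bGH: "\<bar>?G x - ?H x\<bar> <= \<beta> * R powr (\<beta> - 1) * (eb * (sqrt Zw / (w 1)^2 * D))" if x: "x \<in> {a..b}" for x
 proof -
  have p: "0 < ser e c x" "ser e c x <= R" "0 < ser e d x" "ser e d x <= R"
   using lc uc ld ud x C0 by force+
  have "\<bar>?G x - ?H x\<bar> <= \<beta> * R powr (\<beta> - 1) * \<bar>ser e c x - ser e d x\<bar>"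
   using powr_Lipschitz[OF p \<beta>] p by simp
  also have "\<dots> <= \<beta> * R powr (\<beta> - 1) * (eb * (sqrt Zw / (w 1)^2 * D))"
   by (rule mult_left_mono[OF near B0])
  finally show ?thesis .
 qed
 have L1: "(%x. ?G x * sder 3 ?h x) \<in> L2"
  by (rule continuous_L2_mult[OF power_cont[OF \<beta> C0 c lc uc] L(3)])
 have L2: "(%x. (?G x - ?H x) * sder 3 d x) \<in> L2"
  by (rule continuous_L2_mult[OF continuous_on_diff[OF power_cont[OF \<beta> C0 c lc uc] power_cont[OF \<beta> C0 d ld ud]] L(2)])
 have eq: "(%x. flux \<beta> c x - flux \<beta> d x) = (%x. ?G x * sder 3 ?h x + (?G x - ?H x) * sder 3 d x)"
 proof
  fix x
  have eq: "sder 3 ?h x = sder 3 c x - sder 3 d x" using sder_diff[OF c d, of 3 x] by simp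
  show "flux \<beta> c x - flux \<beta> d x = ?G x * sder 3 ?h x + (?G x - ?H x) * sder 3 d x"
   unfolding flux_def eq by (simp add: algebra_simps)
 qed
 have "flux_coef \<beta> c k - flux_coef \<beta> d k = ip (%x. flux \<beta> c x - flux \<beta> d x) (s k)"
  unfolding flux_coef_def
  by (rule ip_diff_left[OF flux_L2[OF \<beta> C0 c lc uc] flux_L2[OF \<beta> C0 d ld ud] s_L2, symmetric])
 moreover have "\<bar>ip (%x. flux \<beta> c x - flux \<beta> d x) (s k)\<bar> <= nrm (%x. flux \<beta> c x - flux \<beta> d x) * nrm (s k)"
  by (rule Cauchy_Schwarz_ip[OF L2_diff[OF flux_L2[OF \<beta> C0 c lc uc] flux_L2[OF \<beta> C0 d ld ud]] s_L2])
 moreover have "nrm (s k) <= 1"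
 proof -
  have "ip (s k) (s k) = nu_s k" using ons_s by (simp add: ons_def)
  then have "(nrm (s k))^2 <= 1^2" unfolding nrm_sq by (simp add: nu_s_def)
  then show ?thesis by (rule power2_le_imp_le) simp
 qed
 moreover have "nrm (%x. flux \<beta> c x - flux \<beta> d x) * nrm (s k) <= nrm (%x. flux \<beta> c x - flux \<beta> d x) * 1"
  by (rule mult_left_mono[OF calculation(3)]) simp
 moreover have "nrm (%x. flux \<beta> c x - flux \<beta> d x)
   <= nrm (%x. ?G x * sder 3 ?h x) + nrm (%x. (?G x - ?H x) * sder 3 d x)"
  unfolding eq by (rule nrm_triangle[OF L1 L2])
 moreover have "nrm (%x. ?G x * sder 3 ?h x) <= R powr \<beta> * D"
  unfolding D_def by (rule nrm_bounded_mult[OF L(3) mG(1)]) (use bG in \<open>auto intro!: AE_I2\<close>)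
 moreover have "nrm (%x. (?G x - ?H x) * sder 3 d x)
   <= (\<beta> * R powr (\<beta> - 1) * (eb * (sqrt Zw / (w 1)^2 * D))) * nrm (sder 3 d)"
 proof (rule nrm_bounded_mult[OF L(2)])
  show "(%x. ?G x - ?H x) \<in> borel_measurable M" using mG by (rule borel_measurable_diff)
  show "AE x in M. \<bar>?G x - ?H x\<bar> <= \<beta> * R powr (\<beta> - 1) * (eb * (sqrt Zw / (w 1)^2 * D))"
   by (rule AE_I2, rule bGH) auto
  show "0 <= \<beta> * R powr (\<beta> - 1) * (eb * (sqrt Zw / (w 1)^2 * D))"
   using \<beta> eb_pos Zw_nonneg by (intro mult_nonneg_nonneg) (auto simp: D_def)
 qed
 ultimately have "\<bar>flux_coef \<beta> c k - flux_coef \<beta> d k\<bar> <= R powr \<beta> * D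
   + (\<beta> * R powr (\<beta> - 1) * (eb * (sqrt Zw / (w 1)^2 * D))) * nrm (sder 3 d)"
  by linarith
 also have "\<dots> = (R powr \<beta> + \<beta> * R powr (\<beta> - 1) * (eb * (sqrt Zw / (w 1)^2)) * nrm (sder 3 d)) * D"
  by (simp add: algebra_simps)
 finally show ?thesis unfolding D_def .
qed

end

section \<open>A priori estimates for coefficient functions\<close>

lemma abs_mult_le_squares: "\<bar>x * y\<bar> <= x^2 + (y::real)^2"
proof -
 have "0 <= (\<bar>x\<bar> - \<bar>y\<bar>)^2" by simp
 then have "2 * (\<bar>x\<bar> * \<bar>y\<bar>) <= x^2 + y^2" by (simp add: power2_diff)
 moreover have "0 <= \<bar>x\<bar> * \<bar>y\<bar>" by simp
 ultimately show ?thesis unfolding abs_mult by linarith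
qed

text \<open>Young's inequality.\<close>

lemma mult_le_weighted_squares:
 assumes "0 < (\<kappa>::real)"
 shows "x * y <= \<kappa> * x^2 + y^2 / (4 * \<kappa>)"
proof -
 have "0 <= (2 * \<kappa> * x - y)^2 / (4 * \<kappa>)" using assms by simp
 also have "\<dots> = \<kappa> * x^2 + y^2 / (4 * \<kappa>) - x * y"
  using assms by (simp add: power2_diff field_simps power2_eq_square)
 finally show ?thesis by simp
qed

context interval
begin

lemma series_CS:
 assumes "hs 4 c" "1 <= j" "j <= 4" "summable (%k. (v k)^2)"
 shows "summable (%k. w k ^ j * c k * v k)"
  "(\<Sum>k. w k ^ j * c k * v k) <= nrm (sder j c) * sqrt (\<Sum>k. (v k)^2)"
proof -
 have sj: "summable (%k. (w k ^ j * c k)^2)" using hs_weight[OF assms(1)] assms by simp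
 note CS = Cauchy_Schwarz_suminf[OF sj assms(4)]
 show "summable (%k. w k ^ j * c k * v k)" by (rule summable_rabs_cancel[OF CS(1)])
 have "(\<Sum>k. w k ^ j * c k * v k) <= \<bar>\<Sum>k. w k ^ j * c k * v k\<bar>" by simp
 also have "\<dots> <= (\<Sum>k. \<bar>w k ^ j * c k * v k\<bar>)" by (rule summable_rabs[OF CS(1)])
 also have "\<dots> <= nrm (sder j c) * sqrt (\<Sum>k. (v k)^2)"
  using CS(2) nrm_sder[OF assms(1,3)] by simp
 finally show "(\<Sum>k. w k ^ j * c k * v k) <= nrm (sder j c) * sqrt (\<Sum>k. (v k)^2)" .
qed

text \<open>Testing the equation with \<open>y\<^sub>x\<^sub>x\<close>: the flux term dissipates \<open>y\<^sub>x\<^sub>x\<^sub>x\<close>, and half of this absorbs the control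
 after \<open>\<parallel>y\<^sub>x\<^sub>x\<parallel> \<le> \<parallel>y\<^sub>x\<^sub>x\<^sub>x\<parallel> / w\<^sub>1\<close>.\<close>

lemma energy_dissipation:
 assumes \<beta>: "1 <= \<beta>" and C0: "0 < C0" and lam: "0 < lam" and c: "hs 4 c"
  and lo: "\<forall>x\<in>{a..b}. C0 <= ser e c x" and up: "\<forall>x\<in>{a..b}. ser e c x <= R"
  and v: "summable (%k. (v k)^2)" and d: "\<forall>k. d k = v k - lam * (w k * flux_coef \<beta> c k)"
 shows "(\<Sum>k. (w k)^2 * c k * d k) <= - (lam * C0 powr \<beta> / 2) * (nrm (sder 3 c))^2
  + 1 / (2 * lam * C0 powr \<beta> * (w 1)^2) * (\<Sum>k. (v k)^2)"
proof -
 define \<kappa> where "\<kappa> = lam * C0 powr \<beta>"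
 have \<kappa>: "0 < \<kappa>" using lam C0 by (simp add: \<kappa>_def)
 have w1: "0 < w 1" by (rule w_pos) simp
 define V where "V = sqrt (\<Sum>k. (v k)^2)"
 have V: "V^2 = (\<Sum>k. (v k)^2)" unfolding V_def by (rule real_sqrt_pow2, rule suminf_nonneg[OF v]) simp
 have V0: "0 <= V" unfolding V_def by (intro real_sqrt_ge_zero suminf_nonneg[OF v]) simp
 note s2 = series_CS[OF c, of 2, simplified, OF v]
 note fl = flux_energy_sums[OF \<beta> C0 c lo up]
 have eq: "(w k)^2 * c k * d k = (w k)^2 * c k * v k - lam * (w k ^ 3 * c k * flux_coef \<beta> c k)" for k
  using d by (simp add: right_diff_distrib eval_nat_numeral)
 have "(\<Sum>k. (w k)^2 * c k * d k) = (\<Sum>k. (w k)^2 * c k * v k) - lam * ip (sder 3 c) (flux \<beta> c)"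
  unfolding eq using suminf_diff[OF s2(1) summable_mult[OF sums_summable[OF fl], of lam]]
   suminf_mult[OF sums_summable[OF fl], of lam] sums_unique[OF fl] by simp
 moreover have "lam * (C0 powr \<beta> * (nrm (sder 3 c))^2) <= lam * ip (sder 3 c) (flux \<beta> c)"
  using flux_energy_lower[OF \<beta> C0 c lo up] lam by (intro mult_left_mono) auto
 moreover have "(\<Sum>k. (w k)^2 * c k * v k) <= nrm (sder 3 c) * (V / w 1)"
 proof -
  have "w 1 ^ (3 - 2) * nrm (sder 2 c) <= nrm (sder 3 c)" by (rule nrm_sder_mono[OF c]) auto
  then have "w 1 * nrm (sder 2 c) <= nrm (sder 3 c)" by simp
  then have "nrm (sder 2 c) <= nrm (sder 3 c) / w 1" using w1 by (simp add: field_simps)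
  from mult_right_mono[OF this V0] s2(2) show ?thesis by (simp add: V_def)
 qed
 moreover have "nrm (sder 3 c) * (V / w 1) <= \<kappa> / 2 * (nrm (sder 3 c))^2 + (V / w 1)^2 / (4 * (\<kappa> / 2))"
  by (rule mult_le_weighted_squares) (use \<kappa> in simp)
 moreover have "(V / w 1)^2 / (4 * (\<kappa> / 2)) = 1 / (2 * lam * C0 powr \<beta> * (w 1)^2) * (\<Sum>k. (v k)^2)"
  unfolding V[symmetric] by (simp add: \<kappa>_def power_divide mult.assoc mult.left_commute)
 moreover have "- (lam * C0 powr \<beta> / 2) * (nrm (sder 3 c))^2 = \<kappa> / 2 * (nrm (sder 3 c))^2 - lam * (C0 powr \<beta> * (nrm (sder 3 c))^2)"
  by (simp add: \<kappa>_def)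
 ultimately show ?thesis by linarith
qed

text \<open>Testing the equation with \<open>y\<^sub>x\<^sub>x\<^sub>x\<^sub>x\<close>; the coercivity of the differentiated flux is a hypothesis so that its
 constant can be fixed once for all times.\<close>

lemma second_order_dissipation:
 assumes \<beta>: "1 <= \<beta>" and C0: "0 < C0" and lam: "0 < lam" and c: "hs 4 c"
  and lo: "\<forall>x\<in>{a..b}. C0 <= ser e c x" and up: "\<forall>x\<in>{a..b}. ser e c x <= R"
  and v: "summable (%k. (v k)^2)" and d: "\<forall>k. d k = v k - lam * (w k * flux_coef \<beta> c k)"
  and coer: "C0 powr \<beta> / 2 * (nrm (sder 4 c))^2 - A * (nrm (sder 3 c))^2 <= ip (sder 4 c) (flux_x \<beta> c)"
 shows "(\<Sum>k. w k ^ 4 * c k * d k) <= - (lam * C0 powr \<beta> / 4) * (nrm (sder 4 c))^2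
  + lam * A * (nrm (sder 3 c))^2 + 1 / (lam * C0 powr \<beta>) * (\<Sum>k. (v k)^2)"
proof -
 define \<kappa> where "\<kappa> = lam * C0 powr \<beta>"
 have \<kappa>: "0 < \<kappa>" using lam C0 by (simp add: \<kappa>_def)
 define V where "V = sqrt (\<Sum>k. (v k)^2)"
 have V: "V^2 = (\<Sum>k. (v k)^2)" unfolding V_def by (rule real_sqrt_pow2, rule suminf_nonneg[OF v]) simp
 note s4 = series_CS[OF c, of 4, simplified, OF v]
 note fl = flux_x_energy_sums[OF \<beta> C0 c lo up]
 have eq: "w k ^ 4 * c k * d k = w k ^ 4 * c k * v k - lam * (w k ^ 4 * c k * (w k * flux_coef \<beta> c k))" for k
  using d by (simp add: right_diff_distrib mult.left_commute)
 have f1: "(\<Sum>k. w k ^ 4 * c k * d k) = (\<Sum>k. w k ^ 4 * c k * v k) - lam * ip (sder 4 c) (flux_x \<beta> c)"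
  unfolding eq using suminf_diff[OF s4(1) summable_mult[OF sums_summable[OF fl], of lam]]
   suminf_mult[OF sums_summable[OF fl], of lam] sums_unique[OF fl] by simp
 have f2: "lam * (C0 powr \<beta> / 2 * (nrm (sder 4 c))^2 - A * (nrm (sder 3 c))^2) <= lam * ip (sder 4 c) (flux_x \<beta> c)"
  using coer lam by (intro mult_left_mono) auto
 have f3: "(\<Sum>k. w k ^ 4 * c k * v k) <= nrm (sder 4 c) * V"
  using s4(2) by (simp add: V_def)
 have f4: "nrm (sder 4 c) * V <= \<kappa> / 4 * (nrm (sder 4 c))^2 + V^2 / (4 * (\<kappa> / 4))"
  by (rule mult_le_weighted_squares) (use \<kappa> in simp)
 have f5: "V^2 / (4 * (\<kappa> / 4)) = 1 / (lam * C0 powr \<beta>) * (\<Sum>k. (v k)^2)"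
  unfolding V[symmetric] by (simp add: \<kappa>_def)
 have f6: "lam * (C0 powr \<beta> / 2 * (nrm (sder 4 c))^2 - A * (nrm (sder 3 c))^2)
   = \<kappa> / 2 * (nrm (sder 4 c))^2 - lam * A * (nrm (sder 3 c))^2"
  by (simp add: \<kappa>_def right_diff_distrib)
 have arith: "S <= - (\<kappa> / 4) * X + L + Z"
  if "S = P - Q" "F <= Q" "P <= N" "N <= \<kappa> / 4 * X + Z'" "Z' = Z" "F = \<kappa> / 2 * X - L" for S P Q X L F N Z Z' :: real
  using that by (simp add: field_simps)
 show ?thesis using arith[OF f1 f2 f3 f4 f5 f6] unfolding \<kappa>_def .
qed

lemma flux_x_partial_sums:
 assumes \<beta>: "1 <= \<beta>" and C0: "0 < C0" and c: "hs 4 c"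
  and lo: "\<forall>x\<in>{a..b}. C0 <= ser e c x" and up: "\<forall>x\<in>{a..b}. ser e c x <= R" and m: "nrm (sder 1 c) <= m"
 shows "(\<Sum>k<n. (w k * flux_coef \<beta> c k)^2)
  <= (R powr \<beta> + (\<beta> * R powr (\<beta> - 1)) * (eb * sqrt Zw) * m)^2 * (nrm (sder 4 c))^2"
proof -
 let ?q = "\<beta> * R powr (\<beta> - 1) * (eb * sqrt Zw)"
 have q: "0 <= ?q" using \<beta> eb_pos Zw_nonneg by (intro mult_nonneg_nonneg) auto
 have "(\<Sum>k<n. (w k * flux_coef \<beta> c k)^2) = (\<Sum>k<n. (ip (flux_x \<beta> c) (e k))^2)"
  unfolding flux_x_facts(3)[OF \<beta> C0 c lo up] ..
 also have "\<dots> <= (nrm (flux_x \<beta> c))^2" by (rule Bessel[OF flux_x_facts(1)[OF \<beta> C0 c lo up]])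
 also have "\<dots> <= ((R powr \<beta> + ?q * m) * nrm (sder 4 c))^2"
 proof (rule power_mono[OF _ nrm_nonneg])
  have "?q * nrm (sder 1 c) <= ?q * m" by (rule mult_left_mono[OF m q])
  then have "(R powr \<beta> + ?q * nrm (sder 1 c)) * nrm (sder 4 c) <= (R powr \<beta> + ?q * m) * nrm (sder 4 c)"
   by (intro mult_right_mono) auto
  with flux_x_upper[OF \<beta> C0 c lo up] show "nrm (flux_x \<beta> c) <= (R powr \<beta> + ?q * m) * nrm (sder 4 c)"
   by (rule order_trans)
 qed
 finally show ?thesis by (simp add: power_mult_distrib)
qed

lemma L2_familyD: "L2_family g ==> g k \<in> L2"
 by (simp add: L2_family_def)

lemma L2_family_meas: "L2_family g ==> g k \<in> borel_measurable M"
 by (rule L2_meas[OF L2_familyD])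

lemma L2_family_summable: "L2_family g ==> summable (%k. \<integral>t. (g k t)^2 \<partial>M)"
 by (simp add: L2_family_def)

lemma nrm_le_of_L2_family: "L2_family g ==> (nrm (g k))^2 <= (\<Sum>k. \<integral>t. (g k t)^2 \<partial>M)"
 using sum_le_suminf[OF L2_family_summable, of g "{k}"] by (simp add: nrm_sq')

lemma L2_family_diff:
 assumes "L2_family f" "L2_family g"
 shows "L2_family (%k t. f k t - g k t)"
proof (rule L2_family_dominated[OF _ assms, where A = 2 and B = 2])
 show "(%t. f k t - g k t) \<in> borel_measurable M" for k
  using assms by (intro borel_measurable_diff L2_family_meas)
 have "(x - y)^2 <= 2 * x^2 + 2 * y^2" for x y :: real
  using zero_le_power2[of "x + y"] by (simp add: power2_sum power2_diff)
 then show "AE t in M. \<forall>k. (f k t - g k t)^2 <= 2 * (f k t)^2 + 2 * (g k t)^2" by simp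
qed

lemma L2_family_sum_meas: "L2_family g ==> (%t. \<Sum>k. (g k t)^2) \<in> borel_measurable M"
 by (rule borel_measurable_integrable[OF L2_family_AE(2)])

text \<open>From \<open>2 \<langle>f, g\<rangle> - \<parallel>g\<parallel>\<^sup>2 \<le> \<parallel>f\<parallel>\<^sup>2\<close>, whose left-hand side is continuous for weak convergence.\<close>

lemma weak_lsc:
 assumes f: "\<And>n k. f n k \<in> L2" and g: "\<And>k. g k \<in> L2"
  and lim: "\<And>k. (%n. ip (f n k) (g k)) \<longlonglongrightarrow> ip (g k) (g k)"
  and B: "\<And>n. (\<Sum>k<K. (nrm (f n k))^2) <= B"
 shows "(\<Sum>k<K. (nrm (g k))^2) <= B"
proof -
 have "(%n. \<Sum>k<K. 2 * ip (f n k) (g k) - (nrm (g k))^2) \<longlonglongrightarrow> (\<Sum>k<K. 2 * ip (g k) (g k) - (nrm (g k))^2)"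
  by (intro tendsto_sum tendsto_diff tendsto_mult tendsto_const lim)
 moreover have "(\<Sum>k<K. 2 * ip (f n k) (g k) - (nrm (g k))^2) <= B" for n
 proof (rule order_trans[OF sum_mono B[of n]])
  fix k
  have "2 * ip (f n k) (g k) <= 2 * (nrm (f n k) * nrm (g k))"
   using Cauchy_Schwarz_ip[OF f g, of n k k] by linarith
  moreover have "0 <= (nrm (f n k) - nrm (g k))^2" by simp
  ultimately show "2 * ip (f n k) (g k) - (nrm (g k))^2 <= (nrm (f n k))^2"
   unfolding power2_diff by linarith
 qed
 ultimately have "(\<Sum>k<K. 2 * ip (g k) (g k) - (nrm (g k))^2) <= B"
  by (intro LIMSEQ_le_const2) auto
 then show ?thesis by (simp add: nrm_sq)
qed

lemma L2_family_of_partial_bound: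
 assumes g: "\<And>k. g k \<in> L2" and B: "\<And>K. (\<Sum>k<K. (nrm (g k))^2) <= B"
 shows "L2_family g" "(\<Sum>k. \<integral>t. (g k t)^2 \<partial>M) <= B"
proof -
 have s: "summable (%k. \<integral>t. (g k t)^2 \<partial>M)"
  by (rule summableI_nonneg_bounded[where x = B]) (use B in \<open>simp_all add: nrm_sq'\<close>)
 then show "L2_family g" using g by (simp add: L2_family_def)
 show "(\<Sum>k. \<integral>t. (g k t)^2 \<partial>M) <= B"
  by (rule suminf_le_const[OF s]) (use B in \<open>simp add: nrm_sq'\<close>)
qed

lemma prim_AE_zero:
 assumes "d \<in> L2" "AE t in M. d t = 0" "t \<in> {a..b}"
 shows "prim d t = 0"
proof -
 have "prim d t = ip d (indicator {a..t})"
  unfolding prim_def using assms by (intro integral_eq_ip) auto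
 also have "\<dots> = ip (%_. 0) (indicator {a..t})"
  by (rule ip_cong_AE[OF assms(2,1) _ indicator_L2]) simp
 finally show ?thesis by (simp add: ip_def)
qed

text \<open>A weighted bound with weights tending to infinity prevents mass from escaping to high modes, so that
 convergence of every single mode suffices.\<close>

lemma tight_series_tendsto:
 fixes f :: "nat => nat => real"
 assumes f0: "\<And>n k. 0 <= f n k" and lim: "\<And>k. (%n. f n k) \<longlonglongrightarrow> 0"
  and s: "\<And>n. summable (%k. (w k)^2 * f n k)" and B: "\<And>n. (\<Sum>k. (w k)^2 * f n k) <= B"
  and sf: "\<And>n. summable (f n)"
 shows "(%n. \<Sum>k. f n k) \<longlonglongrightarrow> 0"
proof (rule LIMSEQ_I)
 fix \<epsilon> :: real assume \<epsilon>: "0 < \<epsilon>"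
 have B0: "0 <= B" using B[of 0] suminf_nonneg[OF s[of 0]] f0 by (meson mult_nonneg_nonneg order_trans zero_le_power2)
 have w1: "0 < w 1" by (rule w_pos) simp
 obtain K0 :: nat where K0: "2 * (B + 1) / \<epsilon> / (w 1)^2 < real K0" using reals_Archimedean2 by blast
 define K where "K = Suc K0"
 have wK: "2 * (B + 1) / \<epsilon> <= (w k)^2" if "K <= k" for k
 proof -
  have k: "real K0 <= real k" "1 <= real k" using that by (auto simp: K_def)
  have "2 * (B + 1) / \<epsilon> <= real K0 * (w 1)^2"
   using K0 w1 pos_divide_less_eq[of "(w 1)^2" "2 * (B + 1) / \<epsilon>" "real K0"] by simp
  also have "\<dots> <= (real k)^2 * (w 1)^2"
   using k mult_mono[of "real K0" "real k" 1 "real k"] by (intro mult_right_mono) (auto simp: power2_eq_square)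
  also have "\<dots> = (w k)^2" unfolding w_eq[of k] power_mult_distrib ..
  finally show ?thesis .
 qed
 have tail: "(\<Sum>k. f n (k + K)) <= \<epsilon> / 2" for n
 proof -
  have sK: "summable (%k. f n (k + K))" using sf[of n] summable_iff_shift[of "f n" K] by blast
  have swK: "summable (%k. (w (k + K))^2 * f n (k + K))"
   using s[of n] summable_iff_shift[of "%k. (w k)^2 * f n k" K] by blast
  have "2 * (B + 1) / \<epsilon> * (\<Sum>k. f n (k + K)) = (\<Sum>k. 2 * (B + 1) / \<epsilon> * f n (k + K))"
   by (rule suminf_mult[OF sK, symmetric])
  also have "\<dots> <= (\<Sum>k. (w (k + K))^2 * f n (k + K))"
   by (rule suminf_le[OF _ summable_mult[OF sK] swK]) (intro mult_right_mono wK f0, simp)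
  also have "\<dots> <= (\<Sum>k. (w k)^2 * f n k)"
   using suminf_split_initial_segment[OF s[of n], of K] sum_nonneg[of "{..<K}" "%k. (w k)^2 * f n k"] f0 by simp
  also have "\<dots> <= B + 1" using B[of n] by simp
  finally have "(B + 1) * (2 / \<epsilon> * (\<Sum>k. f n (k + K))) <= (B + 1) * 1" by (simp add: field_simps)
  then have "2 / \<epsilon> * (\<Sum>k. f n (k + K)) <= 1" using B0 by (subst (asm) mult_le_cancel_left_pos) auto
  then show ?thesis using \<epsilon> by (simp add: field_simps)
 qed
 have "(%n. \<Sum>k<K. f n k) \<longlonglongrightarrow> (\<Sum>k<K. 0)" by (intro tendsto_sum lim)
 then have "(%n. \<Sum>k<K. f n k) \<longlonglongrightarrow> 0" by simp
 from order_tendstoD(2)[OF this, of "\<epsilon> / 2"] \<epsilon>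
 obtain N where N: "\<And>n. n \<ge> N ==> (\<Sum>k<K. f n k) < \<epsilon> / 2" unfolding eventually_sequentially by auto
 show "\<exists>N. \<forall>n\<ge>N. norm ((\<Sum>k. f n k) - 0) < \<epsilon>"
 proof (intro exI[of _ N] allI impI)
  fix n assume "N <= n"
  from N[OF this] tail[of n] have "(\<Sum>k. f n k) < \<epsilon>"
   using suminf_split_initial_segment[OF sf[of n], of K] by simp
  moreover have "0 <= (\<Sum>k. f n k)" by (rule suminf_nonneg[OF sf f0])
  ultimately show "norm ((\<Sum>k. f n k) - 0) < \<epsilon>" by simp
 qed
qed

end

context space_time
begin

text \<open>The control problem written for the cosine coefficients \<open>c\<close> of the state, \<open>d\<close> of its time
 derivative and \<open>v\<close> of the derivative \<open>u\<^sub>x\<close> of the control.\<close>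

definition adm :: "real => real => (nat => real) => real => (nat => real => real) => (nat => real => real) =>
  (nat => real => real) => bool" where
 "adm lam \<beta> \<gamma> C0 c d v \<longleftrightarrow>
   time.L2_family d \<and> time.L2_family v \<and> time.L2_family (%k t. w k ^ 4 * c k t) \<and>
   (\<forall>k. \<forall>t\<in>{0..T}. c k t = \<gamma> k + time.prim (d k) t) \<and>
   (AE t in Tm. v 0 t = 0) \<and>
   (AE t in Tm. \<forall>k. d k t = v k t - lam * (w k * flux_coef \<beta> (%k. c k t) k)) \<and>
   (AE t in Tm. \<forall>x\<in>{a..b}. C0 <= ser e (%k. c k t) x)"

lemma state_coef_L2:
 assumes d: "time.L2_family d" and cd: "\<forall>k. \<forall>t\<in>{0..T}. c k t = \<gamma> k + time.prim (d k) t"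
 shows "c k \<in> time.L2"
proof -
 have "(%t. \<gamma> k + time.prim (d k) t) \<in> time.L2"
  by (intro time.L2_add time.L2_const time.prim_L2 time.L2_familyD[OF d])
 then show ?thesis
  by (rule time.L2_cong_AE) (use cd in \<open>auto intro!: AE_I2\<close>)
qed

lemma state_family:
 assumes d: "time.L2_family d" and c4: "time.L2_family (%k t. w k ^ 4 * c k t)"
  and cd: "\<forall>k. \<forall>t\<in>{0..T}. c k t = \<gamma> k + time.prim (d k) t" and j: "j <= 4"
 shows "time.L2_family (%k t. w k ^ j * c k t)"
proof -
 let ?h = "%k t. if k = 0 then c 0 t else 0"
 have cL: "c k \<in> time.L2" for k by (rule state_coef_L2[OF d cd])
 have w1: "0 < w 1" by (rule w_pos) simp
 have h: "time.L2_family ?h"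
  unfolding time.L2_family_def
 proof (intro conjI allI)
  show "?h k \<in> time.L2" for k using cL by (cases "k = 0") auto
  show "summable (%k. \<integral>t. (?h k t)^2 \<partial>Tm)"
   by (rule summable_finite[of "{0}"]) auto
 qed
 show ?thesis
 proof (rule time.L2_family_dominated[OF _ c4 h, where A = "1 / (w 1 ^ (4 - j))^2" and B = 1])
  show "(%t. w k ^ j * c k t) \<in> borel_measurable Tm" for k
   by (intro borel_measurable_times borel_measurable_const time.L2_meas cL)
  show "AE t in Tm. \<forall>k. (w k ^ j * c k t)^2 <= 1 / (w 1 ^ (4 - j))^2 * (w k ^ 4 * c k t)^2 + 1 * (?h k t)^2"
  proof (intro AE_I2 allI)
   fix t k
   show "(w k ^ j * c k t)^2 <= 1 / (w 1 ^ (4 - j))^2 * (w k ^ 4 * c k t)^2 + 1 * (?h k t)^2"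
   proof (cases "k = 0")
    case True
    have "(0::real) ^ j <= 1" "0 <= (0::real) ^ j" by (auto simp: power_0_left)
    then have "((0::real) ^ j)^2 * (c 0 t)^2 <= 1 * (c 0 t)^2"
     by (intro mult_right_mono power_le_one) auto
    then show ?thesis using True by (simp add: power_mult_distrib)
   next
    case False
    have "w 1 <= w k" using False by (intro w_ge_w1) simp
    then have "(w 1 ^ (4 - j))^2 * (w k ^ j * c k t)^2 <= (w k ^ (4 - j))^2 * (w k ^ j * c k t)^2"
     using w1 by (intro mult_right_mono power_mono) auto
    also have "\<dots> = (w k ^ 4 * c k t)^2"
    proof -
     have "w k ^ 4 = w k ^ (4 - j) * w k ^ j" using j by (simp flip: power_add)
     then show ?thesis by (simp add: power_mult_distrib mult.assoc)
    qed
    finally show ?thesis using w1 False by (simp add: field_simps)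
   qed
  qed
 qed
qed

text \<open>The chain rule in time for weighted square sums.\<close>

lemma weighted_energy:
 assumes d: "time.L2_family d" and pc: "time.L2_family (%k t. p k * c k t)"
  and cd: "\<forall>k. \<forall>t\<in>{0..T}. c k t = \<gamma> k + time.prim (d k) t"
  and \<gamma>: "summable (%k. p k * (\<gamma> k)^2)" and t: "t \<in> {0..T}"
 shows "integrable Tm (%r. indicator {0..t} r * (\<Sum>k. p k * c k r * d k r))"
  "(%k. p k * (c k t)^2) sums
    ((\<Sum>k. p k * (\<gamma> k)^2) + 2 * (\<integral>r. indicator {0..t} r * (\<Sum>k. p k * c k r * d k r) \<partial>Tm))"
proof -
 define f where "f k r = indicator {0..t} r * (p k * c k r * d k r)" for k r
 have iL: "(%r. indicator {0..t} r * (p k * c k r)) \<in> time.L2" for k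
 proof (rule time.L2_bounded_mult[OF time.L2_familyD[OF pc], where B = 1])
  show "(indicator {0..t} :: real => real) \<in> borel_measurable Tm" by (rule time.L2_meas[OF time.indicator_L2])
 qed (auto simp: indicator_def)
 have fi: "integrable Tm (f k)" for k
  using time.L2_mult_integrable[OF iL time.L2_familyD[OF d], of k k] by (simp add: f_def[abs_def] mult.assoc)
 have le: "\<bar>f k r\<bar> <= (p k * c k r)^2 + (d k r)^2" for k r
  using abs_mult_le_squares[of "p k * c k r" "d k r"] by (auto simp: f_def indicator_def)
 have sm: "AE r in Tm. summable (%k. norm (f k r))"
  using time.L2_family_AE(1)[OF pc] time.L2_family_AE(1)[OF d]
 proof eventually_elim
  case (elim r)
  from summable_add[OF this] show ?case
   by (rule summable_comparison_test'[where N = 0]) (use le in simp)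
 qed
 have si: "summable (%k. \<integral>r. norm (f k r) \<partial>Tm)"
 proof (rule summable_comparison_test'[where N = 0])
  show "summable (%k. (\<integral>r. (p k * c k r)^2 \<partial>Tm) + (\<integral>r. (d k r)^2 \<partial>Tm))"
   by (rule summable_add[OF time.L2_family_summable[OF pc] time.L2_family_summable[OF d]])
  fix k
  have "(\<integral>r. norm (f k r) \<partial>Tm) <= (\<integral>r. (p k * c k r)^2 + (d k r)^2 \<partial>Tm)"
   by (rule integral_mono)
     (use le in \<open>auto intro!: integrable_norm fi Bochner_Integration.integrable_add
       time.L2_sq[OF time.L2_familyD[OF pc]] time.L2_sq[OF time.L2_familyD[OF d]]\<close>)
  also have "\<dots> = (\<integral>r. (p k * c k r)^2 \<partial>Tm) + (\<integral>r. (d k r)^2 \<partial>Tm)"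
   by (rule Bochner_Integration.integral_add[OF time.L2_sq[OF time.L2_familyD[OF pc]] time.L2_sq[OF time.L2_familyD[OF d]]])
  finally show "norm (\<integral>r. norm (f k r) \<partial>Tm) <= (\<integral>r. (p k * c k r)^2 \<partial>Tm) + (\<integral>r. (d k r)^2 \<partial>Tm)" by simp
 qed
 have sum_eq: "(\<Sum>k. f k r) = indicator {0..t} r * (\<Sum>k. p k * c k r * d k r)" for r
  by (cases "r \<in> {0..t}") (simp_all add: f_def)
 show "integrable Tm (%r. indicator {0..t} r * (\<Sum>k. p k * c k r * d k r))"
  using integrable_suminf[OF fi sm si] unfolding sum_eq .
 have S: "(%k. \<integral>r. f k r \<partial>Tm) sums (\<integral>r. indicator {0..t} r * (\<Sum>k. p k * c k r * d k r) \<partial>Tm)"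
  using sums_integral[OF fi sm si] unfolding sum_eq .
 have eq: "p k * (c k t)^2 = p k * (\<gamma> k)^2 + 2 * (\<integral>r. f k r \<partial>Tm)" for k
 proof -
  have "c k t = \<gamma> k + time.prim (d k) t" using cd t by blast
  then have "(c k t)^2 = (\<gamma> k)^2 + 2 * time.ip (%x. (\<gamma> k + time.prim (d k) x) * indicator {0..t} x) (d k)"
   using time.prim_square[OF time.L2_familyD[OF d] t, of "\<gamma> k" k] by simp
  moreover have "p k * time.ip (%x. (\<gamma> k + time.prim (d k) x) * indicator {0..t} x) (d k) = (\<integral>r. f k r \<partial>Tm)"
   unfolding time.ip_def integral_mult_right_zero[symmetric]
  proof (rule Bochner_Integration.integral_cong[OF refl])
   fix x assume "x \<in> space Tm"
   then have "c k x = \<gamma> k + time.prim (d k) x" using cd by auto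
   then show "p k * ((\<gamma> k + time.prim (d k) x) * indicator {0..t} x * d k x) = f k x"
    by (simp add: f_def)
  qed
  ultimately show ?thesis by (simp add: distrib_left)
 qed
 show "(%k. p k * (c k t)^2) sums
    ((\<Sum>k. p k * (\<gamma> k)^2) + 2 * (\<integral>r. indicator {0..t} r * (\<Sum>k. p k * c k r * d k r) \<partial>Tm))"
  unfolding eq by (intro sums_add sums_mult S summable_sums \<gamma>)
qed

lemma adm_zero_mode:
 assumes "adm lam \<beta> \<gamma> C0 c d v" "t \<in> {0..T}"
 shows "c 0 t = \<gamma> 0"
proof -
 have "AE t in Tm. v 0 t = 0" "AE t in Tm. \<forall>k. d k t = v k t - lam * (w k * flux_coef \<beta> (%k. c k t) k)"
  using assms(1) by (auto simp: adm_def)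
 then have "AE t in Tm. d 0 t = 0" by eventually_elim simp
 moreover have "d 0 \<in> time.L2" using assms(1) by (auto simp: adm_def time.L2_family_def)
 ultimately have "time.prim (d 0) t = 0" using assms(2) by (intro time.prim_AE_zero)
 then show ?thesis using assms by (auto simp: adm_def)
qed

lemma hs_2_weights:
 assumes "hs 2 \<gamma>"
 shows "summable (%k. (w k)^2 * (\<gamma> k)^2)" "summable (%k. w k ^ 4 * (\<gamma> k)^2)"
proof -
 show "summable (%k. (w k)^2 * (\<gamma> k)^2)"
  using hs_weight[OF assms, of 1] by (simp add: power_mult_distrib)
 have "(w k ^ 2 * \<gamma> k)^2 = w k ^ 4 * (\<gamma> k)^2" for k
  by (simp add: power_mult_distrib flip: power_mult)
 then show "summable (%k. w k ^ 4 * (\<gamma> k)^2)"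
  using hs_weight[OF assms, of 2] by simp
qed

text \<open>The first test needs an upper bound on the state only qualitatively, at almost every time.  It bounds the
 energy uniformly in time, hence \<open>y\<close> by the constant \<open>R\<close>, and with \<open>R\<close> known the constants of the second test
 are uniform as well.\<close>

lemma a_priori:
 assumes \<beta>: "1 <= \<beta>" and C0: "0 < C0" and lam: "0 < lam" and \<gamma>: "hs 2 \<gamma>"
 shows "\<exists>B R. \<forall>c d v. adm lam \<beta> \<gamma> C0 c d v --> (\<Sum>k. \<integral>t. (v k t)^2 \<partial>Tm) <= V0 -->
   (\<Sum>k. \<integral>t. (w k ^ 4 * c k t)^2 \<partial>Tm) <= B \<and> (\<Sum>k. \<integral>t. (d k t)^2 \<partial>Tm) <= B \<and>
   (AE t in Tm. \<forall>x\<in>{a..b}. ser e (%k. c k t) x <= R)"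
proof -
 define \<kappa> where "\<kappa> = lam * C0 powr \<beta>"
 have \<kappa>: "0 < \<kappa>" using lam C0 by (simp add: \<kappa>_def)
 have w1: "0 < w 1" by (rule w_pos) simp
 define K1 where "K1 = 1 / (2 * lam * C0 powr \<beta> * (w 1)^2)"
 have K1: "0 <= K1" using lam by (simp add: K1_def)
 define E2 where "E2 = (\<Sum>k. (w k)^2 * (\<gamma> k)^2)"
 define E4 where "E4 = (\<Sum>k. w k ^ 4 * (\<gamma> k)^2)"
 define V1 where "V1 = max 0 V0"
 define M1 where "M1 = E2 + 2 * (K1 * V1)"
 define m where "m = sqrt M1"
 define R where "R = eb * (\<bar>\<gamma> 0\<bar> + sqrt Zw * m)"
 obtain A where A: "0 <= A"
  "\<forall>c. hs 4 c --> (\<forall>x\<in>{a..b}. C0 <= ser e c x) --> (\<forall>x\<in>{a..b}. ser e c x <= R) --> nrm (sder 1 c) <= m -->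
    C0 powr \<beta> / 2 * (nrm (sder 4 c))^2 - A * (nrm (sder 3 c))^2 <= ip (sder 4 c) (flux_x \<beta> c)"
  by (rule flux_x_coercive[OF \<beta> C0])
 define J3 where "J3 = M1 / \<kappa>"
 define J4 where "J4 = 4 / \<kappa> * (E4 / 2 + lam * A * J3 + V1 / \<kappa>)"
 define Q where "Q = (R powr \<beta> + (\<beta> * R powr (\<beta> - 1)) * (eb * sqrt Zw) * m)^2"
 define B where "B = max J4 (2 * V1 + 2 * lam^2 * (Q * J4))"
 have "(\<Sum>k. \<integral>t. (w k ^ 4 * c k t)^2 \<partial>Tm) <= B \<and> (\<Sum>k. \<integral>t. (d k t)^2 \<partial>Tm) <= B \<and>
   (AE t in Tm. \<forall>x\<in>{a..b}. ser e (%k. c k t) x <= R)"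
  if ad: "adm lam \<beta> \<gamma> C0 c d v" and V: "(\<Sum>k. \<integral>t. (v k t)^2 \<partial>Tm) <= V0" for c d v
 proof -
  have d: "time.L2_family d" and v: "time.L2_family v" and c4: "time.L2_family (%k t. w k ^ 4 * c k t)"
   and cd: "\<forall>k. \<forall>t\<in>{0..T}. c k t = \<gamma> k + time.prim (d k) t"
   and eq: "AE t in Tm. \<forall>k. d k t = v k t - lam * (w k * flux_coef \<beta> (%k. c k t) k)"
   and pos: "AE t in Tm. \<forall>x\<in>{a..b}. C0 <= ser e (%k. c k t) x"
   using ad by (simp_all add: adm_def)
  have cj: "time.L2_family (%k t. w k ^ j * c k t)" if "j <= 4" for j
   by (rule state_family[OF d c4 cd that])
  have h4: "AE t in Tm. hs 4 (%k. c k t)"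
   using time.L2_family_AE(1)[OF c4] by (simp add: hs_def)
  have vs: "AE t in Tm. summable (%k. (v k t)^2)" by (rule time.L2_family_AE(1)[OF v])
  define n3 where "n3 t = (\<Sum>k. (w k ^ 3 * c k t)^2)" for t
  define n4 where "n4 t = (\<Sum>k. (w k ^ 4 * c k t)^2)" for t
  define vv where "vv t = (\<Sum>k. (v k t)^2)" for t
  have n3i: "integrable Tm n3" unfolding n3_def using time.L2_family_AE(2)[OF cj[of 3]] by simp
  have n4i: "integrable Tm n4" unfolding n4_def by (rule time.L2_family_AE(2)[OF c4])
  have vvi: "integrable Tm vv" unfolding vv_def by (rule time.L2_family_AE(2)[OF v])
  have vvI: "(\<integral>t. vv t \<partial>Tm) <= V1"
   using V time.L2_family_AE(3)[OF v] by (simp add: vv_def V1_def)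
  have n3_0: "AE t in Tm. 0 <= n3 t \<and> n3 t = (nrm (sder 3 (%k. c k t)))^2"
   using h4 by eventually_elim (simp add: n3_def nrm_sder_sq[symmetric])
  have n4_0: "AE t in Tm. 0 <= n4 t \<and> n4 t = (nrm (sder 4 (%k. c k t)))^2"
   using h4 by eventually_elim (simp add: n4_def nrm_sder_sq[symmetric])
  have vv_0: "AE t in Tm. 0 <= vv t"
   using vs by eventually_elim (simp add: vv_def suminf_nonneg)
  \<comment> \<open>a crude upper bound, depending on time, suffices for the first estimate\<close>
  have up0: "AE t in Tm. \<exists>R. \<forall>x\<in>{a..b}. ser e (%k. c k t) x <= R"
   using h4
  proof eventually_elim
   case (elim t)
   note h = elim
   have "ser e (%k. c k t) x <= eb * (\<Sum>k. \<bar>w k ^ 0 * c k t\<bar>)" for x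
    using sder_sup_bound[OF h, of 0 x] by (simp add: sder_0)
   then show ?case by blast
  qed
  have dis1: "AE t in Tm. (\<Sum>k. (w k)^2 * c k t * d k t) <= - (\<kappa> / 2) * n3 t + K1 * vv t"
   using h4 pos up0 vs eq n3_0
  proof eventually_elim
   case (elim t)
   note h = elim(1) and lo = elim(2) and up = elim(3) and vt = elim(4) and dt = elim(5) and n = elim(6)
   obtain R' where "\<forall>x\<in>{a..b}. ser e (%k. c k t) x <= R'" using up by blast
   from energy_dissipation[OF \<beta> C0 lam h lo this vt dt] n
   show ?case
    by (simp add: \<kappa>_def K1_def vv_def)
  qed
  have w2: "time.L2_family (%k t. (w k)^2 * c k t)" by (rule cj) simp
  note en = weighted_energy[OF d w2 cd hs_2_weights(1)[OF \<gamma>]]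
  have ind: "(indicator {0..t} :: real => real) \<in> borel_measurable Tm" for t :: real
   by (rule time.L2_meas[OF time.indicator_L2])
  have ii: "integrable Tm (%r. indicator {0..t} r * f r)" if "integrable Tm f" for t :: real and f :: "real => real"
  proof (rule Bochner_Integration.integrable_bound[OF that])
   show "(%r. indicator {0..t} r * f r) \<in> borel_measurable Tm"
    by (rule borel_measurable_times[OF ind borel_measurable_integrable[OF that]])
   show "AE r in Tm. norm (indicator {0..t} r * f r) <= norm (f r)" by (auto simp: indicator_def)
  qed
  have step1: "(\<integral>r. indicator {0..t} r * (\<Sum>k. (w k)^2 * c k r * d k r) \<partial>Tm)
    <= - (\<kappa> / 2) * (\<integral>r. indicator {0..t} r * n3 r \<partial>Tm) + K1 * V1" if t: "t \<in> {0..T}" for t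
  proof -
   have "(\<integral>r. indicator {0..t} r * (\<Sum>k. (w k)^2 * c k r * d k r) \<partial>Tm)
     <= (\<integral>r. - (\<kappa> / 2) * (indicator {0..t} r * n3 r) + K1 * vv r \<partial>Tm)"
   proof (rule integral_mono_AE[OF en(1)[OF t]])
    show "integrable Tm (%r. - (\<kappa> / 2) * (indicator {0..t} r * n3 r) + K1 * vv r)"
     by (intro Bochner_Integration.integrable_add integrable_mult_right ii n3i vvi)
    show "AE r in Tm. indicator {0..t} r * (\<Sum>k. (w k)^2 * c k r * d k r)
      <= - (\<kappa> / 2) * (indicator {0..t} r * n3 r) + K1 * vv r"
     using dis1 vv_0
    proof eventually_elim
     case (elim r)
     then show ?case
      using K1 by (cases "r \<in> {0..t}") auto
    qed
   qed
   also have "\<dots> = - (\<kappa> / 2) * (\<integral>r. indicator {0..t} r * n3 r \<partial>Tm) + K1 * (\<integral>r. vv r \<partial>Tm)"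
    using ii[OF n3i, of t] vvi by simp
   finally show ?thesis using mult_left_mono[OF vvI K1] by linarith
  qed
  have n3ind: "0 <= (\<integral>r. indicator {0..t} r * n3 r \<partial>Tm)" for t :: real
   by (rule integral_nonneg_AE) (use n3_0 in \<open>eventually_elim, auto simp: indicator_def\<close>)
  have En: "(\<Sum>k. (w k)^2 * (c k t)^2) + \<kappa> * (\<integral>r. indicator {0..t} r * n3 r \<partial>Tm) <= M1" if t: "t \<in> {0..T}" for t
   using step1[OF t] sums_unique[OF en(2)[OF t]] by (simp add: M1_def E2_def)
  have m1: "AE t in Tm. nrm (sder 1 (%k. c k t)) <= m"
  proof -
   have "AE t in Tm. t \<in> {0<..<T}" by (intro AE_I2) simp
   with h4 show ?thesis
   proof eventually_elim
    case (elim t)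
    note h = elim(1) and elim(2)
    then have t: "t \<in> {0..T}" by auto
    have "(\<Sum>k. (w k ^ 1 * c k t)^2) <= M1"
     using En[OF t] mult_nonneg_nonneg[OF less_imp_le[OF \<kappa>] n3ind[of t]] by (simp add: power_mult_distrib)
    then show ?case
     using nrm_sder[OF h, of 1] by (simp add: m_def)
   qed
  qed
  have up: "AE t in Tm. \<forall>x\<in>{a..b}. ser e (%k. c k t) x <= R"
  proof -
   have "AE t in Tm. t \<in> {0<..<T}" by (intro AE_I2) simp
   with h4 m1 show ?thesis
   proof eventually_elim
    case (elim t)
    note h = elim(1) and m1 = elim(2) and elim(3)
    then have c0: "c 0 t = \<gamma> 0" by (intro adm_zero_mode[OF ad]) auto
    have h1: "hs (Suc 0) (%k. c k t)" by (rule hs_mono[OF h]) simp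
    have "ser e (%k. c k t) x <= R" for x
    proof -
     have "ser e (%k. c k t) x <= eb * (\<Sum>k. \<bar>w k ^ 0 * c k t\<bar>)"
      using sder_sup_bound[OF h, of 0 x] by (simp add: sder_0)
     also have "\<dots> <= eb * (\<bar>\<gamma> 0\<bar> + sqrt Zw * nrm (sder 1 (%k. c k t)))"
      using abs_sum_le[OF h1] c0 eb_pos by (intro mult_left_mono) auto
     also have "\<dots> <= R"
      unfolding R_def using m1 eb_pos Zw_nonneg by (intro mult_left_mono add_left_mono) auto
     finally show ?thesis .
    qed
    then show ?case by blast
   qed
  qed
  have TT: "T \<in> {0..T}" using T_pos by simp
  have full: "(\<integral>r. indicator {0..T} r * f r \<partial>Tm) = (\<integral>r. f r \<partial>Tm)" for f :: "real => real"
   by (rule Bochner_Integration.integral_cong) auto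
  have I3: "(\<integral>r. n3 r \<partial>Tm) <= J3"
  proof -
   have "0 <= (\<Sum>k. (w k)^2 * (c k T)^2)"
    by (rule suminf_nonneg[OF sums_summable[OF en(2)[OF TT]]]) simp
   then have "\<kappa> * (\<integral>r. n3 r \<partial>Tm) <= M1" using En[OF TT] unfolding full by linarith
   then show ?thesis using \<kappa> by (simp add: J3_def field_simps)
  qed
  have dis2: "AE t in Tm. (\<Sum>k. w k ^ 4 * c k t * d k t) <= - (\<kappa> / 4) * n4 t + lam * A * n3 t + 1 / \<kappa> * vv t"
   using h4 pos up vs eq n3_0 n4_0 m1
  proof eventually_elim
   case (elim t)
   note h = elim(1) and lo = elim(2) and up = elim(3) and vt = elim(4) and dt = elim(5) and n = elim(6,7) and m1 = elim(8)
   from second_order_dissipation[OF \<beta> C0 lam h lo up vt dt A(2)[rule_format, OF h _ _ m1]] lo up n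
   show ?case
    by (simp add: \<kappa>_def vv_def)
  qed
  note en4 = weighted_energy[OF d c4 cd hs_2_weights(2)[OF \<gamma>] TT]
  have I4: "(\<integral>r. n4 r \<partial>Tm) <= J4"
  proof -
   have "0 <= (\<Sum>k. w k ^ 4 * (c k T)^2)"
    by (rule suminf_nonneg[OF sums_summable[OF en4(2)]]) simp
   then have 1: "0 <= E4 + 2 * (\<integral>r. (\<Sum>k. w k ^ 4 * c k r * d k r) \<partial>Tm)"
    using sums_unique[OF en4(2)] unfolding full E4_def by simp
   have i4: "integrable Tm (%r. \<Sum>k. w k ^ 4 * c k r * d k r)"
    using en4(1) by (rule Bochner_Integration.integrable_cong[OF refl, THEN iffD1, rotated]) auto
   have "(\<integral>r. (\<Sum>k. w k ^ 4 * c k r * d k r) \<partial>Tm) <= (\<integral>r. - (\<kappa> / 4) * n4 r + lam * A * n3 r + 1 / \<kappa> * vv r \<partial>Tm)"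
    by (rule integral_mono_AE[OF i4 _ dis2])
      (intro Bochner_Integration.integrable_add integrable_mult_right n3i n4i vvi)
   also have "\<dots> = - (\<kappa> / 4) * (\<integral>r. n4 r \<partial>Tm) + lam * A * (\<integral>r. n3 r \<partial>Tm) + 1 / \<kappa> * (\<integral>r. vv r \<partial>Tm)"
    using n3i n4i vvi by simp
   also have "\<dots> <= - (\<kappa> / 4) * (\<integral>r. n4 r \<partial>Tm) + lam * A * J3 + 1 / \<kappa> * V1"
    by (intro add_mono order_refl mult_left_mono I3 vvI) (use lam A(1) \<kappa> in simp_all)
   finally have "\<kappa> / 4 * (\<integral>r. n4 r \<partial>Tm) <= E4 / 2 + lam * A * J3 + V1 / \<kappa>"
   using 1 times_divide_eq_left[of 1 \<kappa> V1] by linarith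
   then have "4 / \<kappa> * (\<kappa> / 4 * (\<integral>r. n4 r \<partial>Tm)) <= J4"
    unfolding J4_def using \<kappa> by (intro mult_left_mono) auto
   then show ?thesis using \<kappa> by simp
  qed
  have w4: "(\<Sum>k. \<integral>t. (w k ^ 4 * c k t)^2 \<partial>Tm) <= J4"
   using I4 time.L2_family_AE(3)[OF c4] by (simp add: n4_def)
  have dd: "(\<Sum>k. \<integral>t. (d k t)^2 \<partial>Tm) <= (\<integral>r. 2 * vv r + 2 * lam^2 * (Q * n4 r) \<partial>Tm)"
  proof (rule time.L2_family_of_bound(2)[OF time.L2_family_meas[OF d]])
   show "integrable Tm (%r. 2 * vv r + 2 * lam^2 * (Q * n4 r))"
    by (intro Bochner_Integration.integrable_add integrable_mult_right n4i vvi)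
   show "AE t in Tm. \<forall>n. (\<Sum>k<n. (d k t)^2) <= 2 * vv t + 2 * lam^2 * (Q * n4 t)"
    using h4 pos up vs eq n4_0 m1
   proof eventually_elim
    case (elim t)
    note h = elim(1) and lo = elim(2) and up = elim(3) and vt = elim(4) and dt = elim(5) and n = elim(6) and m1 = elim(7)
    show ?case
    proof
     fix n
     let ?F = "%k. w k * flux_coef \<beta> (%k. c k t) k"
     have "(x - lam * y)^2 <= 2 * x^2 + 2 * lam^2 * y^2" for x y
      using zero_le_power2[of "x + lam * y"] by (simp add: power2_sum power2_diff power_mult_distrib)
     then have "(\<Sum>k<n. (d k t)^2) <= (\<Sum>k<n. 2 * (v k t)^2 + 2 * lam^2 * (?F k)^2)"
      using dt by (intro sum_mono) simp
     also have "\<dots> = 2 * (\<Sum>k<n. (v k t)^2) + 2 * lam^2 * (\<Sum>k<n. (?F k)^2)"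
      by (simp add: sum.distrib sum_distrib_left)
     also have "\<dots> <= 2 * vv t + 2 * lam^2 * (Q * n4 t)"
     proof (intro add_mono mult_left_mono)
      show "(\<Sum>k<n. (v k t)^2) <= vv t" unfolding vv_def by (rule sum_le_suminf[OF vt]) auto
      show "(\<Sum>k<n. (?F k)^2) <= Q * n4 t"
       using flux_x_partial_sums[OF \<beta> C0 h lo up m1, of n] n by (simp add: Q_def)
     qed auto
     finally show "(\<Sum>k<n. (d k t)^2) <= 2 * vv t + 2 * lam^2 * (Q * n4 t)" .
    qed
   qed
  qed
  also have "\<dots> = 2 * (\<integral>r. vv r \<partial>Tm) + 2 * lam^2 * (Q * (\<integral>r. n4 r \<partial>Tm))"
   using vvi n4i by simp
  also have "\<dots> <= 2 * V1 + 2 * lam^2 * (Q * J4)"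
  proof (intro add_mono mult_left_mono vvI I4)
   show "0 <= Q" by (simp add: Q_def)
  qed auto
  finally have dd': "(\<Sum>k. \<integral>t. (d k t)^2 \<partial>Tm) <= 2 * V1 + 2 * lam^2 * (Q * J4)" .
  have "(\<Sum>k. \<integral>t. (w k ^ 4 * c k t)^2 \<partial>Tm) <= B" using w4 by (simp add: B_def)
  moreover have "(\<Sum>k. \<integral>t. (d k t)^2 \<partial>Tm) <= B" using dd' by (simp add: B_def)
  ultimately show ?thesis using up by blast
 qed
 then show ?thesis by blast
qed

text \<open>Fubini's theorem: on the full set of times where the series converge absolutely, the flux is a pointwise
 limit of jointly measurable functions.\<close>

lemma flux_coef_measurable:
 assumes c: "\<And>k. c k \<in> borel_measurable Tm" and h: "AE t in Tm. hs 4 (%k. c k t)"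
 shows "(%t. flux_coef \<beta> (%k. c k t) k) \<in> borel_measurable Tm"
proof -
 let ?N = "Tm \<Otimes>\<^sub>M M"
 define f where "f t x = \<bar>\<Sum>j. c j t * e j x\<bar> powr \<beta> * (\<Sum>j. (w j ^ 3 * c j t) * s j x) * s k x" for t x
 have cm: "(%p. c j (fst p)) \<in> borel_measurable ?N" for j
  by (rule measurable_compose[OF measurable_fst c])
 have em: "(%p. e j (snd p)) \<in> borel_measurable ?N" and sm: "(%p. s j (snd p)) \<in> borel_measurable ?N" for j
  by (rule measurable_compose[OF measurable_snd L2_meas[OF e_L2]], rule measurable_compose[OF measurable_snd L2_meas[OF s_L2]])
 have "(%p. f (fst p) (snd p)) \<in> borel_measurable ?N"
  unfolding f_def
  by (intro borel_measurable_times powr_real_measurable borel_measurable_abs borel_measurable_suminf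
    borel_measurable_const cm em sm)
 then have "(%(t, x). f t x) \<in> borel_measurable ?N" by (simp add: case_prod_unfold)
 then have fm: "(%t. \<integral>x. f t x \<partial>M) \<in> borel_measurable Tm"
  by (rule borel_measurable_lebesgue_integral)
 have "AE t in Tm. (\<integral>x. f t x \<partial>M) = flux_coef \<beta> (%k. c k t) k"
  using h
 proof eventually_elim
  case (elim t)
  note h = elim
  have "summable (%k. \<bar>c k t\<bar>)" "summable (%k. \<bar>w k ^ 3 * c k t\<bar>)"
   using hs_abs[OF h, of 0] hs_abs[OF h, of 3] by simp_all
  then have "f t x = flux \<beta> (%k. c k t) x * s k x" for x
   by (simp add: f_def flux_def sder_3 ser_def)
  then show ?case by (simp add: flux_coef_def ip_def)
 qed
 from time.measurable_cong_AE[OF fm this] show ?thesis .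
qed

end

section \<open>Limits of admissible coefficient functions\<close>

context interval
begin

text \<open>The error \<open>f\<^sub>n - h\<close> tends to zero in \<open>L\<^sup>1\<close> only, because the Lipschitz factor \<open>G\<close> is merely square
 integrable; bounded test functions are enough to compare the limits.\<close>

lemma weak_limit_identification:
 assumes f: "\<And>n. f n \<in> L2" and g: "g \<in> L2"
  and weak: "\<And>\<phi>. \<phi> \<in> L2 ==> (%n. ip (f n) \<phi>) \<longlonglongrightarrow> ip g \<phi>"
  and h: "h \<in> borel_measurable M" and G: "G \<in> L2" and p: "\<And>n. p n \<in> L2"
  and le: "\<And>n. AE t in M. \<bar>f n t - h t\<bar> <= G t * p n t" and lim: "(%n. nrm (p n)) \<longlonglongrightarrow> 0"
 shows "AE t in M. g t = h t"
proof -
 have Gp: "integrable M (%t. G t * p n t)" for n by (rule L2_mult_integrable[OF G p])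
 have D: "integrable M (%t. f n t - h t)" for n
  by (rule Bochner_Integration.integrable_bound[OF Gp[of n] borel_measurable_diff[OF L2_meas[OF f] h]])
    (use le[of n] in \<open>eventually_elim, simp\<close>)
 have hi: "integrable M h"
  using Bochner_Integration.integrable_diff[OF L2_integrable[OF f[of 0]] D[of 0]] by simp
 have DI: "(\<integral>t. \<bar>f n t - h t\<bar> \<partial>M) <= nrm G * nrm (p n)" for n
 proof -
  have "(\<integral>t. \<bar>f n t - h t\<bar> \<partial>M) <= (\<integral>t. G t * p n t \<partial>M)"
   by (rule integral_mono_AE[OF integrable_abs[OF D] Gp le])
  then show ?thesis using Cauchy_Schwarz_ip[OF G p, of n] by (simp add: ip_def)
 qed
 have "AE t in M. g t - h t = 0"
 proof (rule fundamental_lemma)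
  show "locally_integrable I (%t. g t - h t)"
   by (intro integrable_locally_integrable Bochner_Integration.integrable_diff L2_integrable g hi)
  fix \<phi> assume \<phi>: "test_function I \<phi>"
  obtain C where C: "0 <= C" "\<And>x. \<bar>\<phi> x\<bar> <= C" using test_bounded[OF \<phi>] by blast
  have \<phi>L: "\<phi> \<in> L2" by (rule test_L2[OF \<phi>])
  have i: "integrable M (%t. u t * \<phi> t)" if "integrable M u" for u
   using locally_integrable_mult_test[OF integrable_locally_integrable[OF that] \<phi>] .
  have le: "\<bar>ip (f n) \<phi> - (\<integral>t. h t * \<phi> t \<partial>M)\<bar> <= C * (nrm G * nrm (p n))" for n
  proof -
   have "ip (f n) \<phi> - (\<integral>t. h t * \<phi> t \<partial>M) = (\<integral>t. (f n t - h t) * \<phi> t \<partial>M)"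
    unfolding ip_def left_diff_distrib
    by (rule Bochner_Integration.integral_diff[OF i[OF L2_integrable[OF f]] i[OF hi], symmetric])
   moreover have "\<bar>\<integral>t. (f n t - h t) * \<phi> t \<partial>M\<bar> <= (\<integral>t. \<bar>(f n t - h t) * \<phi> t\<bar> \<partial>M)"
    by (rule integral_abs_bound)
   moreover have "(\<integral>t. \<bar>(f n t - h t) * \<phi> t\<bar> \<partial>M) <= (\<integral>t. C * \<bar>f n t - h t\<bar> \<partial>M)"
    by (rule integral_mono[OF integrable_abs[OF i[OF D]] integrable_mult_right[OF integrable_abs[OF D]]])
      (auto simp: abs_mult mult.commute intro!: mult_right_mono C(2))
   moreover have "(\<integral>t. C * \<bar>f n t - h t\<bar> \<partial>M) <= C * (nrm G * nrm (p n))"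
    using mult_left_mono[OF DI C(1)] by simp
   ultimately show ?thesis by linarith
  qed
  have cl: "(%n. C * (nrm G * nrm (p n))) \<longlonglongrightarrow> 0"
   using tendsto_mult_left[OF tendsto_mult_left[OF lim, of "nrm G"], of C] by simp
  have "(%n. ip (f n) \<phi> - (\<integral>t. h t * \<phi> t \<partial>M)) \<longlonglongrightarrow> 0"
   by (rule Lim_null_comparison[OF always_eventually cl]) (use le in \<open>unfold real_norm_def, blast\<close>)
  then have "(%n. ip (f n) \<phi>) \<longlonglongrightarrow> (\<integral>t. h t * \<phi> t \<partial>M)" by (rule LIM_zero_cancel)
  from LIMSEQ_unique[OF this weak[OF \<phi>L]] have "(\<integral>t. h t * \<phi> t \<partial>M) = (\<integral>t. g t * \<phi> t \<partial>M)"
   by (simp add: ip_def)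
  then show "(\<integral>t. (g t - h t) * \<phi> t \<partial>M) = 0"
   unfolding left_diff_distrib
   using Bochner_Integration.integral_diff[OF i[OF L2_integrable[OF g]] i[OF hi]] by simp
 qed
 then show ?thesis by eventually_elim simp
qed

lemma prim_eq_ip: "g \<in> L2 ==> x \<in> {a..b} ==> prim g x = ip g (indicator {a..x})"
 unfolding prim_def by (intro integral_eq_ip) auto

lemma prim_abs_le:
 assumes "g \<in> L2" "x \<in> {a..b}" "nrm g <= B"
 shows "\<bar>prim g x\<bar> <= sqrt (b - a) * B"
proof -
 have "\<bar>prim g x\<bar> <= sqrt (x - a) * nrm g"
  unfolding prim_def using assms by (intro integral_CS) auto
 also have "\<dots> <= sqrt (b - a) * B" using assms by (intro mult_mono) auto
 finally show ?thesis .
qed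

lemma nrm_tendsto_0_bounded:
 assumes f: "\<And>n. f n \<in> L2" and g: "g \<in> L2"
  and lim: "\<And>t. t \<in> I ==> (%n. f n t) \<longlonglongrightarrow> g t" and B: "\<And>n t. t \<in> I ==> \<bar>f n t - g t\<bar> <= B"
 shows "(%n. nrm (%t. f n t - g t)) \<longlonglongrightarrow> 0"
proof -
 have "(%n. \<integral>t. (f n t - g t)^2 \<partial>M) \<longlonglongrightarrow> (\<integral>t. 0 \<partial>M)"
 proof (rule integral_dominated_convergence[where w = "%_. B^2"])
  show "AE t in M. (%n. (f n t - g t)^2) \<longlonglongrightarrow> 0"
  proof (rule AE_I2)
   fix t assume "t \<in> space M"
   then have "(%n. (f n t - g t)^2) \<longlonglongrightarrow> (g t - g t)^2"
    by (intro tendsto_intros lim) simp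
   then show "(%n. (f n t - g t)^2) \<longlonglongrightarrow> 0" by simp
  qed
  show "AE t in M. norm ((f n t - g t)^2) <= B^2" for n
   by (rule AE_I2) (use B power_mono[of "\<bar>f n _ - g _\<bar>" B 2] in auto)
 qed (use L2_sq[OF L2_diff[OF f g]] in \<open>auto intro: borel_measurable_integrable\<close>)
 then have "(%n. (nrm (%t. f n t - g t))^2) \<longlonglongrightarrow> 0" by (simp add: nrm_sq')
 from tendsto_real_sqrt[OF this] show ?thesis by simp
qed

lemma L2_family_partial_le: "L2_family g ==> (\<Sum>k. \<integral>t. (g k t)^2 \<partial>M) <= B ==> (\<Sum>k<K. (nrm (g k))^2) <= B"
 using sum_le_suminf[OF L2_family_summable, of g "{..<K}"] by (simp add: nrm_sq')

lemma nrm_le_sqrt_of_L2_family: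
 assumes "L2_family g" "(\<Sum>k. \<integral>t. (g k t)^2 \<partial>M) <= B"
 shows "nrm (g k) <= sqrt B"
 by (rule real_le_rsqrt) (use nrm_le_of_L2_family[OF assms(1), of k] assms(2) in linarith)

lemma AE_zero_of_ip: "g \<in> L2 ==> ip g g = 0 ==> AE x in M. g x = 0"
 by (rule nrm_zero_imp_AE) (simp_all flip: nrm_sq)

end

context space_time
begin

text \<open>Weak limits of the coefficients of \<open>y\<^sub>t\<close> and \<open>u\<^sub>x\<close> exist for all modes along one subsequence.  The state
 coefficients, being primitives, converge pointwise and boundedly, and the \<open>H\<^sup>4\<close> bound makes \<open>y\<^sub>x\<^sub>x\<^sub>x\<close> converge
 strongly.  A further subsequence converges uniformly in space at almost every time, which preserves the
 bounds on \<open>y\<close>; the flux converges by Lipschitz continuity.\<close>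

lemma limit_admissible:
 assumes \<beta>: "1 <= \<beta>" and C0: "0 < C0" and lam: "0 < lam" and \<gamma>: "hs 2 \<gamma>"
  and ad: "\<And>n. adm lam \<beta> \<gamma> C0 (c n) (d n) (v n)"
  and V: "\<And>n. (\<Sum>k. \<integral>t. (v n k t)^2 \<partial>Tm) <= V0"
 shows "\<exists>r c' d' v'. strict_mono (r :: nat => nat) \<and> adm lam \<beta> \<gamma> C0 c' d' v' \<and>
   (\<forall>k. (%n. time.nrm (%t. c (r n) k t - c' k t)) \<longlonglongrightarrow> 0) \<and>
   (\<forall>k. \<forall>h\<in>time.L2. (%n. time.ip (v (r n) k) h) \<longlonglongrightarrow> time.ip (v' k) h)"
proof -
 have d: "time.L2_family (d n)" and v: "time.L2_family (v n)" and c4: "time.L2_family (%k t. w k ^ 4 * c n k t)"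
  and cd: "\<forall>k. \<forall>t\<in>{0..T}. c n k t = \<gamma> k + time.prim (d n k) t"
  and v0: "AE t in Tm. v n 0 t = 0"
  and eq: "AE t in Tm. \<forall>k. d n k t = v n k t - lam * (w k * flux_coef \<beta> (%k. c n k t) k)"
  and pos: "AE t in Tm. \<forall>x\<in>{a..b}. C0 <= ser e (%k. c n k t) x" for n
  using ad[of n] by (simp_all add: adm_def)
 obtain B R where B: "\<And>n. (\<Sum>k. \<integral>t. (w k ^ 4 * c n k t)^2 \<partial>Tm) <= B" "\<And>n. (\<Sum>k. \<integral>t. (d n k t)^2 \<partial>Tm) <= B"
  and R: "\<And>n. AE t in Tm. \<forall>x\<in>{a..b}. ser e (%k. c n k t) x <= R"
  using a_priori[OF \<beta> C0 lam \<gamma>, of V0] ad V by blast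
 \<comment> \<open>both sequences of coefficients are interleaved to share one subsequence\<close>
 define F where "F n i = (if even i then d n (i div 2) else v n (i div 2))" for n i
 have FL: "F n i \<in> time.L2" for n i
  by (simp add: F_def time.L2_familyD[OF d] time.L2_familyD[OF v])
 have FB: "time.nrm (F n i) <= max (sqrt B) (sqrt V0)" for n i
  unfolding le_max_iff_disj F_def using time.nrm_le_sqrt_of_L2_family[OF d B(2), of n "i div 2"]
   time.nrm_le_sqrt_of_L2_family[OF v V, of n "i div 2"] by presburger
 obtain r G where r: "strict_mono (r :: nat => nat)" and G: "\<forall>k. G k \<in> time.L2"
  and FG: "\<forall>k. \<forall>h\<in>time.L2. (%n. time.ip (F (r n) k) h) \<longlonglongrightarrow> time.ip (G k) h"
  using time.weak_compactness[of F "%_. max (sqrt B) (sqrt V0)"] FL FB by blast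
 define d' where "d' k = G (2 * k)" for k
 define v' where "v' k = G (Suc (2 * k))" for k
 define c' where "c' k t = \<gamma> k + time.prim (d' k) t" for k t
 have L': "d' k \<in> time.L2" "v' k \<in> time.L2" for k
  using G by (simp_all add: d'_def v'_def)
 have dw: "(%n. time.ip (d (r n) k) h) \<longlonglongrightarrow> time.ip (d' k) h" if "h \<in> time.L2" for k h
  using FG[rule_format, OF that, of "2 * k"] by (simp add: F_def d'_def)
 have vw: "(%n. time.ip (v (r n) k) h) \<longlonglongrightarrow> time.ip (v' k) h" if "h \<in> time.L2" for k h
  using FG[rule_format, OF that, of "Suc (2 * k)"] by (simp add: F_def v'_def)
 have d'f: "time.L2_family d'"
 proof (rule time.L2_family_of_partial_bound(1)[OF L'(1)])
  show "(\<Sum>k<K. (time.nrm (d' k))^2) <= B" for K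
   by (rule time.weak_lsc[OF time.L2_familyD[OF d] L'(1) dw[OF L'(1)] time.L2_family_partial_le[OF d B(2)]])
 qed
 have v'f: "time.L2_family v'"
 proof (rule time.L2_family_of_partial_bound(1)[OF L'(2)])
  show "(\<Sum>k<K. (time.nrm (v' k))^2) <= V0" for K
   by (rule time.weak_lsc[OF time.L2_familyD[OF v] L'(2) vw[OF L'(2)] time.L2_family_partial_le[OF v V]])
 qed
 have c'd: "\<forall>k. \<forall>t\<in>{0..T}. c' k t = \<gamma> k + time.prim (d' k) t" by (simp add: c'_def)
 have cL: "c n k \<in> time.L2" "c' k \<in> time.L2" for n k
  by (rule state_coef_L2[OF d cd], rule state_coef_L2[OF d'f c'd])
 have cB: "\<bar>c n k t\<bar> <= \<bar>\<gamma> k\<bar> + sqrt (T - 0) * sqrt B" if t: "t \<in> {0..T}" for n k t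
  using time.prim_abs_le[OF time.L2_familyD[OF d] t time.nrm_le_sqrt_of_L2_family[OF d B(2)], of n k] cd t
  by (smt (verit, best))
 have cl: "(%n. c (r n) k t) \<longlonglongrightarrow> c' k t" if t: "t \<in> {0..T}" for k t
 proof -
  have "c (r n) k t = \<gamma> k + time.ip (d (r n) k) (indicator {0..t})" for n
   using cd t time.prim_eq_ip[OF time.L2_familyD[OF d] t] by auto
  moreover have "c' k t = \<gamma> k + time.ip (d' k) (indicator {0..t})"
   using time.prim_eq_ip[OF L'(1) t] by (simp add: c'_def)
  ultimately show ?thesis by (simp add: tendsto_add dw time.indicator_L2)
 qed
 have c'B: "\<bar>c' k t\<bar> <= \<bar>\<gamma> k\<bar> + sqrt (T - 0) * sqrt B" if t: "t \<in> {0..T}" for k t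
  by (rule LIMSEQ_le_const2[OF tendsto_rabs[OF cl[OF t]]]) (use cB[OF t] in blast)
 have cn: "(%n. time.nrm (%t. c (r n) k t - c' k t)) \<longlonglongrightarrow> 0" for k
 proof (rule time.nrm_tendsto_0_bounded[OF cL(1) cL(2)])
  show "(%n. c (r n) k t) \<longlonglongrightarrow> c' k t" if "t \<in> {0<..<T}" for t using that by (intro cl) auto
  show "\<bar>c (r n) k t - c' k t\<bar> <= 2 * (\<bar>\<gamma> k\<bar> + sqrt (T - 0) * sqrt B)" if "t \<in> {0<..<T}" for n t
   using cB[of t "r n" k] c'B[of t k] that by (simp add: abs_le_iff)
 qed
 have scL: "(%t. q * c n k t) \<in> time.L2" "(%t. q * c' k t) \<in> time.L2" for q n k
  by (intro time.L2_scale cL)+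
 have snl: "(%n. time.nrm (%t. q * c (r n) k t - q * c' k t)) \<longlonglongrightarrow> 0" for q k
  unfolding right_diff_distrib[symmetric] time.nrm_scale using tendsto_mult_left[OF cn, of "\<bar>q\<bar>" k] by simp
 have "(\<Sum>k<K. (time.nrm (%t. w k ^ 4 * c' k t))^2) <= B" for K
 proof (rule time.weak_lsc[where f = "%n k t. w k ^ 4 * c (r n) k t"])
  show "(%n. time.ip (%t. w k ^ 4 * c (r n) k t) (%t. w k ^ 4 * c' k t))
   \<longlonglongrightarrow> time.ip (%t. w k ^ 4 * c' k t) (%t. w k ^ 4 * c' k t)" for k
   by (rule time.ip_tendsto[OF scL(1) scL(2) scL(2) snl])
  show "(\<Sum>k<K. (time.nrm (%t. w k ^ 4 * c (r n) k t))^2) <= B" for n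
   by (rule time.L2_family_partial_le[OF c4 B(1)])
 qed (rule scL)+
 note c4' = time.L2_family_of_partial_bound[where g = "%k t. w k ^ 4 * c' k t" and B = B, OF scL(2) this]
 \<comment> \<open>strong convergence of the third derivatives\<close>
 define D where "D n k t = c (r n) k t - c' k t" for n k t
 have Dj: "time.L2_family (%k t. w k ^ j * D n k t)" if "j <= 4" for n j
  using time.L2_family_diff[OF state_family[OF d c4 cd that] state_family[OF d'f c4'(1) c'd that]]
  by (simp add: D_def right_diff_distrib)
 \<comment> \<open>the absolute value only matters where the series diverges\<close>
 define P where "P n t = \<bar>\<Sum>k. (w k ^ 3 * D n k t)^2\<bar>" for n t
 define f where "f n k = (\<integral>t. (w k ^ 3 * D n k t)^2 \<partial>Tm)" for n k
 have fw: "(w k)^2 * f n k = (\<integral>t. (w k ^ 4 * D n k t)^2 \<partial>Tm)" for n k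
  unfolding f_def integral_mult_right_zero[symmetric]
  by (rule Bochner_Integration.integral_cong[OF refl]) (simp add: power_mult_distrib eval_nat_numeral)
 have "(%n. \<Sum>k. f n k) \<longlonglongrightarrow> 0"
 proof (rule tight_series_tendsto)
  show "0 <= f n k" for n k by (simp add: f_def)
  show "(%n. f n k) \<longlonglongrightarrow> 0" for k
   using tendsto_power[OF snl[of "w k ^ 3" k], of 2]
   by (simp add: time.nrm_sq' f_def D_def right_diff_distrib)
  show "summable (%k. (w k)^2 * f n k)" for n unfolding fw by (rule time.L2_family_summable[OF Dj]) simp
  show "summable (f n)" for n unfolding f_def[abs_def] by (rule time.L2_family_summable[OF Dj]) simp
  show "(\<Sum>k. (w k)^2 * f n k) <= 2 * B + 2 * B" for n
   unfolding fw
  proof (rule suminf_le_const[OF time.L2_family_summable[OF Dj]])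
   fix K
   have "(\<Sum>k<K. \<integral>t. (w k ^ 4 * D n k t)^2 \<partial>Tm)
     <= (\<Sum>k<K. 2 * (time.nrm (%t. w k ^ 4 * c (r n) k t))^2 + 2 * (time.nrm (%t. w k ^ 4 * c' k t))^2)"
   proof (rule sum_mono)
    fix k
    have i: "integrable Tm (%t. (w k ^ 4 * c (r n) k t)^2)" "integrable Tm (%t. (w k ^ 4 * c' k t)^2)"
     by (rule time.L2_sq[OF scL(1)], rule time.L2_sq[OF scL(2)])
    have "(x - y)^2 <= 2 * x^2 + 2 * y^2" for x y :: real
     using zero_le_power2[of "x + y"] by (simp add: power2_sum power2_diff)
    then have "(\<integral>t. (w k ^ 4 * D n k t)^2 \<partial>Tm) <= (\<integral>t. 2 * (w k ^ 4 * c (r n) k t)^2 + 2 * (w k ^ 4 * c' k t)^2 \<partial>Tm)"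
     unfolding D_def right_diff_distrib
     by (intro integral_mono time.L2_sq time.L2_diff scL Bochner_Integration.integrable_add integrable_mult_right i)
    then show "(\<integral>t. (w k ^ 4 * D n k t)^2 \<partial>Tm)
      <= 2 * (time.nrm (%t. w k ^ 4 * c (r n) k t))^2 + 2 * (time.nrm (%t. w k ^ 4 * c' k t))^2"
     using i by (simp add: time.nrm_sq')
   qed
   also have "\<dots> <= 2 * B + 2 * B"
    unfolding sum.distrib sum_distrib_left[symmetric]
    by (intro add_mono mult_left_mono time.L2_family_partial_le[OF c4 B(1)] time.L2_family_partial_le[OF c4'(1) c4'(2)]) simp_all
   finally show "(\<Sum>k<K. \<integral>t. (w k ^ 4 * D n k t)^2 \<partial>Tm) <= 2 * B + 2 * B" .
  qed simp
 qed
 moreover have Pi: "integrable Tm (P n)" for n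
  unfolding P_def[abs_def] by (intro integrable_abs time.L2_family_AE(2) Dj) simp
 moreover have PI: "(\<integral>t. P n t \<partial>Tm) = (\<Sum>k. f n k)" for n
 proof -
  have "AE t in Tm. P n t = (\<Sum>k. (w k ^ 3 * D n k t)^2)"
   using time.L2_family_AE(1)[OF Dj[of 3 n], simplified]
   by eventually_elim (simp add: P_def suminf_nonneg)
  then have "(\<integral>t. P n t \<partial>Tm) = (\<integral>t. (\<Sum>k. (w k ^ 3 * D n k t)^2) \<partial>Tm)"
   by (rule integral_cong_AE[OF borel_measurable_integrable[OF Pi] time.L2_family_sum_meas[OF Dj], rotated]) simp
  then show ?thesis using time.L2_family_AE(3)[OF Dj[of 3 n]] by (simp add: f_def)
 qed
 moreover have P0: "0 <= P n t" for n t by (simp add: P_def)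
 ultimately have PL: "(%n. \<integral>t. P n t \<partial>Tm) \<longlonglongrightarrow> 0" by simp
 \<comment> \<open>at almost every time the states converge uniformly in space, so the bounds persist\<close>
 obtain q where q: "strict_mono (q :: nat => nat)" "AE t in Tm. (%n. P (q n) t) \<longlonglongrightarrow> 0"
  using tendsto_L1_AE_subseq[where M = Tm and u = P, OF Pi] PL P0 by fastforce
 have h4: "AE t in Tm. \<forall>n. hs 4 (%k. c (r n) k t)"
  unfolding AE_all_countable using time.L2_family_AE(1)[OF c4] by (simp add: hs_def)
 have h4': "AE t in Tm. hs 4 (%k. c' k t)"
  using time.L2_family_AE(1)[OF c4'(1)] by (simp add: hs_def)
 have tI: "AE t in Tm. t \<in> {0<..<T}" by (intro AE_I2) simp
 have bd: "AE t in Tm. \<forall>n. \<forall>x\<in>{a..b}. C0 <= ser e (%k. c (r n) k t) x \<and> ser e (%k. c (r n) k t) x <= R"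
  unfolding AE_all_countable
 proof
  fix n show "AE t in Tm. \<forall>x\<in>{a..b}. C0 <= ser e (%k. c (r n) k t) x \<and> ser e (%k. c (r n) k t) x <= R"
   using pos[of "r n"] R[of "r n"] by eventually_elim blast
 qed
 have c0: "c (r n) 0 t = c' 0 t" if "t \<in> {0..T}" for n t
 proof -
  have "c (r n) 0 t = \<gamma> 0" for n by (rule adm_zero_mode[OF ad that])
  then show ?thesis using cl[OF that, of 0] LIMSEQ_unique[OF tendsto_const] by auto
 qed
 have bd': "AE t in Tm. \<forall>x\<in>{a..b}. C0 <= ser e (%k. c' k t) x \<and> ser e (%k. c' k t) x <= R"
  using h4 h4' bd q(2) tI
 proof eventually_elim
  case (elim t)
  note h = elim(1,2) and bd = elim(3) and P = elim(4) and t = elim(5)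
  show ?case
  proof
   fix x assume x: "x \<in> {a..b}"
   have le: "\<bar>ser e (%k. c (r (q n)) k t) x - ser e (%k. c' k t) x\<bar> <= eb * (sqrt Zw / (w 1)^2 * sqrt (P (q n) t))" for n
   proof -
    have "nrm (sder 3 (%k. c (r (q n)) k t - c' k t)) = sqrt (P (q n) t)"
     using nrm_sder_sq[OF hs_diff[OF h(1)[rule_format, of "q n"] h(2)], of 3, symmetric] by (simp add: P_def D_def)
    then show ?thesis
     using ser_near[OF h(1)[rule_format, of "q n"] h(2), of x] c0[of t "q n"] t by simp
   qed
   have "(%n. eb * (sqrt Zw / (w 1)^2 * sqrt (P (q n) t))) \<longlonglongrightarrow> eb * (sqrt Zw / (w 1)^2 * sqrt 0)"
    by (intro tendsto_mult_left tendsto_real_sqrt P)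
   then have lim: "(%n. eb * (sqrt Zw / (w 1)^2 * sqrt (P (q n) t))) \<longlonglongrightarrow> 0" by simp
   have "(%n. ser e (%k. c (r (q n)) k t) x - ser e (%k. c' k t) x) \<longlonglongrightarrow> 0"
    by (rule Lim_null_comparison[OF always_eventually lim]) (use le in \<open>unfold real_norm_def, blast\<close>)
   then have l: "(%n. ser e (%k. c (r (q n)) k t) x) \<longlonglongrightarrow> ser e (%k. c' k t) x" by (rule LIM_zero_cancel)
   show "C0 <= ser e (%k. c' k t) x \<and> ser e (%k. c' k t) x <= R"
    using LIMSEQ_le_const[OF l] LIMSEQ_le_const2[OF l] bd x by blast
  qed
 qed
 have n3L: "(%t. sqrt (\<Sum>k. (w k ^ 3 * c' k t)^2)) \<in> time.L2"
 proof -
  have f3: "time.L2_family (%k t. w k ^ 3 * c' k t)" by (rule state_family[OF d'f c4'(1) c'd]) simp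
  have "(%t. sqrt (\<Sum>k. (w k ^ 3 * c' k t)^2)) \<in> borel_measurable Tm"
   using time.L2_family_sum_meas[OF f3] by measurable
  moreover have "AE t in Tm. (\<Sum>k. (w k ^ 3 * c' k t)^2) = (sqrt (\<Sum>k. (w k ^ 3 * c' k t)^2))^2"
   using time.L2_family_AE(1)[OF f3] by eventually_elim (simp add: suminf_nonneg)
  then have "integrable Tm (%t. (sqrt (\<Sum>k. (w k ^ 3 * c' k t)^2))^2)"
   by (rule integrable_cong_AE_imp[OF time.L2_family_AE(2)[OF f3], rotated])
     (use time.L2_family_sum_meas[OF f3] in measurable)
  ultimately show ?thesis by (simp add: time.L2_iff)
 qed
 have PLs: "(%t. sqrt (P n t)) \<in> time.L2" for n
  using borel_measurable_integrable[OF Pi, of n] Pi[of n] P0 by (simp add: time.L2_iff)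
 have eq': "AE t in Tm. v' k t - d' k t = lam * (w k * flux_coef \<beta> (%k. c' k t) k)" for k
 proof -
  define A1 where "A1 = R powr \<beta>"
  define A2 where "A2 = \<beta> * R powr (\<beta> - 1) * (eb * (sqrt Zw / (w 1)^2))"
  define G where "G t = lam * w k * (A1 + A2 * sqrt (\<Sum>k. (w k ^ 3 * c' k t)^2))" for t
  show ?thesis
  proof (rule time.weak_limit_identification[where f = "%n t. v (r n) k t - d (r n) k t" and G = G
     and p = "%n t. sqrt (P n t)"])
   show "(%t. v (r n) k t - d (r n) k t) \<in> time.L2" for n
    by (intro time.L2_diff time.L2_familyD[OF v] time.L2_familyD[OF d])
   show "(%t. v' k t - d' k t) \<in> time.L2" by (intro time.L2_diff L')
   show "(%n. time.ip (%t. v (r n) k t - d (r n) k t) \<phi>) \<longlonglongrightarrow> time.ip (%t. v' k t - d' k t) \<phi>"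
    if \<phi>: "\<phi> \<in> time.L2" for \<phi>
    unfolding time.ip_diff_left[OF time.L2_familyD[OF v] time.L2_familyD[OF d] \<phi>]
     time.ip_diff_left[OF L'(2) L'(1) \<phi>]
    by (intro tendsto_diff vw dw \<phi>)
   show "(%t. lam * (w k * flux_coef \<beta> (%k. c' k t) k)) \<in> borel_measurable Tm"
    by (intro borel_measurable_times borel_measurable_const flux_coef_measurable[OF time.L2_meas[OF cL(2)] h4'])
   show "G \<in> time.L2"
    unfolding G_def[abs_def] by (intro time.L2_scale time.L2_add time.L2_const n3L)
   show "(%t. sqrt (P n t)) \<in> time.L2" for n by (rule PLs)
   show "(%n. time.nrm (%t. sqrt (P n t))) \<longlonglongrightarrow> 0"
    using tendsto_real_sqrt[OF PL] P0 by (simp add: L2_norm_def)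
   show "AE t in Tm. \<bar>(v (r n) k t - d (r n) k t) - lam * (w k * flux_coef \<beta> (%k. c' k t) k)\<bar> <= G t * sqrt (P n t)" for n
    using h4 h4' bd bd' tI eq[of "r n"]
   proof eventually_elim
    case (elim t)
    note h = elim(1,2) and bd = elim(3,4) and t = elim(5) and eqt = elim(6)
    have n3: "nrm (sder 3 (%k. c (r n) k t - c' k t)) = sqrt (P n t)"
     using nrm_sder_sq[OF hs_diff[OF h(1)[rule_format, of n] h(2)], of 3, symmetric] by (simp add: P_def D_def)
    have n3': "nrm (sder 3 (%k. c' k t)) = sqrt (\<Sum>k. (w k ^ 3 * c' k t)^2)"
     using nrm_sder[OF h(2), of 3] by simp
    have ct: "c (r n) 0 t = c' 0 t" using t by (intro c0) auto
    have "\<bar>flux_coef \<beta> (%k. c (r n) k t) k - flux_coef \<beta> (%k. c' k t) k\<bar>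
      <= (A1 + A2 * sqrt (\<Sum>k. (w k ^ 3 * c' k t)^2)) * sqrt (P n t)"
     using flux_coef_Lipschitz[OF \<beta> C0 h(1)[rule_format, of n] h(2) ct, of R k] bd
     unfolding n3 n3' A1_def A2_def by blast
    then have "lam * w k * \<bar>flux_coef \<beta> (%k. c (r n) k t) k - flux_coef \<beta> (%k. c' k t) k\<bar>
      <= lam * w k * ((A1 + A2 * sqrt (\<Sum>k. (w k ^ 3 * c' k t)^2)) * sqrt (P n t))"
     using lam by (intro mult_left_mono) auto
    moreover have "(v (r n) k t - d (r n) k t) - lam * (w k * flux_coef \<beta> (%k. c' k t) k)
      = lam * w k * (flux_coef \<beta> (%k. c (r n) k t) k - flux_coef \<beta> (%k. c' k t) k)"
     using eqt by (simp add: right_diff_distrib mult.assoc)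
    ultimately show ?case
     using lam by (simp add: G_def abs_mult mult.assoc)
   qed
  qed
 qed
 have eqA: "AE t in Tm. \<forall>k. v' k t - d' k t = lam * (w k * flux_coef \<beta> (%k. c' k t) k)"
  unfolding AE_all_countable using eq' by blast
 have "AE t in Tm. v' 0 t = 0"
 proof (rule time.AE_zero_of_ip[OF L'(2)])
  have "time.ip (v (r n) 0) (v' 0) = 0" for n
   using time.ip_cong_AE[OF v0 time.L2_familyD[OF v], of "v' 0" "v' 0" "r n"] L'(2) by (simp add: time.ip_def)
  then show "time.ip (v' 0) (v' 0) = 0" using LIMSEQ_unique[OF vw[OF L'(2)], of 0 0 0] by simp
 qed
 moreover have "AE t in Tm. \<forall>k. d' k t = v' k t - lam * (w k * flux_coef \<beta> (%k. c' k t) k)"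
  using eqA by eventually_elim (simp add: diff_eq_eq eq_diff_eq)
 moreover have "AE t in Tm. \<forall>x\<in>{a..b}. C0 <= ser e (%k. c' k t) x" using bd' by eventually_elim blast
 ultimately have "adm lam \<beta> \<gamma> C0 c' d' v'" using d'f v'f c4'(1) c'd by (simp add: adm_def)
 moreover have "\<forall>k. (%n. time.nrm (%t. c (r n) k t - c' k t)) \<longlonglongrightarrow> 0" using cn by (rule allI)
 moreover have "\<forall>k. \<forall>h\<in>time.L2. (%n. time.ip (v (r n) k) h) \<longlonglongrightarrow> time.ip (v' k) h"
 proof (intro allI ballI)
  fix k h assume "h \<in> time.L2"
  then show "(%n. time.ip (v (r n) k) h) \<longlonglongrightarrow> time.ip (v' k) h" by (rule vw)
 qed
 ultimately show ?thesis using r by (intro exI conjI)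
qed

end

section \<open>Existence for the coefficient problem\<close>

context space_time
begin

text \<open>With this bound only \<open>\<Sum> w\<^sub>k |\<gamma>\<^sub>k|\<close> has to be finite, which initial values in \<open>H\<^sup>2\<close> satisfy; the obvious
 bound \<open>1 - e\<^sup>-\<^sup>z \<le> z\<close> would require \<open>\<Sum> w\<^sub>k\<^sup>4 |\<gamma>\<^sub>k|\<close>.\<close>

lemma one_minus_exp_le:
 assumes "0 <= (y::real)"
 shows "1 - exp (- (y ^ 4)) <= y"
proof (cases "1 <= y")
 case True
 then show ?thesis using exp_gt_zero[of "- (y ^ 4)"] by linarith
next
 case False
 then have "y ^ 4 <= y ^ 1" using assms by (intro power_decreasing) auto
 then show ?thesis using exp_ge_add_one_self[of "- (y ^ 4)"] by simp
qed

text \<open>The state is prescribed as a biharmonic heat flow with small diffusivity \<open>\<delta>\<close>, and \<open>v\<close> is defined by the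
 equation.  The flow has the regularity that a state needs for initial values in \<open>H\<^sup>2\<close>, and it leaves
 \<open>y\<^sub>0\<close> slowly enough not to use up the gap between \<open>C1\<close> and \<open>C0\<close>.\<close>

lemma exists_admissible:
 assumes \<beta>: "1 <= \<beta>" and C0: "0 < C0" "C0 < C1" and lam: "0 < lam" and \<gamma>: "hs 2 \<gamma>"
  and pos: "\<forall>x\<in>{a..b}. C1 <= ser e \<gamma> x"
 shows "\<exists>c d v. adm lam \<beta> \<gamma> C0 c d v"
proof -
 have ab: "summable (%k. \<bar>\<gamma> k\<bar>)" "summable (%k. \<bar>w k * \<gamma> k\<bar>)"
  using hs_abs[OF \<gamma>, of 0] hs_abs[OF \<gamma>, of 1] by simp_all
 define S where "S = (\<Sum>k. \<bar>w k * \<gamma> k\<bar>)"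
 have S: "0 <= S" unfolding S_def by (rule suminf_nonneg[OF ab(2)]) simp
 \<comment> \<open>the mode \<open>k\<close> of the flow moves by at most \<open>\<theta> w\<^sub>k |\<gamma>\<^sub>k|\<close>, which costs the gap at most\<close>
 define \<theta> where "\<theta> = (C1 - C0) / (eb * (S + 1))"
 have \<theta>: "0 < \<theta>" unfolding \<theta>_def using C0 eb_pos S by (intro divide_pos_pos mult_pos_pos) auto
 have \<theta>S: "eb * (\<theta> * S) <= C1 - C0"
 proof -
  have "eb * (\<theta> * S) <= eb * (\<theta> * (S + 1))" using eb_pos \<theta> by (intro mult_left_mono) auto
  also have "\<dots> = C1 - C0" using eb_pos S by (simp add: \<theta>_def)
  finally show ?thesis .
 qed
 define \<delta> where "\<delta> = \<theta> ^ 4 / T"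
 have \<delta>: "0 < \<delta>" using \<theta> T_pos by (simp add: \<delta>_def)
 define c where "c k t = \<gamma> k * exp (- (\<delta> * w k ^ 4 * t))" for k t
 define d where "d k t = - (\<delta> * w k ^ 4 * c k t)" for k t
 define v where "v k t = d k t + lam * (w k * flux_coef \<beta> (%k. c k t) k)" for k t
 have ex: "exp (- (\<delta> * w k ^ 4 * t)) <= 1" if "t \<in> {0..T}" for k t
  using that \<delta> by simp
 have cle: "\<bar>c k t\<bar> <= \<bar>\<gamma> k\<bar>" if "t \<in> {0..T}" for k t
  using mult_left_mono[OF ex[OF that], of "\<bar>\<gamma> k\<bar>" k] by (simp add: c_def abs_mult)
 have near: "\<bar>\<gamma> k - c k t\<bar> <= \<theta> * \<bar>w k * \<gamma> k\<bar>" if t: "t \<in> {0..T}" for k t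
 proof -
  have "\<delta> * w k ^ 4 * t <= \<delta> * w k ^ 4 * T" using t \<delta> by (intro mult_left_mono) auto
  also have "\<dots> = (\<theta> * w k) ^ 4" using T_pos by (simp add: \<delta>_def power_mult_distrib)
  finally have "1 - exp (- (\<delta> * w k ^ 4 * t)) <= 1 - exp (- ((\<theta> * w k) ^ 4))" by simp
  also have "\<dots> <= \<theta> * w k" using \<theta> by (intro one_minus_exp_le) simp
  finally have "\<bar>\<gamma> k\<bar> * (1 - exp (- (\<delta> * w k ^ 4 * t))) <= \<bar>\<gamma> k\<bar> * (\<theta> * w k)" by (rule mult_left_mono) simp
  moreover have "\<bar>\<gamma> k - c k t\<bar> = \<bar>\<gamma> k\<bar> * (1 - exp (- (\<delta> * w k ^ 4 * t)))"
  proof -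
   have "\<gamma> k - c k t = \<gamma> k * (1 - exp (- (\<delta> * w k ^ 4 * t)))" by (simp add: c_def right_diff_distrib)
   then show ?thesis using ex[OF t, of k] by (simp add: abs_mult)
  qed
  ultimately show ?thesis by (simp add: abs_mult mult_ac)
 qed
 have cabs: "summable (%k. \<bar>c k t\<bar>)" if "t \<in> {0..T}" for t
  by (rule summable_comparison_test'[OF ab(1), of 0]) (use cle[OF that] in simp)
 have lo: "C0 <= ser e (%k. c k t) x" if t: "t \<in> {0..T}" and x: "x \<in> {a..b}" for t x
 proof -
  have sd: "summable (%k. \<bar>\<gamma> k - c k t\<bar>)"
   by (rule summable_comparison_test'[OF summable_mult[OF ab(2), of \<theta>], of 0]) (use near[OF t] in simp)
  have "\<bar>ser e (%k. \<gamma> k - c k t) x\<bar> <= eb * (\<Sum>k. \<bar>\<gamma> k - c k t\<bar>)" by (rule ser_abs_bound[OF ons_e sd])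
  also have "\<dots> <= eb * (\<theta> * S)"
   unfolding S_def suminf_mult[OF ab(2), symmetric] using eb_pos
   by (intro mult_left_mono suminf_le near[OF t] sd summable_mult[OF ab(2)]) auto
  finally have "\<bar>ser e (%k. \<gamma> k - c k t) x\<bar> <= C1 - C0" using \<theta>S by linarith
  moreover have "ser e \<gamma> x - ser e (%k. c k t) x = ser e (%k. \<gamma> k - c k t) x"
   by (rule ser_diff[OF ons_e ab(1) cabs[OF t]])
  ultimately show ?thesis using pos x by (smt (verit, best))
 qed
 define R where "R = eb * (\<Sum>k. \<bar>\<gamma> k\<bar>)"
 have up: "ser e (%k. c k t) x <= R" if t: "t \<in> {0..T}" for t x
 proof -
  have "ser e (%k. c k t) x <= \<bar>ser e (%k. c k t) x\<bar>" by simp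
  also have "\<dots> <= eb * (\<Sum>k. \<bar>c k t\<bar>)" by (rule ser_abs_bound[OF ons_e cabs[OF t]])
  also have "\<dots> <= R" unfolding R_def using eb_pos
   by (intro mult_left_mono suminf_le cle[OF t] cabs[OF t] ab) auto
  finally show ?thesis .
 qed
 have cD: "(c k has_real_derivative d k t) (at t within A)" for k t A
  unfolding c_def[abs_def] d_def by (auto intro!: derivative_eq_intros)
 have cc: "continuous_on A (c k)" for A k by (rule DERIV_continuous_on[OF cD])
 have dc: "continuous_on A (d k)" for A k unfolding d_def by (intro continuous_intros cc)
 have cm: "c k \<in> borel_measurable Tm" for k by (rule time.continuous_meas[OF cc])
 have cd: "\<forall>k. \<forall>t\<in>{0..T}. c k t = \<gamma> k + time.prim (d k) t"
 proof (intro allI ballI)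
  fix k t assume "t \<in> {0..T}"
  then have "(d k has_integral (c k t - c k 0)) {0..t}"
   by (intro fundamental_theorem_of_calculus) (auto simp flip: has_real_derivative_iff_has_vector_derivative intro: cD)
  then show "c k t = \<gamma> k + time.prim (d k) t" by (simp add: time.prim_def integral_unique c_def)
 qed
 have c4: "time.L2_family (%k t. w k ^ 4 * c k t)"
 proof (rule time.L2_family_of_partial_bound(1))
  show L: "(%t. w k ^ 4 * c k t) \<in> time.L2" for k
   by (rule time.continuous_L2) (intro continuous_intros cc)
  have sq: "(time.nrm (%t. w k ^ 4 * c k t))^2 <= w k ^ 4 * (\<gamma> k)^2 / (2 * \<delta>)" for k
  proof -
   let ?f = "%t. (2 * \<delta> * w k ^ 4) * exp (- (2 * \<delta> * w k ^ 4 * t))"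
   have "(\<integral>t. ?f t \<partial>Tm) = - exp (- (2 * \<delta> * w k ^ 4 * T)) - (- exp (- (2 * \<delta> * w k ^ 4 * 0)))"
    by (rule time.FTC_M) (auto intro!: derivative_eq_intros continuous_intros)
   also have "\<dots> <= 1" by simp
   finally have f: "(\<integral>t. ?f t \<partial>Tm) <= 1" .
   have "2 * \<delta> * (time.nrm (%t. w k ^ 4 * c k t))^2 = (\<integral>t. (w k ^ 4 * (\<gamma> k)^2) * ?f t \<partial>Tm)"
    unfolding time.nrm_sq' integral_mult_right_zero[symmetric]
   proof (rule Bochner_Integration.integral_cong[OF refl])
    fix t
    have "(exp (- (\<delta> * w k ^ 4 * t)))^2 = exp (- (2 * \<delta> * w k ^ 4 * t))"
     by (simp add: mult.assoc flip: exp_double)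
    then show "2 * \<delta> * (w k ^ 4 * c k t)^2 = (w k ^ 4 * (\<gamma> k)^2) * ?f t"
     by (simp add: c_def power_mult_distrib power2_eq_square[of "w k ^ 4"])
   qed
   also have "\<dots> = (w k ^ 4 * (\<gamma> k)^2) * (\<integral>t. ?f t \<partial>Tm)" by (rule integral_mult_right_zero)
   also have "\<dots> <= (w k ^ 4 * (\<gamma> k)^2) * 1" by (rule mult_left_mono[OF f]) simp
   finally show ?thesis using \<delta> by (simp add: field_simps)
  qed
  show "(\<Sum>k<K. (time.nrm (%t. w k ^ 4 * c k t))^2) <= (\<Sum>k. w k ^ 4 * (\<gamma> k)^2 / (2 * \<delta>))" for K
   by (rule order_trans[OF sum_mono[OF sq] sum_le_suminf[OF summable_divide[OF hs_2_weights(2)[OF \<gamma>]]]])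
     (use \<delta> in auto)
 qed
 have d: "time.L2_family d"
 proof (rule time.L2_family_dominated[OF _ c4 c4, where A = "\<delta>^2" and B = 0])
  show "d k \<in> borel_measurable Tm" for k by (rule time.continuous_meas[OF dc])
  show "AE t in Tm. \<forall>k. (d k t)^2 <= \<delta>^2 * (w k ^ 4 * c k t)^2 + 0 * (w k ^ 4 * c k t)^2"
   by (simp add: d_def power_mult_distrib)
 qed
 have h4: "AE t in Tm. hs 4 (%k. c k t)" using time.L2_family_AE(1)[OF c4] by (simp add: hs_def)
 have tI: "AE t in Tm. t \<in> {0<..<T}" by (intro AE_I2) simp
 define m where "m = sqrt (\<Sum>k. (w k ^ 1 * \<gamma> k)^2)"
 define Q where "Q = (R powr \<beta> + (\<beta> * R powr (\<beta> - 1)) * (eb * sqrt Zw) * m)^2"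
 have v: "time.L2_family v"
 proof (rule time.L2_family_of_bound(1)[where F = "%t. 2 * (\<Sum>k. (d k t)^2) + 2 * lam^2 * (Q * (\<Sum>k. (w k ^ 4 * c k t)^2))"])
  show "v k \<in> borel_measurable Tm" for k
   unfolding v_def[abs_def]
   by (intro borel_measurable_add borel_measurable_times borel_measurable_const
     time.continuous_meas[OF dc] flux_coef_measurable[OF cm h4])
  show "integrable Tm (%t. 2 * (\<Sum>k. (d k t)^2) + 2 * lam^2 * (Q * (\<Sum>k. (w k ^ 4 * c k t)^2)))"
   by (intro Bochner_Integration.integrable_add integrable_mult_right time.L2_family_AE(2) d c4)
  show "AE t in Tm. \<forall>n. (\<Sum>k<n. (v k t)^2) <= 2 * (\<Sum>k. (d k t)^2) + 2 * lam^2 * (Q * (\<Sum>k. (w k ^ 4 * c k t)^2))"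
   using h4 tI time.L2_family_AE(1)[OF d]
  proof eventually_elim
   case (elim t)
   note h = elim(1) and elim(2) and ds = elim(3)
   then have t: "t \<in> {0..T}" by auto
   let ?F = "%k. w k * flux_coef \<beta> (%k. c k t) k"
   have lo': "\<forall>x\<in>{a..b}. C0 <= ser e (%k. c k t) x" and up': "\<forall>x\<in>{a..b}. ser e (%k. c k t) x <= R"
    using lo[OF t] up[OF t] by blast+
   have m: "nrm (sder 1 (%k. c k t)) <= m"
   proof -
    have "(w k ^ 1 * c k t)^2 <= (w k ^ 1 * \<gamma> k)^2" for k
     using mult_left_mono[OF cle[OF t, of k], of "w k"] by (simp add: abs_le_square_iff[symmetric] abs_mult)
    then show ?thesis
     using suminf_le[OF _ hs_weight[OF h, of 1] hs_weight[OF \<gamma>, of 1]] nrm_sder[OF h, of 1]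
     by (simp add: m_def)
   qed
   show ?case
   proof
    fix n
    have "(x + lam * y)^2 <= 2 * x^2 + 2 * lam^2 * y^2" for x y
     using zero_le_power2[of "x - lam * y"] by (simp add: power2_sum power2_diff power_mult_distrib)
    then have "(\<Sum>k<n. (v k t)^2) <= (\<Sum>k<n. 2 * (d k t)^2 + 2 * lam^2 * (?F k)^2)"
     unfolding v_def by (intro sum_mono)
    also have "\<dots> = 2 * (\<Sum>k<n. (d k t)^2) + 2 * lam^2 * (\<Sum>k<n. (?F k)^2)"
     by (simp add: sum.distrib sum_distrib_left)
    also have "\<dots> <= 2 * (\<Sum>k. (d k t)^2) + 2 * lam^2 * (Q * (\<Sum>k. (w k ^ 4 * c k t)^2))"
    proof (intro add_mono mult_left_mono)
     show "(\<Sum>k<n. (d k t)^2) <= (\<Sum>k. (d k t)^2)" by (rule sum_le_suminf[OF ds]) auto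
     show "(\<Sum>k<n. (?F k)^2) <= Q * (\<Sum>k. (w k ^ 4 * c k t)^2)"
      using flux_x_partial_sums[OF \<beta> C0(1) h lo' up' m, of n] nrm_sder_sq[OF h, of 4] by (simp add: Q_def)
    qed auto
    finally show "(\<Sum>k<n. (v k t)^2) <= 2 * (\<Sum>k. (d k t)^2) + 2 * lam^2 * (Q * (\<Sum>k. (w k ^ 4 * c k t)^2))" .
   qed
  qed
 qed
 have "adm lam \<beta> \<gamma> C0 c d v"
  unfolding adm_def
 proof (intro conjI d v c4 cd)
  show "AE t in Tm. v 0 t = 0" by (simp add: v_def d_def)
  show "AE t in Tm. \<forall>k. d k t = v k t - lam * (w k * flux_coef \<beta> (%k. c k t) k)" by (simp add: v_def)
  show "AE t in Tm. \<forall>x\<in>{a..b}. C0 <= ser e (%k. c k t) x"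
   using tI by eventually_elim (use lo in auto)
 qed
 then show ?thesis by blast
qed

definition cost_coef :: "real => (nat => real => real) => (nat => real => real) => (nat => real => real) => real" where
 "cost_coef \<alpha> \<eta> c v = 1 / 2 * (\<Sum>k. \<integral>t. (c k t - \<eta> k t)^2 \<partial>Tm) + \<alpha> / 2 * (\<Sum>k. \<integral>t. (v k t)^2 \<partial>Tm)"

lemma adm_state: "adm lam \<beta> \<gamma> C0 c d v ==> time.L2_family c"
 using state_family[of d c \<gamma> 0] by (simp add: adm_def)

text \<open>The tracking term converges along the subsequence, mode by mode; the control term is weakly lower
 semicontinuous.  Finite partial sums suffice, since the bound by the infimum survives \<open>K \<rightarrow> \<infinity>\<close>.\<close>

lemma coef_minimizer:
 assumes \<beta>: "1 <= \<beta>" and C0: "0 < C0" and lam: "0 < lam" and \<gamma>: "hs 2 \<gamma>" and \<alpha>: "0 < \<alpha>"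
  and \<eta>: "time.L2_family \<eta>" and ex: "\<exists>c d v. adm lam \<beta> \<gamma> C0 c d v"
 shows "\<exists>c d v. adm lam \<beta> \<gamma> C0 c d v \<and>
  (\<forall>c' d' v'. adm lam \<beta> \<gamma> C0 c' d' v' --> cost_coef \<alpha> \<eta> c v <= cost_coef \<alpha> \<eta> c' v')"
proof -
 let ?A = "{cost_coef \<alpha> \<eta> c v | c d v. adm lam \<beta> \<gamma> C0 c d v}"
 define m where "m = Inf ?A"
 have F: "time.L2_family (%k t. c k t - \<eta> k t)" "time.L2_family v" if "adm lam \<beta> \<gamma> C0 c d v" for c d v
  using time.L2_family_diff[OF adm_state[OF that] \<eta>] that by (simp_all add: adm_def)
 have parts: "0 <= (\<Sum>k. \<integral>t. (c k t - \<eta> k t)^2 \<partial>Tm)" "0 <= (\<Sum>k. \<integral>t. (v k t)^2 \<partial>Tm)"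
  if "adm lam \<beta> \<gamma> C0 c d v" for c d v
  using F[OF that] by (intro suminf_nonneg time.L2_family_summable; simp)+
 have nn: "\<alpha> / 2 * (\<Sum>k. \<integral>t. (v k t)^2 \<partial>Tm) <= cost_coef \<alpha> \<eta> c v" "0 <= cost_coef \<alpha> \<eta> c v"
  if "adm lam \<beta> \<gamma> C0 c d v" for c d v
  using parts[OF that] \<alpha> by (simp_all add: cost_coef_def)
 have bb: "bdd_below ?A" by (rule bdd_belowI[of _ 0]) (use nn(2) in blast)
 have ne: "?A \<noteq> {}" using ex by blast
 have "\<exists>c d v. adm lam \<beta> \<gamma> C0 c d v \<and> cost_coef \<alpha> \<eta> c v < m + 1 / real (Suc n)" for n
 proof -
  have "Inf ?A < m + 1 / real (Suc n)" by (simp add: m_def)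
  then show ?thesis using cInf_less_iff[OF ne bb] by blast
 qed
 then obtain c d v where ad: "\<And>n. adm lam \<beta> \<gamma> C0 (c n) (d n) (v n)"
  and near: "\<And>n. cost_coef \<alpha> \<eta> (c n) (v n) < m + 1 / real (Suc n)" by metis
 have V: "(\<Sum>k. \<integral>t. (v n k t)^2 \<partial>Tm) <= (m + 1) * 2 / \<alpha>" for n
 proof -
  have "1 / real (Suc n) <= 1" by simp
  then have "\<alpha> / 2 * (\<Sum>k. \<integral>t. (v n k t)^2 \<partial>Tm) <= m + 1" using nn(1)[OF ad, of n] near[of n] by linarith
  then show ?thesis using \<alpha> by (simp add: field_simps)
 qed
 obtain r c' d' v' where r: "strict_mono (r :: nat => nat)" and ad': "adm lam \<beta> \<gamma> C0 c' d' v'"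
  and cl: "\<forall>k. (%n. time.nrm (%t. c (r n) k t - c' k t)) \<longlonglongrightarrow> 0"
  and vw: "\<forall>k. \<forall>h\<in>time.L2. (%n. time.ip (v (r n) k) h) \<longlonglongrightarrow> time.ip (v' k) h"
  using limit_admissible[where c = c and d = d and v = v, OF \<beta> C0 lam \<gamma> ad V] by blast
 have vL: "v n k \<in> time.L2" "v' k \<in> time.L2"
  and cL: "(%t. c n k t - \<eta> k t) \<in> time.L2" "(%t. c' k t - \<eta> k t) \<in> time.L2" for n k
  using F[OF ad, of n] F[OF ad'] by (auto dest: time.L2_familyD)
 have part: "(\<Sum>k<K. 1 / 2 * (time.nrm (%t. c' k t - \<eta> k t))^2 + \<alpha> / 2 * (time.nrm (v' k))^2) <= m" for K
 proof (rule LIMSEQ_le)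
  show "(%n. \<Sum>k<K. 1 / 2 * (time.nrm (%t. c (r n) k t - \<eta> k t))^2
     + \<alpha> / 2 * (2 * time.ip (v (r n) k) (v' k) - (time.nrm (v' k))^2))
    \<longlonglongrightarrow> (\<Sum>k<K. 1 / 2 * (time.nrm (%t. c' k t - \<eta> k t))^2 + \<alpha> / 2 * (time.nrm (v' k))^2)"
  proof (rule tendsto_sum)
   fix k
   have "(%n. time.nrm (%t. (c (r n) k t - \<eta> k t) - (c' k t - \<eta> k t))) \<longlonglongrightarrow> 0" using cl by simp
   then have 1: "(%n. (time.nrm (%t. c (r n) k t - \<eta> k t))^2) \<longlonglongrightarrow> (time.nrm (%t. c' k t - \<eta> k t))^2"
    by (intro tendsto_power time.nrm_tendsto[OF cL(1) cL(2)])
   have 2: "(%n. 2 * time.ip (v (r n) k) (v' k) - (time.nrm (v' k))^2)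
     \<longlonglongrightarrow> 2 * time.ip (v' k) (v' k) - (time.nrm (v' k))^2"
    by (intro tendsto_diff tendsto_mult tendsto_const) (use vw vL in blast)
   have "2 * time.ip (v' k) (v' k) - (time.nrm (v' k))^2 = (time.nrm (v' k))^2" by (simp add: time.nrm_sq)
   with tendsto_add[OF tendsto_mult_left[OF 1, of "1 / 2"] tendsto_mult_left[OF 2, of "\<alpha> / 2"]]
   show "(%n. 1 / 2 * (time.nrm (%t. c (r n) k t - \<eta> k t))^2
     + \<alpha> / 2 * (2 * time.ip (v (r n) k) (v' k) - (time.nrm (v' k))^2))
    \<longlonglongrightarrow> 1 / 2 * (time.nrm (%t. c' k t - \<eta> k t))^2 + \<alpha> / 2 * (time.nrm (v' k))^2" by simp
  qed
  have "(%n. m + 1 / real (Suc n)) \<longlonglongrightarrow> m + 0" by (intro tendsto_add tendsto_const LIMSEQ_Suc lim_1_over_n)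
  then show "(%n. m + 1 / real (Suc (r n))) \<longlonglongrightarrow> m"
   using LIMSEQ_subseq_LIMSEQ[OF _ r, of "%n. m + 1 / real (Suc n)" m] by (simp add: o_def del: of_nat_Suc)
  have "(\<Sum>k<K. 1 / 2 * (time.nrm (%t. c n k t - \<eta> k t))^2
     + \<alpha> / 2 * (2 * time.ip (v n k) (v' k) - (time.nrm (v' k))^2)) <= m + 1 / real (Suc n)" for n
  proof -
   have "2 * time.ip (v n k) (v' k) - (time.nrm (v' k))^2 <= (time.nrm (v n k))^2" for k
   proof -
    have "2 * time.ip (v n k) (v' k) <= 2 * (time.nrm (v n k) * time.nrm (v' k))"
     using time.Cauchy_Schwarz_ip[OF vL, of n k k] by linarith
    moreover have "0 <= (time.nrm (v n k) - time.nrm (v' k))^2" by simp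
    ultimately show ?thesis unfolding power2_diff by linarith
   qed
   then have "(\<Sum>k<K. 1 / 2 * (time.nrm (%t. c n k t - \<eta> k t))^2
     + \<alpha> / 2 * (2 * time.ip (v n k) (v' k) - (time.nrm (v' k))^2))
     <= (\<Sum>k<K. 1 / 2 * (time.nrm (%t. c n k t - \<eta> k t))^2 + \<alpha> / 2 * (time.nrm (v n k))^2)"
    using \<alpha> by (intro sum_mono add_left_mono mult_left_mono) auto
   also have "\<dots> = 1 / 2 * (\<Sum>k<K. (time.nrm (%t. c n k t - \<eta> k t))^2) + \<alpha> / 2 * (\<Sum>k<K. (time.nrm (v n k))^2)"
    unfolding sum.distrib sum_distrib_left ..
   also have "\<dots> <= cost_coef \<alpha> \<eta> (c n) (v n)"
    unfolding cost_coef_def using \<alpha>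
    by (intro add_mono mult_left_mono time.L2_family_partial_le[OF F(1)[OF ad] order_refl]
      time.L2_family_partial_le[OF F(2)[OF ad] order_refl]) auto
   finally show ?thesis using near[of n] by linarith
  qed
  then show "\<exists>N. \<forall>n\<ge>N. (\<Sum>k<K. 1 / 2 * (time.nrm (%t. c (r n) k t - \<eta> k t))^2
     + \<alpha> / 2 * (2 * time.ip (v (r n) k) (v' k) - (time.nrm (v' k))^2)) <= m + 1 / real (Suc (r n))"
   by blast
 qed
 have "cost_coef \<alpha> \<eta> c' v' <= m"
 proof -
  note s = time.L2_family_summable[OF F(1)[OF ad']] time.L2_family_summable[OF F(2)[OF ad']]
  have "cost_coef \<alpha> \<eta> c' v' = (\<Sum>k. 1 / 2 * (\<integral>t. (c' k t - \<eta> k t)^2 \<partial>Tm) + \<alpha> / 2 * (\<integral>t. (v' k t)^2 \<partial>Tm))"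
   unfolding cost_coef_def suminf_mult[OF s(1), symmetric] suminf_mult[OF s(2), symmetric]
   by (rule suminf_add[OF summable_mult[OF s(1)] summable_mult[OF s(2)]])
  also have "\<dots> <= m"
   by (rule suminf_le_const[OF summable_add[OF summable_mult[OF s(1)] summable_mult[OF s(2)]]])
     (use part in \<open>simp add: time.nrm_sq'\<close>)
  finally show ?thesis .
 qed
 moreover have "m <= cost_coef \<alpha> \<eta> x z" if "adm lam \<beta> \<gamma> C0 x y z" for x y z
  unfolding m_def by (rule cInf_lower[OF _ bb]) (use that in blast)
 ultimately show ?thesis using ad' by (meson order_trans)
qed

end

section \<open>From functions to coefficients and back\<close>

context interval
begin

lemma continuous_AE_le:
 assumes f: "continuous_on {a..b} f" and le: "AE x in M. C <= (f x :: real)" and x: "x \<in> {a..b}"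
 shows "C <= f x"
proof -
 have "max C (f x) = f x"
  by (rule continuous_AE_eq[OF continuous_on_max[OF continuous_on_const f] f _ x])
    (use le in \<open>eventually_elim, simp\<close>)
 then show ?thesis by (simp add: max_def split: if_splits)
qed

lemma has_weak_deriv_scale:
 assumes "has_weak_deriv I k f g" "f \<in> L2" "g \<in> L2"
 shows "has_weak_deriv I k (%x. q * f x) (%x. q * g x)"
 by (rule has_weak_derivI_L2)
   (use assms has_weak_derivD[OF assms(1)] in \<open>auto simp: L2_scale ip_scale_left\<close>)

lemma H1_diff:
 assumes "g \<in> H_space 1 I" "h \<in> H_space 1 I"
 shows "AE x in M. weak_deriv I 1 (%x. g x - h x) x = weak_deriv I 1 g x - weak_deriv I 1 h x"
 by (rule weak_deriv_eq_AE[OF has_weak_deriv_diff])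
   (use H_spaceD[OF assms(1), of 1] H_spaceD[OF assms(2), of 1] H_space_L2[OF assms(1)] H_space_L2[OF assms(2)] in simp_all)

lemma H10_H1: "u \<in> H10_space I ==> u \<in> H_space 1 I"
 by (simp add: H10_space_def)

text \<open>For states the formal fourth derivative of the cosine series is the weak one.\<close>

lemma Neumann_series:
 assumes f: "f \<in> H_space 4 I"
  and tr: "\<forall>x\<in>{a, b}. has_trace a b (weak_deriv I 1 f) x 0 \<and> has_trace a b (weak_deriv I 3 f) x 0"
 shows "hs 4 (%k. ip f (e k))" "AE x in M. f x = ser e (%k. ip f (e k)) x"
  "(\<Sum>k<n. (w k ^ 4 * ip f (e k))^2) <= (H_norm 4 I f)^2"
proof -
 have L: "f \<in> L2" "weak_deriv I 4 f \<in> L2"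
  using H_space_L2[OF f] H_spaceD(2)[OF f, of 4] by simp_all
 show "hs 4 (%k. ip f (e k))"
  using coef_summable[OF L(2)] by (simp add: hs_def Neumann_coef_4[OF f tr])
 show "AE x in M. f x = ser e (%k. ip f (e k)) x" by (rule ser_coef_AE[OF L(1)])
 have "(\<Sum>k<n. (w k ^ 4 * ip f (e k))^2) <= (nrm (weak_deriv I 4 f))^2"
  using Bessel[OF L(2), of n] by (simp add: Neumann_coef_4[OF f tr])
 also have "\<dots> <= (H_norm 4 I f)^2" by (intro power_mono L2_norm_le_H_norm) auto
 finally show "(\<Sum>k<n. (w k ^ 4 * ip f (e k))^2) <= (H_norm 4 I f)^2" .
qed

text \<open>Both sides of the equation are square integrable and hence determined by their cosine coefficients; the weak
 derivative \<open>q\<close> is unique and therefore equals the classical product rule expression.\<close>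

lemma flux_equation_iff:
 assumes \<beta>: "1 <= \<beta>" and C0: "0 < C0" and c: "hs 4 c" and lo: "\<forall>x\<in>{a..b}. C0 <= ser e c x"
  and f: "f \<in> L2" "AE x in M. f x = ser e c x" and g: "g \<in> L2" and u: "u \<in> L2"
 shows "(\<exists>q. has_weak_deriv I 1 (%x. lam * \<bar>f x\<bar> powr \<beta> * weak_deriv I 3 f x) q \<and> (AE x in M. g x = - q x + u x))
   \<longleftrightarrow> (\<forall>k. ip g (e k) = ip u (e k) - lam * (w k * flux_coef \<beta> c k))" (is "?L = ?R")
proof -
 have "ser e c x <= eb * (\<Sum>k. \<bar>w k ^ 0 * c k\<bar>)" for x
  using sder_sup_bound[OF c, of 0 x] by (simp add: sder_0)
 then obtain R where up: "\<forall>x\<in>{a..b}. ser e c x <= R" by blast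
 note fx = flux_x_facts[OF \<beta> C0 c lo up]
 have FL: "flux \<beta> c \<in> L2" by (rule flux_L2[OF \<beta> C0 c lo up])
 have w3: "AE x in M. weak_deriv I 3 f x = sder 3 c x" by (rule series_in_H(3)[OF c f]) simp
 have ae: "AE x in M. lam * flux \<beta> c x = lam * \<bar>f x\<bar> powr \<beta> * weak_deriv I 3 f x"
  using f(2) w3 by eventually_elim (simp add: flux_def)
 have wd: "has_weak_deriv I 1 (%x. lam * \<bar>f x\<bar> powr \<beta> * weak_deriv I 3 f x) (%x. lam * flux_x \<beta> c x)"
  by (rule has_weak_deriv_cong_AE[OF has_weak_deriv_scale[OF fx(2) FL fx(1)] L2_scale[OF FL] L2_scale[OF fx(1)] ae]) simp
 have uL: "(%x. u x - lam * flux_x \<beta> c x) \<in> L2" by (intro L2_diff L2_scale u fx(1))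
 have co: "ip (%x. u x - lam * flux_x \<beta> c x) (e k) = ip u (e k) - lam * (w k * flux_coef \<beta> c k)" for k
  unfolding ip_diff_left[OF u L2_scale[OF fx(1)] e_L2] ip_scale_left fx(3) ..
 show ?thesis
 proof
  assume ?L
  then obtain q where q: "has_weak_deriv I 1 (%x. lam * \<bar>f x\<bar> powr \<beta> * weak_deriv I 3 f x) q"
   and eq: "AE x in M. g x = - q x + u x" by blast
  have ae: "AE x in M. g x = u x - lam * flux_x \<beta> c x"
   using has_weak_deriv_unique[OF q wd] eq by eventually_elim simp
  show ?R
  proof
   fix k
   have "ip g (e k) = ip (%x. u x - lam * flux_x \<beta> c x) (e k)"
    by (rule ip_cong_AE[OF ae g _ e_L2]) simp
   then show "ip g (e k) = ip u (e k) - lam * (w k * flux_coef \<beta> c k)" unfolding co .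
  qed
 next
  assume ?R
  then have "AE x in M. g x = u x - lam * flux_x \<beta> c x"
   by (intro AE_eq_of_coef_eq g uL) (simp add: co)
  then show ?L using wd by (intro exI[of _ "%x. lam * flux_x \<beta> c x"] conjI) auto
 qed
qed

end

context space_time
begin

text \<open>\<open>c\<close> is the continuous representative in time of the coefficients of the state, so it starts exactly at the
 coefficients of \<open>y0\<close>.\<close>

lemma admissible_imp_adm:
 assumes \<beta>: "1 <= \<beta>" and C0: "0 < C0" and y0: "y0 \<in> L2"
  and yu: "(y, u) \<in> admissible T a b lam \<beta> y0 C0"
 shows "\<exists>c d v. adm lam \<beta> (%k. ip y0 (e k)) C0 c d v \<and>
   (AE t in Tm. y t \<in> L2 \<and> (\<forall>k. ip (y t) (e k) = c k t)) \<and>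
   (AE t in Tm. weak_deriv I 1 (u t) \<in> L2 \<and> (\<forall>k. ip (weak_deriv I 1 (u t)) (e k) = v k t))"
proof -
 have yH: "y \<in> bochner_L2 T (H_space 4 I) (H_norm 4 I)" and yL: "y \<in> bochner_L2 T (L2) nrm"
  and uH: "u \<in> bochner_L2 T (H10_space I) (H_norm 1 I)"
  and iv: "has_initial_value T I y y0" and bc: "boundary_conditions T a b y"
  and pos: "AE t in Tm. AE x in M. C0 <= y t x" and tf: "thin_film_equation T I lam \<beta> y u"
  using yu by (auto simp: admissible_def state_space_def control_space_def bochner_H1_def)
 obtain yt where ytL: "yt \<in> bochner_L2 T (L2) nrm" and td: "has_time_deriv T (L2) nrm y yt"
  and eq: "AE t in Tm. \<exists>q. has_weak_deriv I 1 (%x. lam * \<bar>y t x\<bar> powr \<beta> * weak_deriv I 3 (y t) x) q \<and>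
        (AE x in M. yt t x = - q x + weak_deriv I 1 (u t) x)"
  using tf by (auto simp: thin_film_equation_def)
 define d where "d k t = ip (yt t) (e k)" for k t
 define c where "c k t = ip y0 (e k) + time.prim (d k) t" for k t
 define v where "v k t = ip (weak_deriv I 1 (u t)) (e k)" for k t
 note yf = bochner_L2_coef[OF yL] and ytf = bochner_L2_coef[OF ytL]
 have d: "time.L2_family d" unfolding d_def[abs_def] by (rule ytf(1))
 have cy: "AE t in Tm. \<forall>k. ip (y t) (e k) = c k t"
  unfolding AE_all_countable
 proof
  fix k
  show "AE t in Tm. ip (y t) (e k) = c k t"
   unfolding c_def d_def
   by (rule initial_value_coef[OF iv y0 has_time_deriv_coef[OF td yL ytL]])
     (rule time.L2_familyD[OF ytf(1)], rule time.L2_familyD[OF yf(1)])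
 qed
 have cd: "\<forall>k. \<forall>t\<in>{0..T}. c k t = ip y0 (e k) + time.prim (d k) t" by (simp add: c_def)
 have uX: "AE t in Tm. u t \<in> H10_space I" and ui: "integrable Tm (%t. (H_norm 1 I (u t))^2)"
  and us: "strongly_measurable Tm (H10_space I) (H_norm 1 I) u"
  using uH by (auto simp: bochner_L2_def strongly_measurable_def)
 have yX: "AE t in Tm. y t \<in> H_space 4 I" and yi: "integrable Tm (%t. (H_norm 4 I (y t))^2)"
  using yH by (auto simp: bochner_L2_def strongly_measurable_def)
 have uL: "AE t in Tm. weak_deriv I 1 (u t) \<in> L2"
  using uX by eventually_elim (use H_spaceD(2)[OF H10_H1] in simp)
 have vm: "v k \<in> borel_measurable Tm" for k
  unfolding v_def[abs_def]
 proof (rule time.strongly_measurable_functional[OF us])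
  fix g h assume gh: "g \<in> H10_space I" "h \<in> H10_space I"
  note g = H10_H1[OF gh(1)] and h = H10_H1[OF gh(2)]
  have L: "weak_deriv I 1 g \<in> L2" "weak_deriv I 1 h \<in> L2"
   using H_spaceD(2)[OF g, of 1] H_spaceD(2)[OF h, of 1] by simp_all
  have "\<bar>ip (weak_deriv I 1 g) (e k) - ip (weak_deriv I 1 h) (e k)\<bar>
    <= nrm (%x. weak_deriv I 1 g x - weak_deriv I 1 h x)"
   using Cauchy_Schwarz_ip[OF L2_diff[OF L] e_L2, of k] unfolding nrm_e ip_diff_left[OF L e_L2] by simp
  also have "\<dots> = nrm (weak_deriv I 1 (%x. g x - h x))"
   by (rule nrm_cong_AE[OF _ L2_diff[OF L]]) (use H1_diff[OF g h] in \<open>eventually_elim, simp\<close>)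
  also have "\<dots> <= H_norm 1 I (%x. g x - h x)" by (rule L2_norm_le_H_norm) simp
  finally show "\<bar>ip (weak_deriv I 1 g) (e k) - ip (weak_deriv I 1 h) (e k)\<bar> <= H_norm 1 I (%x. g x - h x)" .
 qed
 have v: "time.L2_family v"
 proof (rule time.L2_family_of_bound(1)[OF vm ui])
  show "AE t in Tm. \<forall>n. (\<Sum>k<n. (v k t)^2) <= (H_norm 1 I (u t))^2"
   using uL
  proof eventually_elim
   case (elim t)
   note L = elim
   have "(nrm (weak_deriv I 1 (u t)))^2 <= (H_norm 1 I (u t))^2"
    by (intro power_mono L2_norm_le_H_norm) auto
   then show ?case
    unfolding v_def using Bessel[OF L] order_trans by blast
  qed
 qed
 have NS: "AE t in Tm. y t \<in> L2 \<and> hs 4 (%k. c k t) \<and> (AE x in M. y t x = ser e (%k. c k t) x) \<and>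
   (\<forall>n. (\<Sum>k<n. (w k ^ 4 * c k t)^2) <= (H_norm 4 I (y t))^2)"
  using yX bc[unfolded boundary_conditions_def] cy
 proof eventually_elim
  case (elim t)
  note f = elim(1) and tr = elim(2) and elim(3)
  then have c: "(%k. c k t) = (%k. ip (y t) (e k))" by auto
  show ?case
   using Neumann_series[OF f tr] H_space_L2[OF f] fun_cong[OF c] unfolding c by simp
 qed
 have "adm lam \<beta> (%k. ip y0 (e k)) C0 c d v"
  unfolding adm_def
 proof (intro conjI d v cd)
  show "time.L2_family (%k t. w k ^ 4 * c k t)"
  proof (rule time.L2_family_of_bound(1)[OF _ yi])
   show "(%t. w k ^ 4 * c k t) \<in> borel_measurable Tm" for k
    by (intro time.L2_meas time.L2_scale state_coef_L2[OF d cd])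
   show "AE t in Tm. \<forall>n. (\<Sum>k<n. (w k ^ 4 * c k t)^2) <= (H_norm 4 I (y t))^2"
    using NS by eventually_elim blast
  qed
  show "AE t in Tm. v 0 t = 0"
   using uX unfolding v_def by eventually_elim (rule H10_mean_zero)
  have lo: "AE t in Tm. \<forall>x\<in>{a..b}. C0 <= ser e (%k. c k t) x"
   using NS pos
  proof eventually_elim
   case (elim t)
   note A = elim(1) and p = elim(2)
   then have c: "hs 4 (%k. c k t)" and e: "AE x in M. y t x = ser e (%k. c k t) x" by auto
   have "AE x in M. C0 <= ser e (%k. c k t) x" using p e by eventually_elim simp
   then show ?case
    using sder_cont[OF c, of 0] by (intro ballI continuous_AE_le) (auto simp: sder_0)
  qed
  then show "AE t in Tm. \<forall>x\<in>{a..b}. C0 <= ser e (%k. c k t) x" .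
  show "AE t in Tm. \<forall>k. d k t = v k t - lam * (w k * flux_coef \<beta> (%k. c k t) k)"
   using NS lo eq uL ytf(2)
  proof eventually_elim
   case (elim t)
   note A = elim(1) and lo = elim(2) and q = elim(3) and L = elim(4,5)
   then have c: "hs 4 (%k. c k t)" and y: "y t \<in> L2" "AE x in M. y t x = ser e (%k. c k t) x" by auto
   show ?case
    using q unfolding flux_equation_iff[OF \<beta> C0 c lo y L(2,1)] d_def v_def .
  qed
 qed
 moreover have "AE t in Tm. y t \<in> L2 \<and> (\<forall>k. ip (y t) (e k) = c k t)"
  using yf(2) cy by eventually_elim blast
 moreover have "AE t in Tm. weak_deriv I 1 (u t) \<in> L2 \<and> (\<forall>k. ip (weak_deriv I 1 (u t)) (e k) = v k t)"
  using uL by eventually_elim (simp add: v_def)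
 ultimately show ?thesis by (intro exI conjI)
qed

lemma integrable_H_norm_sq:
 assumes f: "\<And>j. j <= m ==> time.L2_family (%k t. w k ^ j * c k t)"
  and y: "AE t in Tm. hs m (%k. c k t) \<and> (H_norm m I (y t) = sqrt (\<Sum>j\<le>m. \<Sum>k. (w k ^ j * c k t)^2))"
 shows "integrable Tm (%t. (H_norm m I (y t))^2)"
proof -
 have i: "integrable Tm (%t. \<Sum>j\<le>m. \<Sum>k. (w k ^ j * c k t)^2)"
  by (rule Bochner_Integration.integrable_sum) (use f time.L2_family_AE(2) in simp)
 have ae: "AE t in Tm. (\<Sum>j\<le>m. \<Sum>k. (w k ^ j * c k t)^2) = (H_norm m I (y t))^2"
  using y
 proof eventually_elim
  case (elim t)
  note A = elim
  then have "0 <= (\<Sum>j\<le>m. \<Sum>k. (w k ^ j * c k t)^2)"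
   by (intro sum_nonneg suminf_nonneg hs_weight) auto
  then show ?case using A by simp
 qed
 show ?thesis
  by (rule integrable_cong_AE_imp[OF i time.measurable_cong_AE[OF borel_measurable_integrable[OF i] ae]])
    (use ae in \<open>eventually_elim, simp\<close>)
qed

lemma psum_as_ser:
 assumes "ons p \<nu>"
 shows "(\<Sum>k<n. q k * p k x) = ser p (%k. if k < n then q k else 0) x"
proof -
 have "summable (%k. \<bar>if k < n then q k else 0\<bar>)" by (rule summable_finite[of "{..<n}"]) auto
 moreover have "(\<Sum>k. (if k < n then q k else 0) * p k x) = (\<Sum>k<n. (if k < n then q k else 0) * p k x)"
  by (rule suminf_finite) auto
 ultimately show ?thesis by (simp add: ser_def)
qed

text \<open>The \<open>H\<^sup>4\<close> norm of a cosine series is the square sum with weights \<open>\<Sum>\<^sub>j\<^sub>\<le>\<^sub>4 w\<^sub>k\<^sup>2\<^sup>j\<close>.\<close>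

lemma cosine_series_state:
 assumes c: "\<And>j. j <= 4 ==> time.L2_family (%k t. w k ^ j * c k t)"
 shows "(%t. ser e (%k. c k t)) \<in> bochner_L2 T (H_space 4 I) (H_norm 4 I)"
proof -
 let ?y = "%t. ser e (%k. c k t)"
 have h4: "AE t in Tm. hs 4 (%k. c k t)"
  using time.L2_family_AE(1)[OF c[of 4]] by (simp add: hs_def)
 define W where "W k = (\<Sum>j\<le>4. (w k ^ j)^2)" for k
 have Wq: "W k * z^2 = (\<Sum>j\<le>4. (w k ^ j * z)^2)" for k z
  by (simp add: W_def sum_distrib_right power_mult_distrib)
 have yL: "ser e q \<in> L2" if "hs 4 q" for q by (rule ser_L2_limit(1)[OF ons_e hs_0[OF that]])
 have sums: "summable (%k. W k * (q k)^2)"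
   "(\<Sum>j\<le>4. \<Sum>k. (w k ^ j * q k)^2) = (\<Sum>k. W k * (q k)^2)" if "hs 4 q" for q
 proof -
  show "summable (%k. W k * (q k)^2)" unfolding Wq by (rule summable_sum) (use hs_weight[OF that] in simp)
  show "(\<Sum>j\<le>4. \<Sum>k. (w k ^ j * q k)^2) = (\<Sum>k. W k * (q k)^2)"
   unfolding Wq by (rule suminf_sum[symmetric]) (use hs_weight[OF that] in simp)
 qed
 have "strongly_measurable Tm (H_space 4 I) (H_norm 4 I) ?y"
 proof (rule series_strongly_measurable[where p = e and W = W and c = c])
  show "c k \<in> borel_measurable Tm" for k using time.L2_family_meas[OF c[of 0], of k] by simp
  show "1 <= W k" for k
   using member_le_sum[of 0 "{..4}" "%j. (w k ^ j)^2"] by (simp add: W_def)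
  show "AE t in Tm. summable (%k. W k * (c k t)^2)" using h4 by eventually_elim (rule sums(1))
  show "(%x. \<Sum>k<n. q k * e k x) \<in> H_space 4 I" for q n
   unfolding psum_as_ser[OF ons_e]
   by (rule series_in_H(1)[where c = "%k. if k < n then q k else 0"]) (auto intro!: yL hs_finite[of n])
  show "AE t in Tm. ?y t \<in> H_space 4 I"
   using h4 by eventually_elim (rule series_in_H(1)[OF _ yL], auto)
  show "0 <= H_norm 4 I g" for g by (simp add: H_norm_def sum_nonneg)
  show "AE t in Tm. \<forall>q n. (H_norm 4 I (%x. (\<Sum>k<n. q k * e k x) - ?y t x))^2
     <= (\<Sum>k. W k * ((if k < n then q k else 0) - c k t)^2)"
   using h4
  proof eventually_elim
   case (elim t)
   note h = elim
   show ?case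
   proof (intro allI)
    fix q :: "nat => real" and n
    let ?q = "%k. if k < n then q k else 0"
    have hq: "hs 4 ?q" by (rule hs_finite[of n]) simp
    have hd: "hs 4 (%k. ?q k - c k t)" by (rule hs_diff[OF hq h])
    have ab: "summable (%k. \<bar>?q k\<bar>)" "summable (%k. \<bar>c k t\<bar>)"
     using hs_abs[OF hq, of 0] hs_abs[OF h, of 0] by simp_all
    have "H_norm 4 I (%x. ser e ?q x - ?y t x) = sqrt (\<Sum>j\<le>4. \<Sum>k. (w k ^ j * (?q k - c k t))^2)"
     by (rule series_in_H(2)[OF hd L2_diff[OF yL[OF hq] yL[OF h]]]) (simp add: ser_diff[OF ons_e ab])
    moreover have "0 <= (\<Sum>k. W k * (?q k - c k t)^2)"
     by (rule suminf_nonneg[OF sums(1)[OF hd]]) (simp add: W_def sum_nonneg)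
    ultimately show "(H_norm 4 I (%x. (\<Sum>k<n. q k * e k x) - ?y t x))^2 <= (\<Sum>k. W k * (?q k - c k t)^2)"
     unfolding psum_as_ser[OF ons_e] sums(2)[OF hd] by simp
   qed
  qed
 qed
 moreover have "integrable Tm (%t. (H_norm 4 I (?y t))^2)"
 proof (rule integrable_H_norm_sq[OF c])
  show "AE t in Tm. hs 4 (%k. c k t) \<and> H_norm 4 I (?y t) = sqrt (\<Sum>j\<le>4. \<Sum>k. (w k ^ j * c k t)^2)"
   using h4
  proof eventually_elim
   case (elim t)
   note h = elim
   have "H_norm 4 I (?y t) = sqrt (\<Sum>j\<le>4. \<Sum>k. (w k ^ j * c k t)^2)"
    by (rule series_in_H(2)[OF h yL[OF h]]) simp
   with h show ?case by blast
  qed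
 qed
 ultimately show ?thesis by (simp add: bochner_L2_def)
qed

lemma sine_series_control:
 assumes c: "time.L2_family c" and wc: "time.L2_family (%k t. w k * c k t)"
 shows "(%t. ser s (%k. c k t)) \<in> bochner_L2 T (H10_space I) (H_norm 1 I)"
proof -
 let ?u = "%t. ser s (%k. c k t)"
 have h1: "AE t in Tm. hs 1 (%k. c k t)"
  using time.L2_family_AE(1)[OF wc] by (simp add: hs_def)
 have uL: "ser s q \<in> L2" if "hs 1 q" for q by (rule ser_L2_limit(1)[OF ons_s hs_0[OF that]])
 have nu: "nu_s k <= 1" "0 <= nu_s k" for k by (simp_all add: nu_s_def)
 have sums: "summable (%k. (q k)^2 + (w k * q k)^2)" "summable (%k. (q k)^2 * nu_s k + (w k * q k)^2)" if "hs 1 q" for q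
 proof -
  have 1: "summable (%k. (q k)^2)" "summable (%k. (w k * q k)^2)"
   using hs_0[OF that] that by (simp_all add: hs_def)
  then show "summable (%k. (q k)^2 + (w k * q k)^2)" by (rule summable_add)
  have "summable (%k. (q k)^2 * nu_s k)"
   by (rule summable_comparison_test'[OF 1(1), of 0]) (use nu in \<open>simp add: mult_left_le\<close>)
  then show "summable (%k. (q k)^2 * nu_s k + (w k * q k)^2)" using 1(2) by (rule summable_add)
 qed
 have le: "(H_norm 1 I f)^2 <= (\<Sum>k. (q k)^2 + (w k * q k)^2)"
  if q: "hs 1 q" and f: "f \<in> L2" "AE x in M. f x = ser s q x" for f q
  unfolding sine_series_H1(3)[OF q f]
  by (rule suminf_le[OF _ sums(2)[OF q] sums(1)[OF q]]) (use nu in \<open>simp add: mult_left_le\<close>)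
 have sm: "strongly_measurable Tm (H10_space I) (H_norm 1 I) ?u"
 proof (rule series_strongly_measurable[where p = s and W = "%k. 1 + (w k)^2" and c = c])
  show "c k \<in> borel_measurable Tm" for k by (rule time.L2_family_meas[OF c])
  show "AE t in Tm. summable (%k. (1 + (w k)^2) * (c k t)^2)"
   using h1
  proof eventually_elim
   case (elim t)
   from sums(1)[OF this] show ?case
    by (simp add: distrib_right power_mult_distrib)
  qed
  show "(%x. \<Sum>k<n. q k * s k x) \<in> H10_space I" for q n
   unfolding psum_as_ser[OF ons_s]
   by (rule sine_series_H10[where c = "%k. if k < n then q k else 0"]) (auto intro!: uL hs_finite[of n])
  show "AE t in Tm. ?u t \<in> H10_space I"
   using h1 by eventually_elim (rule sine_series_H10[OF _ uL], auto)
  show "0 <= H_norm 1 I g" for g by (simp add: H_norm_def sum_nonneg)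
  show "AE t in Tm. \<forall>q n. (H_norm 1 I (%x. (\<Sum>k<n. q k * s k x) - ?u t x))^2
     <= (\<Sum>k. (1 + (w k)^2) * ((if k < n then q k else 0) - c k t)^2)"
   using h1
  proof eventually_elim
   case (elim t)
   note h = elim
   show ?case
   proof (intro allI)
    fix q :: "nat => real" and n
    let ?q = "%k. if k < n then q k else 0"
    have hq: "hs 1 ?q" by (rule hs_finite[of n]) simp
    have hd: "hs 1 (%k. ?q k - c k t)" by (rule hs_diff[OF hq h])
    have ab: "summable (%k. \<bar>?q k\<bar>)" "summable (%k. \<bar>c k t\<bar>)"
     using hs_abs[OF hq, of 0] hs_abs[OF h, of 0] by simp_all
    show "(H_norm 1 I (%x. (\<Sum>k<n. q k * s k x) - ?u t x))^2 <= (\<Sum>k. (1 + (w k)^2) * (?q k - c k t)^2)"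
     unfolding psum_as_ser[OF ons_s]
     using le[OF hd L2_diff[OF uL[OF hq] uL[OF h]]] ser_diff[OF ons_s ab]
     by (simp add: distrib_right power_mult_distrib)
   qed
  qed
 qed simp
 have i: "integrable Tm (%t. \<Sum>k. (c k t)^2 * nu_s k + (w k * c k t)^2)"
 proof -
  have zf: "time.L2_family (%k t. sqrt (nu_s k) * c k t)"
   by (rule time.L2_family_dominated[OF _ c c, where A = 1 and B = 0])
     (use nu time.L2_family_meas[OF c] in \<open>auto simp: power_mult_distrib mult_left_le_one_le\<close>)
  have i: "integrable Tm (%t. (\<Sum>k. (sqrt (nu_s k) * c k t)^2) + (\<Sum>k. (w k * c k t)^2))"
   by (intro Bochner_Integration.integrable_add time.L2_family_AE(2) wc zf)
  have ae: "AE t in Tm. (\<Sum>k. (sqrt (nu_s k) * c k t)^2) + (\<Sum>k. (w k * c k t)^2)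
    = (\<Sum>k. (c k t)^2 * nu_s k + (w k * c k t)^2)"
   using time.L2_family_AE(1)[OF zf] time.L2_family_AE(1)[OF wc]
   by eventually_elim (subst suminf_add, auto simp: power_mult_distrib nu mult.commute)
  show ?thesis
   by (rule integrable_cong_AE_imp[OF i time.measurable_cong_AE[OF borel_measurable_integrable[OF i] ae]])
     (use ae in \<open>eventually_elim, simp\<close>)
 qed
 have ae: "AE t in Tm. (\<Sum>k. (c k t)^2 * nu_s k + (w k * c k t)^2) = (H_norm 1 I (?u t))^2"
  using h1 by eventually_elim (subst sine_series_H1(3)[OF _ uL], auto)
 have "integrable Tm (%t. (H_norm 1 I (?u t))^2)"
  by (rule integrable_cong_AE_imp[OF i time.measurable_cong_AE[OF borel_measurable_integrable[OF i] ae]])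
    (use ae in \<open>eventually_elim, simp\<close>)
 with sm show ?thesis by (simp add: bochner_L2_def)
qed

text \<open>The control is the sine series with coefficients \<open>v\<^sub>k / w\<^sub>k\<close>; the zeroth term is harmless because \<open>v\<^sub>0\<close>
 vanishes.\<close>

lemma adm_imp_admissible:
 assumes \<beta>: "1 <= \<beta>" and C0: "0 < C0" and y0: "y0 \<in> L2"
  and ad: "adm lam \<beta> (%k. ip y0 (e k)) C0 c d v"
 shows "\<exists>y u. (y, u) \<in> admissible T a b lam \<beta> y0 C0 \<and>
   (AE t in Tm. y t \<in> L2 \<and> (\<forall>k. ip (y t) (e k) = c k t)) \<and>
   (AE t in Tm. weak_deriv I 1 (u t) \<in> L2 \<and> (\<forall>k. ip (weak_deriv I 1 (u t)) (e k) = v k t))"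
proof -
 have d: "time.L2_family d" and v: "time.L2_family v" and c4: "time.L2_family (%k t. w k ^ 4 * c k t)"
  and cd: "\<forall>k. \<forall>t\<in>{0..T}. c k t = ip y0 (e k) + time.prim (d k) t"
  and v0: "AE t in Tm. v 0 t = 0"
  and eq: "AE t in Tm. \<forall>k. d k t = v k t - lam * (w k * flux_coef \<beta> (%k. c k t) k)"
  and pos: "AE t in Tm. \<forall>x\<in>{a..b}. C0 <= ser e (%k. c k t) x"
  using ad by (simp_all add: adm_def)
 have cj: "time.L2_family (%k t. w k ^ j * c k t)" if "j <= 4" for j by (rule state_family[OF d c4 cd that])
 have c: "time.L2_family c" by (rule adm_state[OF ad])
 define y where "y t = ser e (%k. c k t)" for t
 define yt where "yt t = ser e (%k. d k t)" for t
 define z where "z k t = v k t / w k" for k t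
 define u where "u t = ser s (%k. z k t)" for t
 have h4: "AE t in Tm. hs 4 (%k. c k t)" using time.L2_family_AE(1)[OF c4] by (simp add: hs_def)
 have w1: "0 < w 1" by (rule w_pos) simp
 have z: "time.L2_family z"
 proof (rule time.L2_family_dominated[OF _ v v, where A = "1 / (w 1)^2" and B = 0])
  show "z k \<in> borel_measurable Tm" for k
   unfolding z_def[abs_def] by (intro borel_measurable_divide time.L2_family_meas[OF v] borel_measurable_const)
  have "(z k t)^2 <= 1 / (w 1)^2 * (v k t)^2" for k t
  proof (cases "k = 0")
   case False
   then have "(w 1)^2 <= (w k)^2" using w_ge_w1[of k] w1 by (intro power_mono) auto
   then have "1 / (w k)^2 <= 1 / (w 1)^2" using w1 by (intro divide_left_mono) auto
   from mult_right_mono[OF this, of "(v k t)^2"] show ?thesis by (simp add: z_def power_divide)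
  qed (simp add: z_def)
  then show "AE t in Tm. \<forall>k. (z k t)^2 <= 1 / (w 1)^2 * (v k t)^2 + 0 * (v k t)^2" by simp
 qed
 have wz: "time.L2_family (%k t. w k * z k t)"
 proof (rule time.L2_family_dominated[OF _ v v, where A = 1 and B = 0])
  show "(%t. w k * z k t) \<in> borel_measurable Tm" for k
   by (intro borel_measurable_times borel_measurable_const time.L2_family_meas[OF z])
  have "(w k * z k t)^2 <= 1 * (v k t)^2 + 0 * (v k t)^2" for k t
   using w_pos[of k] by (cases "k = 0") (auto simp: z_def)
  then show "AE t in Tm. \<forall>k. (w k * z k t)^2 <= 1 * (v k t)^2 + 0 * (v k t)^2" by simp
 qed
 have yc: "AE t in Tm. y t \<in> L2 \<and> (\<forall>k. ip (y t) (e k) = c k t)"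
  using time.L2_family_AE(1)[OF c]
  by eventually_elim (simp add: y_def ser_L2_limit(1)[OF ons_e] ip_ser_basis[OF ons_e])
 have ytc: "AE t in Tm. yt t \<in> L2 \<and> (\<forall>k. ip (yt t) (e k) = d k t)"
  using time.L2_family_AE(1)[OF d]
  by eventually_elim (simp add: yt_def ser_L2_limit(1)[OF ons_e] ip_ser_basis[OF ons_e])
 have uc: "AE t in Tm. weak_deriv I 1 (u t) \<in> L2 \<and> (\<forall>k. ip (weak_deriv I 1 (u t)) (e k) = v k t)"
  using time.L2_family_AE(1)[OF wz] v0
 proof eventually_elim
  case (elim t)
  note wzs = elim(1) and v0 = elim(2)
  then have h1: "hs 1 (%k. z k t)" by (simp add: hs_def)
  have uL: "u t \<in> L2" unfolding u_def by (rule ser_L2_limit(1)[OF ons_s hs_0[OF h1]])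
  have ut: "AE x in M. u t x = ser s (%k. z k t) x" by (simp add: u_def)
  have L: "weak_deriv I 1 (u t) \<in> L2" by (rule H_spaceD(2)[OF sine_series_H1(1)[OF h1 uL ut]]) simp
  have "ip (weak_deriv I 1 (u t)) (e k) = w k * z k t" for k
   using ip_cong_AE[OF sine_series_H1(2)[OF h1 uL ut] L, of "e k" "e k"] ip_ser_basis[OF ons_e wzs, of k] by simp
  moreover have "w k * z k t = v k t" for k
   using v0 w_pos[of k] by (cases "k = 0") (auto simp: z_def)
  ultimately show ?case
   using L by simp
 qed
 have ytL: "yt \<in> bochner_L2 T (L2) nrm" by (rule bochner_L2_of_coef[OF d ytc])
 have td: "has_time_deriv T (L2) nrm y yt"
  by (rule has_time_deriv_of_coef[OF c d _ yc ytc]) (use cd in blast)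
 have tI: "AE t in Tm. t \<in> {0<..<T}" by (intro AE_I2) simp
 have "y \<in> state_space T I"
  using bochner_L2_of_coef[OF c yc] ytL td cosine_series_state[OF cj]
  by (auto simp: state_space_def bochner_H1_def y_def[abs_def])
 moreover have "u \<in> control_space T I"
  unfolding control_space_def u_def[abs_def] by (rule sine_series_control[OF z wz])
 moreover have "thin_film_equation T I lam \<beta> y u"
  unfolding thin_film_equation_def
 proof (intro bexI[OF _ ytL] conjI td)
  show "AE t in Tm. \<exists>q. has_weak_deriv I 1 (%x. lam * \<bar>y t x\<bar> powr \<beta> * weak_deriv I 3 (y t) x) q \<and>
        (AE x in M. yt t x = - q x + weak_deriv I 1 (u t) x)"
   using h4 pos eq yc ytc uc
  proof eventually_elim
   case (elim t)
   note c = elim(1) and lo = elim(2) and eq = elim(3) and y = elim(4) and yt = elim(5) and u = elim(6)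
   have "AE x in M. y t x = ser e (%k. c k t) x" by (simp add: y_def)
   note iff = flux_equation_iff[OF \<beta> C0 c lo conjunct1[OF y] this conjunct1[OF yt] conjunct1[OF u]]
   show ?case
    unfolding iff using eq yt u by simp
  qed
 qed
 moreover have "has_initial_value T I y y0"
 proof (rule has_initial_value_of_coef[OF d coef_summable[OF y0] _ y0 refl])
  show "AE t in Tm. y t \<in> L2 \<and> (\<forall>k. ip (y t) (e k) = ip y0 (e k) + time.prim (d k) t)"
   using yc tI by eventually_elim (use cd in auto)
 qed
 moreover have "boundary_conditions T a b y"
  unfolding boundary_conditions_def
  using h4 yc
 proof eventually_elim
  case (elim t)
  note c = elim(1) and yL = elim(2)
  have y: "AE x in M. y t x = ser e (%k. c k t) x" by (simp add: y_def)
  have "has_trace a b (weak_deriv I j (y t)) x 0" if "x \<in> {a, b}" "odd j" "j < 4" for j x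
   unfolding has_trace_def
   by (intro exI[of _ "sder j (%k. c k t)"] conjI sder_cont[OF c that(3)] sder_boundary[OF c that(3,2,1)]
     series_in_H(3)[OF c conjunct1[OF yL] y less_imp_le[OF that(3)]])
  then show ?case
   by simp
 qed
 moreover have "AE t in Tm. AE x in M. C0 <= y t x"
  using pos
 proof eventually_elim
  case (elim t)
  note lo = elim
  show ?case by (rule AE_I2) (use lo in \<open>auto simp: y_def\<close>)
 qed
 ultimately have "(y, u) \<in> admissible T a b lam \<beta> y0 C0" by (simp add: admissible_def)
 then show ?thesis by (intro exI[of _ y] exI[of _ u] conjI yc uc)
qed

end

section \<open>The initial value stays away from zero\<close>

text \<open>The bound for functions on an interval of length \<open>l\<close> with Hoelder constant \<open>Q\<^sup>1\<^sup>/\<^sup>2\<close> and entropy integral at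
 most \<open>K\<close>: solving \<open>log (1 + Q \<rho> / \<mu>\<^sup>2) \<le> 2 Q K\<close> for the value \<open>\<mu>\<close> at a point, where \<open>\<rho>\<close> is the length of a
 one-sided neighbourhood.\<close>

definition lower_bound :: "real => real => real => real" where
 "lower_bound l Q K = min (1 / 2) (sqrt (Q * min (l / 2) (1 / (4 * Q)) * exp (- (2 * Q * K))))"

lemma lower_bound_pos: "0 < l ==> 0 < Q ==> 0 < lower_bound l Q K"
 by (simp add: lower_bound_def)

context interval
begin

lemma log_integral:
 assumes Q: "0 < Q" and \<mu>: "0 < \<mu>" and J: "a <= p" "p <= q" "q <= b" and x0: "x0 = p \<or> x0 = q"
 shows "integral {p..q} (%x. 1 / (2 * (\<mu>^2 + Q * \<bar>x - x0\<bar>))) = ln ((\<mu>^2 + Q * (q - p)) / \<mu>^2) / (2 * Q)"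
proof -
 let ?g = "%x. 1 / (2 * (\<mu>^2 + Q * \<bar>x - x0\<bar>))"
 have ln: "ln ((\<mu>^2 + Q * (q - p)) / \<mu>^2) = ln (\<mu>^2 + Q * (q - p)) - ln (\<mu>^2)"
  using Q \<mu> J by (intro ln_divide_pos) (auto intro!: add_pos_nonneg)
 from x0 have "(?g has_integral (ln ((\<mu>^2 + Q * (q - p)) / \<mu>^2) / (2 * Q))) {p..q}"
 proof
  assume x: "x0 = p"
  have "(?g has_integral (ln (\<mu>^2 + Q * (q - p)) / (2 * Q) - ln (\<mu>^2 + Q * (p - p)) / (2 * Q))) {p..q}"
  proof (rule fundamental_theorem_of_calculus[OF J(2)])
   fix t assume t: "t \<in> {p..q}"
   then have "0 < \<mu>^2 + Q * (t - p)" using Q \<mu> by (intro add_pos_nonneg) auto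
   then have "((%t. ln (\<mu>^2 + Q * (t - p)) / (2 * Q)) has_real_derivative ?g t) (at t within {p..q})"
    using t Q x by (auto intro!: derivative_eq_intros simp: divide_simps)
   then show "((%t. ln (\<mu>^2 + Q * (t - p)) / (2 * Q)) has_vector_derivative ?g t) (at t within {p..q})"
    by (simp add: has_real_derivative_iff_has_vector_derivative)
  qed
  then show ?thesis by (simp add: ln diff_divide_distrib)
 next
  assume x: "x0 = q"
  have "(?g has_integral (- (ln (\<mu>^2 + Q * (q - q)) / (2 * Q)) - (- (ln (\<mu>^2 + Q * (q - p)) / (2 * Q))))) {p..q}"
  proof (rule fundamental_theorem_of_calculus[OF J(2)])
   fix t assume t: "t \<in> {p..q}"
   then have "0 < \<mu>^2 + Q * (q - t)" using Q \<mu> by (intro add_pos_nonneg) auto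
   then have "((%t. - (ln (\<mu>^2 + Q * (q - t)) / (2 * Q))) has_real_derivative ?g t) (at t within {p..q})"
    using t Q x by (auto intro!: derivative_eq_intros simp: divide_simps)
   then show "((%t. - (ln (\<mu>^2 + Q * (q - t)) / (2 * Q))) has_vector_derivative ?g t) (at t within {p..q})"
    by (simp add: has_real_derivative_iff_has_vector_derivative)
  qed
  then show ?thesis by (simp add: ln diff_divide_distrib)
 qed
 then show ?thesis by (rule integral_unique)
qed

text \<open>On one side of \<open>x0\<close> there is a neighbourhood of length \<open>\<rho>\<close> within the interval, on which \<open>h \<le> 1\<close> if \<open>h\<close> is at
 most \<open>1/2\<close> at \<open>x0\<close>.  There \<open>h\<^sup>2\<^sup>-\<^sup>\<beta> \<ge> h\<^sup>-\<^sup>2\<close>, and the right-hand side is at least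
 \<open>1 / (2 (\<mu>\<^sup>2 + Q |x - x0|))\<close>.\<close>

lemma Hoelder_lower_bound:
 assumes \<beta>: "4 <= \<beta>" and Q: "0 < Q" and h: "continuous_on {a..b} h" and pos: "\<forall>x\<in>{a..b}. 0 < h x"
  and H: "\<forall>x\<in>{a..b}. \<forall>z\<in>{a..b}. (h x - h z)^2 <= Q * \<bar>x - z\<bar>"
  and K: "(\<integral>x. h x powr (2 - \<beta>) \<partial>M) <= K" and x0: "x0 \<in> {a..b}"
 shows "lower_bound (b - a) Q K <= h x0"
proof (cases "1 / 2 <= h x0")
 case True
 then show ?thesis by (simp add: lower_bound_def min_def)
next
 case False
 define \<mu> where "\<mu> = h x0"
 have \<mu>: "0 < \<mu>" "\<mu> < 1 / 2" using pos x0 False by (auto simp: \<mu>_def)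
 define \<rho> where "\<rho> = min ((b - a) / 2) (1 / (4 * Q))"
 have \<rho>: "0 < \<rho>" "\<rho> <= (b - a) / 2" "Q * \<rho> <= 1 / 4"
 proof -
  show "0 < \<rho>" using Q a_less_b by (simp add: \<rho>_def)
  show "\<rho> <= (b - a) / 2" unfolding \<rho>_def by (rule min.cobounded1)
  have "Q * \<rho> <= Q * (1 / (4 * Q))" using Q by (intro mult_left_mono) (auto simp: \<rho>_def)
  then show "Q * \<rho> <= 1 / 4" using Q by simp
 qed
 \<comment> \<open>the neighbourhood extends into the longer half of the interval\<close>
 define p where "p = (if x0 <= (a + b) / 2 then x0 else x0 - \<rho>)"
 define q where "q = p + \<rho>"
 have J: "a <= p" "p <= q" "q <= b" "x0 = p \<or> x0 = q"
  using x0 \<rho> by (auto simp: p_def q_def field_simps)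
 let ?g = "%x. 1 / (2 * (\<mu>^2 + Q * \<bar>x - x0\<bar>))"
 have den: "0 < \<mu>^2 + Q * \<bar>x - x0\<bar>" for x using Q \<mu> by (intro add_pos_nonneg) auto
 have nz: "2 * (\<mu>^2 + Q * \<bar>x - x0\<bar>) \<noteq> 0" for x
  by (rule less_imp_neq[THEN not_sym], rule mult_pos_pos[OF _ den]) simp
 have gL: "?g \<in> L2"
  by (rule continuous_L2) (intro continuous_intros ballI nz)
 have le: "?g x <= h x powr (2 - \<beta>)" if x: "x \<in> {p..q}" for x
 proof -
  have xab: "x \<in> {a..b}" and r: "\<bar>x - x0\<bar> <= \<rho>" using x J by (auto simp: q_def)
  have hx: "0 < h x" using pos xab by blast
  have s: "(h x - \<mu>)^2 <= Q * \<bar>x - x0\<bar>" using H xab x0 by (simp add: \<mu>_def)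
  have "Q * \<bar>x - x0\<bar> <= Q * \<rho>" using r Q by (intro mult_left_mono) auto
  with s \<rho>(3) have "(h x - \<mu>)^2 <= (1 / 2)^2" by (simp add: power2_eq_square)
  then have "h x - \<mu> <= 1 / 2" by (rule power2_le_imp_le) simp
  with \<mu> have h1: "h x <= 1" by simp
  have "(h x)^2 <= 2 * \<mu>^2 + 2 * (h x - \<mu>)^2"
   using zero_le_power2[of "h x - 2 * \<mu>"] by (simp add: power2_diff power_mult_distrib)
  also have "\<dots> <= 2 * (\<mu>^2 + Q * \<bar>x - x0\<bar>)" using s by simp
  finally have "?g x <= 1 / (h x)^2" 
   by (intro divide_left_mono mult_pos_pos den) (use hx in simp_all)
  also have "\<dots> = h x powr (- 2)" using hx by (simp add: powr_minus divide_inverse)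
  also have "\<dots> <= h x powr (2 - \<beta>)" using hx h1 \<beta> by (intro powr_mono') auto
  finally show ?thesis .
 qed
 have hp: "(%x. h x powr (2 - \<beta>)) \<in> L2"
  by (rule continuous_L2) (use h pos in \<open>force intro!: continuous_intros\<close>)
 have gi: "integrable M (%x. ?g x * indicator {p..q} x)" by (rule L2_mult_integrable[OF gL indicator_L2])
 have "integral {p..q} ?g = (\<integral>x. ?g x * indicator {p..q} x \<partial>M)"
  using integral_eq_ip[OF gL J(1,3)] by (simp add: ip_def)
 also have "\<dots> <= (\<integral>x. h x powr (2 - \<beta>) \<partial>M)"
  by (rule integral_mono[OF gi L2_integrable[OF hp]]) (use le in \<open>auto simp: indicator_def\<close>)
 also have "\<dots> <= K" by (rule K)
 finally have "ln ((\<mu>^2 + Q * \<rho>) / \<mu>^2) / (2 * Q) <= K"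
  unfolding log_integral[OF Q \<mu>(1) J] by (simp add: q_def)
 then have l: "ln ((\<mu>^2 + Q * \<rho>) / \<mu>^2) <= 2 * Q * K" using Q by (simp add: field_simps)
 have "0 < (\<mu>^2 + Q * \<rho>) / \<mu>^2" using \<mu> Q \<rho> by (intro divide_pos_pos add_pos_pos mult_pos_pos) auto
 then have "(\<mu>^2 + Q * \<rho>) / \<mu>^2 <= exp (2 * Q * K)" using l by (metis exp_le_cancel_iff exp_ln)
 then have "\<mu>^2 + Q * \<rho> <= exp (2 * Q * K) * \<mu>^2" using \<mu> by (simp add: pos_divide_le_eq)
 then have "Q * \<rho> <= exp (2 * Q * K) * \<mu>^2" using zero_le_power2[of \<mu>] by linarith
 then have "Q * \<rho> * exp (- (2 * Q * K)) <= exp (2 * Q * K) * \<mu>^2 * exp (- (2 * Q * K))"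
  by (rule mult_right_mono) simp
 also have "\<dots> = \<mu>^2" by (simp add: exp_minus)
 finally have "sqrt (Q * \<rho> * exp (- (2 * Q * K))) <= \<mu>" using \<mu> by (intro real_le_lsqrt) auto
 then show ?thesis unfolding lower_bound_def \<rho>_def[symmetric] \<mu>_def by (rule min.coboundedI2)
qed

lemma Neumann_initial_value:
 assumes f: "f \<in> H_space 2 I" and tr: "\<forall>x\<in>{a, b}. has_trace a b (weak_deriv I 1 f) x 0"
 shows "hs 2 (%k. ip f (e k))"
proof -
 have "weak_deriv I 2 f \<in> L2" using H_spaceD(2)[OF f, of 2] by simp
 from coef_summable[OF this] show ?thesis
  unfolding hs_def Neumann_coef_2[OF f order_refl tr] by simp
qed

text \<open>Finite energy gives Hoelder continuity by the Cauchy-Schwarz inequality.  The absolute value and the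
 summand \<open>1\<close> make the Hoelder constant positive whatever the value of the energy.\<close>

lemma initial_lower_bound:
 assumes \<beta>: "4 <= \<beta>" and f: "f \<in> H_space 2 I" and tr: "\<forall>x\<in>{a, b}. has_trace a b (weak_deriv I 1 f) x 0"
  and C0: "0 < C0" "AE x in M. C0 <= f x" and x: "x \<in> {a..b}"
 shows "lower_bound (b - a) (2 * \<bar>energy I f\<bar> + 1) ((\<beta> - 1) * (\<beta> - 2) * entropy \<beta> I f) <= ser e (%k. ip f (e k)) x"
proof -
 let ?\<gamma> = "%k. ip f (e k)"
 let ?h = "ser e ?\<gamma>" and ?Q = "2 * \<bar>energy I f\<bar> + 1"
 have \<gamma>: "hs 2 ?\<gamma>" by (rule Neumann_initial_value[OF f tr])
 have fL: "f \<in> L2" by (rule H_space_L2[OF f])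
 have fh: "AE x in M. f x = ?h x" by (rule ser_coef_AE[OF fL])
 have hc: "continuous_on {a..b} ?h" using sder_cont[OF \<gamma>, of 0] by (simp add: sder_0)
 have dc: "continuous_on {a..b} (sder 1 ?\<gamma>)" by (rule sder_cont[OF \<gamma>]) simp
 have dL: "sder 1 ?\<gamma> \<in> L2" by (rule sder_L2[OF \<gamma>]) simp
 have wd: "AE x in M. weak_deriv I 1 f x = sder 1 ?\<gamma> x" by (rule series_in_H(3)[OF \<gamma> fL fh]) simp
 have "C0 <= ?h x" if "x \<in> {a..b}" for x
  by (rule continuous_AE_le[OF hc _ that]) (use C0(2) fh in \<open>eventually_elim, simp\<close>)
 then have pos: "\<forall>x\<in>{a..b}. 0 < ?h x" using C0(1) by force
 have E: "(nrm (sder 1 ?\<gamma>))^2 = 2 * energy I f"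
 proof -
  have "nrm (weak_deriv I 1 f) = nrm (sder 1 ?\<gamma>)"
   using H_spaceD(2)[OF f, of 1] by (intro nrm_cong_AE[OF wd]) simp
  moreover have "2 * energy I f = (nrm (weak_deriv I 1 f))^2" by (simp add: energy_def nrm_sq')
  ultimately show ?thesis by simp
 qed
 have Hl: "(?h y - ?h z)^2 <= ?Q * (y - z)" if yz: "z \<in> {a..b}" "y \<in> {a..b}" "z <= y" for y z
 proof -
  have "(sder 1 ?\<gamma> has_integral (?h y - ?h z)) {z..y}"
  proof (rule fundamental_theorem_of_calculus[OF yz(3)])
   fix t assume "t \<in> {z..y}"
   have "(?h has_real_derivative sder 1 ?\<gamma> t) (at t)" using sder_DERIV[OF \<gamma>, of 0 t] by (simp add: sder_0)
   then show "(?h has_vector_derivative sder 1 ?\<gamma> t) (at t within {z..y})"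
    by (simp add: has_real_derivative_iff_has_vector_derivative has_vector_derivative_at_within)
  qed
  then have "?h y - ?h z = integral {z..y} (sder 1 ?\<gamma>)" by (simp add: integral_unique)
  then have "\<bar>?h y - ?h z\<bar> <= sqrt (y - z) * nrm (sder 1 ?\<gamma>)" using integral_CS[OF dL, of z y] yz by simp
  then have "\<bar>?h y - ?h z\<bar>\<^sup>2 <= (sqrt (y - z) * nrm (sder 1 ?\<gamma>))^2" by (rule power_mono) simp
  also have "\<dots> = (y - z) * (2 * energy I f)" using yz E by (simp add: power_mult_distrib)
  also have "\<dots> <= (y - z) * ?Q" using yz by (intro mult_left_mono) auto
  finally show ?thesis by (simp add: mult.commute)
 qed
 have H: "\<forall>y\<in>{a..b}. \<forall>z\<in>{a..b}. (?h y - ?h z)^2 <= ?Q * \<bar>y - z\<bar>"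
 proof (intro ballI)
  fix y z assume "y \<in> {a..b}" "z \<in> {a..b}"
  then show "(?h y - ?h z)^2 <= ?Q * \<bar>y - z\<bar>"
   using Hl[of z y] Hl[of y z] power2_commute[of "?h y" "?h z"] by (cases "z <= y") auto
 qed
 have hp: "(%x. ?h x powr (2 - \<beta>)) \<in> borel_measurable M"
  by (rule L2_meas, rule continuous_L2) (use hc pos in \<open>force intro!: continuous_intros\<close>)
 have ae: "AE x in M. ?h x powr (2 - \<beta>) = f x powr (2 - \<beta>)" using fh by eventually_elim simp
 have "(\<integral>x. ?h x powr (2 - \<beta>) \<partial>M) = (\<integral>x. f x powr (2 - \<beta>) \<partial>M)"
  by (rule integral_cong_AE[OF hp measurable_cong_AE[OF hp ae] ae])
 also have "\<dots> = (\<beta> - 1) * (\<beta> - 2) * entropy \<beta> I f" using \<beta> by (simp add: entropy_def)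
 finally have K: "(\<integral>x. ?h x powr (2 - \<beta>) \<partial>M) <= (\<beta> - 1) * (\<beta> - 2) * entropy \<beta> I f" by simp
 show ?thesis by (rule Hoelder_lower_bound[OF \<beta> _ hc pos H K x]) simp
qed

end

section \<open>The cost in terms of coefficients\<close>

context space_time
begin

text \<open>The target is Lebesgue measurable in two variables, so its time slices are measurable only at almost
 every time: it is replaced by a Borel function first.\<close>

lemma target_family:
 assumes yd: "yd \<in> L2_space ({0<..<T} \<times> I)"
 shows "AE t in Tm. (%x. yd (t, x)) \<in> L2"
  "time.L2_family (%k t. ip (%x. yd (t, x)) (e k))"
proof -
 let ?S = "{0<..<T} \<times> I"
 have S: "?S \<in> sets lebesgue" by (simp add: open_Times)
 let ?F = "%p. if p \<in> ?S then yd p else 0"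
 have Fm: "?F \<in> borel_measurable lebesgue"
  using yd borel_measurable_if[OF S, of yd] by (simp add: L2_space_def)
 have Fi: "integrable lebesgue (%p. (?F p)^2)"
 proof -
  have "(%p. (?F p)^2) = (%p. if p \<in> ?S then (yd p)^2 else 0)" by auto
  then show ?thesis using yd Lebesgue_Measure.integrable_restrict_UNIV[OF S, of "%p. (yd p)^2"]
   by (simp add: L2_space_def)
 qed
 obtain g where g: "g \<in> borel_measurable lborel" and Fg: "AE p in lborel. ?F p = g p"
  using completion_ex_borel_measurable_real[OF Fm] by blast
 have gi: "integrable lborel (%p. (g p)^2)"
 proof -
  have "integrable lebesgue (%p. (g p)^2)"
  proof (rule integrable_cong_AE_imp[OF Fi])
   show "(%p. (g p)^2) \<in> borel_measurable lebesgue"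
    using g by (intro borel_measurable_power measurable_completion)
   show "AE p in lebesgue. (?F p)^2 = (g p)^2" using AE_completion[OF Fg] by eventually_elim simp
  qed
  then show ?thesis using g by (subst (asm) integrable_completion) auto
 qed
 have gb: "g \<in> borel_measurable borel" using g by simp
 have idm: "(%x. x) \<in> borel_measurable (lebesgue_on A)" for A :: "real set"
  by (rule measurable_restrict_space1[OF measurable_completion]) simp
 have gTM: "(%p. g (fst p, snd p)) \<in> borel_measurable (Tm \<Otimes>\<^sub>M M)"
 proof (rule measurable_compose[OF _ gb])
  have "(%p. (fst p, snd p)) \<in> measurable (Tm \<Otimes>\<^sub>M M) (borel \<Otimes>\<^sub>M borel)"
   by (rule measurable_Pair[OF measurable_compose[OF measurable_fst idm] measurable_compose[OF measurable_snd idm]])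
  then show "(%p. (fst p, snd p)) \<in> measurable (Tm \<Otimes>\<^sub>M M) borel" by (simp add: borel_prod)
 qed
 have AE_on: "AE x in lebesgue_on A. P x" if "AE x in lborel. P x" "A \<in> sets lebesgue" for A :: "real set" and P
  using AE_completion[OF that(1)] that(2) by (subst AE_restrict_space_iff) (auto elim: eventually_mono)
 have int_on: "integrable (lebesgue_on A) \<phi>" if "integrable lborel \<phi>" "A \<in> sets lebesgue" for A :: "real set" and \<phi> :: "real => real"
 proof -
  have "integrable lebesgue \<phi>" using that(1) by (subst integrable_completion) auto
  from integrable_mult_indicator[OF that(2) this] show ?thesis
   using that(2) by (subst integrable_restrict_space) auto
 qed
 have sl1: "AE t in lborel. AE x in lborel. ?F (t, x) = g (t, x)"
  by (rule lborel_pair.AE_pair[where Q = "%p. ?F p = g p"]) (unfold lborel_prod, rule Fg)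
 have gi': "integrable (lborel \<Otimes>\<^sub>M lborel) (%p. (g p)^2)" using gi by (simp add: lborel_prod)
 have sl2: "AE t in lborel. integrable lborel (%x. (g (t, x))^2)"
  using lborel_pair.AE_integrable_fst'[OF gi'] .
 have \<Phi>: "integrable lborel (%t. \<integral>x. (g (t, x))^2 \<partial>lborel)"
  using lborel_pair.integrable_fst'[OF gi'] .
 have TS: "{0<..<T} \<in> sets lebesgue" by simp
 have tI: "AE t in Tm. t \<in> {0<..<T}" by (intro AE_I2) simp
 have main: "AE t in Tm. (%x. g (t, x)) \<in> L2 \<and> (AE x in M. g (t, x) = yd (t, x)) \<and>
   (nrm (%x. g (t, x)))^2 <= (\<integral>x. (g (t, x))^2 \<partial>lborel)"
  using AE_on[OF sl1 TS] AE_on[OF sl2 TS] tI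
 proof eventually_elim
  case (elim t)
  note ae = elim(1) and i = elim(2) and t = elim(3)
  have m: "(%x. g (t, x)) \<in> borel_measurable borel"
   by (rule measurable_compose[OF _ gb]) (simp add: borel_measurable_Pair)
  have L: "(%x. g (t, x)) \<in> L2"
   unfolding L2_iff using int_on[OF i I_sets] measurable_compose[OF idm m] by simp
  have "AE x in M. ?F (t, x) = g (t, x)" "AE x in M. x \<in> I" by (rule AE_on[OF ae I_sets], intro AE_I2, simp)
  then have e: "AE x in M. g (t, x) = yd (t, x)" by eventually_elim (use t in auto)
  have "(nrm (%x. g (t, x)))^2 = (\<integral>x. indicator I x * (g (t, x))^2 \<partial>lebesgue)"
   unfolding nrm_sq' by (subst integral_restrict_space) auto
  also have "\<dots> <= (\<integral>x. (g (t, x))^2 \<partial>lebesgue)"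
  proof (rule integral_mono)
   have "integrable lebesgue (%x. (g (t, x))^2)" using i by (subst integrable_completion) auto
   then show "integrable lebesgue (%x. (g (t, x))^2)" "integrable lebesgue (%x. indicator I x * (g (t, x))^2)"
    using integrable_mult_indicator[of I lebesgue "%x. (g (t, x))^2"] by simp_all
  qed (simp add: indicator_def)
  also have "\<dots> = (\<integral>x. (g (t, x))^2 \<partial>lborel)"
   by (rule integral_completion) (use borel_measurable_integrable[OF i] in simp)
  finally show ?case using L e by blast
 qed
 show "AE t in Tm. (%x. yd (t, x)) \<in> L2"
  using main by eventually_elim (elim conjE, rule L2_cong_AE)
 have ipe: "AE t in Tm. ip (%x. g (t, x)) (e k) = ip (%x. yd (t, x)) (e k)" for k
  using main by eventually_elim (intro ip_cong_AE, auto)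
 have gm: "(%t. ip (%x. g (t, x)) (e k)) \<in> borel_measurable Tm" for k
  unfolding ip_def
 proof (rule borel_measurable_lebesgue_integral)
  have "(%p. g (fst p, snd p) * e k (snd p)) \<in> borel_measurable (Tm \<Otimes>\<^sub>M M)"
   by (intro borel_measurable_times gTM measurable_compose[OF measurable_snd L2_meas[OF e_L2]])
  then show "(%(t, x). g (t, x) * e k x) \<in> borel_measurable (Tm \<Otimes>\<^sub>M M)" by (simp add: case_prod_unfold)
 qed
 show "time.L2_family (%k t. ip (%x. yd (t, x)) (e k))"
 proof (rule time.L2_family_of_bound(1)[OF time.measurable_cong_AE[OF gm ipe] int_on[OF \<Phi> TS]])
  have "AE t in Tm. \<forall>k. ip (%x. g (t, x)) (e k) = ip (%x. yd (t, x)) (e k)"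
   unfolding AE_all_countable using ipe by blast
  with main show "AE t in Tm. \<forall>n. (\<Sum>k<n. (ip (%x. yd (t, x)) (e k))^2) <= (\<integral>x. (g (t, x))^2 \<partial>lborel)"
  proof eventually_elim
   case (elim t)
   note A = elim(1) and elim(2)
   then show ?case
    using order_trans[OF Bessel[OF conjunct1[OF A]]] by simp
  qed
 qed
qed

lemma integral_nrm_sq_of_coef:
 assumes g: "time.L2_family g" and f: "AE t in Tm. f t \<in> L2 \<and> (\<forall>k. ip (f t) (e k) = g k t)"
 shows "(\<integral>t. (\<integral>x. \<bar>f t x\<bar>\<^sup>2 \<partial>M) \<partial>Tm) = (\<Sum>k. \<integral>t. (g k t)^2 \<partial>Tm)"
proof -
 have ae: "AE t in Tm. (\<Sum>k. (g k t)^2) = (\<integral>x. \<bar>f t x\<bar>\<^sup>2 \<partial>M)"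
  using f
 proof eventually_elim
  case (elim t)
  then show ?case using Parseval[of "f t"] by (simp add: sums_iff nrm_sq')
 qed
 note m = time.L2_family_sum_meas[OF g]
 have "(\<integral>t. (\<Sum>k. (g k t)^2) \<partial>Tm) = (\<integral>t. (\<integral>x. \<bar>f t x\<bar>\<^sup>2 \<partial>M) \<partial>Tm)"
  by (rule integral_cong_AE[OF m time.measurable_cong_AE[OF m ae] ae])
 then show ?thesis using time.L2_family_AE(3)[OF g] by simp
qed

lemma cost_eq_cost_coef:
 assumes yd: "yd \<in> L2_space ({0<..<T} \<times> I)" and c: "time.L2_family c" and v: "time.L2_family v"
  and y: "AE t in Tm. y t \<in> L2 \<and> (\<forall>k. ip (y t) (e k) = c k t)"
  and u: "AE t in Tm. weak_deriv I 1 (u t) \<in> L2 \<and> (\<forall>k. ip (weak_deriv I 1 (u t)) (e k) = v k t)"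
 shows "cost T I \<alpha> yd y u = cost_coef \<alpha> (%k t. ip (%x. yd (t, x)) (e k)) c v"
proof -
 note f = time.L2_family_diff[OF c target_family(2)[OF yd]]
 have "AE t in Tm. (%x. y t x - yd (t, x)) \<in> L2 \<and>
   (\<forall>k. ip (%x. y t x - yd (t, x)) (e k) = c k t - ip (%x. yd (t, x)) (e k))"
  using y target_family(1)[OF yd] by eventually_elim (simp add: L2_diff ip_diff_left)
 from integral_nrm_sq_of_coef[OF f this] integral_nrm_sq_of_coef[OF v u]
 show ?thesis by (simp add: cost_def cost_coef_def)
qed

text \<open>The direct method for the coefficient problem, translated back to functions.\<close>

theorem minimizer_exists:
 assumes \<beta>: "4 <= \<beta>" and lam: "0 < lam" and \<alpha>: "0 < \<alpha>" and yd: "yd \<in> L2_space ({0<..<T} \<times> I)"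
  and y0: "y0 \<in> H_space 2 I" "\<forall>x\<in>{a, b}. has_trace a b (weak_deriv I 1 y0) x 0"
  and C0: "0 < C0" "AE x in M. C0 <= y0 x"
  and small: "C0 < lower_bound (b - a) (2 * \<bar>energy I y0\<bar> + 1) ((\<beta> - 1) * (\<beta> - 2) * entropy \<beta> I y0)"
 shows "\<exists>(y, u) \<in> admissible T a b lam \<beta> y0 C0. \<forall>(y', u') \<in> admissible T a b lam \<beta> y0 C0.
   cost T I \<alpha> yd y u <= cost T I \<alpha> yd y' u'"
proof -
 have \<beta>1: "1 <= \<beta>" using \<beta> by simp
 have y0L: "y0 \<in> L2" by (rule H_space_L2[OF y0(1)])
 have \<gamma>: "hs 2 (%k. ip y0 (e k))" by (rule Neumann_initial_value[OF y0])
 have ex: "\<exists>c d v. adm lam \<beta> (%k. ip y0 (e k)) C0 c d v"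
  by (rule exists_admissible[OF \<beta>1 C0(1) small lam \<gamma>]) (intro ballI initial_lower_bound[OF \<beta> y0 C0])
 obtain c d v where ad: "adm lam \<beta> (%k. ip y0 (e k)) C0 c d v"
  and min: "\<forall>c' d' v'. adm lam \<beta> (%k. ip y0 (e k)) C0 c' d' v' -->
   cost_coef \<alpha> (%k t. ip (%x. yd (t, x)) (e k)) c v <= cost_coef \<alpha> (%k t. ip (%x. yd (t, x)) (e k)) c' v'"
  using coef_minimizer[OF \<beta>1 C0(1) lam \<gamma> \<alpha> target_family(2)[OF yd] ex] by (elim exE conjE)
 have vf: "time.L2_family v'" if "adm lam \<beta> (%k. ip y0 (e k)) C0 c' d' v'" for c' d' v'
  using that by (simp add: adm_def)
 obtain y u where yu: "(y, u) \<in> admissible T a b lam \<beta> y0 C0"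
  and y: "AE t in Tm. y t \<in> L2 \<and> (\<forall>k. ip (y t) (e k) = c k t)"
  and u: "AE t in Tm. weak_deriv I 1 (u t) \<in> L2 \<and> (\<forall>k. ip (weak_deriv I 1 (u t)) (e k) = v k t)"
  using adm_imp_admissible[OF \<beta>1 C0(1) y0L ad] by (elim exE conjE)
 have "cost T I \<alpha> yd y u <= cost T I \<alpha> yd y' u'" if yu': "(y', u') \<in> admissible T a b lam \<beta> y0 C0" for y' u'
 proof -
  obtain c' d' v' where ad': "adm lam \<beta> (%k. ip y0 (e k)) C0 c' d' v'"
   and y': "AE t in Tm. y' t \<in> L2 \<and> (\<forall>k. ip (y' t) (e k) = c' k t)"
   and u': "AE t in Tm. weak_deriv I 1 (u' t) \<in> L2 \<and> (\<forall>k. ip (weak_deriv I 1 (u' t)) (e k) = v' k t)"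
   using admissible_imp_adm[OF \<beta>1 C0(1) y0L yu'] by (elim exE conjE)
  show ?thesis
   unfolding cost_eq_cost_coef[OF yd adm_state[OF ad] vf[OF ad] y u]
    cost_eq_cost_coef[OF yd adm_state[OF ad'] vf[OF ad'] y' u']
   by (rule min[rule_format, OF ad'])
 qed
 then show ?thesis using yu by (intro bexI[of _ "(y, u)"]) auto
qed

end

theorem theorem3p1:
 shows "\<exists>Ctilde :: real \<Rightarrow> real \<Rightarrow> real \<Rightarrow> real \<Rightarrow> real \<Rightarrow> real.
  (\<forall>E H a b \<beta>. a < b \<longrightarrow> 4 \<le> \<beta> \<longrightarrow> 0 < Ctilde E H a b \<beta>) \<and>
  (\<forall>(a::real) (b::real) (T::real) (\<beta>::real) (lam::real) (\<alpha>::real)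
    (yd :: real \<times> real \<Rightarrow> real) (y0 :: real \<Rightarrow> real) (C0::real).
    a < b \<longrightarrow> 0 < T \<longrightarrow> 4 \<le> \<beta> \<longrightarrow> 0 < lam \<longrightarrow> 0 < \<alpha> \<longrightarrow>
    yd \<in> L2_space ({0<..<T} \<times> {a<..<b}) \<longrightarrow>
    y0 \<in> H_space 2 {a<..<b} \<longrightarrow>
    (\<forall>x\<in>{a, b}. has_trace a b (weak_deriv {a<..<b} 1 y0) x 0) \<longrightarrow>
    0 < C0 \<longrightarrow> (AE x in lebesgue_on {a<..<b}. C0 \<le> y0 x) \<longrightarrow>
    C0 \<le> Ctilde (energy {a<..<b} y0) (entropy \<beta> {a<..<b} y0) a b \<beta> \<longrightarrow>
    (\<exists>(y, u) \<in> admissible T a b lam \<beta> y0 C0.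
     \<forall>(y', u') \<in> admissible T a b lam \<beta> y0 C0.
      cost T {a<..<b} \<alpha> yd y u \<le> cost T {a<..<b} \<alpha> yd y' u'))"
proof -
 define Ctilde :: "real \<Rightarrow> real \<Rightarrow> real \<Rightarrow> real \<Rightarrow> real \<Rightarrow> real" where
  \<comment> \<open>half of the bound, as the initial value must lie strictly above the constraint\<close>
  "Ctilde E H a b \<beta> = lower_bound (b - a) (2 * \<bar>E\<bar> + 1) ((\<beta> - 1) * (\<beta> - 2) * H) / 2" for E H a b \<beta>
 show ?thesis
 proof (rule exI[of _ Ctilde], intro conjI allI impI)
  fix E H a b \<beta> :: real assume "a < b" "4 \<le> \<beta>"
  then show "0 < Ctilde E H a b \<beta>" by (simp add: Ctilde_def lower_bound_pos)
 next
  fix a b T \<beta> lam \<alpha> C0 :: real and yd :: "real \<times> real \<Rightarrow> real" and y0 :: "real \<Rightarrow> real"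
  assume ab: "a < b" and T: "0 < T" and A: "4 \<le> \<beta>" "0 < lam" "0 < \<alpha>"
   "yd \<in> L2_space ({0<..<T} \<times> {a<..<b})" "y0 \<in> H_space 2 {a<..<b}"
   "\<forall>x\<in>{a, b}. has_trace a b (weak_deriv {a<..<b} 1 y0) x 0"
   "0 < C0" "AE x in lebesgue_on {a<..<b}. C0 \<le> y0 x"
   and small: "C0 \<le> Ctilde (energy {a<..<b} y0) (entropy \<beta> {a<..<b} y0) a b \<beta>"
  interpret space_time a b T by unfold_locales (rule ab, rule T)
  have "0 < lower_bound (b - a) (2 * \<bar>energy {a<..<b} y0\<bar> + 1) ((\<beta> - 1) * (\<beta> - 2) * entropy \<beta> {a<..<b} y0)"
   using ab by (intro lower_bound_pos) auto
  with small have "C0 < lower_bound (b - a) (2 * \<bar>energy {a<..<b} y0\<bar> + 1) ((\<beta> - 1) * (\<beta> - 2) * entropy \<beta> {a<..<b} y0)"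
   unfolding Ctilde_def by linarith
  from minimizer_exists[OF A this]
  show "\<exists>(y, u) \<in> admissible T a b lam \<beta> y0 C0. \<forall>(y', u') \<in> admissible T a b lam \<beta> y0 C0.
      cost T {a<..<b} \<alpha> yd y u \<le> cost T {a<..<b} \<alpha> yd y' u'" .
 qed
qed

end
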